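(* Let $(\mathcal X,d,\mu)$ be a space of homogeneous type. Let $\{Q_k\}_{k=0}^\infty$ and $\{P_k\}_{k=0}^\infty$ be two exp-IATIs, $\beta,\gamma\in(0,\eta)$ and $s\in(-(\beta\wedge\gamma),\beta\wedge\gamma)$. Let $N,N'\in\mathbb N$ be the integers of the inhomogeneous discrete Calderón reproducing formula (see context) associated with $\{Q_k\}_{k=0}^\infty$ and $\{P_k\}_{k=0}^\infty$, respectively. (i) If $p\in(p(s,\beta\wedge\gamma),\infty]$ and $q\in(0,\infty]$, then, for any $f\in(\mathcal G^\eta_0(\beta,\gamma))'$, $$\Big\{\sum_{k=0}^N\sum_{\alpha\in\mathcal A_k}\sum_{m=1}^{N(k,\alpha)}\mu(Q^{k,m}_\alpha)\big[m_{Q^{k,m}_\alpha}(|Q_k(f)|)\big]^p\Big\}^{1/p}+\Big[\sum_{k=N+1}^\infty\delta^{-ksq}\|Q_k(f)\|_{L^p(\mathcal X)}^q\Big]^{1/q}$$ $$\sim\Big\{\sum_{k'=0}^{N'}\sum_{\alpha'\in\mathcal A_{k'}}\sum_{m'=1}^{N(k',\alpha')}\mu(Q^{k',m'}_{\alpha'})\big[m_{Q^{k',m'}_{\alpha'}}(|P_{k'}(f)|)\big]^p\Big\}^{1/p}+\Big[\sum_{k'=N'+1}^\infty\delta^{-k'sq}\|P_{k'}(f)\|_{L^p(\mathcal X)}^q\Big]^{1/q},$$ with the usual modifications when $p=\infty$ or $q=\infty$, where the positive equivalence constants are independent of $f$. (ii) If $p\in(p(s,\beta\wedge\gamma),\infty)$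 and $q\in(p(s,\beta\wedge\gamma),\infty]$, then, for any $f\in(\mathcal G^\eta_0(\beta,\gamma))'$, $$\Big\{\sum_{k=0}^N\sum_{\alpha\in\mathcal A_k}\sum_{m=1}^{N(k,\alpha)}\mu(Q^{k,m}_\alpha)\big[m_{Q^{k,m}_\alpha}(|Q_k(f)|)\big]^p\Big\}^{1/p}+\Big\|\Big[\sum_{k=N+1}^\infty\delta^{-ksq}|Q_k(f)|^q\Big]^{1/q}\Big\|_{L^p(\mathcal X)}$$ $$\sim\Big\{\sum_{k'=0}^{N'}\sum_{\alpha'\in\mathcal A_{k'}}\sum_{m'=1}^{N(k',\alpha')}\mu(Q^{k',m'}_{\alpha'})\big[m_{Q^{k',m'}_{\alpha'}}(|P_{k'}(f)|)\big]^p\Big\}^{1/p}+\Big\|\Big[\sum_{k'=N'+1}^\infty\delta^{-k'sq}|P_{k'}(f)|^q\Big]^{1/q}\Big\|_{L^p(\mathcal X)},$$ with the usual modification when $q=\infty$, where the positive equivalence constants are independent of $f$.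
   Context: Space. $d$ is a quasi-metric on $\mathcal X$: $d\ge0$, $d(x,y)=0$ iff $x=y$, $d$ symmetric, $d(x,z)\le A_0[d(x,y)+d(y,z)]$ for some $A_0\in[1,\infty)$. $B(x,r):=\{y:d(x,y)<r\}$. $(\mathcal X,d,\mu)$ is a space of homogeneous type: $\mu$ is a measure for which balls are measurable with $0<\mu(B)<\infty$, and $\mu(2B)\le C_{(\mu)}\mu(B)$ for every ball $B$; $\omega:=\log_2C_{(\mu)}$. $\mu(\mathcal X)$ may be finite or infinite. $V_r(x):=\mu(B(x,r))$, $V(x,y):=\mu(B(x,d(x,y)))$ ($=0$ if $x=y$). $a\wedge b:=\min\{a,b\}$. $m_E(g):=\frac1{\mu(E)}\int_Eg\,d\mu$. $\mathbb Z_+=\{0,1,2,\dots\}$, $\mathbb N=\{1,2,\dots\}$. Dyadic cubes. Fix $0<c_0\le C_0<\infty$, a small $\delta\in(0,1)$ (e.g. $\delta\le(2A_0)^{-10}$) with $12A_0^3C_0\delta\le c_0$, and points $\{z^k_\alpha:k\in\mathbb Z,\alpha\in\mathcal A_k\}$, nested ($\mathcal A_k\subset\mathcal A_{k+1}$ and $z^{k+1}_\alpha=z^k_\alpha$ for $\alpha\in\mathcal A_k$), with $d(z^k_\alpha,z^k_\beta)\ge c_0\delta^k$ if $\alpha\ne\beta$ and $\min_{\alpha\in\mathcal A_k}d(x,z^k_\alpha)<C_0\delta^k$ for all $x$. $\mathcal Y^k:=\{z^{k+1}_\alpha:\alpha\in\mathcal A_{k+1}\setminus\mathcal A_k\}$,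 $d(x,\mathcal Y^k):=\inf_{y\in\mathcal Y^k}d(x,y)$. $\{Q^k_\alpha\}$ is an associated (Hytönen–Kairema) system of dyadic cubes: for each $k$, $\{Q^k_\alpha\}_{\alpha\in\mathcal A_k}$ is disjoint with union $\mathcal X$; for $k\le l$ each $Q^l_\beta$ is contained in or disjoint from each $Q^k_\alpha$; $B(z^k_\alpha,(3A_0^2)^{-1}c_0\delta^k)\subset Q^k_\alpha\subset B(z^k_\alpha,2A_0C_0\delta^k)$. Fix $j_0\in\mathbb N$ large with $\delta^{j_0}\le(2A_0)^{-3}C_0$; $\{Q^{k,m}_\alpha\}_{m=1}^{N(k,\alpha)}$ enumerates the cubes $Q^{k+j_0}_\tau$ contained in $Q^k_\alpha$. exp-IATI. $\eta\in(0,1)$ is a fixed exponent for which such approximations exist on $\mathcal X$. Put $$E_k(x,y):=\frac{1}{\sqrt{V_{\delta^k}(x)V_{\delta^k}(y)}}\exp\Big\{-\nu\Big[\frac{d(x,y)}{\delta^k}\Big]^a\Big\}\exp\Big\{-\nu\Big[\frac{\max\{d(x,\mathcal Y^k),d(y,\mathcal Y^k)\}}{\delta^k}\Big]^a\Big\}.$$ An exp-IATI is a sequence $\{Q_k\}_{k\in\mathbb Z_+}$ of bounded linear integral operators on $L^2(\mathcal X)$, with kernels $Q_k(x,y)$, with $\sum_{k=0}^\infty Q_k=I$ in $L^2(\mathcal X)$, such that for some constants $C,\nu\in(0,\infty)$, $a\in(0,1]$, for all $k\in\mathbb N$ and all points: (a) $|Q_k(x,y)|\le CE_k(x,y)$;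 (b) if $d(x,x')\le\delta^k$, then $|Q_k(x,y)-Q_k(x',y)|+|Q_k(y,x)-Q_k(y,x')|\le C[d(x,x')/\delta^k]^\eta E_k(x,y)$; (c) if $d(x,x')\le\delta^k$ and $d(y,y')\le\delta^k$, then $|[Q_k(x,y)-Q_k(x',y)]-[Q_k(x,y')-Q_k(x',y')]|\le C[d(x,x')/\delta^k]^\eta[d(y,y')/\delta^k]^\eta E_k(x,y)$; (d) $\int Q_k(x,y)\,d\mu(y)=0=\int Q_k(y,x)\,d\mu(y)$; while $Q_0$ satisfies (a)–(c) with $k=0$ and with the second exponential factor removed from $E_0$, and $\int Q_0(x,y)\,d\mu(y)=1=\int Q_0(y,x)\,d\mu(y)$. Test functions and distributions. Fix $x_0\in\mathcal X$. For $\beta\in(0,1]$, $\gamma\in(0,\infty)$, $\mathcal G(\beta,\gamma)$ is the set of functions $f$ for which there is $C>0$ such that, with $D_\gamma(x):=\frac{1}{V_1(x_0)+V(x_0,x)}[1+d(x_0,x)]^{-\gamma}$: $|f(x)|\le CD_\gamma(x)$ for all $x$, and $|f(x)-f(y)|\le C[\frac{d(x,y)}{1+d(x_0,x)}]^\beta D_\gamma(x)$ whenever $d(x,y)\le(2A_0)^{-1}[1+d(x_0,x)]$; its norm is the infimum of such $C$. For $\beta,\gamma\in(0,\eta]$, $\mathcal G^\eta_0(\beta,\gamma)$ is the completion of $\mathcal G(\eta,\eta)$ in $\mathcal G(\beta,\gamma)$, and $(\mathcal G^\eta_0(\beta,\gamma))'$ is its dual. For $f$ in this dual, $Q_k(f)(x)=Q_kf(x):=\langle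 f,Q_k(x,\cdot)\rangle$. The integer $N$. With an exp-IATI $\{Q_k\}$ one associates a fixed $N\in\mathbb N$ for which the following (known) reproducing formula holds: for $\beta,\gamma\in(0,\eta)$ and arbitrary points $y^{k,m}_\alpha\in Q^{k,m}_\alpha$ there are bounded linear integral operators $\{\widetilde Q_k\}_{k\in\mathbb Z_+}$ on $L^2(\mathcal X)$ with, for all $f\in(\mathcal G^\eta_0(\beta,\gamma))'$, $$f=\sum_{\alpha\in\mathcal A_0}\sum_m\int_{Q^{0,m}_\alpha}\widetilde Q_0(\cdot,y)\,d\mu(y)\,Q^{0,m}_{\alpha,1}(f)+\sum_{k=1}^N\sum_{\alpha,m}\mu(Q^{k,m}_\alpha)\widetilde Q_k(\cdot,y^{k,m}_\alpha)Q^{k,m}_{\alpha,1}(f)+\sum_{k=N+1}^\infty\sum_{\alpha,m}\mu(Q^{k,m}_\alpha)\widetilde Q_k(\cdot,y^{k,m}_\alpha)Q_kf(y^{k,m}_\alpha)$$ in $(\mathcal G^\eta_0(\beta,\gamma))'$, where $Q^{k,m}_{\alpha,1}(f):=m_{Q^{k,m}_\alpha}(Q_kf)$ and, with $R_k(x,y):=\frac{1}{V_{\delta^k}(x)+V(x,y)}[\frac{\delta^k}{\delta^k+d(x,y)}]^\gamma$ and $C$ independent of the points $y^{k,m}_\alpha$: $|\widetilde Q_k(x,y)|\le CR_k(x,y)$; $|\widetilde Q_k(x,y)-\widetilde Q_k(x',y)|\le C[\frac{d(x,x')}{\delta^k+d(x,y)}]^\beta R_k(x,y)$ if $d(x,x')\le(2A_0)^{-1}[\delta^k+d(x,y)]$;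 $\int\widetilde Q_k(x,y)\,d\mu(y)=\int\widetilde Q_k(y,x)\,d\mu(y)$ equals $1$ if $k\le N$ and $0$ if $k>N$. Index. For $|s|<t$, $p(s,t):=\max\{\frac{\omega}{\omega+t},\frac{\omega}{\omega+t+s}\}$. $A\sim B$ means $C^{-1}A\le B\le CA$ for a positive constant $C$. *)

theory Defs
  imports "HOL-Analysis.Analysis" "HOL-Probability.Essential_Supremum"
begin

section \<open>Spaces of homogeneous type\<close>

definition qball :: "('a \<Rightarrow> 'a \<Rightarrow> real) \<Rightarrow> 'a \<Rightarrow> real \<Rightarrow> 'a set" where
  "qball d x r = {y. d x y < r}"

definition quasi_metric :: "('a \<Rightarrow> 'a \<Rightarrow> real) \<Rightarrow> real \<Rightarrow> bool" where
  "quasi_metric d A0 \<longleftrightarrow> 1 \<le> A0 \<and>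
     (\<forall>x y. 0 \<le> d x y) \<and> (\<forall>x y. d x y = 0 \<longleftrightarrow> x = y) \<and> (\<forall>x y. d x y = d y x) \<and>
     (\<forall>x y z. d x z \<le> A0 * (d x y + d y z))"

definition homogeneous_type ::
    "'a measure \<Rightarrow> ('a \<Rightarrow> 'a \<Rightarrow> real) \<Rightarrow> real \<Rightarrow> real \<Rightarrow> bool" where
  "homogeneous_type M d A0 C\<mu> \<longleftrightarrow> quasi_metric d A0 \<and> space M = UNIV \<and> 0 < C\<mu> \<and>
     (\<forall>x r. 0 < r \<longrightarrow> qball d x r \<in> sets M \<and>
        0 < emeasure M (qball d x r) \<and> emeasure M (qball d x r) < \<infinity> \<and>
        emeasure M (qball d x (2 * r)) \<le> ennreal C\<mu> * emeasure M (qball d x r))"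

definition vol :: "'a measure \<Rightarrow> ('a \<Rightarrow> 'a \<Rightarrow> real) \<Rightarrow> real \<Rightarrow> 'a \<Rightarrow> real" where
  "vol M d r x = measure M (qball d x r)"

definition vol2 :: "'a measure \<Rightarrow> ('a \<Rightarrow> 'a \<Rightarrow> real) \<Rightarrow> 'a \<Rightarrow> 'a \<Rightarrow> real" where
  "vol2 M d x y = vol M d (d x y) x"

section \<open>Dyadic cubes\<close>

definition dyadic_points :: "('a \<Rightarrow> 'a \<Rightarrow> real) \<Rightarrow> real \<Rightarrow> real \<Rightarrow> real \<Rightarrow> real \<Rightarrow>
    (int \<Rightarrow> 'i set) \<Rightarrow> (int \<Rightarrow> 'i \<Rightarrow> 'a) \<Rightarrow> bool" where
  "dyadic_points d A0 c0 C0 \<delta> A z \<longleftrightarrow>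
     0 < c0 \<and> c0 \<le> C0 \<and> 0 < \<delta> \<and> \<delta> < 1 \<and> 12 * A0 ^ 3 * C0 * \<delta> \<le> c0 \<and>
     (\<forall>k. A k \<subseteq> A (k + 1) \<and> (\<forall>\<alpha>\<in>A k. z (k + 1) \<alpha> = z k \<alpha>)) \<and>
     (\<forall>k. \<forall>\<alpha>\<in>A k. \<forall>\<beta>\<in>A k. \<alpha> \<noteq> \<beta> \<longrightarrow> c0 * \<delta> powi k \<le> d (z k \<alpha>) (z k \<beta>)) \<and>
     (\<forall>k x. \<exists>\<alpha>\<in>A k. d x (z k \<alpha>) < C0 * \<delta> powi k)"

definition new_points :: "(int \<Rightarrow> 'i set) \<Rightarrow> (int \<Rightarrow> 'i \<Rightarrow> 'a) \<Rightarrow> int \<Rightarrow> 'a set" where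
  "new_points A z k = z (k + 1) ` (A (k + 1) - A k)"

definition dyadic_cubes :: "'a measure \<Rightarrow> ('a \<Rightarrow> 'a \<Rightarrow> real) \<Rightarrow> real \<Rightarrow> real \<Rightarrow> real \<Rightarrow> real \<Rightarrow>
    (int \<Rightarrow> 'i set) \<Rightarrow> (int \<Rightarrow> 'i \<Rightarrow> 'a) \<Rightarrow> (int \<Rightarrow> 'i \<Rightarrow> 'a set) \<Rightarrow> bool" where
  "dyadic_cubes M d A0 c0 C0 \<delta> A z cube \<longleftrightarrow>
     (\<forall>k. \<forall>\<alpha>\<in>A k. cube k \<alpha> \<in> sets M) \<and>
     (\<forall>k. disjoint_family_on (cube k) (A k) \<and> (\<Union>\<alpha>\<in>A k. cube k \<alpha>) = UNIV) \<and>
     (\<forall>k l. k \<le> l \<longrightarrow> (\<forall>\<alpha>\<in>A k. \<forall>\<beta>\<in>A l.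
        cube l \<beta> \<subseteq> cube k \<alpha> \<or> cube l \<beta> \<inter> cube k \<alpha> = {})) \<and>
     (\<forall>k. \<forall>\<alpha>\<in>A k.
        qball d (z k \<alpha>) (c0 * \<delta> powi k / (3 * A0\<^sup>2)) \<subseteq> cube k \<alpha> \<and>
        cube k \<alpha> \<subseteq> qball d (z k \<alpha>) (2 * A0 * C0 * \<delta> powi k))"

text \<open>\<open>S k \<alpha> 1, \<dots>, S k \<alpha> (Num k \<alpha>)\<close> enumerates, without repetition, the cubes of generation
  \<open>k + j0\<close> contained in \<open>cube k \<alpha>\<close>.\<close>

definition subcube_enumeration :: "real \<Rightarrow> real \<Rightarrow> real \<Rightarrow> (int \<Rightarrow> 'i set) \<Rightarrow>
    (int \<Rightarrow> 'i \<Rightarrow> 'a set) \<Rightarrow> nat \<Rightarrow> (int \<Rightarrow> 'i \<Rightarrow> nat) \<Rightarrow> (int \<Rightarrow> 'i \<Rightarrow> nat \<Rightarrow> 'a set) \<Rightarrow> bool" where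
  "subcube_enumeration A0 C0 \<delta> A cube j0 Num S \<longleftrightarrow>
     1 \<le> j0 \<and> \<delta> ^ j0 \<le> C0 / (2 * A0) ^ 3 \<and>
     (\<forall>k. \<forall>\<alpha>\<in>A k. bij_betw (S k \<alpha>) {1..Num k \<alpha>}
        {cube (k + int j0) \<tau> | \<tau>. \<tau> \<in> A (k + int j0) \<and> cube (k + int j0) \<tau> \<subseteq> cube k \<alpha>})"

section \<open>Integral operators and exp-IATIs\<close>

definition square_integrable :: "'a measure \<Rightarrow> ('a \<Rightarrow> complex) \<Rightarrow> bool" where
  "square_integrable M g \<longleftrightarrow> g \<in> borel_measurable M \<and> integrable M (\<lambda>x. (cmod (g x))\<^sup>2)"

definition L2norm :: "'a measure \<Rightarrow> ('a \<Rightarrow> complex) \<Rightarrow> real" where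
  "L2norm M g = sqrt (\<integral>x. (cmod (g x))\<^sup>2 \<partial>M)"

definition int_op :: "'a measure \<Rightarrow> ('a \<Rightarrow> 'a \<Rightarrow> complex) \<Rightarrow> ('a \<Rightarrow> complex) \<Rightarrow> 'a \<Rightarrow> complex" where
  "int_op M K g x = (\<integral>y. K x y * g y \<partial>M)"

definition L2_bounded_kernel :: "'a measure \<Rightarrow> ('a \<Rightarrow> 'a \<Rightarrow> complex) \<Rightarrow> bool" where
  "L2_bounded_kernel M K \<longleftrightarrow>
     (\<lambda>(x, y). K x y) \<in> borel_measurable (M \<Otimes>\<^sub>M M) \<and>
     (\<exists>C. \<forall>g. square_integrable M g \<longrightarrow>
        (AE x in M. integrable M (\<lambda>y. K x y * g y)) \<and>
        square_integrable M (int_op M K g) \<and> L2norm M (int_op M K g) \<le> C * L2norm M g)"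

text \<open>The distance to a set takes the value \<open>\<infinity>\<close> on the empty set (the sets \<open>new_points A z k\<close>
  can be empty, for instance when the space has isolated points); the exponential factor is
  then \<open>0\<close>.\<close>

definition dist_set :: "('a \<Rightarrow> 'a \<Rightarrow> real) \<Rightarrow> 'a \<Rightarrow> 'a set \<Rightarrow> ereal" where
  "dist_set d x Y = (INF y\<in>Y. ereal (d x y))"

definition exp_factor :: "real \<Rightarrow> real \<Rightarrow> real \<Rightarrow> ereal \<Rightarrow> real" where
  "exp_factor \<nu> a r t = (if t = \<infinity> then 0 else exp (- \<nu> * (real_of_ereal t / r) powr a))"

definition exp_bound0 :: "'a measure \<Rightarrow> ('a \<Rightarrow> 'a \<Rightarrow> real) \<Rightarrow> real \<Rightarrow> real \<Rightarrow> real \<Rightarrow> 'a \<Rightarrow> 'a \<Rightarrow> real" where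
  "exp_bound0 M d r \<nu> a x y =
     1 / sqrt (vol M d r x * vol M d r y) * exp_factor \<nu> a r (ereal (d x y))"

definition exp_bound :: "'a measure \<Rightarrow> ('a \<Rightarrow> 'a \<Rightarrow> real) \<Rightarrow> 'a set \<Rightarrow> real \<Rightarrow> real \<Rightarrow> real \<Rightarrow>
    'a \<Rightarrow> 'a \<Rightarrow> real" where
  "exp_bound M d Y r \<nu> a x y =
     exp_bound0 M d r \<nu> a x y * exp_factor \<nu> a r (max (dist_set d x Y) (dist_set d y Y))"

definition kernel_estimates :: "('a \<Rightarrow> 'a \<Rightarrow> real) \<Rightarrow> real \<Rightarrow> real \<Rightarrow> real \<Rightarrow>
    ('a \<Rightarrow> 'a \<Rightarrow> real) \<Rightarrow> ('a \<Rightarrow> 'a \<Rightarrow> complex) \<Rightarrow> bool" where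
  "kernel_estimates d \<eta> r C E K \<longleftrightarrow>
     (\<forall>x y. cmod (K x y) \<le> C * E x y) \<and>
     (\<forall>x x' y. d x x' \<le> r \<longrightarrow>
        cmod (K x y - K x' y) + cmod (K y x - K y x') \<le> C * (d x x' / r) powr \<eta> * E x y) \<and>
     (\<forall>x x' y y'. d x x' \<le> r \<longrightarrow> d y y' \<le> r \<longrightarrow>
        cmod ((K x y - K x' y) - (K x y' - K x' y'))
          \<le> C * (d x x' / r) powr \<eta> * (d y y' / r) powr \<eta> * E x y)"

definition exp_IATI :: "'a measure \<Rightarrow> ('a \<Rightarrow> 'a \<Rightarrow> real) \<Rightarrow> real \<Rightarrow> (int \<Rightarrow> 'i set) \<Rightarrow>
    (int \<Rightarrow> 'i \<Rightarrow> 'a) \<Rightarrow> real \<Rightarrow> (nat \<Rightarrow> 'a \<Rightarrow> 'a \<Rightarrow> complex) \<Rightarrow> bool" where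
  "exp_IATI M d \<delta> A z \<eta> Q \<longleftrightarrow>
     (\<forall>k. L2_bounded_kernel M (Q k)) \<and>
     (\<forall>g. square_integrable M g \<longrightarrow>
        (\<lambda>n. L2norm M (\<lambda>x. (\<Sum>k<n. int_op M (Q k) g x) - g x)) \<longlonglongrightarrow> 0) \<and>
     (\<exists>C \<nu> a. 0 < C \<and> 0 < \<nu> \<and> 0 < a \<and> a \<le> 1 \<and>
        kernel_estimates d \<eta> 1 C (exp_bound0 M d 1 \<nu> a) (Q 0) \<and>
        (\<forall>k\<ge>1. kernel_estimates d \<eta> (\<delta> ^ k) C
           (exp_bound M d (new_points A z (int k)) (\<delta> ^ k) \<nu> a) (Q k))) \<and>
     (\<forall>x. (\<integral>y. Q 0 x y \<partial>M) = 1 \<and> (\<integral>y. Q 0 y x \<partial>M) = 1) \<and>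
     (\<forall>k\<ge>1. \<forall>x. (\<integral>y. Q k x y \<partial>M) = 0 \<and> (\<integral>y. Q k y x \<partial>M) = 0)"

section \<open>Test functions and distributions\<close>

definition test_decay :: "'a measure \<Rightarrow> ('a \<Rightarrow> 'a \<Rightarrow> real) \<Rightarrow> 'a \<Rightarrow> real \<Rightarrow> 'a \<Rightarrow> real" where
  "test_decay M d x0 \<gamma> x = 1 / (vol M d 1 x0 + vol2 M d x0 x) * (1 + d x0 x) powr (- \<gamma>)"

definition test_consts :: "'a measure \<Rightarrow> ('a \<Rightarrow> 'a \<Rightarrow> real) \<Rightarrow> real \<Rightarrow> 'a \<Rightarrow> real \<Rightarrow> real \<Rightarrow>
    ('a \<Rightarrow> complex) \<Rightarrow> real set" where
  "test_consts M d A0 x0 \<beta> \<gamma> f = {C. 0 < C \<and>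
     (\<forall>x. cmod (f x) \<le> C * test_decay M d x0 \<gamma> x) \<and>
     (\<forall>x y. d x y \<le> (1 + d x0 x) / (2 * A0) \<longrightarrow>
        cmod (f x - f y) \<le> C * (d x y / (1 + d x0 x)) powr \<beta> * test_decay M d x0 \<gamma> x)}"

definition test_space :: "'a measure \<Rightarrow> ('a \<Rightarrow> 'a \<Rightarrow> real) \<Rightarrow> real \<Rightarrow> 'a \<Rightarrow> real \<Rightarrow> real \<Rightarrow>
    ('a \<Rightarrow> complex) set" where
  "test_space M d A0 x0 \<beta> \<gamma> = {f. test_consts M d A0 x0 \<beta> \<gamma> f \<noteq> {}}"

definition test_norm :: "'a measure \<Rightarrow> ('a \<Rightarrow> 'a \<Rightarrow> real) \<Rightarrow> real \<Rightarrow> 'a \<Rightarrow> real \<Rightarrow> real \<Rightarrow>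
    ('a \<Rightarrow> complex) \<Rightarrow> real" where
  "test_norm M d A0 x0 \<beta> \<gamma> f = Inf (test_consts M d A0 x0 \<beta> \<gamma> f)"

text \<open>The completion of \<open>test_space \<eta> \<eta>\<close> inside the Banach space \<open>test_space \<beta> \<gamma>\<close> is realised as
  its closure there.\<close>

definition test_space0 :: "'a measure \<Rightarrow> ('a \<Rightarrow> 'a \<Rightarrow> real) \<Rightarrow> real \<Rightarrow> 'a \<Rightarrow> real \<Rightarrow> real \<Rightarrow> real \<Rightarrow>
    ('a \<Rightarrow> complex) set" where
  "test_space0 M d A0 x0 \<eta> \<beta> \<gamma> = {f \<in> test_space M d A0 x0 \<beta> \<gamma>.
     \<forall>e>0. \<exists>g \<in> test_space M d A0 x0 \<eta> \<eta>. test_norm M d A0 x0 \<beta> \<gamma> (\<lambda>x. f x - g x) < e}"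

text \<open>Distributions are functionals on all functions, constrained only on \<open>test_space0\<close>.\<close>

definition distributions :: "'a measure \<Rightarrow> ('a \<Rightarrow> 'a \<Rightarrow> real) \<Rightarrow> real \<Rightarrow> 'a \<Rightarrow> real \<Rightarrow> real \<Rightarrow> real \<Rightarrow>
    (('a \<Rightarrow> complex) \<Rightarrow> complex) set" where
  "distributions M d A0 x0 \<eta> \<beta> \<gamma> = {f.
     (\<forall>\<phi>\<in>test_space0 M d A0 x0 \<eta> \<beta> \<gamma>. \<forall>\<psi>\<in>test_space0 M d A0 x0 \<eta> \<beta> \<gamma>.
        f (\<lambda>x. \<phi> x + \<psi> x) = f \<phi> + f \<psi>) \<and>
     (\<forall>c. \<forall>\<phi>\<in>test_space0 M d A0 x0 \<eta> \<beta> \<gamma>. f (\<lambda>x. c * \<phi> x) = c * f \<phi>) \<and>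
     (\<exists>C. \<forall>\<phi>\<in>test_space0 M d A0 x0 \<eta> \<beta> \<gamma>. cmod (f \<phi>) \<le> C * test_norm M d A0 x0 \<beta> \<gamma> \<phi>)}"

definition dist_apply :: "(nat \<Rightarrow> 'a \<Rightarrow> 'a \<Rightarrow> complex) \<Rightarrow> nat \<Rightarrow> (('a \<Rightarrow> complex) \<Rightarrow> complex) \<Rightarrow>
    'a \<Rightarrow> complex" where
  "dist_apply Q k f x = f (\<lambda>y. Q k x y)"

section \<open>The inhomogeneous discrete Calderon reproducing formula\<close>

definition cmean :: "'a measure \<Rightarrow> 'a set \<Rightarrow> ('a \<Rightarrow> complex) \<Rightarrow> complex" where
  "cmean M E g = (\<integral>x\<in>E. g x \<partial>M) / complex_of_real (measure M E)"

definition poly_bound :: "'a measure \<Rightarrow> ('a \<Rightarrow> 'a \<Rightarrow> real) \<Rightarrow> real \<Rightarrow> real \<Rightarrow> 'a \<Rightarrow> 'a \<Rightarrow> real" where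
  "poly_bound M d \<gamma> r x y = 1 / (vol M d r x + vol2 M d x y) * (r / (r + d x y)) powr \<gamma>"

definition reproducing_kernels :: "'a measure \<Rightarrow> ('a \<Rightarrow> 'a \<Rightarrow> real) \<Rightarrow> real \<Rightarrow> real \<Rightarrow> real \<Rightarrow> real \<Rightarrow>
    real \<Rightarrow> nat \<Rightarrow> (nat \<Rightarrow> 'a \<Rightarrow> 'a \<Rightarrow> complex) \<Rightarrow> bool" where
  "reproducing_kernels M d A0 \<delta> \<beta> \<gamma> C N Qt \<longleftrightarrow>
     (\<forall>k. L2_bounded_kernel M (Qt k)) \<and>
     (\<forall>k x y. cmod (Qt k x y) \<le> C * poly_bound M d \<gamma> (\<delta> ^ k) x y) \<and>
     (\<forall>k x x' y. d x x' \<le> (\<delta> ^ k + d x y) / (2 * A0) \<longrightarrow>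
        cmod (Qt k x y - Qt k x' y)
          \<le> C * (d x x' / (\<delta> ^ k + d x y)) powr \<beta> * poly_bound M d \<gamma> (\<delta> ^ k) x y) \<and>
     (\<forall>k x. (\<integral>y. Qt k x y \<partial>M) = (if k \<le> N then 1 else 0) \<and>
            (\<integral>y. Qt k y x \<partial>M) = (if k \<le> N then 1 else 0))"

text \<open>The summand with index \<open>(k, \<alpha>, m)\<close> of the reproducing formula for \<open>f\<close>, tested against \<open>\<phi>\<close>;
  \<open>E\<close> is the subcube and \<open>y\<close> the point chosen in it. A function \<open>g\<close> acts on \<open>\<phi>\<close> by
  \<open>\<integral>x. g x * \<phi> x \<partial>M\<close>.\<close>

definition reproducing_term :: "'a measure \<Rightarrow> (nat \<Rightarrow> 'a \<Rightarrow> 'a \<Rightarrow> complex) \<Rightarrow>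
    (nat \<Rightarrow> 'a \<Rightarrow> 'a \<Rightarrow> complex) \<Rightarrow> nat \<Rightarrow> nat \<Rightarrow> 'a set \<Rightarrow> 'a \<Rightarrow>
    (('a \<Rightarrow> complex) \<Rightarrow> complex) \<Rightarrow> ('a \<Rightarrow> complex) \<Rightarrow> complex" where
  "reproducing_term M Q Qt N k E y f \<phi> =
     (if k = 0 then (\<integral>x. (\<integral>y\<in>E. Qt 0 x y \<partial>M) * \<phi> x \<partial>M) * cmean M E (dist_apply Q 0 f)
      else if k \<le> N then
        complex_of_real (measure M E) * (\<integral>x. Qt k x y * \<phi> x \<partial>M) * cmean M E (dist_apply Q k f)
      else
        complex_of_real (measure M E) * (\<integral>x. Qt k x y * \<phi> x \<partial>M) * dist_apply Q k f y)"

text \<open>\<open>N\<close> is an integer for which the reproducing formula associated with \<open>Q\<close> holds on the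
  distributions over \<open>test_space0 \<eta> \<beta> \<gamma>\<close>. The sum over the countable set \<open>A k\<close> is an unordered
  sum, the sum over \<open>k\<close> is a series, and convergence is tested on each \<open>\<phi>\<close>. The constant
  \<open>C\<close> is chosen before the points \<open>y\<close>.\<close>

definition calderon_index :: "'a measure \<Rightarrow> ('a \<Rightarrow> 'a \<Rightarrow> real) \<Rightarrow> real \<Rightarrow> real \<Rightarrow> (int \<Rightarrow> 'i set) \<Rightarrow>
    (int \<Rightarrow> 'i \<Rightarrow> nat) \<Rightarrow> (int \<Rightarrow> 'i \<Rightarrow> nat \<Rightarrow> 'a set) \<Rightarrow> 'a \<Rightarrow> real \<Rightarrow> real \<Rightarrow> real \<Rightarrow>
    (nat \<Rightarrow> 'a \<Rightarrow> 'a \<Rightarrow> complex) \<Rightarrow> nat \<Rightarrow> bool" where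
  "calderon_index M d A0 \<delta> A Num S x0 \<eta> \<beta> \<gamma> Q N \<longleftrightarrow> 1 \<le> N \<and>
     (\<exists>C>0. \<forall>y :: nat \<Rightarrow> 'i \<Rightarrow> nat \<Rightarrow> 'a.
        (\<forall>k. \<forall>\<alpha>\<in>A (int k). \<forall>m\<in>{1..Num (int k) \<alpha>}. y k \<alpha> m \<in> S (int k) \<alpha> m) \<longrightarrow>
        (\<exists>Qt. reproducing_kernels M d A0 \<delta> \<beta> \<gamma> C N Qt \<and>
           (\<forall>f\<in>distributions M d A0 x0 \<eta> \<beta> \<gamma>. \<forall>\<phi>\<in>test_space0 M d A0 x0 \<eta> \<beta> \<gamma>.
              let T = (\<lambda>k \<alpha>. \<Sum>m = 1..Num (int k) \<alpha>.
                         reproducing_term M Q Qt N k (S (int k) \<alpha> m) (y k \<alpha> m) f \<phi>)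
              in (\<forall>k. T k summable_on A (int k)) \<and>
                 (\<lambda>k. \<Sum>\<^sub>\<infinity>\<alpha>\<in>A (int k). T k \<alpha>) sums f \<phi>)))"

section \<open>Besov and Triebel--Lizorkin quantities\<close>

text \<open>Meant for \<open>r > 0\<close> only. The exponents \<open>p\<close> and \<open>q\<close> below range over \<open>(0, \<infinity>]\<close>.\<close>

definition epowr :: "ennreal \<Rightarrow> real \<Rightarrow> ennreal" where
  "epowr t r = (if t = \<infinity> then \<infinity> else ennreal (enn2real t powr r))"

definition Lp_norm :: "'a measure \<Rightarrow> ennreal \<Rightarrow> ('a \<Rightarrow> ennreal) \<Rightarrow> ennreal" where
  "Lp_norm M p g = (if p = \<infinity> then esssup M g
     else epowr (\<integral>\<^sup>+x. epowr (g x) (enn2real p) \<partial>M) (1 / enn2real p))"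

definition lq_norm :: "nat set \<Rightarrow> ennreal \<Rightarrow> (nat \<Rightarrow> ennreal) \<Rightarrow> ennreal" where
  "lq_norm I q c = (if q = \<infinity> then (SUP k\<in>I. c k)
     else epowr (\<integral>\<^sup>+k. epowr (c k) (enn2real q) \<partial>count_space I) (1 / enn2real q))"

definition abs_mean :: "'a measure \<Rightarrow> 'a set \<Rightarrow> ('a \<Rightarrow> complex) \<Rightarrow> ennreal" where
  "abs_mean M E g = (\<integral>\<^sup>+x\<in>E. ennreal (cmod (g x)) \<partial>M) / emeasure M E"

definition low_part :: "'a measure \<Rightarrow> (int \<Rightarrow> 'i set) \<Rightarrow> (int \<Rightarrow> 'i \<Rightarrow> nat) \<Rightarrow>
    (int \<Rightarrow> 'i \<Rightarrow> nat \<Rightarrow> 'a set) \<Rightarrow> (nat \<Rightarrow> 'a \<Rightarrow> 'a \<Rightarrow> complex) \<Rightarrow> nat \<Rightarrow> ennreal \<Rightarrow>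
    (('a \<Rightarrow> complex) \<Rightarrow> complex) \<Rightarrow> ennreal" where
  "low_part M A Num S Q N p f =
     (if p = \<infinity> then
        (SUP k\<in>{0..N}. SUP \<alpha>\<in>A (int k). SUP m\<in>{1..Num (int k) \<alpha>}.
           abs_mean M (S (int k) \<alpha> m) (dist_apply Q k f))
      else epowr
        (\<Sum>k = 0..N. \<integral>\<^sup>+\<alpha>. (\<Sum>m = 1..Num (int k) \<alpha>.
           emeasure M (S (int k) \<alpha> m) *
           epowr (abs_mean M (S (int k) \<alpha> m) (dist_apply Q k f)) (enn2real p)) \<partial>count_space (A (int k)))
        (1 / enn2real p))"

definition besov_quantity :: "'a measure \<Rightarrow> real \<Rightarrow> (int \<Rightarrow> 'i set) \<Rightarrow> (int \<Rightarrow> 'i \<Rightarrow> nat) \<Rightarrow>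
    (int \<Rightarrow> 'i \<Rightarrow> nat \<Rightarrow> 'a set) \<Rightarrow> (nat \<Rightarrow> 'a \<Rightarrow> 'a \<Rightarrow> complex) \<Rightarrow> nat \<Rightarrow> real \<Rightarrow> ennreal \<Rightarrow> ennreal \<Rightarrow>
    (('a \<Rightarrow> complex) \<Rightarrow> complex) \<Rightarrow> ennreal" where
  "besov_quantity M \<delta> A Num S Q N s p q f =
     low_part M A Num S Q N p f +
     lq_norm {N+1..} q (\<lambda>k. ennreal (\<delta> powr (- real k * s)) *
       Lp_norm M p (\<lambda>x. ennreal (cmod (dist_apply Q k f x))))"

definition triebel_lizorkin_quantity :: "'a measure \<Rightarrow> real \<Rightarrow> (int \<Rightarrow> 'i set) \<Rightarrow>
    (int \<Rightarrow> 'i \<Rightarrow> nat) \<Rightarrow> (int \<Rightarrow> 'i \<Rightarrow> nat \<Rightarrow> 'a set) \<Rightarrow> (nat \<Rightarrow> 'a \<Rightarrow> 'a \<Rightarrow> complex) \<Rightarrow> nat \<Rightarrow>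
    real \<Rightarrow> ennreal \<Rightarrow> ennreal \<Rightarrow> (('a \<Rightarrow> complex) \<Rightarrow> complex) \<Rightarrow> ennreal" where
  "triebel_lizorkin_quantity M \<delta> A Num S Q N s p q f =
     low_part M A Num S Q N p f +
     Lp_norm M p (\<lambda>x. lq_norm {N+1..} q
       (\<lambda>k. ennreal (\<delta> powr (- real k * s)) * ennreal (cmod (dist_apply Q k f x))))"

definition p_index :: "real \<Rightarrow> real \<Rightarrow> real \<Rightarrow> real" where
  "p_index \<omega> s t = max (\<omega> / (\<omega> + t)) (\<omega> / (\<omega> + t + s))"

definition equivalent_on :: "'f set \<Rightarrow> ('f \<Rightarrow> ennreal) \<Rightarrow> ('f \<Rightarrow> ennreal) \<Rightarrow> bool" where
  "equivalent_on F a b \<longleftrightarrow>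
     (\<exists>C>0. \<forall>f\<in>F. ennreal (1 / C) * a f \<le> b f \<and> b f \<le> ennreal C * a f)"

end

theory Submission imports Defs "HOL-Real_Asymp.Real_Asymp"
begin

text \<open>Choose \<open>r \<le> 1\<close> between \<open>p(s, \<beta> \<and> \<gamma>)\<close> and \<open>min p q\<close>. Paired with the test function
  \<open>P\<^bsub>k'\<^esub>(x, \<cdot>)\<close>, the reproducing formula for \<open>{Q\<^sub>k}\<close> writes \<open>P\<^bsub>k'\<^esub>f(x)\<close> as a sum over cells
  \<open>E\<close> of \<open>\<mu>(E) Q\<^sub>kf(y\<^sub>E)\<close> times a kernel that almost orthogonality makes
  \<open>O(\<delta>\<^bsup>t|k-k'|\<^esup>)\<close> for each \<open>t < \<beta> \<and> \<gamma>\<close>, with polynomial decay at scale \<open>\<delta>\<^bsup>min k k'\<^esup>\<close>.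
  The formula holds for every choice of sample points, so each \<open>y\<^sub>E\<close> can be taken with
  \<open>|Q\<^sub>kf(y\<^sub>E)|\<^sup>r\<close> at most the mean of \<open>|Q\<^sub>kf|\<^sup>r\<close> over \<open>E\<close>. Taking \<open>r\<close>-th powers term by term loses
  \<open>\<delta>\<^bsup>-\<omega>(1-r)|k-k'|\<^esup>\<close> when \<open>k > k'\<close> and in the spatial tails, which \<open>r > p(s, \<beta> \<and> \<gamma>)\<close> makes affordable.
  The outcome bounds \<open>|\<delta>\<^bsup>-k's\<^esup>P\<^bsub>k'\<^esub>f|\<^sup>r\<close> pointwise by
  \<open>\<Sum>\<^sub>k \<Sum>\<^sub>i \<theta>\<^bsup>|k-k'|\<^esup> \<kappa>\<^sup>i T\<^bsub>min k k' - i\<^esub>(|\<delta>\<^bsup>-ks\<^esup>Q\<^sub>kf|\<^sup>r)\<close>, where \<open>T\<^sub>l\<close> averages over balls of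
  radius about \<open>\<delta>\<^sup>l\<close> attached to dyadic cubes.

  Positive averaging operators make the estimate in \<open>L\<^bsup>p/r\<^esup>(\<ell>\<^bsup>q/r\<^esup>)\<close> elementary, without the
  Fefferman--Stein inequality: the diagonal case is Schur's test, and the others reduce to it and to
  the scalar maximal function by Hoelder's inequality or by duality. Exchanging \<open>{Q\<^sub>k}\<close> and \<open>{P\<^sub>k}\<close> gives
  the equivalence.\<close>

section \<open>Powers of extended nonnegative reals\<close>

text \<open>The averaging balls are fixed by the dyadic cube that contains x instead of being
  centred at x. Hence T_l g is constant on cubes of generation l, and the right-hand side of the
  pointwise estimate is constant on cells of generation k'. A bound for |P_k' f| therefore passes to
  the cell means that replace it for k' <= N'. Only countably many balls occur, so the maximal
  function is measurable, and it also controls the transpose of T_l. The loss in r-th powers has a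
  single source. If a ball of radius n >= \<delta>^k meets a cell of generation k near its centre,
  the cell has at least a fixed multiple of (\<delta>^k/n)^\<omega> of its measure. The power 1-r of
  this ratio lowers the spatial decay from \<gamma> to \<gamma> r - \<omega> (1-r) and costs a power
  of \<delta>^(k'-k) when k > k'. The sample points, and with them the operators of the formula,
  depend on f. The estimate is still uniform in f because the constant in the kernel bounds is fixed
  before the points. Levels k <= N lack cancellation, but for k' <= k <= N the factor
  \<delta>^(t|k-k'|) is bounded below and can be inserted.\<close>

lemma epowr_top [simp]: "epowr top r = top"
  by (simp add: epowr_def)

lemma epowr_ennreal: "0 \<le> x \<Longrightarrow> epowr (ennreal x) r = ennreal (x powr r)"
  by (simp add: epowr_def)

lemma epowr_0 [simp]: "epowr 0 r = 0"
  by (simp add: epowr_def)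

lemma epowr_1 [simp]: "epowr 1 r = 1"
  by (simp add: epowr_def)

lemma epowr_exp_1 [simp]: "epowr t 1 = t"
  by (cases t) (auto simp: epowr_ennreal)

lemma epowr_mono: "x \<le> y \<Longrightarrow> 0 \<le> r \<Longrightarrow> epowr x r \<le> epowr y r"
  by (cases x; cases y) (auto simp: epowr_ennreal intro!: ennreal_leI powr_mono2 simp: top_unique)

lemma epowr_mult: "0 < r \<Longrightarrow> epowr (x * y) r = epowr x r * epowr y r"
proof (cases x; cases y)
  fix a b assume "x = ennreal a" "0 \<le> a" "y = ennreal b" "0 \<le> b"
  then show ?thesis
    by (simp add: epowr_ennreal ennreal_mult[symmetric] powr_mult)
next
  fix a assume "x = ennreal a" "0 \<le> a" "y = top"
  then show ?thesis
    by (cases "a = 0") (auto simp: epowr_ennreal ennreal_mult_top)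
next
  fix a assume "y = ennreal a" "0 \<le> a" "x = top"
  then show ?thesis
    by (cases "a = 0") (auto simp: epowr_ennreal ennreal_top_mult)
qed (auto simp: epowr_def)

lemma epowr_epowr: "epowr (epowr t a) b = epowr t (a * b)"
  by (cases t) (auto simp: epowr_ennreal powr_powr)

lemma epowr_cmult: "0 \<le> c \<Longrightarrow> 0 < r \<Longrightarrow> epowr (ennreal c * x) r = ennreal (c powr r) * epowr x r"
  by (simp add: epowr_mult epowr_ennreal)

text \<open>Exponents of any sign are allowed because 0 and top are fixed by every power:
  \<open>epowr 0 r = 0\<close> and \<open>epowr top r = top\<close> also for r <= 0. The argument
  for P < Q below works with negative powers in this sense.\<close>

lemma epowr_add: "epowr t (a + b) = epowr t a * epowr t b"
  by (cases t) (auto simp: epowr_ennreal powr_add ennreal_mult)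

lemma epowr_inverse: "0 < r \<Longrightarrow> epowr (epowr x r) (1 / r) = x" "0 < r \<Longrightarrow> epowr (epowr x (1 / r)) r = x"
  by (simp_all add: epowr_epowr)

lemma epowr_eq_top_iff [simp]: "epowr x r = top \<longleftrightarrow> x = top"
  by (cases x) (auto simp: epowr_ennreal)

lemma epowr_eq_0_iff [simp]: "epowr x r = 0 \<longleftrightarrow> x = 0"
  by (cases x) (auto simp: epowr_ennreal)

lemma epowr_measurable [measurable]:
  assumes [measurable]: "f \<in> borel_measurable M"
  shows "(\<lambda>x. epowr (f x) r) \<in> borel_measurable M"
  unfolding epowr_def by measurable

text \<open>The power 1/r is a monotone inverse of the power r, and an order isomorphism commutes
  with suprema.\<close>

lemma epowr_Sup:
  assumes "0 < r" "X \<noteq> {}"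
  shows "epowr (SUP i\<in>X. f i) r = (SUP i\<in>X. epowr (f i) r)"
proof (rule antisym)
  show "(SUP i\<in>X. epowr (f i) r) \<le> epowr (SUP i\<in>X. f i) r"
    using assms by (intro SUP_least epowr_mono SUP_upper) auto
  have "(SUP i\<in>X. f i) \<le> epowr (SUP i\<in>X. epowr (f i) r) (1/r)"
  proof (rule SUP_least)
    fix i assume "i \<in> X"
    then have "epowr (epowr (f i) r) (1/r) \<le> epowr (SUP i\<in>X. epowr (f i) r) (1/r)"
      using assms by (intro epowr_mono SUP_upper) auto
    then show "f i \<le> epowr (SUP i\<in>X. epowr (f i) r) (1/r)"
      using assms by (simp add: epowr_inverse)
  qed
  then have "epowr (SUP i\<in>X. f i) r \<le> epowr (epowr (SUP i\<in>X. epowr (f i) r) (1/r)) r"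
    using assms by (intro epowr_mono) auto
  then show "epowr (SUP i\<in>X. f i) r \<le> (SUP i\<in>X. epowr (f i) r)"
    using assms by (simp add: epowr_inverse)
qed

section \<open>Young, Hoelder and Jensen inequalities, and powers of sums\<close>

lemma epowr_Young:
  assumes "0 < a" "a < 1"
  shows "epowr x a * epowr y (1 - a) \<le> ennreal a * x + ennreal (1 - a) * y"
proof (cases x; cases y)
  fix u v assume *: "x = ennreal u" "0 \<le> u" "y = ennreal v" "0 \<le> v"
  then have "u powr a * v powr (1 - a) \<le> a * u + (1 - a) * v"
    using Youngs_inequality_0[of a "1 - a" u v] assms by (cases "u = 0 \<or> v = 0") auto
  then show ?thesis
    using assms *
    by (simp add: epowr_ennreal ennreal_mult[symmetric] ennreal_plus[symmetric] ennreal_leI del: ennreal_plus)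
qed (use assms in \<open>auto simp: ennreal_mult_top ennreal_top_mult\<close>)

text \<open>Hoelder for the conjugate exponents 1/a and 1/(1-a), with the powers already inside.
  After both integrals are normalised to 1 it is Young's inequality integrated.\<close>

lemma nn_integral_Holder:
  assumes a: "0 < a" "a < 1"
  assumes [measurable]: "f \<in> borel_measurable M" "g \<in> borel_measurable M"
  shows "(\<integral>\<^sup>+x. epowr (f x) a * epowr (g x) (1 - a) \<partial>M)
           \<le> epowr (\<integral>\<^sup>+x. f x \<partial>M) a * epowr (\<integral>\<^sup>+x. g x \<partial>M) (1 - a)" (is "?L \<le> epowr ?F a * epowr ?G (1 - a)")
proof -
  have z1: "?L = 0" if "?F = 0"
  proof -
    have "AE x in M. f x = 0" using that by (simp add: nn_integral_0_iff_AE)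
    then have "AE x in M. epowr (f x) a * epowr (g x) (1 - a) = 0" by eventually_elim simp
    then show ?thesis by (simp add: nn_integral_0_iff_AE)
  qed
  have z2: "?L = 0" if "?G = 0"
  proof -
    have "AE x in M. g x = 0" using that by (simp add: nn_integral_0_iff_AE)
    then have "AE x in M. epowr (f x) a * epowr (g x) (1 - a) = 0" by eventually_elim simp
    then show ?thesis by (simp add: nn_integral_0_iff_AE)
  qed
  \<comment> \<open>A vanishing integral is treated first: the right-hand side may then be 0 * top =
    0, so the left-hand side has to be shown to vanish. Once both integrals are nonzero, an infinite
    one makes the right-hand side top.\<close>
  consider "?F = 0 \<or> ?G = 0" | "?F \<noteq> 0" "?G \<noteq> 0" "?F = top \<or> ?G = top"
    | F G where "?F = ennreal F" "?G = ennreal G" "0 < F" "0 < G"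
  proof (cases "?F"; cases "?G")
    fix F G assume *: "?F = ennreal F" "?G = ennreal G" "0 \<le> F" "0 \<le> G"
    then show thesis
      using that(1) that(3)[of F G] by (cases "F = 0"; cases "G = 0") auto
  qed (use that in auto)
  then show ?thesis
  proof cases
    case 1 then show ?thesis using z1 z2 by auto
  next
    case 2
    then have "epowr ?F a * epowr ?G (1 - a) = top" by (auto simp: ennreal_mult_eq_top_iff)
    then show ?thesis by simp
  next
    case 3
    define c where "c = F powr a * G powr (1 - a)"
    have c: "0 < c" using 3 by (simp add: c_def)
    have pw: "epowr (f x) a * epowr (g x) (1 - a) \<le>
       ennreal c * (ennreal (a / F) * f x + ennreal ((1 - a) / G) * g x)" for x
    proof -
      have "epowr (f x) a = ennreal (F powr a) * epowr (ennreal (1/F) * f x) a"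
        using 3 a by (simp add: epowr_mult epowr_ennreal mult.assoc[symmetric] ennreal_mult[symmetric] powr_mult[symmetric])
      moreover have "epowr (g x) (1-a) = ennreal (G powr (1-a)) * epowr (ennreal (1/G) * g x) (1-a)"
        using 3 a by (simp add: epowr_mult epowr_ennreal mult.assoc[symmetric] ennreal_mult[symmetric] powr_mult[symmetric])
      ultimately have "epowr (f x) a * epowr (g x) (1 - a) =
          ennreal c * (epowr (ennreal (1/F) * f x) a * epowr (ennreal (1/G) * g x) (1-a))"
        by (simp add: c_def ennreal_mult mult_ac)
      also have "\<dots> \<le> ennreal c * (ennreal a * (ennreal (1/F) * f x) + ennreal (1-a) * (ennreal (1/G) * g x))"
        by (intro mult_left_mono epowr_Young a) auto
      also have "\<dots> = ennreal c * (ennreal (a / F) * f x + ennreal ((1 - a) / G) * g x)"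
        using 3 a by (simp add: mult.assoc[symmetric] ennreal_mult[symmetric])
      finally show ?thesis .
    qed
    have "?L \<le> (\<integral>\<^sup>+x. ennreal c * (ennreal (a / F) * f x + ennreal ((1 - a) / G) * g x) \<partial>M)"
      by (intro nn_integral_mono pw)
    also have "\<dots> = ennreal c * (ennreal (a / F) * ?F + ennreal ((1 - a) / G) * ?G)"
      by (simp add: nn_integral_cmult nn_integral_add)
    also have "ennreal (a / F) * ?F + ennreal ((1 - a) / G) * ?G = 1"
      using 3 a by (simp add: ennreal_mult[symmetric] ennreal_plus[symmetric] del: ennreal_plus)
    finally show ?thesis using 3 by (simp add: c_def epowr_ennreal ennreal_mult)
  qed
qed

text \<open>Hoelder applied to w b = (w b^p)^(1/p) w^(1-1/p). The weight need not have mass 1; its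
  mass appears with the exponent p - 1.\<close>

lemma nn_integral_Jensen:
  assumes p: "1 \<le> p"
  assumes [measurable]: "b \<in> borel_measurable M" "w \<in> borel_measurable M"
  shows "epowr (\<integral>\<^sup>+x. w x * b x \<partial>M) p \<le> epowr (\<integral>\<^sup>+x. w x \<partial>M) (p - 1) * (\<integral>\<^sup>+x. w x * epowr (b x) p \<partial>M)"
proof (cases "p = 1")
  case True
  \<comment> \<open>Here p - 1 = 0 and \<open>epowr 0 0 = 0\<close> instead of 1, so a weight of
    total mass 0 must be seen to give 0 on the left as well.\<close>
  show ?thesis
  proof (cases "(\<integral>\<^sup>+x. w x \<partial>M) = 0")
    case z: True
    then have "AE x in M. w x = 0" by (simp add: nn_integral_0_iff_AE)
    then have "AE x in M. w x * b x = 0" by eventually_elim simp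
    then have "(\<integral>\<^sup>+x. w x * b x \<partial>M) = 0" by (simp add: nn_integral_0_iff_AE)
    then show ?thesis by simp
  next
    case False
    then have "epowr (\<integral>\<^sup>+x. w x \<partial>M) 0 \<ge> 1"
      by (cases "\<integral>\<^sup>+x. w x \<partial>M") (auto simp: epowr_ennreal)
    then have "1 * (\<integral>\<^sup>+x. w x * b x \<partial>M) \<le> epowr (\<integral>\<^sup>+x. w x \<partial>M) 0 * (\<integral>\<^sup>+x. w x * b x \<partial>M)"
      by (intro mult_right_mono) auto
    then show ?thesis using True by simp
  qed
next
  case False
  with p have p: "1 < p" by simp
  have eq: "w x * b x = epowr (w x * epowr (b x) p) (1/p) * epowr (w x) (1 - 1/p)" for x
  proof -
    have "epowr (w x * epowr (b x) p) (1/p) * epowr (w x) (1 - 1/p) =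
      (epowr (w x) (1/p) * epowr (w x) (1 - 1/p)) * epowr (epowr (b x) p) (1/p)"
      using p by (simp add: epowr_mult mult_ac)
    also have "\<dots> = w x * b x"
      using p by (subst epowr_add[symmetric]) (simp add: epowr_inverse)
    finally show ?thesis by simp
  qed
  have "(\<integral>\<^sup>+x. w x * b x \<partial>M) \<le> epowr (\<integral>\<^sup>+x. w x * epowr (b x) p \<partial>M) (1/p) * epowr (\<integral>\<^sup>+x. w x \<partial>M) (1 - 1/p)"
    unfolding eq using p by (intro nn_integral_Holder) auto
  then have "epowr (\<integral>\<^sup>+x. w x * b x \<partial>M) p \<le>
     epowr (epowr (\<integral>\<^sup>+x. w x * epowr (b x) p \<partial>M) (1/p) * epowr (\<integral>\<^sup>+x. w x \<partial>M) (1 - 1/p)) p"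
    using p by (intro epowr_mono) auto
  also have "\<dots> = (\<integral>\<^sup>+x. w x * epowr (b x) p \<partial>M) * epowr (\<integral>\<^sup>+x. w x \<partial>M) (p - 1)"
    using p by (simp add: epowr_mult epowr_epowr algebra_simps)
  finally show ?thesis by (simp add: mult.commute)
qed

text \<open>With B the sum of the b_i^r, each b_i^r is at most B, so b_i = b_i^(1-r) b_i^r <=
  B^(1/r-1) b_i^r. Summation over i gives B^(1/r). The bound of a single value by the whole sum is
  where the counting measure enters.\<close>

lemma epowr_nn_integral_count_le:
  assumes r: "0 < r" "r \<le> 1"
  shows "epowr (\<integral>\<^sup>+i. b i \<partial>count_space I) r \<le> (\<integral>\<^sup>+i. epowr (b i) r \<partial>count_space I)"
proof -
  define B where "B = (\<integral>\<^sup>+i. epowr (b i) r \<partial>count_space I)"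
  have "b i \<le> epowr B (1/r - 1) * epowr (b i) r" if "i \<in> I" for i
  proof -
    have "epowr (b i) r \<le> B"
      unfolding B_def using nn_integral_ge_point[OF that, of "\<lambda>i. epowr (b i) r"] by simp
    then have "epowr (epowr (b i) r) (1/r - 1) \<le> epowr B (1/r - 1)"
      using r by (intro epowr_mono) auto
    then have "epowr (b i) (1 - r) \<le> epowr B (1/r - 1)"
      using r by (simp add: epowr_epowr algebra_simps)
    then have "epowr (b i) (1 - r) * epowr (b i) r \<le> epowr B (1/r - 1) * epowr (b i) r"
      by (rule mult_right_mono) simp
    then show ?thesis by (simp add: epowr_add[symmetric])
  qed
  then have "(\<integral>\<^sup>+i. b i \<partial>count_space I) \<le> (\<integral>\<^sup>+i. epowr B (1/r - 1) * epowr (b i) r \<partial>count_space I)"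
    by (intro nn_integral_mono) simp
  also have "\<dots> = epowr B (1/r - 1) * epowr B 1"
    by (simp add: nn_integral_cmult B_def)
  also have "\<dots> = epowr B (1/r)" by (subst epowr_add[symmetric]) simp
  finally have "epowr (\<integral>\<^sup>+i. b i \<partial>count_space I) r \<le> epowr (epowr B (1/r)) r"
    using r by (intro epowr_mono) auto
  then show ?thesis using r by (simp add: epowr_inverse B_def)
qed

lemma epowr_sum_le:
  assumes "0 < r" "r \<le> 1" "finite I"
  shows "epowr (\<Sum>i\<in>I. b i) r \<le> (\<Sum>i\<in>I. epowr (b i) r)"
  using epowr_nn_integral_count_le[OF assms(1,2), where b = b and I = I] assms(3)
  by (simp add: nn_integral_count_space_finite)

lemma epowr_sum_le_card:
  assumes "1 \<le> p" "finite I"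
  shows "epowr (\<Sum>i\<in>I. b i) p \<le> ennreal (real (card I) powr (p - 1)) * (\<Sum>i\<in>I. epowr (b i) p)"
  using nn_integral_Jensen[OF assms(1), where b = b and M = "count_space I" and w = "\<lambda>_. 1"] assms(2)
  by (simp add: nn_integral_count_space_finite ennreal_of_nat_eq_real_of_nat epowr_ennreal)

lemma epowr_sum_le_quasi:
  assumes "0 < p" "finite I"
  shows "epowr (\<Sum>i\<in>I. b i) p \<le> ennreal (max 1 (real (card I) powr (p - 1))) * (\<Sum>i\<in>I. epowr (b i) p)"
proof (cases "p \<le> 1")
  case True
  have "epowr (\<Sum>i\<in>I. b i) p \<le> 1 * (\<Sum>i\<in>I. epowr (b i) p)"
    using epowr_sum_le[where r = p and I = I and b = b] True assms by simp
  also have "\<dots> \<le> ennreal (max 1 (real (card I) powr (p - 1))) * (\<Sum>i\<in>I. epowr (b i) p)"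
    by (intro mult_right_mono) (auto simp flip: ennreal_1 intro!: ennreal_leI)
  finally show ?thesis .
next
  case False
  then have "epowr (\<Sum>i\<in>I. b i) p \<le> ennreal (real (card I) powr (p - 1)) * (\<Sum>i\<in>I. epowr (b i) p)"
    using assms by (intro epowr_sum_le_card) auto
  also have "\<dots> \<le> ennreal (max 1 (real (card I) powr (p - 1))) * (\<Sum>i\<in>I. epowr (b i) p)"
    by (intro mult_right_mono) (auto intro!: ennreal_leI)
  finally show ?thesis .
qed

lemma ennreal_divide_real: "0 < v \<Longrightarrow> X / ennreal v = ennreal (1 / v) * X"
  by (simp add: divide_ennreal_def inverse_ennreal mult.commute inverse_eq_divide)

section \<open>Geometry of spaces of homogeneous type\<close>

locale homogeneous_space =
  fixes M :: "'a measure" and d :: "'a \<Rightarrow> 'a \<Rightarrow> real" and A0 C\<mu> :: real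
  assumes homogeneous: "homogeneous_type M d A0 C\<mu>"
begin

abbreviation V :: "real \<Rightarrow> 'a \<Rightarrow> real" where "V \<equiv> vol M d"

definition \<omega> :: real where "\<omega> = log 2 C\<mu>"

lemma quasi: "quasi_metric d A0"
  using homogeneous unfolding homogeneous_type_def by (elim conjE)

lemma A0_ge_1: "1 \<le> A0"
  using quasi unfolding quasi_metric_def by (elim conjE)

lemma d_nonneg [simp]: "0 \<le> d x y"
proof -
  have "\<forall>x y. 0 \<le> d x y"
    using quasi unfolding quasi_metric_def by (elim conjE)
  then show ?thesis by blast
qed

lemma d_eq_0_iff [simp]: "d x y = 0 \<longleftrightarrow> x = y"
proof -
  have "\<forall>x y. d x y = 0 \<longleftrightarrow> x = y"
    using quasi unfolding quasi_metric_def by (elim conjE)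
  then show ?thesis by blast
qed

lemma d_self [simp]: "d x x = 0"
  by simp

lemma d_sym: "d x y = d y x"
proof -
  have "\<forall>x y. d x y = d y x"
    using quasi unfolding quasi_metric_def by (elim conjE)
  then show ?thesis by blast
qed

lemma d_triangle: "d x z \<le> A0 * (d x y + d y z)"
proof -
  have "\<forall>x y z. d x z \<le> A0 * (d x y + d y z)"
    using quasi unfolding quasi_metric_def by (elim conjE)
  then show ?thesis by blast
qed

lemma A0_pos [simp]: "0 < A0"
  using A0_ge_1 by simp

lemma A0_neq [simp]: "A0 \<noteq> 0" and A0_nonneg [simp]: "0 \<le> A0"
  using A0_pos by linarith+

lemma space_M [simp]: "space M = UNIV"
  using homogeneous unfolding homogeneous_type_def by (elim conjE)

lemma qball_empty: "r \<le> 0 \<Longrightarrow> qball d x r = {}"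
  using d_nonneg by (auto simp: qball_def not_less intro: order_trans)

lemma sets_qball [measurable, simp]: "qball d x r \<in> sets M"
  using homogeneous qball_empty[of r x] by (cases "0 < r") (auto simp: homogeneous_type_def)

lemma emeasure_qball: "emeasure M (qball d x r) = ennreal (V r x)"
proof (cases "0 < r")
  case True
  then have "emeasure M (qball d x r) \<noteq> \<infinity>"
    using homogeneous by (simp add: homogeneous_type_def less_top)
  then show ?thesis by (simp add: vol_def emeasure_eq_ennreal_measure)
qed (simp add: qball_empty vol_def)

lemma V_nonneg [simp]: "0 \<le> V r x"
  by (simp add: vol_def)

lemma V_pos: "0 < r \<Longrightarrow> 0 < V r x"
  using homogeneous emeasure_qball[of x r] unfolding homogeneous_type_def
  by (metis ennreal_0 linorder_neqE_linordered_idom order_less_irrefl V_nonneg not_less)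

lemma V_le_of_subset: "qball d x r \<subseteq> qball d y r' \<Longrightarrow> V r x \<le> V r' y"
  using emeasure_mono[of "qball d x r" "qball d y r'" M] by (simp add: emeasure_qball)

lemma V_mono: "r \<le> r' \<Longrightarrow> V r x \<le> V r' x"
  by (rule V_le_of_subset) (auto simp: qball_def)

lemma C\<mu>_pos: "0 < C\<mu>"
  using homogeneous unfolding homogeneous_type_def by (elim conjE)

lemma V_double: "0 < r \<Longrightarrow> V (2 * r) x \<le> C\<mu> * V r x"
  using homogeneous C\<mu>_pos unfolding homogeneous_type_def
  by (simp add: emeasure_qball ennreal_mult[symmetric])

lemma C\<mu>_ge_1: "1 \<le> C\<mu>"
proof -
  fix x :: 'a
  have "1 * V 1 x \<le> C\<mu> * V 1 x" using V_double[of 1 x] V_mono[of 1 2 x] by simp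
  then show ?thesis using V_pos[of 1 x] by (subst (asm) mult_le_cancel_right) auto
qed

lemma omega_nonneg: "0 \<le> \<omega>"
  using C\<mu>_ge_1 by (simp add: \<omega>_def)

lemma C\<mu>_eq: "C\<mu> = 2 powr \<omega>"
  using C\<mu>_pos by (simp add: \<omega>_def)

text \<open>The doubling inequality is iterated as often as the logarithm of l to base 2, rounded
  up, prescribes; the rounding costs the factor C\<mu>.\<close>

lemma V_scale:
  assumes "0 < r" "1 \<le> l"
  shows "V (l * r) x \<le> C\<mu> * l powr \<omega> * V r x"
proof -
  define n where "n = nat \<lceil>log 2 l\<rceil>"
  have l0: "0 \<le> log 2 l" using assms by simp
  have "real n = real_of_int \<lceil>log 2 l\<rceil>" using l0 by (simp add: n_def)
  then have n: "log 2 l \<le> n" "real n \<le> log 2 l + 1"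
    using le_of_int_ceiling[of "log 2 l"] of_int_ceiling_le_add_one[of "log 2 l"] by auto
  have "l = 2 powr (log 2 l)" using assms by (intro powr_log_cancel[symmetric]) auto
  also have "\<dots> \<le> 2 powr (real n)" using n by (intro powr_mono) auto
  finally have ln: "l \<le> 2 ^ n" by (simp add: powr_realpow)
  have "V (2 ^ k * r) x \<le> C\<mu> ^ k * V r x" for k :: nat
  proof (induction k)
    case (Suc k)
    have "V (2 ^ Suc k * r) x \<le> C\<mu> * V (2 ^ k * r) x"
      using V_double[of "2 ^ k * r" x] assms by (simp add: mult.assoc)
    also have "\<dots> \<le> C\<mu> * (C\<mu> ^ k * V r x)"
      using Suc C\<mu>_pos by (intro mult_left_mono) auto
    finally show ?case by (simp add: mult.assoc)
  qed simp
  note this[of n]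
  moreover have "V (l * r) x \<le> V (2 ^ n * r) x"
    using ln assms by (intro V_mono mult_right_mono) auto
  ultimately have "V (l * r) x \<le> C\<mu> ^ n * V r x" by simp
  also have "C\<mu> ^ n = 2 powr (\<omega> * n)"
    using C\<mu>_pos by (simp add: powr_realpow flip: powr_powr C\<mu>_eq)
  also have "\<dots> \<le> 2 powr (\<omega> * (log 2 l + 1))"
    using n omega_nonneg by (intro powr_mono mult_left_mono) auto
  also have "\<dots> = C\<mu> * l powr \<omega>"
  proof -
    have "2 powr (\<omega> * log 2 l) = l powr \<omega>"
      using assms by (subst mult.commute) (simp flip: powr_powr)
    then show ?thesis by (simp add: distrib_left powr_add flip: C\<mu>_eq)
  qed
  finally show ?thesis by (simp add: mult_right_mono)
qed

text \<open>The ball about y lies in the ball about x of radius A0 (d x y + r') <= 2 A0 K r, to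
  which \<open>V_scale\<close> applies.\<close>

lemma V_compare:
  assumes "0 < r" "r' \<le> K * r" "d y x \<le> K * r" "1 \<le> K"
  shows "V r' y \<le> C\<mu> * (2 * A0 * K) powr \<omega> * V r x"
proof -
  have "qball d y r' \<subseteq> qball d x (2 * A0 * K * r)"
  proof
    fix w assume "w \<in> qball d y r'"
    then have "d x y + d y w < 2 * (K * r)" using assms by (simp add: qball_def d_sym[of x])
    then have "A0 * (d x y + d y w) < A0 * (2 * (K * r))" by simp
    then show "w \<in> qball d x (2 * A0 * K * r)"
      using d_triangle[of x w y] by (simp add: qball_def algebra_simps)
  qed
  moreover have "1 * 1 \<le> (2 * A0) * K" using assms A0_ge_1 by (intro mult_mono) auto
  ultimately show ?thesis
    using V_scale[of r "2 * A0 * K" x] V_le_of_subset[of y r' x "2 * A0 * K * r"] assms by linarith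
qed

lemma measurable_d [measurable]: "d x \<in> borel_measurable M"
  using sets_qball[of x] by (intro borel_measurableI_less) (simp add: qball_def)

lemma measurable_V [measurable]: "(\<lambda>r. V r x) \<in> borel_measurable borel"
  by (intro borel_measurable_mono monoI V_mono)

section \<open>The polynomially decaying kernel majorant\<close>

text \<open>A majorant at scale \<open>R\<close> of the bounds \<open>R_k\<close> and \<open>E_k\<close>.\<close>

definition W :: "real \<Rightarrow> real \<Rightarrow> 'a \<Rightarrow> 'a \<Rightarrow> real" where
  "W R e x y = (R / (R + d x y)) powr e / V (R + d x y) x"

lemma measurable_W [measurable]: "W R e x \<in> borel_measurable M"
  unfolding W_def by measurable

lemma W_nonneg [simp]: "0 \<le> W R e x y"
  by (simp add: W_def)

lemma add_d_pos [simp]: "0 < R \<Longrightarrow> 0 < R + d x y"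
  by (intro add_pos_nonneg) auto

lemma add_d_neq [simp]: "0 < R \<Longrightarrow> R + d x y \<noteq> 0"
  using add_d_pos[of R x y] by linarith

text \<open>The price of a change of arguments in \<open>W\<close>: K^e comes from the decay factor,
  the rest from \<open>V_compare\<close>.\<close>

definition WC :: "real \<Rightarrow> real \<Rightarrow> real" where
  "WC e K = K powr e * (C\<mu> * (2 * A0 * K) powr \<omega>)"

lemma WC_pos: "1 \<le> K \<Longrightarrow> 0 < WC e K"
  using C\<mu>_pos by (simp add: WC_def)

text \<open>\<open>W\<close> depends on its arguments only through the size R + d x y and the volume
  of the ball of that radius. A pair of comparable or smaller size, with first point within the same
  order of distance, changes both by controlled factors. Symmetry, moving a point inside a cell and
  moving the centre to x0 are all instances.\<close>

lemma W_compare_scale: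
  assumes "0 < R" "0 < R'" "0 \<le> e" "1 \<le> K"
    and N: "R' + d x' y' \<le> K * (R + d x y)" and x: "d x x' \<le> K * (R + d x y)"
  shows "W R e x y \<le> (R / R') powr e * WC e K * W R' e x' y'"
proof -
  define n where "n = R + d x y"
  define n' where "n' = R' + d x' y'"
  have pos: "0 < n" "0 < n'" using assms d_nonneg unfolding n_def n'_def by (auto intro: add_pos_nonneg)
  have "V n' x' \<le> C\<mu> * (2 * A0 * K) powr \<omega> * V n x"
    using assms pos by (intro V_compare) (auto simp: n_def n'_def d_sym)
  then have v: "1 / V n x \<le> C\<mu> * (2 * A0 * K) powr \<omega> / V n' x'"
    using V_pos[OF pos(1), of x] V_pos[OF pos(2), of x'] by (simp add: field_simps)
  have "1 / n \<le> K / n'"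
    using pos N by (simp add: field_simps n_def[symmetric] n'_def[symmetric])
  then have "R * (1 / n) \<le> R * (K / n')"
    using assms by (intro mult_left_mono) auto
  then have "R / n \<le> R / R' * K * (R' / n')"
    using assms by simp
  then have "(R / n) powr e \<le> (R / R' * K * (R' / n')) powr e"
    using assms pos by (intro powr_mono2) auto
  also have "\<dots> = (R / R') powr e * K powr e * (R' / n') powr e"
    using assms pos by (simp only: powr_mult)
  finally have p: "(R / n) powr e \<le> (R / R') powr e * K powr e * (R' / n') powr e" .
  have "(R / n) powr e * (1 / V n x) \<le>
      ((R / R') powr e * K powr e * (R' / n') powr e) * (C\<mu> * (2 * A0 * K) powr \<omega> / V n' x')"
    by (intro mult_mono p v) auto
  then show ?thesis by (simp add: W_def n_def n'_def WC_def field_simps)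
qed

lemma W_compare:
  assumes "0 < R" "0 \<le> e" "1 \<le> K"
    and "R + d x' y' \<le> K * (R + d x y)" "d x x' \<le> K * (R + d x y)"
  shows "W R e x y \<le> WC e K * W R e x' y'"
  using W_compare_scale[of R R e K x' y' x y] assms by simp

lemma W_sym:
  assumes "0 < R" "0 \<le> e"
  shows "W R e x y \<le> WC e 1 * W R e y x"
  using assms by (intro W_compare) (auto simp: d_sym[of x y])

lemma W_mono_exp:
  assumes "0 < R" "e \<le> e'"
  shows "W R e' x y \<le> W R e x y"
proof -
  have "(R / (R + d x y)) powr e' \<le> (R / (R + d x y)) powr e"
    using assms d_nonneg[of x y] by (intro powr_mono') (auto simp: field_simps)
  then show ?thesis by (simp add: W_def divide_right_mono)
qed

lemma W_exp_split: "W R (e + e') x y = (R / (R + d x y)) powr e' * W R e x y"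
  by (simp add: W_def powr_add)

text \<open>The index i is the least one with d x u < R / \<delta>^i. Minimality bounds d x u from
  below one step earlier; that step costs \<delta>^(-e) in the decay factor and C\<mu>
  \<delta>^(-\<omega>) in the volume.\<close>

lemma W_dom:
  assumes "0 < R" "0 \<le> e" "0 < \<delta>" "\<delta> < 1"
  obtains i where "d x u < R / \<delta> ^ i"
    "W R e x u \<le> \<delta> powr (- e) * (C\<mu> * \<delta> powr (- \<omega>)) * \<delta> powr (e * real i) / V (R / \<delta> ^ i) x"
proof -
  define i where "i = (LEAST i. d x u < R / \<delta> ^ i)"
  have "\<exists>i. \<delta> ^ i < R / (d x u + 1)"
    using assms by (intro real_arch_pow_inv divide_pos_pos add_nonneg_pos) auto
  then obtain j where "\<delta> ^ j < R / (d x u + 1)" by auto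
  then have "\<delta> ^ j * (d x u + 1) < R"
    using d_nonneg[of x u] by (simp add: pos_less_divide_eq add_nonneg_pos)
  moreover have "\<delta> ^ j * d x u \<le> \<delta> ^ j * (d x u + 1)"
    using assms by (intro mult_left_mono) auto
  ultimately have "\<delta> ^ j * d x u < R" by linarith
  then have "d x u < R / \<delta> ^ j"
    using assms zero_less_power[of \<delta> j] by (simp add: field_simps)
  then have i: "d x u < R / \<delta> ^ i" unfolding i_def by (rule LeastI)
  have "W R e x u \<le> \<delta> powr (- e) * (C\<mu> * \<delta> powr (- \<omega>)) * \<delta> powr (e * real i) / V (R / \<delta> ^ i) x"
  proof (cases i)
    case 0
    have "(R / (R + d x u)) powr e \<le> 1 powr e"
      using assms d_nonneg[of x u] by (intro powr_mono2) (auto simp: field_simps)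
    moreover have "V R x \<le> V (R + d x u) x" by (intro V_mono) simp
    ultimately have "W R e x u \<le> 1 / V R x"
      unfolding W_def using V_pos[of R x] assms by (intro frac_le) auto
    moreover have "1 \<le> \<delta> powr (- e)" "1 \<le> \<delta> powr (- \<omega>)"
      using assms omega_nonneg by (auto simp: powr_minus one_le_inverse powr_le1)
    then have "1 * (1 * 1) \<le> \<delta> powr (- e) * (C\<mu> * \<delta> powr (- \<omega>))"
      using C\<mu>_ge_1 by (intro mult_mono) auto
    then have "1 / V R x \<le> \<delta> powr (- e) * (C\<mu> * \<delta> powr (- \<omega>)) / V R x"
      by (intro divide_right_mono) auto
    ultimately show ?thesis using 0 assms by simp
  next
    case (Suc j)
    have "\<not> d x u < R / \<delta> ^ j"
      using not_less_Least[of j "\<lambda>i. d x u < R / \<delta> ^ i"] Suc by (simp add: i_def)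
    then have dj: "R / \<delta> ^ j \<le> d x u" by simp
    define r where "r = R / \<delta> ^ j"
    have r: "0 < r" "r \<le> R + d x u" using assms dj by (auto simp: r_def)
    have "R / (R + d x u) \<le> \<delta> ^ j"
      using assms r dj d_nonneg[of x u] by (simp add: r_def field_simps add_nonneg_pos)
    then have "(R / (R + d x u)) powr e \<le> (\<delta> ^ j) powr e"
      using assms d_nonneg[of x u] by (intro powr_mono2) auto
    also have "(\<delta> ^ j) powr e = \<delta> powr (- e) * \<delta> powr (e * real i)"
      using assms by (simp add: Suc powr_powr algebra_simps flip: powr_realpow powr_add)
    finally have p: "(R / (R + d x u)) powr e \<le> \<delta> powr (- e) * \<delta> powr (e * real i)" .
    have "V (1 / \<delta> * r) x \<le> C\<mu> * (1 / \<delta>) powr \<omega> * V r x"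
      using assms r by (intro V_scale) auto
    also have "\<dots> \<le> C\<mu> * (1 / \<delta>) powr \<omega> * V (R + d x u) x"
      using C\<mu>_pos r by (intro mult_left_mono V_mono) auto
    also have "(1 / \<delta>) powr \<omega> = \<delta> powr (- \<omega>)" using assms by (simp add: powr_minus powr_divide field_simps)
    finally have "V (R / \<delta> ^ i) x \<le> C\<mu> * \<delta> powr (- \<omega>) * V (R + d x u) x"
      by (simp add: Suc r_def)
    then have v: "1 / V (R + d x u) x \<le> C\<mu> * \<delta> powr (- \<omega>) / V (R / \<delta> ^ i) x"
      using V_pos[of "R / \<delta> ^ i" x] V_pos[of "R + d x u" x] r assms by (simp add: field_simps)
    have "(R / (R + d x u)) powr e * (1 / V (R + d x u) x) \<le>
        (\<delta> powr (- e) * \<delta> powr (e * real i)) * (C\<mu> * \<delta> powr (- \<omega>) / V (R / \<delta> ^ i) x)"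
      by (intro mult_mono p v) auto
    then show ?thesis by (simp add: W_def mult_ac)
  qed
  with i show thesis by (rule that)
qed

text \<open>At each u a single term of the series already dominates the kernel by
  \<open>W_dom\<close>, so the kernel is at most the whole series, which is then integrated term by
  term. This turns integration against \<open>W\<close> into a geometric sum of ball
  averages.\<close>

lemma nn_integral_W_le:
  assumes "0 < R" "0 \<le> e" "0 < \<delta>" "\<delta> < 1" and [measurable]: "g \<in> borel_measurable M"
  shows "(\<integral>\<^sup>+u. ennreal (W R e x u) * g u \<partial>M) \<le> ennreal (\<delta> powr (- e) * (C\<mu> * \<delta> powr (- \<omega>))) *
    (\<Sum>i. ennreal (\<delta> powr (e * real i)) *
       ((\<integral>\<^sup>+u\<in>qball d x (R / \<delta> ^ i). g u \<partial>M) / emeasure M (qball d x (R / \<delta> ^ i))))"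
proof -
  define c where "c = \<delta> powr (- e) * (C\<mu> * \<delta> powr (- \<omega>))"
  have c: "0 < c" using assms C\<mu>_pos by (simp add: c_def)
  have Vp: "0 < V (R / \<delta> ^ i) x" for i using assms by (intro V_pos) auto
  have le: "ennreal (W R e x u) * g u \<le>
     (\<Sum>i. ennreal (c * \<delta> powr (e * real i) / V (R / \<delta> ^ i) x) * (g u * indicator (qball d x (R / \<delta> ^ i)) u))" for u
  proof -
    obtain i where i: "d x u < R / \<delta> ^ i" "W R e x u \<le> c * \<delta> powr (e * real i) / V (R / \<delta> ^ i) x"
      using W_dom[OF assms(1-4)] unfolding c_def by metis
    have "ennreal (W R e x u) * g u \<le> ennreal (c * \<delta> powr (e * real i) / V (R / \<delta> ^ i) x) * g u"
      using i by (intro mult_right_mono ennreal_leI) auto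
    also have "\<dots> = (\<Sum>i\<in>{i}. ennreal (c * \<delta> powr (e * real i) / V (R / \<delta> ^ i) x) * (g u * indicator (qball d x (R / \<delta> ^ i)) u))"
      using i by (simp add: qball_def)
    also have "\<dots> \<le> (\<Sum>i. ennreal (c * \<delta> powr (e * real i) / V (R / \<delta> ^ i) x) * (g u * indicator (qball d x (R / \<delta> ^ i)) u))"
      by (intro sum_le_suminf) auto
    finally show ?thesis .
  qed
  have "(\<integral>\<^sup>+u. ennreal (W R e x u) * g u \<partial>M) \<le>
     (\<Sum>i. ennreal (c * \<delta> powr (e * real i) / V (R / \<delta> ^ i) x) * (\<integral>\<^sup>+u\<in>qball d x (R / \<delta> ^ i). g u \<partial>M))"
    by (rule order_trans[OF nn_integral_mono[OF le]]) (simp add: nn_integral_suminf nn_integral_cmult)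
  also have "\<dots> = (\<Sum>i. ennreal c * (ennreal (\<delta> powr (e * real i)) *
       ((\<integral>\<^sup>+u\<in>qball d x (R / \<delta> ^ i). g u \<partial>M) / emeasure M (qball d x (R / \<delta> ^ i)))))"
  proof (intro suminf_cong)
    fix i
    show "ennreal (c * \<delta> powr (e * real i) / V (R / \<delta> ^ i) x) * (\<integral>\<^sup>+u\<in>qball d x (R / \<delta> ^ i). g u \<partial>M) =
       ennreal c * (ennreal (\<delta> powr (e * real i)) *
       ((\<integral>\<^sup>+u\<in>qball d x (R / \<delta> ^ i). g u \<partial>M) / emeasure M (qball d x (R / \<delta> ^ i))))"
      using Vp[of i] c
      by (simp add: emeasure_qball ennreal_divide_real mult.assoc[symmetric] flip: ennreal_mult)
  qed
  finally show ?thesis by (simp add: c_def)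
qed

lemma suminf_geometric_powr:
  assumes "0 < e" "0 < \<delta>" "\<delta> < 1"
  shows "(\<Sum>i. ennreal (\<delta> powr (e * real i))) = ennreal (1 / (1 - \<delta> powr e))"
proof -
  have lt: "\<delta> powr e < 1" using powr_less_mono2[of e \<delta> 1] assms by simp
  have "(\<Sum>i. ennreal ((\<delta> powr e) ^ i)) = ennreal (\<Sum>i. (\<delta> powr e) ^ i)"
    using lt by (intro suminf_ennreal2) (auto intro: summable_geometric)
  moreover have "\<delta> powr (e * real i) = (\<delta> powr e) ^ i" for i
    using assms by (subst powr_powr[symmetric], subst powr_realpow) auto
  ultimately show ?thesis
    using lt by (simp add: suminf_geometric)
qed

text \<open>With g = 1 every ball average is 1 and only the geometric series is left, so the
  constant depends on neither the scale nor the centre.\<close>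

lemma nn_integral_W:
  assumes "0 < e"
  obtains C where "0 < C" "\<And>R x. 0 < R \<Longrightarrow> (\<integral>\<^sup>+u. ennreal (W R e x u) \<partial>M) \<le> ennreal C"
    "\<And>R x. 0 < R \<Longrightarrow> (\<integral>\<^sup>+u. ennreal (W R e u x) \<partial>M) \<le> ennreal C"
proof -
  \<comment> \<open>No dyadic system is present in this locale; any ratio between 0 and 1 can be
    used to cut space into rings.\<close>
  obtain \<delta> :: real where \<delta>: "0 < \<delta>" "\<delta> < 1" using dense[of 0 "1::real"] by auto
  define c where "c = \<delta> powr (- e) * (C\<mu> * \<delta> powr (- \<omega>)) * (1 / (1 - \<delta> powr e))"
  have lt: "\<delta> powr e < 1" using powr_less_mono2[of e \<delta> 1] assms \<delta> by simp
  have c: "0 < c" using lt C\<mu>_pos \<delta> by (simp add: c_def)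
  have b: "(\<integral>\<^sup>+u. ennreal (W R e x u) \<partial>M) \<le> ennreal c" if "0 < R" for R x
  proof -
    have "(\<integral>\<^sup>+u. ennreal (W R e x u) * 1 \<partial>M) \<le> ennreal (\<delta> powr (- e) * (C\<mu> * \<delta> powr (- \<omega>))) *
      (\<Sum>i. ennreal (\<delta> powr (e * real i)) *
       ((\<integral>\<^sup>+u\<in>qball d x (R / \<delta> ^ i). 1 \<partial>M) / emeasure M (qball d x (R / \<delta> ^ i))))"
      using assms that \<delta> by (intro nn_integral_W_le) auto
    also have "(\<lambda>i. ennreal (\<delta> powr (e * real i)) *
       ((\<integral>\<^sup>+u\<in>qball d x (R / \<delta> ^ i). 1 \<partial>M) / emeasure M (qball d x (R / \<delta> ^ i)))) =
       (\<lambda>i. ennreal (\<delta> powr (e * real i)))"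
    proof
      fix i
      have "0 < V (R / \<delta> ^ i) x" using that \<delta> by (intro V_pos) auto
      then show "ennreal (\<delta> powr (e * real i)) *
         ((\<integral>\<^sup>+u\<in>qball d x (R / \<delta> ^ i). 1 \<partial>M) / emeasure M (qball d x (R / \<delta> ^ i))) = ennreal (\<delta> powr (e * real i))"
        by (simp add: emeasure_qball ennreal_divide_self)
    qed
    also have "ennreal (\<delta> powr (- e) * (C\<mu> * \<delta> powr (- \<omega>))) * (\<Sum>i. ennreal (\<delta> powr (e * real i))) = ennreal c"
      using assms lt C\<mu>_pos \<delta> by (subst suminf_geometric_powr) (simp_all add: c_def flip: ennreal_mult)
    finally show ?thesis by simp
  qed
  show thesis
  proof (rule that[of "max c (WC e 1 * c)"])
    fix R :: real and x assume R: "0 < R"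
    show "(\<integral>\<^sup>+u. ennreal (W R e x u) \<partial>M) \<le> ennreal (max c (WC e 1 * c))"
      using b[OF R, of x] by (meson ennreal_leI max.cobounded1 order_trans)
    have "(\<integral>\<^sup>+u. ennreal (W R e u x) \<partial>M) \<le> (\<integral>\<^sup>+u. ennreal (WC e 1) * ennreal (W R e x u) \<partial>M)"
      using R assms WC_pos[of 1 e] W_sym[of R e _ x] by (intro nn_integral_mono) (simp add: ennreal_mult[symmetric])
    also have "\<dots> \<le> ennreal (WC e 1) * ennreal c"
      using b[OF R, of x] by (simp add: nn_integral_cmult mult_left_mono)
    also have "\<dots> \<le> ennreal (max c (WC e 1 * c))"
      using c WC_pos[of 1 e] by (simp add: ennreal_mult[symmetric] ennreal_leI)
    finally show "(\<integral>\<^sup>+u. ennreal (W R e u x) \<partial>M) \<le> ennreal (max c (WC e 1 * c))" .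
  qed (use c in simp)
qed

text \<open>R + d x y is at most twice the larger of R and d x y, so one doubling bounds the volume
  in \<open>W\<close> by the corresponding term of the sum in \<open>poly_bound\<close>.\<close>

lemma poly_bound_le_W:
  assumes "0 < R"
  shows "poly_bound M d e R x y \<le> C\<mu> * W R e x y"
proof -
  have "V (R + d x y) x \<le> C\<mu> * (V R x + vol2 M d x y)"
  proof (cases "d x y \<le> R")
    case True
    have "V (R + d x y) x \<le> V (2 * R) x" using True by (intro V_mono) auto
    also have "\<dots> \<le> C\<mu> * V R x" using assms by (rule V_double)
    also have "\<dots> \<le> C\<mu> * (V R x + vol2 M d x y)"
      using C\<mu>_pos by (intro mult_left_mono) (auto simp: vol2_def)
    finally show ?thesis .
  next
    case False
    have "V (R + d x y) x \<le> V (2 * d x y) x" using False by (intro V_mono) auto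
    also have "\<dots> \<le> C\<mu> * V (d x y) x" using assms False by (intro V_double) auto
    also have "\<dots> \<le> C\<mu> * (V R x + vol2 M d x y)"
      using C\<mu>_pos by (intro mult_left_mono) (auto simp: vol2_def)
    finally show ?thesis .
  qed
  moreover have "0 < V R x + vol2 M d x y"
    using V_pos[OF assms, of x] by (simp add: vol2_def add_pos_nonneg)
  moreover have "0 < V (R + d x y) x" using assms by (intro V_pos add_pos_nonneg) auto
  ultimately have "1 / (V R x + vol2 M d x y) \<le> C\<mu> * (1 / V (R + d x y) x)"
    by (simp add: field_simps)
  then have "1 / (V R x + vol2 M d x y) * (R / (R + d x y)) powr e \<le> C\<mu> * (1 / V (R + d x y) x) * (R / (R + d x y)) powr e"
    by (intro mult_right_mono) auto
  then show ?thesis by (simp add: poly_bound_def W_def)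
qed

lemma W_le_test_decay: "W 1 e x0 x \<le> 2 * test_decay M d x0 e x"
proof -
  have "V 1 x0 + vol2 M d x0 x \<le> 2 * V (1 + d x0 x) x0"
    using V_mono[of 1 "1 + d x0 x" x0] V_mono[of "d x0 x" "1 + d x0 x" x0] by (simp add: vol2_def)
  moreover have "0 < V 1 x0 + vol2 M d x0 x"
    using V_pos[of 1 x0] by (simp add: vol2_def add_pos_nonneg)
  moreover have "0 < V (1 + d x0 x) x0" by (intro V_pos add_pos_nonneg) auto
  ultimately have "1 / V (1 + d x0 x) x0 \<le> 2 * (1 / (V 1 x0 + vol2 M d x0 x))"
    by (simp add: field_simps)
  then have "1 / V (1 + d x0 x) x0 * (1 + d x0 x) powr (- e) \<le> 2 * (1 / (V 1 x0 + vol2 M d x0 x)) * (1 + d x0 x) powr (- e)"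
    by (intro mult_right_mono) auto
  then show ?thesis
    by (simp add: W_def test_decay_def powr_divide powr_minus field_simps add_nonneg_pos)
qed

lemma exp_decay_poly:
  fixes \<nu> a L :: real
  assumes "0 < \<nu>" "0 < a" "0 \<le> L"
  obtains C where "0 < C" "\<And>t. 0 \<le> t \<Longrightarrow> exp (- \<nu> * t powr a) \<le> C * (1 + t) powr (- L)"
proof -
  have "((\<lambda>t. (1 + t) powr L * exp (- \<nu> * t powr a)) \<longlongrightarrow> 0) at_top"
    using assms by real_asymp
  then have "eventually (\<lambda>t. (1 + t) powr L * exp (- \<nu> * t powr a) < 1) at_top"
    by (rule order_tendstoD) simp
  then obtain T where T: "\<And>t. T \<le> t \<Longrightarrow> (1 + t) powr L * exp (- \<nu> * t powr a) < 1"
    by (auto simp: eventually_at_top_linorder)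
  define C where "C = 1 + (1 + \<bar>T\<bar>) powr L"
  have "exp (- \<nu> * t powr a) \<le> C * (1 + t) powr (- L)" if t: "0 \<le> t" for t
  proof -
    have "(1 + t) powr L * exp (- \<nu> * t powr a) \<le> C"
    proof (cases "T \<le> t")
      case True
      then show ?thesis using T[of t] by (simp add: C_def) (smt (verit) powr_ge_zero)
    next
      case False
      have "(1 + t) powr L * exp (- \<nu> * t powr a) \<le> (1 + \<bar>T\<bar>) powr L * 1"
        using False t assms by (intro mult_mono powr_mono2) auto
      then show ?thesis by (simp add: C_def)
    qed
    then show ?thesis using t by (simp add: powr_minus field_simps add_pos_nonneg)
  qed
  moreover have "0 < C" unfolding C_def by (smt (verit) powr_ge_zero)
  ultimately show thesis using that by blast
qed

text \<open>With t = d x y / R, the exponential is bounded by (1+t)^(-L-\<omega>). The power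
  \<omega> is spent on replacing the geometric mean of the two volumes at radius R by the larger
  volume V (R + d x y) x, and L remains as decay.\<close>

lemma exp_bound0_le_W:
  assumes "0 < \<nu>" "0 < a" "0 \<le> L"
  obtains C where "0 < C" "\<And>R x y. 0 < R \<Longrightarrow> exp_bound0 M d R \<nu> a x y \<le> C * W R L x y"
proof -
  obtain c where c: "0 < c" "\<And>t. 0 \<le> t \<Longrightarrow> exp (- \<nu> * t powr a) \<le> c * (1 + t) powr (- (L + \<omega>))"
    using exp_decay_poly[of \<nu> a "L + \<omega>"] assms omega_nonneg by auto
  define B where "B = C\<mu> * (2 * A0) powr \<omega>"
  have B: "0 < B" using C\<mu>_pos by (simp add: B_def)
  have "exp_bound0 M d R \<nu> a x y \<le> (c * B) * W R L x y" if R: "0 < R" for R x y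
  proof -
    define t where "t = d x y / R"
    have t: "0 \<le> t" "d x y = t * R" using R by (auto simp: t_def)
    have N: "R + d x y = (1 + t) * R" by (simp add: t algebra_simps)
    have le: "V (R + d x y) x \<le> B * (1 + t) powr \<omega> * V R w" if "w = x \<or> w = y" for w
    proof -
      have "V (R + d x y) x \<le> C\<mu> * (2 * A0 * (1 + t)) powr \<omega> * V R w"
        using that R t by (intro V_compare) (auto simp: N algebra_simps add_nonneg_nonneg)
      moreover have "(2 * A0 * (1 + t)) powr \<omega> = (2 * A0) powr \<omega> * (1 + t) powr \<omega>"
        by (rule powr_mult)
      ultimately show ?thesis by (simp only: B_def mult_ac)
    qed
    define v where "v = V (R + d x y) x"
    have v: "0 < v" unfolding v_def using R by (intro V_pos add_pos_nonneg) auto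
    have b: "0 < B * (1 + t) powr \<omega>" using B t by simp
    have "v * v \<le> (B * (1 + t) powr \<omega> * V R x) * (B * (1 + t) powr \<omega> * V R y)"
      using le[of x] le[of y] v b V_nonneg by (intro mult_mono) (auto simp: v_def)
    also have "\<dots> = (B * (1 + t) powr \<omega>)\<^sup>2 * (V R x * V R y)" by (simp add: power2_eq_square)
    finally have "v \<le> sqrt ((B * (1 + t) powr \<omega>)\<^sup>2 * (V R x * V R y))"
      using v by (intro real_le_rsqrt) (simp add: power2_eq_square)
    then have "v \<le> B * (1 + t) powr \<omega> * sqrt (V R x * V R y)"
      using b by (simp add: real_sqrt_mult)
    moreover have "0 < sqrt (V R x * V R y)" using V_pos[OF R] by simp
    ultimately have s: "1 / sqrt (V R x * V R y) \<le> B * (1 + t) powr \<omega> / v"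
      using v by (simp add: field_simps)
    have "exp_bound0 M d R \<nu> a x y = 1 / sqrt (V R x * V R y) * exp (- \<nu> * t powr a)"
      by (simp add: exp_bound0_def exp_factor_def t_def)
    also have "\<dots> \<le> (B * (1 + t) powr \<omega> / v) * (c * (1 + t) powr (- (L + \<omega>)))"
      using c(2)[OF t(1)] s b v by (intro mult_mono) auto
    also have "\<dots> = c * B * ((1 + t) powr (- L) / v)"
      using t by (simp add: powr_diff powr_minus field_simps powr_add)
    also have "(1 + t) powr (- L) / v = W R L x y"
    proof -
      have "R / (R + d x y) = 1 / (1 + t)" using R t unfolding N by simp
      then show ?thesis using t unfolding W_def v_def by (simp add: powr_minus_divide powr_divide)
    qed
    finally show ?thesis .
  qed
  then show thesis using that[of "c * B"] c B by auto
qed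

lemma exp_factor_bounds: "0 < \<nu> \<Longrightarrow> 0 \<le> exp_factor \<nu> a r t" "0 < \<nu> \<Longrightarrow> exp_factor \<nu> a r t \<le> 1"
  by (auto simp: exp_factor_def)

lemma exp_bound_le_exp_bound0: "0 < \<nu> \<Longrightarrow> exp_bound M d Y r \<nu> a x y \<le> exp_bound0 M d r \<nu> a x y"
  unfolding exp_bound_def
  by (rule mult_left_le) (auto simp: exp_bound0_def intro!: exp_factor_bounds divide_nonneg_nonneg mult_nonneg_nonneg)

end

section \<open>Almost orthogonality\<close>

text \<open>A non-integrable F has Bochner integral 0 by convention, and then B >= 0
  suffices.\<close>

lemma norm_integral_le_nn:
  fixes F :: "'a \<Rightarrow> complex"
  assumes "(\<integral>\<^sup>+u. ennreal (cmod (F u)) \<partial>M) \<le> ennreal B" "0 \<le> B"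
  shows "cmod (\<integral>u. F u \<partial>M) \<le> B"
proof (cases "integrable M F")
  case True
  then have "ennreal (cmod (\<integral>u. F u \<partial>M)) \<le> ennreal B"
    using integral_norm_bound_ennreal[OF True] assms(1) by (meson order_trans)
  then show ?thesis using assms(2) by simp
qed (simp add: not_integrable_integral_eq assms(2))

context homogeneous_space
begin

text \<open>The common ending of the almost orthogonality estimates: the integrand is bounded by a
  constant times a kernel around one endpoint plus a kernel around the other, and each has bounded
  mass at every scale. The second kernel has its integration variable in first place and is turned
  around by \<open>W_sym\<close>.\<close>

lemma nn_integral_two_W:
  assumes "0 < e1" "0 < e2"
  obtains C where "0 < C" "\<And>r R a b F c. \<lbrakk>0 < r; 0 < R; 0 \<le> c;
      \<And>u. cmod (F u) \<le> c * (W r e1 a u + W R e2 u b)\<rbrakk> \<Longrightarrow> (\<integral>\<^sup>+u. ennreal (cmod (F u)) \<partial>M) \<le> ennreal (C * c)"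
proof -
  obtain C1 where C1: "0 < C1" "\<And>R x. 0 < R \<Longrightarrow> (\<integral>\<^sup>+u. ennreal (W R e1 x u) \<partial>M) \<le> ennreal C1"
    using nn_integral_W[OF assms(1)] by metis
  obtain C2 where C2: "0 < C2" "\<And>R x. 0 < R \<Longrightarrow> (\<integral>\<^sup>+u. ennreal (W R e2 x u) \<partial>M) \<le> ennreal C2"
    using nn_integral_W[OF assms(2)] by metis
  have w: "0 < WC e2 1" by (rule WC_pos) simp
  have main: "(\<integral>\<^sup>+u. ennreal (cmod (F u)) \<partial>M) \<le> ennreal ((C1 + WC e2 1 * C2) * c)"
    if "0 < r" "0 < R" "0 \<le> c" and F: "\<And>u. cmod (F u) \<le> c * (W r e1 a u + W R e2 u b)"
    for r R a b c and F :: "'a \<Rightarrow> complex"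
  proof -
    have "cmod (F u) \<le> c * W r e1 a u + c * WC e2 1 * W R e2 b u" for u
    proof -
      have "c * W R e2 u b \<le> c * (WC e2 1 * W R e2 b u)"
        using that assms by (intro mult_left_mono W_sym) auto
      then show ?thesis using F[of u] by (simp add: algebra_simps)
    qed
    then have "(\<integral>\<^sup>+u. ennreal (cmod (F u)) \<partial>M) \<le>
        (\<integral>\<^sup>+u. ennreal c * ennreal (W r e1 a u) + ennreal (c * WC e2 1) * ennreal (W R e2 b u) \<partial>M)"
      using that w by (intro nn_integral_mono) (simp add: ennreal_leI flip: ennreal_mult ennreal_plus)
    also have "\<dots> = ennreal c * (\<integral>\<^sup>+u. ennreal (W r e1 a u) \<partial>M) + ennreal (c * WC e2 1) * (\<integral>\<^sup>+u. ennreal (W R e2 b u) \<partial>M)"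
      by (simp add: nn_integral_add nn_integral_cmult)
    also have "\<dots> \<le> ennreal c * ennreal C1 + ennreal (c * WC e2 1) * ennreal C2"
      using that by (intro add_mono mult_left_mono C1 C2) auto
    also have "\<dots> = ennreal ((C1 + WC e2 1 * C2) * c)"
      using that w C1 C2 by (simp add: algebra_simps flip: ennreal_mult ennreal_plus)
    finally show ?thesis .
  qed
  have "0 < C1 + WC e2 1 * C2" using C1 C2 w by (intro add_pos_pos mult_pos_pos)
  then show thesis using main by (rule that)
qed

lemma integrable_of_W_bound:
  fixes F :: "'a \<Rightarrow> complex"
  assumes [measurable]: "F \<in> borel_measurable M"
    and "0 < R" "0 < e" "0 \<le> c" and F: "(\<forall>u. cmod (F u) \<le> c * W R e x u) \<or> (\<forall>u. cmod (F u) \<le> c * W R e u x)"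
  shows "integrable M F"
proof -
  obtain C where C: "0 < C" "\<And>r R a b F c. \<lbrakk>0 < r; 0 < R; 0 \<le> c;
      \<And>u. cmod (F u) \<le> c * (W r e a u + W R e u b)\<rbrakk> \<Longrightarrow> (\<integral>\<^sup>+u. ennreal (cmod (F u)) \<partial>M) \<le> ennreal (C * c)"
    using nn_integral_two_W[OF assms(3,3)] by metis
  have "cmod (F u) \<le> c * (W R e x u + W R e u x)" for u
    using F mult_left_mono[OF W_nonneg \<open>0 \<le> c\<close>, of R e x u] mult_left_mono[OF W_nonneg \<open>0 \<le> c\<close>, of R e u x]
    by (simp add: distrib_left) (metis add_increasing add_increasing2)
  then have "(\<integral>\<^sup>+u. ennreal (cmod (F u)) \<partial>M) \<le> ennreal (C * c)"
    using assms by (intro C(2)) auto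
  then show ?thesis
    by (intro integrableI_bounded) (auto simp: less_top[symmetric] top_unique intro: le_less_trans)
qed

text \<open>How a gain arises: Hoelder smoothness at scale R against decay at scale r gives (r/R)^t
  whatever the distance d0, since d0 / (r + d0) <= 1.\<close>

lemma ratio_powr_le:
  assumes "0 \<le> d0" "0 < (r::real)" "0 < R" "0 \<le> t"
  shows "(d0 / R) powr t * (r / (r + d0)) powr t \<le> (r / R) powr t"
proof -
  have "(d0 / R) * (r / (r + d0)) \<le> r / R"
  proof -
    have "r / R * (d0 / (r + d0)) \<le> r / R * 1"
      using assms by (intro mult_left_mono) auto
    then show ?thesis by (simp add: mult_ac)
  qed
  then have "((d0 / R) * (r / (r + d0))) powr t \<le> (r / R) powr t"
    using assms by (intro powr_mono2) auto
  then show ?thesis by (simp only: powr_mult)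
qed

text \<open>The finer function \<phi> has integral 0, so H may be replaced by H - H x. Near x the
  regularity of H meets the surplus decay \<beta> of \<phi> as in \<open>ratio_powr_le\<close>. Far
  from x, where r + d x u is at least c (R + d x y), the surplus decay alone gives (r/R)^\<beta> and
  the sizes of H u and H x suffice.\<close>

lemma almost_orthogonal_fine:
  assumes "0 < \<beta>" "0 < \<gamma>" "0 < c" "c \<le> 1"
  obtains C where "0 < C" "\<And>r R x y \<phi> H C1 C2. \<lbrakk>0 < r; r \<le> R; 0 \<le> C1; 0 \<le> C2;
      \<phi> \<in> borel_measurable M; H \<in> borel_measurable M;
      \<And>u. cmod (\<phi> u) \<le> C1 * W r (\<gamma> + \<beta>) x u; (\<integral>u. \<phi> u \<partial>M) = 0;
      \<And>u. cmod (H u) \<le> C2 * W R \<gamma> u y;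
      \<And>u. d x u \<le> c * (R + d x y) \<Longrightarrow>
         cmod (H u - H x) \<le> C2 * (d x u / (R + d x y)) powr \<beta> * W R \<gamma> x y\<rbrakk>
    \<Longrightarrow> cmod (\<integral>u. H u * \<phi> u \<partial>M) \<le> C * C1 * C2 * (r / R) powr \<beta> * W R \<gamma> x y"
proof -
  obtain C where C: "0 < C" "\<And>r R a b F c. \<lbrakk>0 < r; 0 < R; 0 \<le> c;
      \<And>u. cmod (F u) \<le> c * (W r \<gamma> a u + W R \<gamma> u b)\<rbrakk> \<Longrightarrow> (\<integral>\<^sup>+u. ennreal (cmod (F u)) \<partial>M) \<le> ennreal (C * c)"
    using nn_integral_two_W[OF assms(2,2)] by metis
  define K where "K = 1 + (1 / c) powr \<beta> * (1 + WC \<gamma> (1 / c))"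
  have wc: "0 < WC \<gamma> (1 / c)" using assms by (intro WC_pos) auto
  have cb: "0 < (1 / c) powr \<beta>" using assms by simp
  have K: "1 \<le> K" "(1 / c) powr \<beta> \<le> K" "(1 / c) powr \<beta> * WC \<gamma> (1 / c) \<le> K"
    using wc cb by (auto simp: K_def algebra_simps intro: add_nonneg_nonneg)
  have "cmod (\<integral>u. H u * \<phi> u \<partial>M) \<le> C * K * C1 * C2 * (r / R) powr \<beta> * W R \<gamma> x y"
    if rR: "0 < r" "r \<le> R" "0 \<le> C1" "0 \<le> C2"
      and [measurable]: "\<phi> \<in> borel_measurable M" "H \<in> borel_measurable M"
      and \<phi>: "\<And>u. cmod (\<phi> u) \<le> C1 * W r (\<gamma> + \<beta>) x u" "(\<integral>u. \<phi> u \<partial>M) = 0"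
      and H: "\<And>u. cmod (H u) \<le> C2 * W R \<gamma> u y"
        "\<And>u. d x u \<le> c * (R + d x y) \<Longrightarrow>
           cmod (H u - H x) \<le> C2 * (d x u / (R + d x y)) powr \<beta> * W R \<gamma> x y"
    for r R x y \<phi> H C1 C2
  proof -
    have R: "0 < R" using rR by simp
    define A where "A = C1 * C2 * (r / R) powr \<beta> * W R \<gamma> x y"
    have A: "0 \<le> A" using rR by (simp add: A_def)
    have \<phi>': "cmod (\<phi> u) \<le> C1 * ((r / (r + d x u)) powr \<beta> * W r \<gamma> x u)" for u
      using \<phi>(1)[of u] by (simp only: W_exp_split)
    have pw: "cmod ((H u - H x) * \<phi> u) \<le> (K * A) * (W r \<gamma> x u + W R \<gamma> u y)" for u
    proof (cases "d x u \<le> c * (R + d x y)")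
      case True
      have "cmod (H u - H x) \<le> C2 * (d x u / R) powr \<beta> * W R \<gamma> x y"
      proof -
        have "d x u / (R + d x y) \<le> d x u / R" using R by (intro divide_left_mono) auto
        then have "(d x u / (R + d x y)) powr \<beta> \<le> (d x u / R) powr \<beta>"
          using R assms by (intro powr_mono2) (auto intro!: divide_nonneg_pos)
        then have "C2 * (d x u / (R + d x y)) powr \<beta> * W R \<gamma> x y \<le> C2 * (d x u / R) powr \<beta> * W R \<gamma> x y"
          using rR by (intro mult_right_mono mult_left_mono) auto
        then show ?thesis using H(2)[OF True] by simp
      qed
      then have "cmod ((H u - H x) * \<phi> u) \<le> (C2 * (d x u / R) powr \<beta> * W R \<gamma> x y) * (C1 * ((r / (r + d x u)) powr \<beta> * W r \<gamma> x u))"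
        unfolding norm_mult using rR by (intro mult_mono \<phi>') auto
      also have "\<dots> = C1 * C2 * W R \<gamma> x y * ((d x u / R) powr \<beta> * (r / (r + d x u)) powr \<beta>) * W r \<gamma> x u"
        by (simp add: mult_ac)
      also have "\<dots> \<le> C1 * C2 * W R \<gamma> x y * (r / R) powr \<beta> * W r \<gamma> x u"
        using rR R assms by (intro mult_right_mono mult_left_mono ratio_powr_le) auto
      also have "\<dots> = 1 * A * W r \<gamma> x u" by (simp add: A_def)
      also have "\<dots> \<le> K * A * (W r \<gamma> x u + W R \<gamma> u y)"
        using K A by (intro mult_mono) auto
      finally show ?thesis .
    next
      case False
      then have far: "R + d x y \<le> (1 / c) * (r + d x u)"
        using assms rR by (simp add: field_simps)
      have "r / (r + d x u) \<le> (1 / c) * (r / R)"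
      proof -
        have "c * R \<le> c * (R + d x y)" using assms by (intro mult_left_mono) auto
        then have "c * R \<le> r + d x u" using False rR by simp
        then have "r / (r + d x u) \<le> r / (c * R)" using rR R assms by (intro divide_left_mono) auto
        then show ?thesis by (simp add: field_simps)
      qed
      then have "(r / (r + d x u)) powr \<beta> \<le> ((1 / c) * (r / R)) powr \<beta>"
        using assms rR by (intro powr_mono2) (auto intro!: divide_nonneg_pos)
      then have ratio: "(r / (r + d x u)) powr \<beta> \<le> (1 / c) powr \<beta> * (r / R) powr \<beta>"
        by (simp only: powr_mult)
      have w: "W r \<gamma> x u \<le> WC \<gamma> (1 / c) * W R \<gamma> x y"
      proof -
        have "W r \<gamma> x u \<le> (r / R) powr \<gamma> * WC \<gamma> (1 / c) * W R \<gamma> x y"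
          using rR R assms far by (intro W_compare_scale) (auto intro!: mult_nonneg_nonneg)
        also have "\<dots> \<le> 1 * WC \<gamma> (1 / c) * W R \<gamma> x y"
          using rR assms wc powr_mono2[of \<gamma> "r / R" 1] by (intro mult_right_mono) auto
        finally show ?thesis by simp
      qed
      have \<phi>2: "cmod (\<phi> u) \<le> C1 * ((1 / c) powr \<beta> * (r / R) powr \<beta> * W r \<gamma> x u)"
        by (rule order_trans[OF \<phi>']) (use rR ratio in \<open>intro mult_left_mono mult_right_mono; simp\<close>)
      \<comment> \<open>For H u the kernel of \<phi> becomes the factor W R \<gamma> x y and W R
        \<gamma> u y is left to integrate. For H x the factor W R \<gamma> x y comes from H and W r
        \<gamma> x u is left.\<close>
      have "cmod (H u) * cmod (\<phi> u) \<le> (C2 * W R \<gamma> u y) * (C1 * ((1 / c) powr \<beta> * (r / R) powr \<beta> * (WC \<gamma> (1 / c) * W R \<gamma> x y)))"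
        by (rule mult_mono[OF H(1) order_trans[OF \<phi>2]]) (use rR w in \<open>auto intro!: mult_left_mono\<close>)
      also have "\<dots> = ((1 / c) powr \<beta> * WC \<gamma> (1 / c)) * A * W R \<gamma> u y" by (simp add: A_def mult_ac)
      also have "\<dots> \<le> K * A * W R \<gamma> u y" using K A by (intro mult_right_mono) auto
      finally have 1: "cmod (H u) * cmod (\<phi> u) \<le> K * A * W R \<gamma> u y" .
      have "cmod (H x) * cmod (\<phi> u) \<le> (C2 * W R \<gamma> x y) * (C1 * ((1 / c) powr \<beta> * (r / R) powr \<beta> * W r \<gamma> x u))"
        by (rule mult_mono[OF H(1) \<phi>2]) (use rR in auto)
      also have "\<dots> = ((1 / c) powr \<beta>) * A * W r \<gamma> x u" by (simp add: A_def mult_ac)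
      also have "\<dots> \<le> K * A * W r \<gamma> x u" using K A by (intro mult_right_mono) auto
      finally have 2: "cmod (H x) * cmod (\<phi> u) \<le> K * A * W r \<gamma> x u" .
      have "cmod ((H u - H x) * \<phi> u) \<le> (cmod (H u) + cmod (H x)) * cmod (\<phi> u)"
        unfolding norm_mult by (intro mult_right_mono norm_triangle_ineq4) auto
      then show ?thesis using 1 2 by (simp add: algebra_simps)
    qed
    have KA: "0 \<le> K * A" using K A by simp
    have nn: "(\<integral>\<^sup>+u. ennreal (cmod ((H u - H x) * \<phi> u)) \<partial>M) \<le> ennreal (C * (K * A))"
      using rR(1) R KA pw by (rule C(2))
    have i1: "integrable M (\<lambda>u. (H u - H x) * \<phi> u)"
      using nn by (intro integrableI_bounded) (auto intro: le_less_trans)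
    have i2: "integrable M \<phi>"
      using \<phi>(1) rR assms by (intro integrable_of_W_bound[of \<phi> r "\<gamma> + \<beta>" C1 x]) auto
    have "(\<integral>u. H u * \<phi> u \<partial>M) = (\<integral>u. (H u - H x) * \<phi> u + H x * \<phi> u \<partial>M)"
      by (intro Bochner_Integration.integral_cong) (auto simp: algebra_simps)
    also have "\<dots> = (\<integral>u. (H u - H x) * \<phi> u \<partial>M)"
      using i1 i2 \<phi>(2) by (subst Bochner_Integration.integral_add) auto
    finally have "cmod (\<integral>u. H u * \<phi> u \<partial>M) \<le> C * (K * A)"
      using norm_integral_le_nn[OF nn] C K A by simp
    then show ?thesis by (simp add: A_def mult_ac)
  qed
  then show thesis using that[of "C * K"] C K by simp
qed

text \<open>By the quasi-triangle inequality u cannot be close to both x and y. If d u y is small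
  against r + d x y, then d x u controls r + d x y and the first kernel becomes W r \<gamma> x y;
  otherwise d u y controls it and the second kernel does. The gain (R/r)^t is cut out of the decay
  of the second kernel, which keeps the exponent \<gamma> - t; this requires r < d u y unless t =
  0.\<close>

lemma W_product_le:
  assumes "0 < \<gamma>" "0 \<le> t" "t \<le> \<gamma>" "0 < R" "R \<le> r" "t = 0 \<or> r < d u y"
  shows "W r \<gamma> x u * W R \<gamma> u y \<le>
    (WC \<gamma> (2 * A0) + WC \<gamma> (3 * A0\<^sup>2)) * (R / r) powr t * W r \<gamma> x y * (W R (\<gamma> - t) u y + W r \<gamma> x u)"
    and "W R \<gamma> u y \<le> (R / r) powr t * W R (\<gamma> - t) u y"
proof -
  have r: "0 < r" using assms by simp
  have k1: "1 \<le> 2 * A0" using A0_ge_1 by simp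
  have A0sq: "A0 \<le> A0\<^sup>2" using A0_ge_1 by (simp add: power2_eq_square)
  have k2: "1 \<le> 3 * A0\<^sup>2" "2 * A0 \<le> 3 * A0\<^sup>2" using A0_ge_1 A0sq by linarith+
  have p1: "0 < WC \<gamma> (2 * A0)" "0 < WC \<gamma> (3 * A0\<^sup>2)" using k1 k2 by (auto intro: WC_pos)
  have "(R / (R + d u y)) powr t \<le> (R / r) powr t"
  proof (cases "t = 0")
    case False
    then have "R / (R + d u y) \<le> R / r" using assms by (intro divide_left_mono) auto
    then show ?thesis using assms by (intro powr_mono2) auto
  qed (use assms r in simp)
  then have "(R / (R + d u y)) powr t * W R (\<gamma> - t) u y \<le> (R / r) powr t * W R (\<gamma> - t) u y"
    by (rule mult_right_mono) simp
  then show a: "W R \<gamma> u y \<le> (R / r) powr t * W R (\<gamma> - t) u y"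
    using W_exp_split[of R "\<gamma> - t" t u y] by simp
  define q where "q = (R / r) powr t"
  have q: "0 \<le> q" by (simp add: q_def)
  show "W r \<gamma> x u * W R \<gamma> u y \<le>
    (WC \<gamma> (2 * A0) + WC \<gamma> (3 * A0\<^sup>2)) * (R / r) powr t * W r \<gamma> x y * (W R (\<gamma> - t) u y + W r \<gamma> x u)"
  proof (cases "d u y \<le> (r + d x y) / (2 * A0)")
    case True
    then have "2 * (A0 * d u y) \<le> r + d x y" by (simp add: field_simps)
    then have "d x y \<le> 2 * (A0 * d x u) + r"
      using d_triangle[of x y u] distrib_left[of A0 "d x u" "d u y"] by linarith
    moreover have "r \<le> A0 * r" using A0_ge_1 r by simp
    ultimately have "r + d x y \<le> 2 * A0 * (r + d x u)"
      using distrib_left[of A0 r "d x u"] by simp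
    then have "W r \<gamma> x u \<le> WC \<gamma> (2 * A0) * W r \<gamma> x y"
      using r assms k1 by (intro W_compare) auto
    then have "W r \<gamma> x u * W R \<gamma> u y \<le> (WC \<gamma> (2 * A0) * W r \<gamma> x y) * (q * W R (\<gamma> - t) u y)"
      using a p1 unfolding q_def by (intro mult_mono) auto
    also have "\<dots> = WC \<gamma> (2 * A0) * q * W r \<gamma> x y * W R (\<gamma> - t) u y" by simp
    also have "\<dots> \<le> (WC \<gamma> (2 * A0) + WC \<gamma> (3 * A0\<^sup>2)) * q * W r \<gamma> x y * (W R (\<gamma> - t) u y + W r \<gamma> x u)"
      using p1 q by (intro mult_mono) auto
    finally show ?thesis by (simp add: q_def)
  next
    case False
    then have far: "r + d x y \<le> 2 * A0 * d u y" by (simp add: field_simps)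
    have "2 * A0 * d u y \<le> 3 * A0\<^sup>2 * (R + d u y)" using k2 assms(4) by (intro mult_mono[OF k2(2)]) auto
    then have n: "r + d x y \<le> 3 * A0\<^sup>2 * (R + d u y)" using far by linarith
    have "d u x \<le> A0 * (d u y + 2 * A0 * d u y)"
      using d_triangle[of u x y] far r by (smt (verit, best) A0_pos d_sym mult_left_mono)
    also have "\<dots> = A0 * d u y + 2 * A0\<^sup>2 * d u y" by (simp add: power2_eq_square algebra_simps)
    also have "\<dots> \<le> A0\<^sup>2 * d u y + 2 * A0\<^sup>2 * d u y" using A0sq by (intro add_right_mono mult_right_mono) auto
    also have "\<dots> \<le> 3 * A0\<^sup>2 * (R + d u y)" using assms by (simp add: algebra_simps)
    finally have "W R \<gamma> u y \<le> (R / r) powr \<gamma> * WC \<gamma> (3 * A0\<^sup>2) * W r \<gamma> x y"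
      using n r assms(1,4) k2 by (intro W_compare_scale) simp_all
    also have "\<dots> \<le> q * WC \<gamma> (3 * A0\<^sup>2) * W r \<gamma> x y"
      using assms p1 unfolding q_def by (intro mult_right_mono powr_mono') auto
    finally have "W r \<gamma> x u * W R \<gamma> u y \<le> W r \<gamma> x u * (q * WC \<gamma> (3 * A0\<^sup>2) * W r \<gamma> x y)"
      by (rule mult_left_mono) simp
    also have "\<dots> = WC \<gamma> (3 * A0\<^sup>2) * q * W r \<gamma> x y * W r \<gamma> x u" by simp
    also have "\<dots> \<le> (WC \<gamma> (2 * A0) + WC \<gamma> (3 * A0\<^sup>2)) * q * W r \<gamma> x y * (W R (\<gamma> - t) u y + W r \<gamma> x u)"
      using p1 q by (intro mult_mono) auto
    finally show ?thesis by (simp add: q_def)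
  qed
qed

text \<open>The case t = 0 of \<open>W_product_le\<close>: a size estimate without gain. It serves
  the levels k <= N, on which the operators of the reproducing formula have no cancellation.\<close>

lemma almost_orthogonal_size:
  assumes "0 < \<gamma>"
  obtains C where "0 < C" "\<And>r R x y \<phi> H C1 C2. \<lbrakk>0 < R; R \<le> r; 0 \<le> C1; 0 \<le> C2;
      \<And>u. cmod (\<phi> u) \<le> C1 * W r \<gamma> x u; \<And>u. cmod (H u) \<le> C2 * W R \<gamma> u y\<rbrakk>
    \<Longrightarrow> cmod (\<integral>u. H u * \<phi> u \<partial>M) \<le> C * C1 * C2 * W r \<gamma> x y"
proof -
  obtain C where C: "0 < C" "\<And>r R a b F c. \<lbrakk>0 < r; 0 < R; 0 \<le> c;
      \<And>u. cmod (F u) \<le> c * (W r \<gamma> a u + W R \<gamma> u b)\<rbrakk> \<Longrightarrow> (\<integral>\<^sup>+u. ennreal (cmod (F u)) \<partial>M) \<le> ennreal (C * c)"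
    using nn_integral_two_W[OF assms(1,1)] by metis
  define K where "K = WC \<gamma> (2 * A0) + WC \<gamma> (3 * A0\<^sup>2)"
  have "1 * 1 \<le> A0 * A0" using A0_ge_1 by (intro mult_mono) auto
  then have K: "0 < K"
    unfolding K_def using A0_ge_1 by (intro add_pos_pos WC_pos) (auto simp: power2_eq_square)
  have "cmod (\<integral>u. H u * \<phi> u \<partial>M) \<le> C * K * C1 * C2 * W r \<gamma> x y"
    if rR: "0 < R" "R \<le> r" "0 \<le> C1" "0 \<le> C2"
      and \<phi>: "\<And>u. cmod (\<phi> u) \<le> C1 * W r \<gamma> x u" and H: "\<And>u. cmod (H u) \<le> C2 * W R \<gamma> u y"
    for r R x y C1 C2 and \<phi> H :: "'a \<Rightarrow> complex"
  proof -
    define c where "c = C1 * C2 * (K * W r \<gamma> x y)"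
    have pw: "cmod (H u * \<phi> u) \<le> c * (W r \<gamma> x u + W R \<gamma> u y)" for u
    proof -
      have "cmod (H u * \<phi> u) \<le> (C2 * W R \<gamma> u y) * (C1 * W r \<gamma> x u)"
        unfolding norm_mult using rR by (intro mult_mono \<phi> H) auto
      also have "\<dots> = C1 * C2 * (W r \<gamma> x u * W R \<gamma> u y)" by simp
      also have "\<dots> \<le> C1 * C2 * (K * (R / r) powr 0 * W r \<gamma> x y * (W R (\<gamma> - 0) u y + W r \<gamma> x u))"
        unfolding K_def using rR assms by (intro mult_left_mono W_product_le(1)) auto
      also have "(R / r) powr 0 = 1" using rR by simp
      finally show ?thesis by (simp add: c_def algebra_simps)
    qed
    have r: "0 < r" and c: "0 \<le> c" using rR K by (auto simp: c_def)
    have "(\<integral>\<^sup>+u. ennreal (cmod (H u * \<phi> u)) \<partial>M) \<le> ennreal (C * c)"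
      by (rule C(2)[OF r rR(1) c pw])
    then have "cmod (\<integral>u. H u * \<phi> u \<partial>M) \<le> C * c"
      using rR K C by (intro norm_integral_le_nn) (auto simp: c_def)
    then show ?thesis by (simp add: c_def mult_ac)
  qed
  then show thesis using that[of "C * K"] C K by simp
qed

text \<open>Now H lives at the finer scale and has the cancellation, so \<phi> y is subtracted. H
  decays only with exponent \<gamma>; spending t of it on the gain leaves \<gamma> - t, which must
  stay positive for the kernel to have finite mass. Hence t < \<gamma> here, while the fine case
  reaches the full exponent \<beta>.\<close>

lemma almost_orthogonal_coarse:
  assumes "0 < \<gamma>" "0 < t" "t < \<gamma>"
  obtains C where "0 < C" "\<And>r R x y \<phi> H C1 C2. \<lbrakk>0 < R; R \<le> r; 0 \<le> C1; 0 \<le> C2;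
      \<phi> \<in> borel_measurable M; H \<in> borel_measurable M;
      \<And>u. cmod (\<phi> u) \<le> C1 * W r \<gamma> x u;
      \<And>u. d y u \<le> r \<Longrightarrow> cmod (\<phi> u - \<phi> y) \<le> C1 * (d y u / r) powr t * W r \<gamma> x y;
      \<And>u. cmod (H u) \<le> C2 * W R \<gamma> u y; (\<integral>u. H u \<partial>M) = 0\<rbrakk>
    \<Longrightarrow> cmod (\<integral>u. H u * \<phi> u \<partial>M) \<le> C * C1 * C2 * (R / r) powr t * W r \<gamma> x y"
proof -
  obtain C where C: "0 < C" "\<And>r R a b F c. \<lbrakk>0 < r; 0 < R; 0 \<le> c;
      \<And>u. cmod (F u) \<le> c * (W r \<gamma> a u + W R (\<gamma> - t) u b)\<rbrakk> \<Longrightarrow> (\<integral>\<^sup>+u. ennreal (cmod (F u)) \<partial>M) \<le> ennreal (C * c)"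
    using nn_integral_two_W[of \<gamma> "\<gamma> - t"] assms by auto
  define K where "K = WC \<gamma> (2 * A0) + WC \<gamma> (3 * A0\<^sup>2)"
  have "1 * 1 \<le> A0 * A0" using A0_ge_1 by (intro mult_mono) auto
  then have K: "0 < K"
    unfolding K_def using A0_ge_1 by (intro add_pos_pos WC_pos) (auto simp: power2_eq_square)
  have "cmod (\<integral>u. H u * \<phi> u \<partial>M) \<le> C * (K + 1) * C1 * C2 * (R / r) powr t * W r \<gamma> x y"
    if rR: "0 < R" "R \<le> r" "0 \<le> C1" "0 \<le> C2"
      and [measurable]: "\<phi> \<in> borel_measurable M" "H \<in> borel_measurable M"
      and \<phi>: "\<And>u. cmod (\<phi> u) \<le> C1 * W r \<gamma> x u"
        "\<And>u. d y u \<le> r \<Longrightarrow> cmod (\<phi> u - \<phi> y) \<le> C1 * (d y u / r) powr t * W r \<gamma> x y"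
      and H: "\<And>u. cmod (H u) \<le> C2 * W R \<gamma> u y" "(\<integral>u. H u \<partial>M) = 0"
    for r R x y C1 C2 and \<phi> H :: "'a \<Rightarrow> complex"
  proof -
    have r: "0 < r" using rR by simp
    define c where "c = C1 * C2 * ((R / r) powr t * W r \<gamma> x y)"
    have c: "0 \<le> c" using rR by (simp add: c_def)
    have pw: "cmod (H u * (\<phi> u - \<phi> y)) \<le> ((K + 1) * c) * (W r \<gamma> x u + W R (\<gamma> - t) u y)" for u
    proof (cases "d y u \<le> r")
      case True
      have "cmod (H u * (\<phi> u - \<phi> y)) \<le> (C2 * ((R / (R + d y u)) powr t * W R (\<gamma> - t) u y)) * (C1 * (d y u / r) powr t * W r \<gamma> x y)"
        unfolding norm_mult using rR H(1)[of u] W_exp_split[of R "\<gamma> - t" t u y]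
        by (intro mult_mono \<phi> True) (auto simp: d_sym[of u y])
      also have "\<dots> = C1 * C2 * W r \<gamma> x y * ((d y u / r) powr t * (R / (R + d y u)) powr t) * W R (\<gamma> - t) u y"
        by simp
      also have "\<dots> \<le> C1 * C2 * W r \<gamma> x y * (R / r) powr t * W R (\<gamma> - t) u y"
        using rR r assms by (intro mult_right_mono mult_left_mono ratio_powr_le) auto
      also have "\<dots> = 1 * c * W R (\<gamma> - t) u y" by (simp add: c_def)
      also have "\<dots> \<le> (K + 1) * c * (W r \<gamma> x u + W R (\<gamma> - t) u y)"
        using c K by (intro mult_mono) auto
      finally show ?thesis .
    next
      case False
      then have far: "r < d u y" by (simp add: d_sym)
      have "cmod (H u) * cmod (\<phi> u) \<le> (C2 * W R \<gamma> u y) * (C1 * W r \<gamma> x u)"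
        using rR by (intro mult_mono \<phi> H) auto
      also have "\<dots> = C1 * C2 * (W r \<gamma> x u * W R \<gamma> u y)" by simp
      also have "\<dots> \<le> C1 * C2 * (K * (R / r) powr t * W r \<gamma> x y * (W R (\<gamma> - t) u y + W r \<gamma> x u))"
        unfolding K_def using rR assms far by (intro mult_left_mono W_product_le(1)) auto
      finally have 1: "cmod (H u) * cmod (\<phi> u) \<le> K * c * (W r \<gamma> x u + W R (\<gamma> - t) u y)"
        by (simp add: c_def algebra_simps)
      have "cmod (H u) * cmod (\<phi> y) \<le> (C2 * ((R / r) powr t * W R (\<gamma> - t) u y)) * (C1 * W r \<gamma> x y)"
        using rR assms far by (intro mult_mono \<phi> order_trans[OF H(1)] mult_left_mono W_product_le(2)) auto
      also have "\<dots> = c * W R (\<gamma> - t) u y" by (simp add: c_def)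
      also have "\<dots> \<le> c * (W r \<gamma> x u + W R (\<gamma> - t) u y)" using c by (intro mult_left_mono) auto
      finally have 2: "cmod (H u) * cmod (\<phi> y) \<le> c * (W r \<gamma> x u + W R (\<gamma> - t) u y)" .
      have "cmod (H u * (\<phi> u - \<phi> y)) \<le> cmod (H u) * (cmod (\<phi> u) + cmod (\<phi> y))"
        unfolding norm_mult by (intro mult_left_mono norm_triangle_ineq4) auto
      then show ?thesis using 1 2 by (simp add: algebra_simps)
    qed
    have nn: "(\<integral>\<^sup>+u. ennreal (cmod (H u * (\<phi> u - \<phi> y))) \<partial>M) \<le> ennreal (C * ((K + 1) * c))"
      by (rule C(2)[OF r rR(1) _ pw]) (use c K in simp)
    have i1: "integrable M (\<lambda>u. H u * (\<phi> u - \<phi> y))"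
      using nn by (intro integrableI_bounded) (auto intro: le_less_trans)
    have i2: "integrable M H"
      using H(1) rR assms by (intro integrable_of_W_bound[of H R \<gamma> C2 y]) auto
    have "(\<integral>u. H u * \<phi> u \<partial>M) = (\<integral>u. H u * (\<phi> u - \<phi> y) + \<phi> y * H u \<partial>M)"
      by (intro Bochner_Integration.integral_cong) (auto simp: algebra_simps)
    also have "\<dots> = (\<integral>u. H u * (\<phi> u - \<phi> y) \<partial>M)"
      using i1 i2 H(2) by (subst Bochner_Integration.integral_add) auto
    finally have "cmod (\<integral>u. H u * \<phi> u \<partial>M) \<le> C * ((K + 1) * c)"
      using norm_integral_le_nn[OF nn] C K c by simp
    then show ?thesis by (simp add: c_def mult_ac)
  qed
  then show thesis using that[of "C * (K + 1)"] C K by simp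
qed

section \<open>Kernels of exp-IATIs\<close>

text \<open>Exponential decay dominates polynomial decay of every order L. The order is left free
  because almost orthogonality asks for \<gamma> + \<beta> and membership in the test spaces for
  twice \<eta>.\<close>

lemma exp_IATI_W_bounds:
  assumes "exp_IATI M d \<delta> A z \<eta> Q" "0 < \<delta>" "\<delta> < 1" "0 \<le> L"
  obtains C where "0 < C"
    "\<And>k x y. cmod (Q k x y) \<le> C * W (\<delta> ^ k) L x y"
    "\<And>k x y y'. d y y' \<le> \<delta> ^ k \<Longrightarrow>
        cmod (Q k x y - Q k x y') \<le> C * (d y y' / \<delta> ^ k) powr \<eta> * W (\<delta> ^ k) L x y"
    "\<And>k x x' y. d x x' \<le> \<delta> ^ k \<Longrightarrow>
        cmod (Q k x y - Q k x' y) \<le> C * (d x x' / \<delta> ^ k) powr \<eta> * W (\<delta> ^ k) L x y"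
    "\<And>k x x' y y'. d x x' \<le> \<delta> ^ k \<Longrightarrow> d y y' \<le> \<delta> ^ k \<Longrightarrow>
        cmod ((Q k x y - Q k x' y) - (Q k x y' - Q k x' y'))
          \<le> C * (d x x' / \<delta> ^ k) powr \<eta> * (d y y' / \<delta> ^ k) powr \<eta> * W (\<delta> ^ k) L x y"
proof -
  obtain c \<nu> a where c: "0 < c" "0 < \<nu>" "0 < a"
    and e0: "kernel_estimates d \<eta> 1 c (exp_bound0 M d 1 \<nu> a) (Q 0)"
    and ek: "\<And>k. k \<ge> 1 \<Longrightarrow> kernel_estimates d \<eta> (\<delta> ^ k) c
           (exp_bound M d (new_points A z (int k)) (\<delta> ^ k) \<nu> a) (Q k)"
    using assms(1) unfolding exp_IATI_def by (elim conjE exE) blast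
  obtain B where B: "0 < B" "\<And>R x y. 0 < R \<Longrightarrow> exp_bound0 M d R \<nu> a x y \<le> B * W R L x y"
    using exp_bound0_le_W[OF c(2,3) assms(4)] by metis
  \<comment> \<open>The regularity estimate in the second variable is stated with the arguments of
    E_k interchanged; the summand \<open>WC L 1\<close> pays for turning them back.\<close>
  define D where "D = B * (1 + WC L 1)"
  have w: "0 < WC L 1" by (rule WC_pos) simp
  have D: "0 < D" using B w by (simp add: D_def)
  have "\<exists>E. kernel_estimates d \<eta> (\<delta> ^ k) c E (Q k) \<and> (\<forall>x y. E x y \<le> B * W (\<delta> ^ k) L x y)" for k :: nat
  proof (cases k)
    case 0
    then show ?thesis using e0 B(2)[of 1] by auto
  next
    case (Suc j)
    have "exp_bound M d (new_points A z (int k)) (\<delta> ^ k) \<nu> a x y \<le> B * W (\<delta> ^ k) L x y" for x y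
      using order_trans[OF exp_bound_le_exp_bound0[OF c(2)] B(2)] assms(2) by simp
    then show ?thesis
      using ek[of k] Suc by (intro exI[of _ "exp_bound M d (new_points A z (int k)) (\<delta> ^ k) \<nu> a"]) simp
  qed
  then obtain E where E: "\<And>k. kernel_estimates d \<eta> (\<delta> ^ k) c (E k) (Q k)"
    "\<And>k x y. E k x y \<le> B * W (\<delta> ^ k) L x y" by metis
  have ED: "E k x y \<le> D * W (\<delta> ^ k) L x y" "E k y x \<le> D * W (\<delta> ^ k) L x y" for k x y
  proof -
    have "B * W (\<delta> ^ k) L x y \<le> D * W (\<delta> ^ k) L x y"
      using w B by (intro mult_right_mono) (auto simp: D_def)
    then show "E k x y \<le> D * W (\<delta> ^ k) L x y" using E(2)[of k x y] by simp
    have "B * W (\<delta> ^ k) L y x \<le> B * (WC L 1 * W (\<delta> ^ k) L x y)"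
      using assms B by (intro mult_left_mono W_sym) auto
    also have "\<dots> \<le> D * W (\<delta> ^ k) L x y"
      using w B by (simp add: D_def algebra_simps)
    finally show "E k y x \<le> D * W (\<delta> ^ k) L x y" using E(2)[of k y x] by simp
  qed
  have E': "c * m * E k x y \<le> c * D * m * W (\<delta> ^ k) L x y" "c * m * E k y x \<le> c * D * m * W (\<delta> ^ k) L x y"
    if "0 \<le> m" for m k x y
  proof -
    have "c * m * E k x y \<le> c * m * (D * W (\<delta> ^ k) L x y)" "c * m * E k y x \<le> c * m * (D * W (\<delta> ^ k) L x y)"
      using that c by (auto intro!: mult_left_mono ED)
    then show "c * m * E k x y \<le> c * D * m * W (\<delta> ^ k) L x y" "c * m * E k y x \<le> c * D * m * W (\<delta> ^ k) L x y"
      by (simp_all add: mult_ac)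
  qed
  show thesis
  proof (rule that[of "c * D"])
    show "0 < c * D" using c D by simp
    fix k x y
    have "cmod (Q k x y) \<le> c * 1 * E k x y" using E(1)[of k] unfolding kernel_estimates_def by simp
    also note E'(1)[of 1 k x y]
    finally show "cmod (Q k x y) \<le> c * D * W (\<delta> ^ k) L x y" by simp
  next
    fix k x y y' assume "d y y' \<le> \<delta> ^ k"
    then have "cmod (Q k y x - Q k y' x) + cmod (Q k x y - Q k x y') \<le> c * (d y y' / \<delta> ^ k) powr \<eta> * E k y x"
      using E(1)[of k] unfolding kernel_estimates_def by blast
    also note E'(2)[of "(d y y' / \<delta> ^ k) powr \<eta>" k y x]
    finally show "cmod (Q k x y - Q k x y') \<le> c * D * (d y y' / \<delta> ^ k) powr \<eta> * W (\<delta> ^ k) L x y"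
      by simp (smt (verit) norm_ge_zero)
  next
    fix k x x' y assume "d x x' \<le> \<delta> ^ k"
    then have "cmod (Q k x y - Q k x' y) + cmod (Q k y x - Q k y x') \<le> c * (d x x' / \<delta> ^ k) powr \<eta> * E k x y"
      using E(1)[of k] unfolding kernel_estimates_def by blast
    also note E'(1)[of "(d x x' / \<delta> ^ k) powr \<eta>" k x y]
    finally show "cmod (Q k x y - Q k x' y) \<le> c * D * (d x x' / \<delta> ^ k) powr \<eta> * W (\<delta> ^ k) L x y"
      by simp (smt (verit) norm_ge_zero)
  next
    fix k x x' y y' assume "d x x' \<le> \<delta> ^ k" "d y y' \<le> \<delta> ^ k"
    then have "cmod ((Q k x y - Q k x' y) - (Q k x y' - Q k x' y')) \<le>
        c * (d x x' / \<delta> ^ k) powr \<eta> * (d y y' / \<delta> ^ k) powr \<eta> * E k x y"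
      using E(1)[of k] unfolding kernel_estimates_def by blast
    also have "\<dots> \<le> c * D * ((d x x' / \<delta> ^ k) powr \<eta> * (d y y' / \<delta> ^ k) powr \<eta>) * W (\<delta> ^ k) L x y"
      using E'(1)[of "(d x x' / \<delta> ^ k) powr \<eta> * (d y y' / \<delta> ^ k) powr \<eta>" k x y] by (simp add: mult_ac)
    finally show "cmod ((Q k x y - Q k x' y) - (Q k x y' - Q k x' y'))
          \<le> c * D * (d x x' / \<delta> ^ k) powr \<eta> * (d y y' / \<delta> ^ k) powr \<eta> * W (\<delta> ^ k) L x y"
      by (simp add: mult_ac)
  qed
qed

end

section \<open>Test functions and distributions\<close>

context homogeneous_space
begin

text \<open>Moves the kernel from x at scale r to the base point x0 at scale 1. The constant depends
  on x and r, which does no harm because it only serves qualitative facts: membership in the test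
  space, and continuity of Q_k f at x.\<close>

lemma W_mono_center:
  assumes "0 < r" "0 \<le> e"
  obtains B where "0 < B" "\<And>u. W r e x u \<le> B * W 1 e x0 u"
proof -
  define K where "K = A0 + (1 + A0 * d x x0) / r"
  have q: "0 \<le> (1 + A0 * d x x0) / r" using assms by (intro divide_nonneg_pos add_nonneg_nonneg) auto
  have K: "1 \<le> K" using q A0_ge_1 by (simp add: K_def)
  have Kr: "K * r = A0 * r + (1 + A0 * d x x0)" using assms by (simp add: K_def field_simps)
  have "W r e x u \<le> (r / 1) powr e * WC e K * W 1 e x0 u" for u
  proof (rule W_compare_scale)
    have "1 + d x0 u \<le> 1 + (A0 * d x x0 + A0 * d x u)"
      using d_triangle[of x0 u x] distrib_left[of A0 "d x0 x" "d x u"] by (simp add: d_sym[of x0 x])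
    also have "\<dots> \<le> K * r + A0 * d x u" using assms by (simp add: Kr)
    also have "\<dots> \<le> K * r + K * d x u" using q by (simp add: K_def mult_right_mono)
    finally show "1 + d x0 u \<le> K * (r + d x u)" by (simp add: distrib_left)
    have "1 * d x x0 \<le> A0 * d x x0" using A0_ge_1 by (intro mult_right_mono) auto
    then have "d x x0 \<le> K * r" using assms unfolding Kr by (smt (verit) A0_pos mult_pos_pos)
    also have "\<dots> \<le> K * (r + d x u)" using K by (intro mult_left_mono) auto
    finally show "d x x0 \<le> K * (r + d x u)" .
  qed (use assms K in auto)
  moreover have "0 < (r / 1) powr e * WC e K" using assms WC_pos[OF K] by simp
  ultimately show thesis using that by blast
qed

lemma test_decay_nonneg: "0 \<le> test_decay M d x0 e u"
  by (simp add: test_decay_def vol2_def)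

lemma test_decay_antimono: "e \<le> e' \<Longrightarrow> test_decay M d x0 e' u \<le> test_decay M d x0 e u"
  unfolding test_decay_def by (intro mult_left_mono powr_mono) (auto simp: vol2_def)

text \<open>The decay exponent is twice \<eta>: one half gives the decay required of a test
  function, the other supplies (1 + d x0 u)^(-\<eta>), which converts Hoelder regularity at the
  fixed scale r into regularity at the growing scale 1 + d x0 u. That the constant is linear in c is
  used for continuity.\<close>

lemma test_consts_of_W_bounds:
  assumes "0 < r" "0 < \<eta>"
  obtains K where "0 < K" "\<And>\<phi> c \<beta> \<gamma>. \<lbrakk>0 < c; 0 < \<beta>; \<beta> \<le> \<eta>; \<gamma> \<le> \<eta>;
      \<And>u. cmod (\<phi> u) \<le> c * W r (\<eta> + \<eta>) x u;
      \<And>u u'. d u u' \<le> r \<Longrightarrow> cmod (\<phi> u - \<phi> u') \<le> c * (d u u' / r) powr \<eta> * W r (\<eta> + \<eta>) x u\<rbrakk>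
    \<Longrightarrow> c * K \<in> test_consts M d A0 x0 \<beta> \<gamma> \<phi>"
proof -
  obtain B where B: "0 < B" "\<And>u. W r (\<eta> + \<eta>) x u \<le> B * W 1 (\<eta> + \<eta>) x0 u"
    using W_mono_center[of r "\<eta> + \<eta>" x x0] assms by auto
  have k: "1 \<le> 2 * A0" using A0_ge_1 by simp
  define c2 where "c2 = WC (\<eta> + \<eta>) (2 * A0)"
  have c2: "0 < c2" unfolding c2_def using k by (rule WC_pos)
  define K where "K = 2 * B * (1 + (1 / r) powr \<eta> * (1 + c2))"
  have K: "0 < K" using B c2 by (simp add: K_def add_pos_nonneg)
  have "c * K \<in> test_consts M d A0 x0 \<beta> \<gamma> \<phi>"
    if c: "0 < c" "0 < \<beta>" "\<beta> \<le> \<eta>" "\<gamma> \<le> \<eta>"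
      and s: "\<And>u. cmod (\<phi> u) \<le> c * W r (\<eta> + \<eta>) x u"
      and reg: "\<And>u u'. d u u' \<le> r \<Longrightarrow> cmod (\<phi> u - \<phi> u') \<le> c * (d u u' / r) powr \<eta> * W r (\<eta> + \<eta>) x u"
    for \<phi> c \<beta> \<gamma>
  proof -
    define n where "n u = 1 + d x0 u" for u
    have n: "1 \<le> n u" "0 < n u" for u by (auto simp: n_def add_pos_nonneg)
    have W2: "W 1 (\<eta> + \<eta>) x0 u = (1 / n u) powr \<eta> * W 1 \<eta> x0 u" for u
      unfolding W_exp_split n_def by simp
    have dec: "W 1 \<eta> x0 u \<le> 2 * test_decay M d x0 \<gamma> u" for u
      using W_le_test_decay[of \<eta> x0 u] test_decay_antimono[OF c(4), of x0 u] by linarith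
    have sz: "cmod (\<phi> u) \<le> c * B * ((1 / n u) powr \<eta> * W 1 \<eta> x0 u)" for u
      using order_trans[OF s mult_left_mono[OF B(2)]] c unfolding W2 mult.assoc by simp
    have "cmod (\<phi> u) \<le> c * K * test_decay M d x0 \<gamma> u" for u
    proof -
      have "(1 / n u) powr \<eta> \<le> 1" using n[of u] assms by (intro powr_le1) auto
      then have "c * B * ((1 / n u) powr \<eta> * W 1 \<eta> x0 u) \<le> c * B * (1 * (2 * test_decay M d x0 \<gamma> u))"
        using c B by (intro mult_left_mono mult_mono dec) auto
      also have "\<dots> = c * (2 * B) * test_decay M d x0 \<gamma> u" by simp
      also have "\<dots> \<le> c * K * test_decay M d x0 \<gamma> u"
        using c B c2 by (intro mult_right_mono mult_left_mono test_decay_nonneg) (auto simp: K_def)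
      finally show ?thesis using sz[of u] by linarith
    qed
    moreover have "cmod (\<phi> u - \<phi> u') \<le> c * K * (d u u' / (1 + d x0 u)) powr \<beta> * test_decay M d x0 \<gamma> u"
      if near: "d u u' \<le> (1 + d x0 u) / (2 * A0)" for u u'
    proof -
      define q where "q = (d u u' / n u) powr \<eta>"
      have "d u u' * 1 \<le> d u u' * (2 * A0)" using k by (intro mult_left_mono) auto
      then have "d u u' / n u \<le> 1" using near n[of u] by (simp add: n_def field_simps)
      then have q: "q \<le> (d u u' / n u) powr \<beta>" "0 \<le> q"
        unfolding q_def using c n[of u] by (auto intro!: powr_mono' simp: divide_nonneg_pos)
      have main: "cmod (\<phi> u - \<phi> u') \<le> c * B * ((1 / r) powr \<eta> * (1 + c2)) * q * W 1 \<eta> x0 u"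
      proof (cases "d u u' \<le> r")
        case True
        have "cmod (\<phi> u - \<phi> u') \<le> c * (d u u' / r) powr \<eta> * (B * ((1 / n u) powr \<eta> * W 1 \<eta> x0 u))"
          using order_trans[OF reg[OF True] mult_left_mono[OF B(2)]] c unfolding W2 by simp
        also have "\<dots> = c * B * ((d u u' / r) powr \<eta> * (1 / n u) powr \<eta>) * W 1 \<eta> x0 u" by simp
        also have "(d u u' / r) powr \<eta> * (1 / n u) powr \<eta> = (1 / r) powr \<eta> * q"
          unfolding q_def by (simp flip: powr_mult)
        also have "c * B * ((1 / r) powr \<eta> * q) * W 1 \<eta> x0 u \<le> c * B * ((1 / r) powr \<eta> * (1 + c2) * q) * W 1 \<eta> x0 u"
          using c B c2 q by (intro mult_right_mono mult_left_mono) (auto simp: algebra_simps)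
        finally show ?thesis by (simp add: mult_ac)
      next
        \<comment> \<open>Beyond distance r the regularity hypothesis says nothing. The two values
          are bounded separately, and 1 <= d u u' / r supplies the missing Hoelder factor.\<close>
        case False
        have "2 * (A0 * d u u') \<le> n u" using near by (simp add: n_def field_simps)
        moreover have "n u \<le> 1 + A0 * d x0 u' + A0 * d u u'"
          using d_triangle[of x0 u u'] distrib_left[of A0 "d x0 u'" "d u' u"] by (simp add: n_def d_sym[of u' u])
        ultimately have "n u \<le> 2 * (1 + A0 * d x0 u')" by (simp add: algebra_simps)
        also have "\<dots> \<le> 2 * A0 * (1 + d x0 u')" using A0_ge_1 by (simp add: distrib_left)
        finally have "W 1 (\<eta> + \<eta>) x0 u' \<le> c2 * W 1 (\<eta> + \<eta>) x0 u"
          unfolding c2_def using assms k by (intro W_compare) (auto simp: n_def)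
        then have 1: "cmod (\<phi> u') \<le> c * B * (c2 * ((1 / n u) powr \<eta> * W 1 \<eta> x0 u))"
          using sz[of u'] c B unfolding W2 by (smt (verit, best) mult_left_mono mult_pos_pos)
        have "(1 / n u) powr \<eta> \<le> (1 / r) powr \<eta> * q"
        proof -
          have "1 / n u \<le> (1 / r) * (d u u' / n u)" using False assms n[of u] by (simp add: field_simps)
          then have "(1 / n u) powr \<eta> \<le> ((1 / r) * (d u u' / n u)) powr \<eta>"
            using assms n[of u] by (intro powr_mono2) auto
          then show ?thesis by (simp only: powr_mult q_def)
        qed
        then have "c * B * (1 + c2) * (1 / n u) powr \<eta> * W 1 \<eta> x0 u \<le> c * B * (1 + c2) * ((1 / r) powr \<eta> * q) * W 1 \<eta> x0 u"
          using c B c2 by (intro mult_right_mono mult_left_mono) auto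
        moreover have "cmod (\<phi> u - \<phi> u') \<le> c * B * (1 + c2) * (1 / n u) powr \<eta> * W 1 \<eta> x0 u"
          using norm_triangle_ineq4[of "\<phi> u" "\<phi> u'"] 1 sz[of u] by (simp add: algebra_simps)
        ultimately show ?thesis by (simp add: mult_ac)
      qed
      have "c * B * ((1 / r) powr \<eta> * (1 + c2)) * q * W 1 \<eta> x0 u \<le>
          c * B * (1 + (1 / r) powr \<eta> * (1 + c2)) * (d u u' / n u) powr \<beta> * (2 * test_decay M d x0 \<gamma> u)"
        using c B c2 q by (intro mult_mono dec mult_nonneg_nonneg add_nonneg_nonneg) auto
      also have "\<dots> = c * K * (d u u' / n u) powr \<beta> * test_decay M d x0 \<gamma> u" by (simp add: K_def)
      finally show ?thesis using main unfolding n_def by linarith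
    qed
    ultimately show ?thesis using c K by (simp add: test_consts_def)
  qed
  then show thesis using that K by blast
qed

lemma test_norm_le: "C \<in> test_consts M d A0 x0 \<beta> \<gamma> \<phi> \<Longrightarrow> test_norm M d A0 x0 \<beta> \<gamma> \<phi> \<le> C"
  unfolding test_norm_def by (intro cInf_lower bdd_belowI[of _ 0]) (auto simp: test_consts_def)

lemma test_norm_nonneg: "\<phi> \<in> test_space M d A0 x0 \<beta> \<gamma> \<Longrightarrow> 0 \<le> test_norm M d A0 x0 \<beta> \<gamma> \<phi>"
  unfolding test_norm_def test_space_def by (intro cInf_greatest) (auto simp: test_consts_def)

text \<open>A member of both spaces is approximated by itself. The constants in
  \<open>test_consts\<close> are strictly positive, so for the zero function the value e/2 witnesses
  a norm below e.\<close>

lemma test_space0I: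
  assumes "\<phi> \<in> test_space M d A0 x0 \<beta> \<gamma>" "\<phi> \<in> test_space M d A0 x0 \<eta> \<eta>"
  shows "\<phi> \<in> test_space0 M d A0 x0 \<eta> \<beta> \<gamma>"
proof -
  have "test_norm M d A0 x0 \<beta> \<gamma> (\<lambda>x. \<phi> x - \<phi> x) < e" if "0 < e" for e
  proof -
    have "e / 2 \<in> test_consts M d A0 x0 \<beta> \<gamma> (\<lambda>x. \<phi> x - \<phi> x)"
      using that by (auto simp: test_consts_def intro!: mult_nonneg_nonneg test_decay_nonneg)
    then show ?thesis using test_norm_le that by fastforce
  qed
  then show ?thesis using assms unfolding test_space0_def by blast
qed

text \<open>Kernel-type bounds at x give membership and a bound on f \<phi> that is linear in c. The
  continuity of Q_k f comes from letting c tend to 0.\<close>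

lemma distribution_bound:
  assumes f: "f \<in> distributions M d A0 x0 \<eta> \<beta> \<gamma>" and "0 < r" "0 < \<beta>" "\<beta> \<le> \<eta>" "\<gamma> \<le> \<eta>"
  obtains K where "0 \<le> K" "\<And>\<phi> c. \<lbrakk>0 < c;
      \<And>u. cmod (\<phi> u) \<le> c * W r (\<eta> + \<eta>) x u;
      \<And>u u'. d u u' \<le> r \<Longrightarrow> cmod (\<phi> u - \<phi> u') \<le> c * (d u u' / r) powr \<eta> * W r (\<eta> + \<eta>) x u\<rbrakk>
    \<Longrightarrow> \<phi> \<in> test_space0 M d A0 x0 \<eta> \<beta> \<gamma> \<and> cmod (f \<phi>) \<le> c * K"
proof -
  have \<eta>: "0 < \<eta>" using assms by simp
  obtain K where K: "0 < K" "\<And>\<phi> c \<beta> \<gamma>. \<lbrakk>0 < c; 0 < \<beta>; \<beta> \<le> \<eta>; \<gamma> \<le> \<eta>;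
      \<And>u. cmod (\<phi> u) \<le> c * W r (\<eta> + \<eta>) x u;
      \<And>u u'. d u u' \<le> r \<Longrightarrow> cmod (\<phi> u - \<phi> u') \<le> c * (d u u' / r) powr \<eta> * W r (\<eta> + \<eta>) x u\<rbrakk>
    \<Longrightarrow> c * K \<in> test_consts M d A0 x0 \<beta> \<gamma> \<phi>"
    using test_consts_of_W_bounds[OF assms(2) \<eta>, of x x0] by blast
  obtain B where B: "\<And>\<phi>. \<phi> \<in> test_space0 M d A0 x0 \<eta> \<beta> \<gamma> \<Longrightarrow> cmod (f \<phi>) \<le> B * test_norm M d A0 x0 \<beta> \<gamma> \<phi>"
    using f unfolding distributions_def by blast
  show thesis
  proof (rule that[of "\<bar>B\<bar> * K"])
    show "0 \<le> \<bar>B\<bar> * K" using K by simp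
    fix \<phi> c assume *: "0 < c" "\<And>u. cmod (\<phi> u) \<le> c * W r (\<eta> + \<eta>) x u"
      "\<And>u u'. d u u' \<le> r \<Longrightarrow> cmod (\<phi> u - \<phi> u') \<le> c * (d u u' / r) powr \<eta> * W r (\<eta> + \<eta>) x u"
    have c1: "c * K \<in> test_consts M d A0 x0 \<beta> \<gamma> \<phi>" using * assms by (intro K(2)) auto
    have c2: "c * K \<in> test_consts M d A0 x0 \<eta> \<eta> \<phi>" using * \<eta> by (intro K(2)) auto
    have \<phi>: "\<phi> \<in> test_space0 M d A0 x0 \<eta> \<beta> \<gamma>"
      using c1 c2 by (intro test_space0I) (auto simp: test_space_def)
    have "cmod (f \<phi>) \<le> \<bar>B\<bar> * test_norm M d A0 x0 \<beta> \<gamma> \<phi>"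
    proof -
      have "\<phi> \<in> test_space M d A0 x0 \<beta> \<gamma>" using c1 by (auto simp: test_space_def)
      then have "B * test_norm M d A0 x0 \<beta> \<gamma> \<phi> \<le> \<bar>B\<bar> * test_norm M d A0 x0 \<beta> \<gamma> \<phi>"
        by (intro mult_right_mono test_norm_nonneg) auto
      then show ?thesis using B[OF \<phi>] by simp
    qed
    also have "\<dots> \<le> \<bar>B\<bar> * (c * K)" using test_norm_le[OF c1] by (intro mult_left_mono) auto
    finally show "\<phi> \<in> test_space0 M d A0 x0 \<eta> \<beta> \<gamma> \<and> cmod (f \<phi>) \<le> c * (\<bar>B\<bar> * K)"
      using \<phi> by (simp add: mult_ac)
  qed
qed

lemma distributions_add:
  assumes f: "f \<in> distributions M d A0 x0 \<eta> \<beta> \<gamma>"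
    and m: "\<phi> \<in> test_space0 M d A0 x0 \<eta> \<beta> \<gamma>" "\<psi> \<in> test_space0 M d A0 x0 \<eta> \<beta> \<gamma>"
  shows "f (\<lambda>x. \<phi> x + \<psi> x) = f \<phi> + f \<psi>"
proof -
  have "\<forall>\<phi>\<in>test_space0 M d A0 x0 \<eta> \<beta> \<gamma>. \<forall>\<psi>\<in>test_space0 M d A0 x0 \<eta> \<beta> \<gamma>.
      f (\<lambda>x. \<phi> x + \<psi> x) = f \<phi> + f \<psi>"
    using f unfolding distributions_def mem_Collect_eq by (elim conjE)
  from this[THEN bspec, OF m(1), THEN bspec, OF m(2)] show ?thesis .
qed

lemma exp_IATI_test_space0:
  assumes Q: "exp_IATI M d \<delta> A z \<eta> Q" and \<delta>: "0 < \<delta>" "\<delta> < 1"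
    and e: "0 < \<beta>" "\<beta> \<le> \<eta>" "\<gamma> \<le> \<eta>"
  shows "(\<lambda>y. c * Q k x y) \<in> test_space0 M d A0 x0 \<eta> \<beta> \<gamma>"
proof -
  have "0 \<le> \<eta> + \<eta>" using e by simp
  then obtain C where C: "0 < C" "\<And>k x y. cmod (Q k x y) \<le> C * W (\<delta> ^ k) (\<eta> + \<eta>) x y"
    "\<And>k x y y'. d y y' \<le> \<delta> ^ k \<Longrightarrow>
        cmod (Q k x y - Q k x y') \<le> C * (d y y' / \<delta> ^ k) powr \<eta> * W (\<delta> ^ k) (\<eta> + \<eta>) x y"
    using exp_IATI_W_bounds[OF Q \<delta>] by metis
  \<comment> \<open>The zero functional serves only to extract the membership half of
    \<open>distribution_bound\<close>.\<close>
  have f0: "(\<lambda>_. 0) \<in> distributions M d A0 x0 \<eta> \<beta> \<gamma>"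
    by (auto simp: distributions_def intro: exI[of _ 0])
  obtain K where K: "\<And>\<phi> c. \<lbrakk>0 < c; \<And>u. cmod (\<phi> u) \<le> c * W (\<delta> ^ k) (\<eta> + \<eta>) x u;
      \<And>u u'. d u u' \<le> \<delta> ^ k \<Longrightarrow> cmod (\<phi> u - \<phi> u') \<le> c * (d u u' / \<delta> ^ k) powr \<eta> * W (\<delta> ^ k) (\<eta> + \<eta>) x u\<rbrakk>
    \<Longrightarrow> \<phi> \<in> test_space0 M d A0 x0 \<eta> \<beta> \<gamma>"
    using distribution_bound[OF f0 _ e, of "\<delta> ^ k" x] \<delta> by (metis zero_less_power)
  \<comment> \<open>The summand 1 keeps m positive when c = 0.\<close>
  define m where "m = (cmod c + 1) * C"
  have m: "0 < m" using C(1) by (simp add: m_def add_nonneg_pos)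
  show ?thesis
  proof (rule K[OF m])
    show "cmod (c * Q k x u) \<le> m * W (\<delta> ^ k) (\<eta> + \<eta>) x u" for u
      using mult_mono[of "cmod c" "cmod c + 1", OF _ C(2)[of k x u]] by (simp add: m_def norm_mult mult_ac)
    show "cmod (c * Q k x u - c * Q k x u') \<le> m * (d u u' / \<delta> ^ k) powr \<eta> * W (\<delta> ^ k) (\<eta> + \<eta>) x u"
      if "d u u' \<le> \<delta> ^ k" for u u'
    proof -
      have "cmod c * cmod (Q k x u - Q k x u') \<le> (cmod c + 1) * (C * (d u u' / \<delta> ^ k) powr \<eta> * W (\<delta> ^ k) (\<eta> + \<eta>) x u)"
        by (intro mult_mono C(3) that) auto
      then show ?thesis by (simp add: m_def mult_ac norm_mult flip: right_diff_distrib)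
    qed
  qed
qed

text \<open>The second-difference estimate says that Q_k(x, .) - Q_k(x', .) satisfies the bounds of
  \<open>distribution_bound\<close> with c proportional to (d x x' / \<delta>^k)^\<eta>, and by
  linearity f of it is the difference of the two values.\<close>

lemma dist_apply_continuous:
  assumes f: "f \<in> distributions M d A0 x0 \<eta> \<beta> \<gamma>"
    and Q: "exp_IATI M d \<delta> A z \<eta> Q" and \<delta>: "0 < \<delta>" "\<delta> < 1"
    and e: "0 < \<beta>" "\<beta> \<le> \<eta>" "\<gamma> \<le> \<eta>" and "0 < \<epsilon>"
  obtains s where "0 < s" "\<And>x'. d x x' < s \<Longrightarrow> cmod (dist_apply Q k f x - dist_apply Q k f x') < \<epsilon>"
proof -
  define r where "r = \<delta> ^ k"
  have r: "0 < r" using \<delta> by (simp add: r_def)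
  have \<eta>: "0 < \<eta>" "0 \<le> \<eta> + \<eta>" using e by auto
  obtain C where C: "0 < C" 
    "\<And>k x x' y. d x x' \<le> \<delta> ^ k \<Longrightarrow>
        cmod (Q k x y - Q k x' y) \<le> C * (d x x' / \<delta> ^ k) powr \<eta> * W (\<delta> ^ k) (\<eta> + \<eta>) x y"
    "\<And>k x x' y y'. d x x' \<le> \<delta> ^ k \<Longrightarrow> d y y' \<le> \<delta> ^ k \<Longrightarrow>
        cmod ((Q k x y - Q k x' y) - (Q k x y' - Q k x' y'))
          \<le> C * (d x x' / \<delta> ^ k) powr \<eta> * (d y y' / \<delta> ^ k) powr \<eta> * W (\<delta> ^ k) (\<eta> + \<eta>) x y"
    using exp_IATI_W_bounds[OF Q \<delta> \<eta>(2)] by metis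
  obtain K where K: "0 \<le> K" "\<And>\<phi> c. \<lbrakk>0 < c; \<And>u. cmod (\<phi> u) \<le> c * W r (\<eta> + \<eta>) x u;
      \<And>u u'. d u u' \<le> r \<Longrightarrow> cmod (\<phi> u - \<phi> u') \<le> c * (d u u' / r) powr \<eta> * W r (\<eta> + \<eta>) x u\<rbrakk>
    \<Longrightarrow> cmod (f \<phi>) \<le> c * K"
    using distribution_bound[OF f r e, of x] by metis
  have lin: "dist_apply Q k f x - dist_apply Q k f x' = f (\<lambda>y. Q k x y - Q k x' y)" for x'
  proof -
    have m: "(\<lambda>y. Q k x y) \<in> test_space0 M d A0 x0 \<eta> \<beta> \<gamma>" "(\<lambda>y. Q k x' y) \<in> test_space0 M d A0 x0 \<eta> \<beta> \<gamma>"
      "(\<lambda>y. - 1 * Q k x' y) \<in> test_space0 M d A0 x0 \<eta> \<beta> \<gamma>"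
      using exp_IATI_test_space0[OF Q \<delta> e, of 1 k x x0] exp_IATI_test_space0[OF Q \<delta> e, of 1 k x' x0]
        exp_IATI_test_space0[OF Q \<delta> e, of "- 1" k x' x0] by simp_all
    have "f (\<lambda>y. Q k x y + - 1 * Q k x' y) = f (\<lambda>y. Q k x y) + f (\<lambda>y. - 1 * Q k x' y)"
      by (rule distributions_add[OF f m(1,3)])
    also have "f (\<lambda>y. - 1 * Q k x' y) = - 1 * f (\<lambda>y. Q k x' y)"
      using f m unfolding distributions_def by blast
    finally show ?thesis by (simp add: dist_apply_def)
  qed
  have main: "cmod (dist_apply Q k f x - dist_apply Q k f x') \<le> C * (d x x' / r) powr \<eta> * K"
    if "d x x' \<le> r" "x \<noteq> x'" for x'
    unfolding lin
  proof (rule K(2))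
    have "0 < d x x'" using that d_nonneg[of x x'] by (simp add: less_le)
    then show "0 < C * (d x x' / r) powr \<eta>" using C(1) r that by simp
    show "cmod (Q k x u - Q k x' u) \<le> C * (d x x' / r) powr \<eta> * W r (\<eta> + \<eta>) x u" for u
      using C(2)[of x x' k u] that unfolding r_def by blast
    show "cmod (Q k x u - Q k x' u - (Q k x u' - Q k x' u')) \<le> C * (d x x' / r) powr \<eta> * (d u u' / r) powr \<eta> * W r (\<eta> + \<eta>) x u"
      if "d u u' \<le> r" for u u'
      using C(3)[of x x' k u u'] that \<open>d x x' \<le> r\<close> unfolding r_def by blast
  qed
  \<comment> \<open>Solves C K (s/r)^\<eta> < \<epsilon>; the summand 1 in the denominator covers K
    = 0, and the minimum keeps s within the range r of the estimate.\<close>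
  define s where "s = r * min 1 ((\<epsilon> / (C * K + 1)) powr (1 / \<eta>))"
  have CK: "0 < C * K + 1" using C(1) K(1) by (intro add_nonneg_pos) auto
  have s: "0 < s" using r \<open>0 < \<epsilon>\<close> CK by (simp add: s_def)
  show thesis
  proof (rule that[OF s])
    fix x' assume x': "d x x' < s"
    show "cmod (dist_apply Q k f x - dist_apply Q k f x') < \<epsilon>"
    proof (cases "x = x'")
      case False
      have "s \<le> r * 1" unfolding s_def using r by (intro mult_left_mono) auto
      then have "d x x' \<le> r" using x' by simp
      then have m: "cmod (dist_apply Q k f x - dist_apply Q k f x') \<le> C * (d x x' / r) powr \<eta> * K"
        using main False by blast
      have "s \<le> r * (\<epsilon> / (C * K + 1)) powr (1 / \<eta>)" unfolding s_def using r by (intro mult_left_mono) auto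
      then have "d x x' / r \<le> (\<epsilon> / (C * K + 1)) powr (1 / \<eta>)" using x' r by (simp add: field_simps)
      then have "(d x x' / r) powr \<eta> \<le> ((\<epsilon> / (C * K + 1)) powr (1 / \<eta>)) powr \<eta>"
        using r \<eta> by (intro powr_mono2) auto
      then have "(d x x' / r) powr \<eta> \<le> \<epsilon> / (C * K + 1)"
        using \<eta> CK \<open>0 < \<epsilon>\<close> by (simp add: powr_powr)
      then have "(C * K) * (d x x' / r) powr \<eta> \<le> (C * K) * (\<epsilon> / (C * K + 1))"
        using C(1) K(1) by (intro mult_left_mono) auto
      also have "\<dots> < \<epsilon>" using CK \<open>0 < \<epsilon>\<close> by (simp add: field_simps)
      finally show ?thesis using m by (simp add: mult_ac)
    qed (use \<open>0 < \<epsilon>\<close> in simp)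
  qed
qed

end

section \<open>Dyadic cubes\<close>

lemma measurable_nn_integral_count_space:
  fixes f :: "'i \<Rightarrow> 'a \<Rightarrow> ennreal"
  assumes "countable I" and [measurable]: "\<And>i. i \<in> I \<Longrightarrow> f i \<in> borel_measurable M"
  shows "(\<lambda>x. \<integral>\<^sup>+i. f i x \<partial>count_space I) \<in> borel_measurable M"
proof (cases "finite I")
  case True
  then show ?thesis by (simp add: nn_integral_count_space_finite)
next
  case False
  then have bij: "bij_betw (from_nat_into I) UNIV I"
    using assms by (intro bij_betw_from_nat_into)
  have m: "f (from_nat_into I n) \<in> borel_measurable M" for n
    using bij by (intro assms) (auto simp: bij_betw_def)
  have "(\<integral>\<^sup>+i. f i x \<partial>count_space I) = (\<Sum>n. f (from_nat_into I n) x)" for x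
    by (subst nn_integral_bij_count_space[OF bij, symmetric]) (simp add: nn_integral_count_space_nat)
  then show ?thesis using m by simp
qed

lemma nn_integral_count_space_point:
  assumes "a \<in> B" "\<And>b. b \<in> B \<Longrightarrow> b \<noteq> a \<Longrightarrow> f b = 0"
  shows "(\<integral>\<^sup>+b. f b \<partial>count_space B) = f a"
  using nn_integral_count_space'[of "{a}" B f] assms by auto

lemma sum_point:
  assumes "finite B" "a \<in> B" "\<And>b. b \<in> B \<Longrightarrow> b \<noteq> a \<Longrightarrow> f b = 0"
  shows "(\<Sum>b\<in>B. f b) = f a"
  using sum.remove[OF assms(1,2), of f] assms(3) by simp

lemma ennreal_norm_infsum_le:
  fixes f :: "'i \<Rightarrow> complex"
  assumes "f summable_on I"
  shows "ennreal (cmod (\<Sum>\<^sub>\<infinity>i\<in>I. f i)) \<le> (\<integral>\<^sup>+i. ennreal (cmod (f i)) \<partial>count_space I)"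
proof (rule tendsto_upperbound)
  show "((\<lambda>F. ennreal (cmod (sum f F))) \<longlongrightarrow> ennreal (cmod (\<Sum>\<^sub>\<infinity>i\<in>I. f i))) (finite_subsets_at_top I)"
    using has_sum_infsum[OF assms] unfolding has_sum_def
    by (intro tendsto_ennrealI tendsto_norm)
  show "eventually (\<lambda>F. ennreal (cmod (sum f F)) \<le> (\<integral>\<^sup>+i. ennreal (cmod (f i)) \<partial>count_space I)) (finite_subsets_at_top I)"
  proof (rule eventually_finite_subsets_at_top_weakI)
    fix F assume F: "finite F" "F \<subseteq> I"
    have "ennreal (cmod (sum f F)) \<le> (\<Sum>i\<in>F. ennreal (cmod (f i)))"
      by (simp add: sum_ennreal ennreal_leI norm_sum)
    also have "\<dots> = (\<integral>\<^sup>+i. ennreal (cmod (f i)) \<partial>count_space F)"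
      using F by (simp add: nn_integral_count_space_finite)
    also have "\<dots> \<le> (\<integral>\<^sup>+i. ennreal (cmod (f i)) \<partial>count_space I)"
      using F by (auto simp: nn_integral_count_space_indicator[of F] nn_integral_count_space_indicator[of I]
          intro!: nn_integral_mono split: split_indicator)
    finally show "ennreal (cmod (sum f F)) \<le> (\<integral>\<^sup>+i. ennreal (cmod (f i)) \<partial>count_space I)" .
  qed
qed simp

lemma ennreal_norm_sums_le:
  fixes f :: "nat \<Rightarrow> complex"
  assumes "f sums s"
  shows "ennreal (cmod s) \<le> (\<Sum>i. ennreal (cmod (f i)))"
proof (rule LIMSEQ_le_const2)
  show "(\<lambda>n. ennreal (cmod (\<Sum>i<n. f i))) \<longlonglongrightarrow> ennreal (cmod s)"
    using assms unfolding sums_def by (intro tendsto_ennrealI tendsto_norm)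
  have "ennreal (cmod (\<Sum>i<n. f i)) \<le> (\<Sum>i. ennreal (cmod (f i)))" for n
  proof -
    have "ennreal (cmod (\<Sum>i<n. f i)) \<le> (\<Sum>i<n. ennreal (cmod (f i)))"
      by (simp add: sum_ennreal ennreal_leI norm_sum)
    also have "\<dots> \<le> (\<Sum>i. ennreal (cmod (f i)))" by (intro sum_le_suminf) auto
    finally show ?thesis .
  qed
  then show "\<exists>N. \<forall>n\<ge>N. ennreal (cmod (\<Sum>i<n. f i)) \<le> (\<Sum>i. ennreal (cmod (f i)))" by blast
qed

text \<open>Otherwise g exceeds its mean at every point of E while the integral of g minus the mean
  over E is 0, which makes E a null set. It supplies the sample points of the reproducing
  formula.\<close>

lemma exists_le_mean:
  assumes [measurable]: "g \<in> borel_measurable M" "E \<in> sets M"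
    and E: "0 < emeasure M E" "emeasure M E < \<infinity>" and g: "\<And>y. g y < \<infinity>"
  obtains y where "y \<in> E" "g y * emeasure M E \<le> (\<integral>\<^sup>+u\<in>E. g u \<partial>M)"
proof (rule ccontr)
  note wit = that
  assume n: "\<not> thesis"
  define I where "I = (\<integral>\<^sup>+u\<in>E. g u \<partial>M)"
  have lt: "I < g y * emeasure M E" if "y \<in> E" for y
    using n wit[OF that] unfolding I_def by (meson not_less)
  obtain y where "y \<in> E" using E(1) by (metis all_not_in_conv emeasure_empty order_less_irrefl)
  then have I: "I < \<infinity>"
    using lt[of y] by (metis infinity_ennreal_def order_less_le_trans top_greatest)
  define m where "m = I / emeasure M E"
  have mE: "m * emeasure M E = I"
    using E by (simp add: m_def ennreal_divide_times ennreal_divide_self)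
  have m: "m < g y" if "y \<in> E" for y
    using lt[OF that] unfolding mE[symmetric] by (metis mult_right_mono not_less zero_le)
  have "(\<integral>\<^sup>+u\<in>E. m \<partial>M) = I" using mE by (simp add: nn_integral_cmult_indicator)
  have "(\<integral>\<^sup>+u. g u * indicator E u - m * indicator E u \<partial>M) = I - I"
    using m I \<open>(\<integral>\<^sup>+u\<in>E. m \<partial>M) = I\<close>
    by (subst nn_integral_diff) (auto simp: I_def split: split_indicator intro: less_imp_le)
  then have "(\<integral>\<^sup>+u. g u * indicator E u - m * indicator E u \<partial>M) = 0" using I by simp
  then have "AE u in M. g u * indicator E u - m * indicator E u = 0"
    by (subst (asm) nn_integral_0_iff_AE) auto
  then have "AE u in M. u \<notin> E"
  proof eventually_elim
    case (elim u)
    show ?case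
    proof
      assume u: "u \<in> E"
      then have "g u - m = 0" using elim by simp
      then show False using m[OF u] by (metis diff_gr0_ennreal g infinity_ennreal_def not_less_zero order_less_irrefl less_top)
    qed
  qed
  then have "E \<in> null_sets M" by (simp add: AE_iff_null_sets)
  then show False using E by (auto simp: null_sets_def)
qed

locale dyadic_system = homogeneous_space M d A0 C\<mu>
  for M :: "'a measure" and d A0 C\<mu> +
  fixes c0 C0 \<delta> :: real and A :: "int \<Rightarrow> 'i set" and z :: "int \<Rightarrow> 'i \<Rightarrow> 'a"
    and cube :: "int \<Rightarrow> 'i \<Rightarrow> 'a set" and j0 :: nat
    and Num :: "int \<Rightarrow> 'i \<Rightarrow> nat" and S :: "int \<Rightarrow> 'i \<Rightarrow> nat \<Rightarrow> 'a set"
  assumes points: "dyadic_points d A0 c0 C0 \<delta> A z"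
    and cubes: "dyadic_cubes M d A0 c0 C0 \<delta> A z cube"
    and subcubes: "subcube_enumeration A0 C0 \<delta> A cube j0 Num S"
begin

lemma delta: "0 < \<delta>" "\<delta> < 1" and c0_pos: "0 < c0" and C0_pos: "0 < C0"
  using points unfolding dyadic_points_def by auto

lemma delta_powi_pos [simp]: "0 < \<delta> powi k"
  using delta by (simp add: zero_less_power_int)

lemma cube_measurable [measurable]: "\<alpha> \<in> A k \<Longrightarrow> cube k \<alpha> \<in> sets M"
  using cubes unfolding dyadic_cubes_def by blast

lemma cube_disjoint: "\<alpha> \<in> A k \<Longrightarrow> \<beta> \<in> A k \<Longrightarrow> x \<in> cube k \<alpha> \<Longrightarrow> x \<in> cube k \<beta> \<Longrightarrow> \<alpha> = \<beta>"
  using cubes unfolding dyadic_cubes_def disjoint_family_on_def by blast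

lemma cube_cover: "\<exists>\<alpha>\<in>A k. x \<in> cube k \<alpha>"
proof -
  have "(\<Union>\<alpha>\<in>A k. cube k \<alpha>) = UNIV" using cubes unfolding dyadic_cubes_def by blast
  then show ?thesis by blast
qed

lemma cube_nested:
  "k \<le> l \<Longrightarrow> \<alpha> \<in> A k \<Longrightarrow> \<beta> \<in> A l \<Longrightarrow> x \<in> cube l \<beta> \<Longrightarrow> x \<in> cube k \<alpha> \<Longrightarrow> cube l \<beta> \<subseteq> cube k \<alpha>"
  using cubes unfolding dyadic_cubes_def by blast

lemma cube_inner: "\<alpha> \<in> A k \<Longrightarrow> qball d (z k \<alpha>) (c0 * \<delta> powi k / (3 * A0\<^sup>2)) \<subseteq> cube k \<alpha>"
  and cube_outer: "\<alpha> \<in> A k \<Longrightarrow> cube k \<alpha> \<subseteq> qball d (z k \<alpha>) (2 * A0 * C0 * \<delta> powi k)"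
  using cubes unfolding dyadic_cubes_def by blast+

definition idx :: "int \<Rightarrow> 'a \<Rightarrow> 'i" where
  "idx k x = (SOME \<alpha>. \<alpha> \<in> A k \<and> x \<in> cube k \<alpha>)"

lemma idx: "idx k x \<in> A k" "x \<in> cube k (idx k x)"
  using someI_ex[of "\<lambda>\<alpha>. \<alpha> \<in> A k \<and> x \<in> cube k \<alpha>"] cube_cover[of k x] unfolding idx_def by blast+

lemma idx_eq: "\<alpha> \<in> A k \<Longrightarrow> x \<in> cube k \<alpha> \<Longrightarrow> idx k x = \<alpha>"
  using cube_disjoint idx by blast

lemma idx_nested:
  assumes "k \<le> l" "\<beta> \<in> A l" "x \<in> cube l \<beta>" "y \<in> cube l \<beta>"
  shows "idx k x = idx k y"
  using cube_nested[OF assms(1) idx(1) assms(2,3) idx(2)] assms(4)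
  by (intro idx_eq[symmetric] idx(1)) (rule subsetD)

text \<open>For the indices whose points lie within distance n of a fixed point, the cubes are
  disjoint, lie in one ball, and have measure bounded below by \<open>cube_inner\<close> and
  doubling. Hence there are finitely many for each n.\<close>

lemma countable_A: "countable (A k)"
proof -
  obtain x0 :: 'a where True by simp
  define r where "r = c0 * \<delta> powi k / (3 * A0\<^sup>2)"
  have r: "0 < r" using c0_pos by (simp add: r_def)
  define F where "F n = {\<alpha>\<in>A k. d x0 (z k \<alpha>) < real n}" for n
  have "finite (F n)" for n
  proof -
    define R where "R = A0 * (real n + 2 * A0 * C0 * \<delta> powi k) + r"
    define c where "c = V r x0 / (C\<mu> * (2 * A0 * (real n / r + 1)) powr \<omega>)"
    have C: "0 < C\<mu> * (2 * A0 * (real n / r + 1)) powr \<omega>"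
      using C\<mu>_pos r by (auto simp: add_nonneg_pos intro!: mult_pos_pos less_imp_neq[symmetric])
    have c: "0 < c" unfolding c_def using V_pos[OF r] C by (intro divide_pos_pos) auto
    have vol: "c \<le> measure M (cube k \<alpha>)" "cube k \<alpha> \<subseteq> qball d x0 R" if "\<alpha> \<in> F n" for \<alpha>
    proof -
      have \<alpha>: "\<alpha> \<in> A k" "d x0 (z k \<alpha>) < real n" using that by (auto simp: F_def)
      show "cube k \<alpha> \<subseteq> qball d x0 R"
      proof
        fix y assume "y \<in> cube k \<alpha>"
        then have "d (z k \<alpha>) y < 2 * A0 * C0 * \<delta> powi k" using cube_outer[OF \<alpha>(1)] by (auto simp: qball_def)
        then have "A0 * (d x0 (z k \<alpha>) + d (z k \<alpha>) y) \<le> A0 * (real n + 2 * A0 * C0 * \<delta> powi k)"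
          using \<alpha> by (intro mult_left_mono) auto
        then show "y \<in> qball d x0 R"
          using d_triangle[of x0 y "z k \<alpha>"] r unfolding qball_def R_def mem_Collect_eq by linarith
      qed
      then have fin: "emeasure M (cube k \<alpha>) < \<infinity>"
        using emeasure_mono[of "cube k \<alpha>" "qball d x0 R" M] by (auto simp: emeasure_qball intro: le_less_trans)
      have "V r x0 \<le> C\<mu> * (2 * A0 * (real n / r + 1)) powr \<omega> * V r (z k \<alpha>)"
        using r \<alpha> by (intro V_compare) (auto simp: field_simps intro: order_trans[OF mult_left_mono[OF less_imp_le]] add_increasing)
      then have "c \<le> V r (z k \<alpha>)" unfolding c_def using C by (simp add: field_simps)
      also have "\<dots> \<le> measure M (cube k \<alpha>)"
        unfolding vol_def using cube_inner[OF \<alpha>(1)] fin \<alpha>(1)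
        by (intro measure_mono_fmeasurable) (auto simp: r_def[symmetric] fmeasurable_def)
      finally show "c \<le> measure M (cube k \<alpha>)" .
    qed
    have "card G \<le> nat \<lfloor>V R x0 / c\<rfloor>" if G: "finite G" "G \<subseteq> F n" for G
    proof -
      have fm: "cube k \<alpha> \<in> fmeasurable M" if "\<alpha> \<in> G" for \<alpha>
      proof -
        have "emeasure M (cube k \<alpha>) \<le> emeasure M (qball d x0 R)"
          using vol(2)[of \<alpha>] G that by (intro emeasure_mono) auto
        then show ?thesis using G that
          by (intro fmeasurableI) (auto simp: F_def emeasure_qball intro: le_less_trans)
      qed
      have "card G * c \<le> (\<Sum>\<alpha>\<in>G. measure M (cube k \<alpha>))"
        using vol(1) G by (intro sum_bounded_below) auto
      also have "\<dots> = measure M (\<Union>\<alpha>\<in>G. cube k \<alpha>)"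
        using G fm cubes unfolding dyadic_cubes_def
        by (intro measure_UNION'[symmetric]) (auto simp: pairwise_def disjnt_def disjoint_family_on_def F_def subset_iff)
      also have "\<dots> \<le> V R x0"
        unfolding vol_def using vol(2) G fm by (intro measure_mono_fmeasurable) (auto simp: fmeasurable_def emeasure_qball)
      finally have "real (card G) \<le> V R x0 / c" using c by (simp add: field_simps)
      then show ?thesis by (simp add: le_nat_floor)
    qed
    then show ?thesis using finite_if_finite_subsets_card_bdd[of "F n"] by blast
  qed
  moreover have "A k = (\<Union>n. F n)"
  proof -
    have "\<exists>n. d x0 (z k \<alpha>) < real n" for \<alpha> using reals_Archimedean2 by blast
    then show ?thesis by (auto simp: F_def)
  qed
  ultimately show ?thesis by (metis countable_UN countable_finite countableI_type)
qed

lemma nn_integral_idx: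
  "(\<integral>\<^sup>+\<alpha>. c \<alpha> * indicator (cube k \<alpha>) x \<partial>count_space (A k)) = c (idx k x)"
proof -
  have "(\<integral>\<^sup>+\<alpha>. c \<alpha> * indicator (cube k \<alpha>) x \<partial>count_space (A k)) = c (idx k x) * indicator (cube k (idx k x)) x"
    using idx_eq idx(1) by (intro nn_integral_count_space_point) (auto split: split_indicator)
  then show ?thesis using idx(2) by simp
qed

lemma measurable_idx [measurable]: "(\<lambda>x. c (idx k x) :: ennreal) \<in> borel_measurable M"
proof -
  have "(\<lambda>x. \<integral>\<^sup>+\<alpha>. c \<alpha> * indicator (cube k \<alpha>) x \<partial>count_space (A k)) \<in> borel_measurable M"
    using countable_A by (intro measurable_nn_integral_count_space) auto
  then show ?thesis by (simp add: nn_integral_idx)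
qed

subsection \<open>Measurability of quasi-continuous functions\<close>

text \<open>Balls of a quasi-metric need not be open, so a set that contains a ball about each of
  its points is written as a union of balls directly. The dyadic points of all generations form a
  countable dense set of centres, and radii 1/(n+1) suffice.\<close>

lemma quasi_open_measurable:
  assumes "\<And>x. x \<in> U \<Longrightarrow> \<exists>s>0. qball d x s \<subseteq> U"
  shows "U \<in> sets M"
proof -
  define D where "D = (\<Union>k. z k ` A k)"
  have D: "countable D" unfolding D_def using countable_A by (intro countable_UN) auto
  have dense: "\<exists>y\<in>D. d x y < e" if "0 < e" for x e
  proof -
    obtain k where "\<delta> ^ k < e / C0"
      using real_arch_pow_inv[of "e / C0" \<delta>] delta C0_pos \<open>0 < e\<close> by auto
    then have k: "C0 * \<delta> powi int k < e" using C0_pos by (simp add: field_simps)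
    obtain \<alpha> where "\<alpha> \<in> A (int k)" "d x (z (int k) \<alpha>) < C0 * \<delta> powi int k"
      using points unfolding dyadic_points_def by blast
    moreover from this have "z (int k) \<alpha> \<in> D" unfolding D_def by blast
    ultimately show ?thesis using k by (meson less_trans)
  qed
  define P where "P = {(y, n). y \<in> D \<and> qball d y (1 / real (Suc n)) \<subseteq> U}"
  have "countable P" using D by (intro countable_subset[of P "D \<times> UNIV"]) (auto simp: P_def)
  moreover have "U = (\<Union>(y, n)\<in>P. qball d y (1 / real (Suc n)))"
  proof (intro equalityI subsetI)
    fix x assume "x \<in> U"
    then obtain s where s: "0 < s" "qball d x s \<subseteq> U" using assms by blast
    obtain n where n: "inverse (real (Suc n)) < s / (2 * A0)"
      using reals_Archimedean[of "s / (2 * A0)"] s by auto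
    define e where "e = 1 / real (Suc n)"
    have e: "0 < e" "2 * A0 * e < s" using n by (auto simp: e_def field_simps)
    obtain y where y: "y \<in> D" "d x y < e" using dense[OF e(1)] by blast
    have "qball d y e \<subseteq> U"
    proof
      fix w assume "w \<in> qball d y e"
      then have "A0 * (d x y + d y w) < A0 * (2 * e)" using y by (simp add: qball_def)
      then have "d x w < s" using d_triangle[of x w y] e by linarith
      then show "w \<in> U" using s by (auto simp: qball_def)
    qed
    then show "x \<in> (\<Union>(y, n)\<in>P. qball d y (1 / real (Suc n)))"
      using y by (intro UN_I[of "(y, n)"]) (auto simp: P_def e_def qball_def d_sym)
  qed (auto simp: P_def)
  moreover have "(\<Union>(y, n)\<in>P. qball d y (1 / real (Suc n))) \<in> sets M"
    using \<open>countable P\<close> by (intro sets.countable_UN') auto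
  ultimately show ?thesis by simp
qed

lemma dist_apply_measurable:
  assumes f: "f \<in> distributions M d A0 x0 \<eta> \<beta> \<gamma>" and Q: "exp_IATI M d \<delta> A' z' \<eta> Q"
    and e: "0 < \<beta>" "\<beta> \<le> \<eta>" "\<gamma> \<le> \<eta>"
  shows "dist_apply Q k f \<in> borel_measurable M"
proof (rule borel_measurableI)
  fix O' :: "complex set" assume O: "open O'"
  show "dist_apply Q k f -` O' \<inter> space M \<in> sets M"
  proof (rule quasi_open_measurable)
    fix x assume "x \<in> dist_apply Q k f -` O' \<inter> space M"
    then obtain \<epsilon> where \<epsilon>: "0 < \<epsilon>" "\<And>w. dist w (dist_apply Q k f x) < \<epsilon> \<Longrightarrow> w \<in> O'"
      using O unfolding open_dist by auto
    obtain s where "0 < s" "\<And>x'. d x x' < s \<Longrightarrow> cmod (dist_apply Q k f x - dist_apply Q k f x') < \<epsilon>"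
      using dist_apply_continuous[OF f Q delta e \<epsilon>(1), of x k] by metis
    then show "\<exists>s>0. qball d x s \<subseteq> dist_apply Q k f -` O' \<inter> space M"
      using \<epsilon>(2) by (intro exI[of _ s]) (auto simp: qball_def dist_norm norm_minus_commute)
  qed
qed

subsection \<open>Subcubes\<close>

abbreviation cells :: "int \<Rightarrow> 'i \<Rightarrow> nat \<Rightarrow> bool" where
  "cells k \<alpha> m \<equiv> \<alpha> \<in> A k \<and> m \<in> {1..Num k \<alpha>}"

lemma subcube_bij: "\<alpha> \<in> A k \<Longrightarrow> bij_betw (S k \<alpha>) {1..Num k \<alpha>}
    {cube (k + int j0) \<tau> | \<tau>. \<tau> \<in> A (k + int j0) \<and> cube (k + int j0) \<tau> \<subseteq> cube k \<alpha>}"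
  using subcubes unfolding subcube_enumeration_def by blast

lemma subcube:
  assumes "cells k \<alpha> m"
  obtains \<tau> where "\<tau> \<in> A (k + int j0)" "S k \<alpha> m = cube (k + int j0) \<tau>" "S k \<alpha> m \<subseteq> cube k \<alpha>"
proof -
  have "S k \<alpha> m \<in> {cube (k + int j0) \<tau> | \<tau>. \<tau> \<in> A (k + int j0) \<and> cube (k + int j0) \<tau> \<subseteq> cube k \<alpha>}"
    using bij_betwE[OF subcube_bij] assms by blast
  then show thesis using that by auto
qed

lemma subcube_measurable [measurable]: "cells k \<alpha> m \<Longrightarrow> S k \<alpha> m \<in> sets M"
  by (metis subcube cube_measurable)

lemma subcube_cover: "\<exists>\<alpha> m. cells k \<alpha> m \<and> x \<in> S k \<alpha> m"
proof -
  define \<tau> where "\<tau> = idx (k + int j0) x"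
  have \<tau>: "\<tau> \<in> A (k + int j0)" "x \<in> cube (k + int j0) \<tau>" using idx by (auto simp: \<tau>_def)
  have "cube (k + int j0) \<tau> \<subseteq> cube k (idx k x)"
    using cube_nested[of k "k + int j0" "idx k x" \<tau> x] \<tau> idx by auto
  then have "cube (k + int j0) \<tau> \<in> S k (idx k x) ` {1..Num k (idx k x)}"
    using bij_betw_imp_surj_on[OF subcube_bij[OF idx(1)]] \<tau>(1) by blast
  then obtain m where "m \<in> {1..Num k (idx k x)}" "cube (k + int j0) \<tau> = S k (idx k x) m" by blast
  then show ?thesis using \<tau>(2) idx(1) by metis
qed

text \<open>Cells are cubes of one generation, so a common point makes them equal. Their parent
  cubes then meet and coincide, and the enumeration inside a parent is injective.\<close>

lemma subcube_unique:
  assumes "cells k \<alpha> m" "cells k \<beta> n" "x \<in> S k \<alpha> m" "x \<in> S k \<beta> n"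
  shows "\<alpha> = \<beta> \<and> m = n"
proof -
  obtain \<tau> where \<tau>: "\<tau> \<in> A (k + int j0)" "S k \<alpha> m = cube (k + int j0) \<tau>" "S k \<alpha> m \<subseteq> cube k \<alpha>"
    using subcube[OF assms(1)] .
  obtain \<sigma> where \<sigma>: "\<sigma> \<in> A (k + int j0)" "S k \<beta> n = cube (k + int j0) \<sigma>" "S k \<beta> n \<subseteq> cube k \<beta>"
    using subcube[OF assms(2)] .
  have "\<tau> = \<sigma>" using cube_disjoint \<tau> \<sigma> assms by metis
  then have eq: "S k \<alpha> m = S k \<beta> n" using \<tau> \<sigma> by simp
  have "\<alpha> = \<beta>" using cube_disjoint[of \<alpha> k \<beta> x] \<tau> \<sigma> assms by blast
  then show ?thesis
    using eq assms bij_betw_imp_inj_on[OF subcube_bij[of \<alpha> k]] by (auto dest: inj_onD)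
qed

definition cell_sum :: "int \<Rightarrow> ('i \<Rightarrow> nat \<Rightarrow> ennreal) \<Rightarrow> ennreal" where
  "cell_sum k h = (\<integral>\<^sup>+\<alpha>. (\<Sum>m = 1..Num k \<alpha>. h \<alpha> m) \<partial>count_space (A k))"

lemma cell_sum_mono: "(\<And>\<alpha> m. cells k \<alpha> m \<Longrightarrow> h \<alpha> m \<le> h' \<alpha> m) \<Longrightarrow> cell_sum k h \<le> cell_sum k h'"
  unfolding cell_sum_def by (intro nn_integral_mono sum_mono) auto

lemma cell_sum_cong: "(\<And>\<alpha> m. cells k \<alpha> m \<Longrightarrow> h \<alpha> m = h' \<alpha> m) \<Longrightarrow> cell_sum k h = cell_sum k h'"
  by (intro antisym cell_sum_mono) auto

lemma cell_sum_cmult: "cell_sum k (\<lambda>\<alpha> m. c * h \<alpha> m) = c * cell_sum k h"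
  by (simp add: cell_sum_def nn_integral_cmult flip: sum_distrib_left)

lemma cell_sum_epowr_le:
  assumes "0 < r" "r \<le> 1"
  shows "epowr (cell_sum k h) r \<le> cell_sum k (\<lambda>\<alpha> m. epowr (h \<alpha> m) r)"
proof -
  have "epowr (cell_sum k h) r \<le> (\<integral>\<^sup>+\<alpha>. epowr (\<Sum>m = 1..Num k \<alpha>. h \<alpha> m) r \<partial>count_space (A k))"
    unfolding cell_sum_def by (rule epowr_nn_integral_count_le[OF assms])
  also have "\<dots> \<le> cell_sum k (\<lambda>\<alpha> m. epowr (h \<alpha> m) r)"
    unfolding cell_sum_def using assms by (intro nn_integral_mono epowr_sum_le) auto
  finally show ?thesis .
qed

lemma cell_sum_measurable [measurable]:
  assumes "\<And>\<alpha> m. cells k \<alpha> m \<Longrightarrow> g \<alpha> m \<in> borel_measurable M"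
  shows "(\<lambda>x. cell_sum k (\<lambda>\<alpha> m. g \<alpha> m x)) \<in> borel_measurable M"
  unfolding cell_sum_def using assms countable_A
  by (intro measurable_nn_integral_count_space borel_measurable_sum) auto

lemma nn_integral_cell_sum:
  assumes "\<And>\<alpha> m. cells k \<alpha> m \<Longrightarrow> g \<alpha> m \<in> borel_measurable M"
  shows "(\<integral>\<^sup>+x. cell_sum k (\<lambda>\<alpha> m. g \<alpha> m x) \<partial>M) = cell_sum k (\<lambda>\<alpha> m. \<integral>\<^sup>+x. g \<alpha> m x \<partial>M)"
  unfolding cell_sum_def using assms countable_A
  by (subst nn_integral_count_space_nn_integral) (auto intro!: nn_integral_cong borel_measurable_sum nn_integral_sum)

lemma cell_sum_point:
  assumes "cells k \<alpha> m" "x \<in> S k \<alpha> m"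
  shows "cell_sum k (\<lambda>\<alpha> m. c \<alpha> m * indicator (S k \<alpha> m) x) = c \<alpha> m"
proof -
  have z: "indicator (S k \<beta> n) x = (0::ennreal)" if "cells k \<beta> n" "\<not> (\<beta> = \<alpha> \<and> n = m)" for \<beta> n
    using subcube_unique[OF that(1) assms(1) _ assms(2)] that(2) by (auto split: split_indicator)
  have "cell_sum k (\<lambda>\<alpha> m. c \<alpha> m * indicator (S k \<alpha> m) x) =
      (\<Sum>m = 1..Num k \<alpha>. c \<alpha> m * indicator (S k \<alpha> m) x)"
    unfolding cell_sum_def using assms z by (intro nn_integral_count_space_point sum.neutral) auto
  also have "\<dots> = c \<alpha> m * indicator (S k \<alpha> m) x"
    using assms z by (intro sum_point) auto
  finally show ?thesis using assms by simp
qed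

text \<open>The cells of one generation partition the space, so a sum of cell integrals is the whole
  integral.\<close>

lemma cell_sum_integral:
  assumes [measurable]: "g \<in> borel_measurable M"
  shows "cell_sum k (\<lambda>\<alpha> m. \<integral>\<^sup>+x\<in>S k \<alpha> m. g x \<partial>M) = (\<integral>\<^sup>+x. g x \<partial>M)"
proof -
  have "cell_sum k (\<lambda>\<alpha> m. \<integral>\<^sup>+x\<in>S k \<alpha> m. g x \<partial>M) = (\<integral>\<^sup>+x. cell_sum k (\<lambda>\<alpha> m. g x * indicator (S k \<alpha> m) x) \<partial>M)"
    by (rule nn_integral_cell_sum[symmetric]) measurable
  also have "\<dots> = (\<integral>\<^sup>+x. g x \<partial>M)"
  proof (intro nn_integral_cong)
    fix x
    obtain \<alpha> m where "cells k \<alpha> m" "x \<in> S k \<alpha> m" using subcube_cover by blast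
    then show "cell_sum k (\<lambda>\<alpha> m. g x * indicator (S k \<alpha> m) x) = g x"
      by (rule cell_sum_point[where c = "\<lambda>_ _. g x"])
  qed
  finally show ?thesis .
qed

text \<open>The volume estimate is the source of all losses in r-th powers: a cell of generation k
  occupies at least a fixed multiple of (\<delta>^k/n)^\<omega> of a ball of radius n whose centre
  is within n of a point of the cell.\<close>

lemma subcube_size:
  obtains D where "1 \<le> D" "\<And>k \<alpha> m x y. cells (int k) \<alpha> m \<Longrightarrow> x \<in> S (int k) \<alpha> m \<Longrightarrow> y \<in> S (int k) \<alpha> m \<Longrightarrow> d x y \<le> D * \<delta> ^ k"
    "\<And>k \<alpha> m x y n. cells (int k) \<alpha> m \<Longrightarrow> y \<in> S (int k) \<alpha> m \<Longrightarrow> d x y \<le> n \<Longrightarrow> \<delta> ^ k \<le> n \<Longrightarrow>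
       V n x \<le> D * (n / \<delta> ^ k) powr \<omega> * measure M (S (int k) \<alpha> m)"
    "\<And>k \<alpha> m. cells (int k) \<alpha> m \<Longrightarrow> 0 < emeasure M (S (int k) \<alpha> m) \<and> emeasure M (S (int k) \<alpha> m) < \<infinity>"
proof -
  define B where "B = 2 * A0 * C0"
  define r where "r k = c0 * \<delta> ^ (k + j0) / (3 * A0\<^sup>2)" for k :: nat
  \<comment> \<open>A cell contains a ball about w of radius \<open>r k\<close>. K is made so that
    \<open>K * r k\<close> exceeds (1 + A0 (1 + B)) \<delta>^k; enlarged by L = K n / \<delta>^k,
    the radius \<open>r k\<close> then exceeds both n and the bound A0 (n + B n) for d x w.\<close>
  define K where "K = 1 + A0 * (1 + B) * (3 * A0\<^sup>2) / (c0 * \<delta> ^ j0) + (3 * A0\<^sup>2) / (c0 * \<delta> ^ j0)"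
  define D where "D = 1 + 2 * A0 * B + C\<mu> * (2 * A0 * K) powr \<omega>"
  have B: "0 < B" using C0_pos by (simp add: B_def)
  have r: "0 < r k" for k using c0_pos delta by (simp add: r_def)
  have q: "0 \<le> (3 * A0\<^sup>2) / (c0 * \<delta> ^ j0)" "0 \<le> A0 * (1 + B) * (3 * A0\<^sup>2) / (c0 * \<delta> ^ j0)"
    using c0_pos delta B by auto
  have K: "1 \<le> K" unfolding K_def using q by linarith
  have pw: "\<delta> powi (int k + int j0) = \<delta> ^ (k + j0)" for k
    by (metis of_nat_add power_int_of_nat)
  have le: "\<delta> ^ (k + j0) \<le> \<delta> ^ k" for k
    using delta by (intro power_decreasing) auto
  have ball: "\<exists>w. qball d w (r k) \<subseteq> S (int k) \<alpha> m \<and> S (int k) \<alpha> m \<subseteq> qball d w (B * \<delta> ^ k)"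
    if c: "cells (int k) \<alpha> m" for k \<alpha> m
  proof -
    obtain \<tau> where \<tau>: "\<tau> \<in> A (int k + int j0)" "S (int k) \<alpha> m = cube (int k + int j0) \<tau>"
      using subcube[OF c] .
    have "qball d (z (int k + int j0) \<tau>) (B * \<delta> ^ (k + j0)) \<subseteq> qball d (z (int k + int j0) \<tau>) (B * \<delta> ^ k)"
      using mult_left_mono[OF le[of k], of B] B by (auto simp: qball_def intro: less_le_trans)
    then show ?thesis using cube_inner[OF \<tau>(1)] cube_outer[OF \<tau>(1)] unfolding \<tau>(2) pw r_def B_def by blast
  qed
  have meas: "0 < emeasure M (S (int k) \<alpha> m) \<and> emeasure M (S (int k) \<alpha> m) < \<infinity>" if c: "cells (int k) \<alpha> m" for k \<alpha> m
  proof -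
    obtain w where w: "qball d w (r k) \<subseteq> S (int k) \<alpha> m" "S (int k) \<alpha> m \<subseteq> qball d w (B * \<delta> ^ k)" using ball[OF c] by blast
    have "ennreal (V (r k) w) \<le> emeasure M (S (int k) \<alpha> m)" "emeasure M (S (int k) \<alpha> m) \<le> ennreal (V (B * \<delta> ^ k) w)"
      using emeasure_mono[OF w(1) subcube_measurable[OF c]] emeasure_mono[OF w(2), of M] by (auto simp: emeasure_qball)
    moreover have "0 < ennreal (V (r k) w)" using V_pos[OF r] by simp
    ultimately show ?thesis using ennreal_less_top le_less_trans less_le_trans infinity_ennreal_def by metis
  qed
  show thesis
  proof (rule that[of D])
    have q2: "0 \<le> 2 * A0 * B" "0 \<le> C\<mu> * (2 * A0 * K) powr \<omega>" using B C\<mu>_pos by auto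
    then show "1 \<le> D" unfolding D_def by linarith
    fix k \<alpha> m x y assume c: "cells (int k) \<alpha> m"
    obtain w where w: "qball d w (r k) \<subseteq> S (int k) \<alpha> m" "S (int k) \<alpha> m \<subseteq> qball d w (B * \<delta> ^ k)" using ball[OF c] by blast
    show "0 < emeasure M (S (int k) \<alpha> m) \<and> emeasure M (S (int k) \<alpha> m) < \<infinity>" by (rule meas[OF c])
    assume y: "y \<in> S (int k) \<alpha> m"
    then have wy: "d w y \<le> B * \<delta> ^ k" using w by (auto simp: qball_def)
    show "d x y \<le> D * \<delta> ^ k" if "x \<in> S (int k) \<alpha> m"
    proof -
      have "d x w \<le> B * \<delta> ^ k" using that w by (auto simp: qball_def d_sym[of x])
      then have "A0 * (d x w + d w y) \<le> A0 * (B * \<delta> ^ k + B * \<delta> ^ k)" using wy by (intro mult_left_mono) auto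
      also have "\<dots> = 2 * A0 * B * \<delta> ^ k" by simp
      also have "\<dots> \<le> D * \<delta> ^ k" using q2 delta by (intro mult_right_mono) (auto simp: D_def)
      finally show ?thesis using d_triangle[of x y w] by simp
    qed
    fix n assume n: "d x y \<le> n" "\<delta> ^ k \<le> n"
    have dk: "0 < \<delta> ^ k" using delta by simp
    have n0: "0 < n" using n dk by linarith
    define L where "L = K * (n / \<delta> ^ k)"
    have "1 * 1 \<le> K * (n / \<delta> ^ k)" using K n dk by (intro mult_mono) auto
    then have L: "1 \<le> L" by (simp add: L_def)
    have rk: "r k * ((3 * A0\<^sup>2) / (c0 * \<delta> ^ j0)) = \<delta> ^ k"
      using c0_pos delta by (simp add: r_def power_add field_simps)
    have Lr: "L * r k = n * (K * r k / \<delta> ^ k)" by (simp add: L_def)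
    have Kr: "K * r k = r k + A0 * (1 + B) * \<delta> ^ k + \<delta> ^ k"
    proof -
      have "K * r k = r k + A0 * (1 + B) * (r k * ((3 * A0\<^sup>2) / (c0 * \<delta> ^ j0))) + r k * ((3 * A0\<^sup>2) / (c0 * \<delta> ^ j0))"
        by (simp add: K_def algebra_simps)
      then show ?thesis by (simp only: rk)
    qed
    have "1 + A0 * (1 + B) \<le> K * r k / \<delta> ^ k"
      using r[of k] dk by (simp add: Kr field_simps)
    then have "n * (1 + A0 * (1 + B)) \<le> L * r k" unfolding Lr using n0 by (intro mult_left_mono) auto
    moreover have "0 \<le> n * (A0 * (1 + B))" using n0 B by simp
    ultimately have L1: "n \<le> L * r k" and L2: "A0 * (n + B * n) \<le> L * r k" using n0 by (auto simp: algebra_simps)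
    have "B * \<delta> ^ k \<le> B * n" using n B by simp
    then have "A0 * (d x y + d y w) \<le> A0 * (n + B * n)"
      using n wy by (intro mult_left_mono add_mono) (auto simp: d_sym[of y w])
    then have "d x w \<le> L * r k" using d_triangle[of x w y] L2 by linarith
    then have "V n x \<le> C\<mu> * (2 * A0 * L) powr \<omega> * V (r k) w"
      using L1 L r by (intro V_compare) auto
    also have "\<dots> \<le> C\<mu> * (2 * A0 * L) powr \<omega> * measure M (S (int k) \<alpha> m)"
      unfolding vol_def using C\<mu>_pos meas[OF c] c w(1)
      by (intro mult_left_mono measure_mono_fmeasurable) (auto simp: fmeasurable_def)
    also have "(2 * A0 * L) powr \<omega> = (2 * A0 * K) powr \<omega> * (n / \<delta> ^ k) powr \<omega>"
      unfolding L_def by (simp flip: powr_mult add: mult.assoc)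
    also have "C\<mu> * ((2 * A0 * K) powr \<omega> * (n / \<delta> ^ k) powr \<omega>) * measure M (S (int k) \<alpha> m) \<le>
        D * (n / \<delta> ^ k) powr \<omega> * measure M (S (int k) \<alpha> m)"
      using q2 by (auto simp: D_def mult.assoc[symmetric] intro!: mult_right_mono)
    finally show "V n x \<le> D * (n / \<delta> ^ k) powr \<omega> * measure M (S (int k) \<alpha> m)" .
  qed
qed

end

section \<open>The maximal function\<close>

lemma nn_integral_int_atMost_geometric:
  fixes n :: int and t :: real
  assumes "0 < t"
  shows "(\<integral>\<^sup>+i. ennreal (2 powr (t * real_of_int i)) \<partial>count_space {..n}) = ennreal (2 powr (t * real_of_int n) / (1 - 2 powr (- t)))"
proof -
  have bij: "bij_betw (\<lambda>j. n - int j) UNIV {..n}"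
    by (rule bij_betwI[where g = "\<lambda>i. nat (n - i)"]) auto
  have lt: "2 powr (- t) < 1" using assms by (simp add: powr_minus inverse_less_1_iff)
  have eq: "2 powr (t * real_of_int (n - int j)) = 2 powr (t * real_of_int n) * (2 powr (- t)) ^ j" for j
    by (simp add: powr_powr right_diff_distrib powr_diff powr_minus field_simps flip: powr_realpow)
  have "(\<integral>\<^sup>+i. ennreal (2 powr (t * real_of_int i)) \<partial>count_space {..n}) =
      (\<Sum>j. ennreal (2 powr (t * real_of_int n) * (2 powr (- t)) ^ j))"
    by (subst nn_integral_bij_count_space[OF bij, symmetric]) (simp add: nn_integral_count_space_nat eq[simplified])
  also have "\<dots> = ennreal (\<Sum>j. 2 powr (t * real_of_int n) * (2 powr (- t)) ^ j)"
    using lt by (intro suminf_ennreal2) (auto intro!: summable_mult summable_geometric)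
  also have "(\<Sum>j. 2 powr (t * real_of_int n) * (2 powr (- t)) ^ j) = 2 powr (t * real_of_int n) / (1 - 2 powr (- t))"
    using lt by (subst suminf_mult) (auto simp: summable_geometric suminf_geometric)
  finally show ?thesis .
qed

lemma dyadic_interval:
  fixes t :: real
  assumes "0 < t"
  obtains n :: int where "2 powr (real_of_int n) < t" "t \<le> 2 powr (real_of_int n + 1)"
proof -
  define n where "n = \<lceil>log 2 t\<rceil> - 1"
  have "real_of_int n < log 2 t" "log 2 t \<le> real_of_int n + 1" unfolding n_def by linarith+
  then show thesis using that assms by (simp add: less_log_iff log_le_iff)
qed

text \<open>Marcinkiewicz interpolation over the dyadic levels 2^i. The hypothesis is the weak type
  estimate at level lam for the part of g above lam/2, which leads to a convergent sum over
  levels.\<close>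

lemma strong_type_of_weak_type:
  assumes P: "1 < P" and K: "0 < K"
  obtains C where "0 < C" "\<And>M m g. \<lbrakk>m \<in> borel_measurable M; g \<in> borel_measurable M;
      \<And>lam::real. 0 < lam \<Longrightarrow> ennreal lam * emeasure M {x\<in>space M. ennreal lam < m x} \<le>
         ennreal K * (\<integral>\<^sup>+x. g x * indicator {x. ennreal (lam / 2) < g x} x \<partial>M)\<rbrakk>
    \<Longrightarrow> (\<integral>\<^sup>+x. epowr (m x) P \<partial>M) \<le> ennreal C * (\<integral>\<^sup>+x. epowr (g x) P \<partial>M)"
proof -
  define t where "t = P - 1"
  have t: "0 < t" using P by (simp add: t_def)
  have lt: "2 powr (- t) < 1" using t by (simp add: powr_minus inverse_less_1_iff)
  define c where "c = 2 powr (2 * t) / (1 - 2 powr (- t))"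
  have c: "0 < c" using lt by (simp add: c_def)
  \<comment> \<open>Among the levels 2^i below s is one with s <= 2^(i+1), and its term alone
    dominates s^P.\<close>
  have layer: "epowr s P \<le> (\<integral>\<^sup>+i. ennreal (2 powr (P * (real_of_int i + 1))) * indicator {s. ennreal (2 powr real_of_int i) < s} s
      \<partial>count_space UNIV)" for s :: ennreal
  proof (cases s)
    case (real u)
    show ?thesis
    proof (cases "u = 0")
      case False
      then have "0 < u" using real by simp
      then obtain n :: int where n: "2 powr (real_of_int n) < u" "u \<le> 2 powr (real_of_int n + 1)"
        by (rule dyadic_interval)
      have "u powr P \<le> (2 powr (real_of_int n + 1)) powr P" using n real P by (intro powr_mono2) auto
      then have "epowr s P \<le> ennreal (2 powr (P * (real_of_int n + 1))) * indicator {s. ennreal (2 powr real_of_int n) < s} s"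
        using n real by (simp add: epowr_ennreal powr_powr mult.commute ennreal_leI ennreal_less_iff)
      also have "\<dots> \<le> (\<integral>\<^sup>+i. ennreal (2 powr (P * (real_of_int i + 1))) * indicator {s. ennreal (2 powr real_of_int i) < s} s \<partial>count_space UNIV)"
        by (rule nn_integral_ge_point) simp
      finally show ?thesis .
    qed (use real in simp)
  next
    case top
    have "ennreal (real n) \<le> (\<integral>\<^sup>+i. ennreal (2 powr (P * (real_of_int i + 1))) * indicator {s. ennreal (2 powr real_of_int i) < s} s \<partial>count_space UNIV)" for n :: nat
    proof -
      have "real n \<le> 2 ^ n" by (simp add: less_imp_le of_nat_less_two_power)
      also have "(2::real) ^ n = 2 powr (real n)" by (simp add: powr_realpow)
      also have "\<dots> \<le> 2 powr (P * (real n + 1))"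
      proof (intro powr_mono)
        have "real n \<le> 1 * (real n + 1)" by simp
        also have "\<dots> \<le> P * (real n + 1)" using P by (intro mult_right_mono) auto
        finally show "real n \<le> P * (real n + 1)" .
      qed simp
      finally have "ennreal (real n) \<le> ennreal (2 powr (P * (real_of_int (int n) + 1))) * indicator {s. ennreal (2 powr real_of_int (int n)) < s} s"
        using top by (simp add: ennreal_leI)
      also have "\<dots> \<le> (\<integral>\<^sup>+i. ennreal (2 powr (P * (real_of_int i + 1))) * indicator {s. ennreal (2 powr real_of_int i) < s} s \<partial>count_space UNIV)"
        by (rule nn_integral_ge_point) simp
      finally show ?thesis .
    qed
    then have "X = top" if "X = (\<integral>\<^sup>+i. ennreal (2 powr (P * (real_of_int i + 1))) * indicator {s. ennreal (2 powr real_of_int i) < s} s \<partial>count_space UNIV)" for X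
    proof (cases X)
      case (real u)
      obtain n :: nat where "u < real n" using reals_Archimedean2 by blast
      moreover have "ennreal (real n) \<le> ennreal u"
        using \<open>\<And>n. ennreal (real n) \<le> _\<close> real that by simp
      ultimately show ?thesis using real by simp
    qed simp
    then show ?thesis by simp
  qed
  \<comment> \<open>Only levels with 2^i < 2 s contribute. Over them the sum of 2^((P-1) i) is
    geometric, and because P > 1 it is of size s^(P-1).\<close>
  have tail: "(\<integral>\<^sup>+i. ennreal (2 powr (t * real_of_int i)) * indicator {s. ennreal (2 powr real_of_int i / 2) < s} s \<partial>count_space UNIV) * s
      \<le> ennreal c * epowr s P" for s :: ennreal
  proof (cases s)
    case (real u)
    show ?thesis
    proof (cases "u = 0")
      case False
      then have "0 < u" using real by simp
      then obtain n :: int where n: "2 powr (real_of_int n) < u" "u \<le> 2 powr (real_of_int n + 1)"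
        by (rule dyadic_interval)
      have ind: "indicator {s. ennreal (2 powr real_of_int i / 2) < s} s \<le> (indicator {..n + 1} i :: ennreal)" for i :: int
      proof (cases "ennreal (2 powr real_of_int i / 2) < s")
        case True
        then have "2 powr (real_of_int i - 1) < u" using real by (simp add: powr_diff ennreal_less_iff)
        then have "2 powr (real_of_int i - 1) < 2 powr (real_of_int n + 1)" using n by linarith
        then have "real_of_int i - 1 < real_of_int n + 1" by (subst (asm) powr_less_cancel_iff) auto
        then have "i \<le> n + 1" by linarith
        then show ?thesis by (simp add: indicator_def)
      qed simp
      have "(\<integral>\<^sup>+i. ennreal (2 powr (t * real_of_int i)) * indicator {s. ennreal (2 powr real_of_int i / 2) < s} s \<partial>count_space UNIV)
          \<le> (\<integral>\<^sup>+i. ennreal (2 powr (t * real_of_int i)) * indicator {..n + 1} i \<partial>count_space UNIV)"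
        by (intro nn_integral_mono mult_left_mono ind) simp
      also have "\<dots> = ennreal (2 powr (t * real_of_int (n + 1)) / (1 - 2 powr (- t)))"
        by (subst nn_integral_count_space_indicator[symmetric]) (use nn_integral_int_atMost_geometric[OF t] in simp_all)
      also have "\<dots> \<le> ennreal (c * u powr t)"
      proof (rule ennreal_leI)
        have "(2 powr real_of_int n) powr t \<le> u powr t" using n t by (intro powr_mono2) auto
        then have "2 powr t * 2 powr (t * real_of_int n) \<le> 2 powr (2 * t) * u powr t"
          using t by (intro mult_mono powr_mono) (auto simp: powr_powr mult.commute)
        then have "2 powr (t * real_of_int (n + 1)) \<le> 2 powr (2 * t) * u powr t"
          by (simp add: distrib_left powr_add mult.commute)
        then show "2 powr (t * real_of_int (n + 1)) / (1 - 2 powr (- t)) \<le> c * u powr t"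
          using lt unfolding c_def times_divide_eq_left by (intro divide_right_mono) auto
      qed
      finally have "(\<integral>\<^sup>+i. ennreal (2 powr (t * real_of_int i)) * indicator {s. ennreal (2 powr real_of_int i / 2) < s} s \<partial>count_space UNIV) * s
          \<le> ennreal (c * u powr t) * ennreal u" using real by (simp add: mult_right_mono)
      also have "\<dots> = ennreal c * epowr s P"
      proof -
        have "u powr t * u = u powr P" using \<open>0 < u\<close> by (simp add: t_def powr_diff)
        then show ?thesis using real c by (simp add: epowr_ennreal mult.assoc flip: ennreal_mult)
      qed
      finally show ?thesis .
    qed (use real in simp)
  next
    case top
    then show ?thesis using c by (simp add: ennreal_mult_eq_top_iff)
  qed
  define C where "C = 2 powr P * K * c"
  have "(\<integral>\<^sup>+x. epowr (m x) P \<partial>M) \<le> ennreal C * (\<integral>\<^sup>+x. epowr (g x) P \<partial>M)"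
    if [measurable]: "m \<in> borel_measurable M" "g \<in> borel_measurable M" and
      w: "\<And>lam::real. 0 < lam \<Longrightarrow> ennreal lam * emeasure M {x\<in>space M. ennreal lam < m x} \<le>
         ennreal K * (\<integral>\<^sup>+x. g x * indicator {x. ennreal (lam / 2) < g x} x \<partial>M)" for M and m g :: "'z \<Rightarrow> ennreal"
  proof -
    define l where "l i = 2 powr real_of_int i" for i :: int
    have l: "0 < l i" for i by (simp add: l_def)
    have "(\<integral>\<^sup>+x. epowr (m x) P \<partial>M) \<le>
        (\<integral>\<^sup>+x. (\<integral>\<^sup>+i. ennreal (2 powr (P * (real_of_int i + 1))) * indicator {s. ennreal (l i) < s} (m x) \<partial>count_space UNIV) \<partial>M)"
      unfolding l_def by (intro nn_integral_mono layer)
    also have "\<dots> = (\<integral>\<^sup>+i. (\<integral>\<^sup>+x. ennreal (2 powr (P * (real_of_int i + 1))) * indicator {s. ennreal (l i) < s} (m x) \<partial>M) \<partial>count_space UNIV)"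
      by (rule nn_integral_count_space_nn_integral) auto
    also have "\<dots> \<le> (\<integral>\<^sup>+i. (\<integral>\<^sup>+x. ennreal (2 powr P * K) *
        ((ennreal (2 powr (t * real_of_int i)) * indicator {s. ennreal (l i / 2) < s} (g x)) * g x) \<partial>M) \<partial>count_space UNIV)"
    proof (rule nn_integral_mono)
      fix i :: int
      have e: "2 powr (P * (real_of_int i + 1)) = 2 powr P * 2 powr (t * real_of_int i) * l i"
        by (simp add: t_def l_def algebra_simps flip: powr_add)
      have "(\<integral>\<^sup>+x. ennreal (2 powr (P * (real_of_int i + 1))) * indicator {s. ennreal (l i) < s} (m x) \<partial>M) =
          ennreal (2 powr (P * (real_of_int i + 1))) * emeasure M {x\<in>space M. ennreal (l i) < m x}"
      proof -
        have "(\<integral>\<^sup>+x. indicator {s. ennreal (l i) < s} (m x) \<partial>M) = (\<integral>\<^sup>+x. indicator {x\<in>space M. ennreal (l i) < m x} x \<partial>M)"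
          by (intro nn_integral_cong) (simp split: split_indicator)
        then show ?thesis by (simp add: nn_integral_cmult)
      qed
      also have "\<dots> = ennreal (2 powr P * 2 powr (t * real_of_int i)) * (ennreal (l i) * emeasure M {x\<in>space M. ennreal (l i) < m x})"
        unfolding e by (simp add: ennreal_mult l_def mult_ac)
      also have "\<dots> \<le> ennreal (2 powr P * 2 powr (t * real_of_int i)) * (ennreal K * (\<integral>\<^sup>+x. g x * indicator {x. ennreal (l i / 2) < g x} x \<partial>M))"
        by (intro mult_left_mono w l) simp
      also have "\<dots> = (\<integral>\<^sup>+x. ennreal (2 powr P * K) * ((ennreal (2 powr (t * real_of_int i)) * indicator {s. ennreal (l i / 2) < s} (g x)) * g x) \<partial>M)"
      proof -
        have "(\<integral>\<^sup>+x. ennreal (2 powr P * K) * ((ennreal (2 powr (t * real_of_int i)) * indicator {s. ennreal (l i / 2) < s} (g x)) * g x) \<partial>M) =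
          (\<integral>\<^sup>+x. ennreal (2 powr P * 2 powr (t * real_of_int i)) * (ennreal K * (g x * indicator {x. ennreal (l i / 2) < g x} x)) \<partial>M)"
          using K by (intro nn_integral_cong) (auto simp: ennreal_mult mult_ac split: split_indicator)
        then show ?thesis by (simp add: nn_integral_cmult)
      qed
      finally show "(\<integral>\<^sup>+x. ennreal (2 powr (P * (real_of_int i + 1))) * indicator {s. ennreal (l i) < s} (m x) \<partial>M) \<le>
        (\<integral>\<^sup>+x. ennreal (2 powr P * K) * ((ennreal (2 powr (t * real_of_int i)) * indicator {s. ennreal (l i / 2) < s} (g x)) * g x) \<partial>M)" .
    qed
    also have "\<dots> = (\<integral>\<^sup>+x. (\<integral>\<^sup>+i. ennreal (2 powr P * K) *
        ((ennreal (2 powr (t * real_of_int i)) * indicator {s. ennreal (l i / 2) < s} (g x)) * g x) \<partial>count_space UNIV) \<partial>M)"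
      by (rule nn_integral_count_space_nn_integral[symmetric]) auto
    also have "\<dots> = (\<integral>\<^sup>+x. ennreal (2 powr P * K) *
        ((\<integral>\<^sup>+i. ennreal (2 powr (t * real_of_int i)) * indicator {s. ennreal (l i / 2) < s} (g x) \<partial>count_space UNIV) * g x) \<partial>M)"
      by (simp add: nn_integral_cmult nn_integral_multc)
    also have "\<dots> \<le> (\<integral>\<^sup>+x. ennreal (2 powr P * K) * (ennreal c * epowr (g x) P) \<partial>M)"
      unfolding l_def by (intro nn_integral_mono mult_left_mono tail) simp
    also have "\<dots> = ennreal C * (\<integral>\<^sup>+x. epowr (g x) P \<partial>M)"
      using K c by (simp add: nn_integral_cmult C_def ennreal_mult mult.assoc)
    finally show ?thesis .
  qed
  moreover have "0 < C" using K c by (simp add: C_def)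
  ultimately show thesis using that by blast
qed

section \<open>Covering by disjoint balls, and ball averages\<close>

lemma emeasure_countable_UN_le:
  assumes "countable I" "\<And>i. i \<in> I \<Longrightarrow> B i \<in> sets M"
    and F: "\<And>F. finite F \<Longrightarrow> F \<subseteq> I \<Longrightarrow> emeasure M (\<Union>i\<in>F. B i) \<le> b"
  shows "emeasure M (\<Union>i\<in>I. B i) \<le> b"
proof (cases "I = {}")
  case True then show ?thesis by simp
next
  case False
  define U where "U n = (\<Union>i\<in>from_nat_into I ` {..n}. B i)" for n :: nat
  have s: "from_nat_into I ` {..n} \<subseteq> I" for n using from_nat_into[OF False] by auto
  have "(\<Union>i\<in>I. B i) = (\<Union>n. U n)"
  proof -
    have "(\<Union>n. from_nat_into I ` {..n}) = range (from_nat_into I)" by auto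
    then have "I = (\<Union>n. from_nat_into I ` {..n})"
      using range_from_nat_into[OF False assms(1)] by simp
    then show ?thesis unfolding U_def by (metis UN_UN_flatten)
  qed
  moreover have "emeasure M (\<Union>n. U n) = (SUP n. emeasure M (U n))"
  proof (intro SUP_emeasure_incseq[symmetric])
    show "range U \<subseteq> sets M" using s assms(2) by (auto simp: U_def)
    show "incseq U" unfolding U_def by (intro monoI UN_mono image_mono) auto
  qed
  moreover have "emeasure M (U n) \<le> b" for n unfolding U_def using s by (intro F) auto
  ultimately show ?thesis by (auto intro: SUP_least)
qed

text \<open>Greedy selection: take a ball of largest radius r, drop all that meet it, and continue
  with the rest. A dropped ball has radius at most r, so the quasi-triangle inequality applied twice
  puts it at distance below A0 (r + 2 A0 r) <= 3 A0^2 r from the chosen centre.\<close>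

lemma (in homogeneous_space) finite_Vitali:
  assumes "finite F"
  obtains G where "G \<subseteq> F" "\<And>p q. p \<in> G \<Longrightarrow> q \<in> G \<Longrightarrow> p \<noteq> q \<Longrightarrow> qball d (fst p) (snd p) \<inter> qball d (fst q) (snd q) = {}"
    "(\<Union>p\<in>F. qball d (fst p) (snd p)) \<subseteq> (\<Union>p\<in>G. qball d (fst p) (3 * A0\<^sup>2 * snd p))"
proof -
  define Vit where "Vit F G \<longleftrightarrow> G \<subseteq> F \<and> (\<forall>p\<in>G. \<forall>q\<in>G. p \<noteq> q \<longrightarrow> qball d (fst p) (snd p) \<inter> qball d (fst q) (snd q) = {}) \<and>
    (\<Union>p\<in>F. qball d (fst p) (snd p)) \<subseteq> (\<Union>p\<in>G. qball d (fst p) (3 * A0\<^sup>2 * snd p))" for F G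
  have "\<exists>G. Vit F G"
    using assms
  proof (induction F rule: finite_psubset_induct)
    case (psubset F)
    show ?case
    proof (cases "F = {}")
      case False
      then have "Max (snd ` F) \<in> snd ` F" using psubset(1) by (intro Max_in) auto
      then obtain p where "p \<in> F" "snd p = Max (snd ` F)" by (metis imageE)
      then have p: "p \<in> F" "\<And>q. q \<in> F \<Longrightarrow> snd q \<le> snd p" using psubset(1) by auto
      show ?thesis
      proof (cases "snd p \<le> 0")
        case True
        then have "(\<Union>q\<in>F. qball d (fst q) (snd q)) = {}" using p(2) by (force simp: qball_empty)
        then show ?thesis by (intro exI[of _ "{}"]) (auto simp: Vit_def)
      next
        case pos: False
        define F' where "F' = {q\<in>F. qball d (fst q) (snd q) \<inter> qball d (fst p) (snd p) = {}}"
        have "fst p \<in> qball d (fst p) (snd p)" using pos by (simp add: qball_def)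
        then have "p \<notin> F'" by (auto simp: F'_def)
        then have "F' \<subset> F" using p(1) by (auto simp: F'_def)
        from psubset(2)[OF this] obtain G where G: "G \<subseteq> F'" "\<forall>p\<in>G. \<forall>q\<in>G. p \<noteq> q \<longrightarrow> qball d (fst p) (snd p) \<inter> qball d (fst q) (snd q) = {}"
          "(\<Union>p\<in>F'. qball d (fst p) (snd p)) \<subseteq> (\<Union>p\<in>G. qball d (fst p) (3 * A0\<^sup>2 * snd p))"
          unfolding Vit_def by auto
        have hit: "qball d (fst q) (snd q) \<subseteq> qball d (fst p) (3 * A0\<^sup>2 * snd p)" if q: "q \<in> F" "q \<notin> F'" for q
        proof
          fix y assume y: "y \<in> qball d (fst q) (snd q)"
          obtain w where w: "w \<in> qball d (fst q) (snd q)" "w \<in> qball d (fst p) (snd p)" using q by (auto simp: F'_def)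
          have "A0 * (d w (fst q) + d (fst q) y) \<le> A0 * (2 * snd p)"
            using y w p(2)[OF q(1)] by (intro mult_left_mono) (auto simp: qball_def d_sym[of w])
          then have "d w y \<le> A0 * (2 * snd p)" using d_triangle[of w y "fst q"] by linarith
          moreover have "1 * snd p \<le> A0 * snd p" using A0_ge_1 pos by (intro mult_right_mono) auto
          ultimately have "d (fst p) w + d w y < 3 * A0 * snd p" using w by (auto simp: qball_def)
          then have "A0 * (d (fst p) w + d w y) < A0 * (3 * A0 * snd p)" by (intro mult_strict_left_mono) auto
          also have "A0 * (3 * A0 * snd p) = 3 * A0\<^sup>2 * snd p" by (simp add: power2_eq_square)
          finally show "y \<in> qball d (fst p) (3 * A0\<^sup>2 * snd p)"
            using d_triangle[of "fst p" y w] unfolding qball_def mem_Collect_eq by linarith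
        qed
        have "(\<Union>q\<in>F. qball d (fst q) (snd q)) \<subseteq> (\<Union>q\<in>insert p G. qball d (fst q) (3 * A0\<^sup>2 * snd q))"
        proof
          fix y assume "y \<in> (\<Union>q\<in>F. qball d (fst q) (snd q))"
          then obtain q where q: "q \<in> F" "y \<in> qball d (fst q) (snd q)" by blast
          show "y \<in> (\<Union>q\<in>insert p G. qball d (fst q) (3 * A0\<^sup>2 * snd q))"
            using G(3) hit[of q] q by (cases "q \<in> F'") blast+
        qed
        moreover have "insert p G \<subseteq> F" using G(1) p(1) by (auto simp: F'_def)
        moreover have "\<forall>p'\<in>insert p G. \<forall>q\<in>insert p G. p' \<noteq> q \<longrightarrow> qball d (fst p') (snd p') \<inter> qball d (fst q) (snd q) = {}"
          using G(1,2) unfolding F'_def by blast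
        ultimately show ?thesis unfolding Vit_def by blast
      qed
    qed (auto simp: Vit_def)
  qed
  then obtain G where "Vit F G" by blast
  then show thesis by (intro that[of G]) (auto simp: Vit_def)
qed

context homogeneous_space
begin

definition avg :: "'a set \<Rightarrow> ('a \<Rightarrow> ennreal) \<Rightarrow> ennreal" where
  "avg B g = (\<integral>\<^sup>+u\<in>B. g u \<partial>M) / emeasure M B"

lemma avg_mono: "(\<And>u. u \<in> B \<Longrightarrow> g u \<le> h u) \<Longrightarrow> avg B g \<le> avg B h"
  unfolding avg_def by (intro divide_right_mono_ennreal nn_integral_mono) (auto split: split_indicator)

lemma avg_ball: "0 < r \<Longrightarrow> avg (qball d x r) g = ennreal (1 / V r x) * (\<integral>\<^sup>+u\<in>qball d x r. g u \<partial>M)"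
  using V_pos[of r x] by (simp add: avg_def emeasure_qball ennreal_divide_real)

lemma avg_ball_Holder:
  assumes "0 < a" "a < 1" and [measurable]: "f \<in> borel_measurable M" "g \<in> borel_measurable M" and r: "0 < r"
  shows "avg (qball d x r) (\<lambda>u. epowr (f u) a * epowr (g u) (1 - a)) \<le>
    epowr (avg (qball d x r) f) a * epowr (avg (qball d x r) g) (1 - a)"
proof -
  define c where "c = ennreal (1 / V r x)"
  define I where "I u = (indicator (qball d x r) u :: ennreal)" for u
  have [measurable]: "I \<in> borel_measurable M" unfolding I_def by measurable
  have "(\<integral>\<^sup>+u. (epowr (f u) a * epowr (g u) (1 - a)) * I u \<partial>M) = (\<integral>\<^sup>+u. epowr (f u * I u) a * epowr (g u * I u) (1 - a) \<partial>M)"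
    by (intro nn_integral_cong) (auto simp: I_def split: split_indicator)
  also have "\<dots> \<le> epowr (\<integral>\<^sup>+u. f u * I u \<partial>M) a * epowr (\<integral>\<^sup>+u. g u * I u \<partial>M) (1 - a)"
    using assms by (intro nn_integral_Holder) auto
  finally have "c * (\<integral>\<^sup>+u. (epowr (f u) a * epowr (g u) (1 - a)) * I u \<partial>M) \<le>
     (epowr c a * epowr c (1 - a)) * (epowr (\<integral>\<^sup>+u. f u * I u \<partial>M) a * epowr (\<integral>\<^sup>+u. g u * I u \<partial>M) (1 - a))"
    by (simp add: mult_left_mono flip: epowr_add)
  also have "\<dots> = epowr (c * (\<integral>\<^sup>+u. f u * I u \<partial>M)) a * epowr (c * (\<integral>\<^sup>+u. g u * I u \<partial>M)) (1 - a)"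
    using assms by (simp add: epowr_mult mult_ac)
  finally show ?thesis using r by (simp add: avg_ball c_def I_def)
qed

lemma avg_ball_Jensen:
  assumes "1 \<le> p" and [measurable]: "f \<in> borel_measurable M" and r: "0 < r"
  shows "epowr (avg (qball d x r) f) p \<le> avg (qball d x r) (\<lambda>u. epowr (f u) p)"
proof -
  define w where "w u = ennreal (1 / V r x) * indicator (qball d x r) u" for u
  have [measurable]: "w \<in> borel_measurable M" unfolding w_def by measurable
  have a: "avg (qball d x r) h = (\<integral>\<^sup>+u. w u * h u \<partial>M)" if [measurable]: "h \<in> borel_measurable M" for h
    using r by (simp add: avg_ball w_def nn_integral_cmult[symmetric] mult_ac)
  have "(\<integral>\<^sup>+u. w u \<partial>M) = 1"
    using V_pos[OF r, of x] by (simp add: w_def nn_integral_cmult emeasure_qball flip: ennreal_mult)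
  then show ?thesis using nn_integral_Jensen[OF assms(1), of f M w] by (simp add: a)
qed

end

section \<open>Averages attached to cubes, and their maximal function\<close>

context dyadic_system
begin

text \<open>C1 lets the ball of a cube contain the ball of radius \<delta>^l about every point of
  that cube. C2 lets \<open>big l \<beta>\<close> contain each cube whose \<open>bl\<close> ball
  meets the cube of \<beta>; the extra summand C1 turns the resulting inequalities into strict ones
  and gives C1 <= C2.\<close>

definition C1 :: real where "C1 = A0 * (1 + 2 * A0 * C0)"
definition C2 :: real where "C2 = C1 + A0 * (2 * A0 * C0 + A0 * (C1 + 2 * A0 * C0))"

definition bl :: "int \<Rightarrow> 'i \<Rightarrow> 'a set" where "bl l \<alpha> = qball d (z l \<alpha>) (C1 * \<delta> powi l)"
definition big :: "int \<Rightarrow> 'i \<Rightarrow> 'a set" where "big l \<alpha> = qball d (z l \<alpha>) (C2 * \<delta> powi l)"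

lemma C1_pos: "0 < C1" using C0_pos by (simp add: C1_def add_pos_pos)
lemma C2_pos: "0 < C2" and C1_le_C2: "C1 \<le> C2"
  using C0_pos C1_pos by (simp_all add: C2_def add_pos_pos)

lemma radius_pos: "0 < C1 * \<delta> powi l" "0 < C2 * \<delta> powi l"
  using C1_pos C2_pos by simp_all

lemma delta_powi_nonneg [simp]: "0 \<le> \<delta> powi k"
  using delta_powi_pos[of k] by linarith

lemma C1_ge: "2 * A0 * C0 \<le> C1"
proof -
  have "1 * (2 * A0 * C0) \<le> A0 * (2 * A0 * C0)" using A0_ge_1 C0_pos by (intro mult_right_mono) auto
  then show ?thesis using A0_pos unfolding C1_def distrib_left by linarith
qed

lemma radius_mono: "2 * A0 * C0 * \<delta> powi l \<le> C2 * \<delta> powi l" "C1 * \<delta> powi l \<le> C2 * \<delta> powi l"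
  using C1_ge C1_le_C2 by (auto intro!: mult_right_mono)

lemma bl_measurable [measurable]: "bl l \<alpha> \<in> sets M" and big_measurable [measurable]: "big l \<alpha> \<in> sets M"
  by (simp_all add: bl_def big_def)

text \<open>The ball depends on x only through its cube, so the average is constant on cubes of
  generation l.\<close>

definition T :: "int \<Rightarrow> ('a \<Rightarrow> ennreal) \<Rightarrow> 'a \<Rightarrow> ennreal" where
  "T l g x = avg (bl l (idx l x)) g"

text \<open>A maximal function over a countable family of balls, hence measurable. The family
  suffices because the averages \<open>T l\<close> and their transposes are compared with these
  balls only.\<close>

definition maxi :: "('a \<Rightarrow> ennreal) \<Rightarrow> 'a \<Rightarrow> ennreal" where
  "maxi g x = (SUP (l, \<alpha>)\<in>Sigma UNIV A. avg (big l \<alpha>) g * indicator (big l \<alpha>) x)"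

lemma T_measurable [measurable]: "T l g \<in> borel_measurable M"
  unfolding T_def[abs_def] by (rule measurable_idx)

lemma maxi_measurable [measurable]: "maxi g \<in> borel_measurable M"
  unfolding maxi_def[abs_def] using countable_A
  by (intro borel_measurable_SUP) (auto intro: countable_SIGMA)

lemma T_mono: "(\<And>u. g u \<le> h u) \<Longrightarrow> T l g x \<le> T l h x"
  unfolding T_def by (intro avg_mono)

lemma cube_dist: "d (z l (idx l x)) x < 2 * A0 * C0 * \<delta> powi l"
  using subsetD[OF cube_outer[OF idx(1)] idx(2)] by (simp add: qball_def)

lemma maxi_ge: "\<alpha> \<in> A l \<Longrightarrow> x \<in> big l \<alpha> \<Longrightarrow> avg (big l \<alpha>) g \<le> maxi g x"
  unfolding maxi_def by (rule SUP_upper2[of "(l, \<alpha>)"]) auto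

definition K1 :: real where "K1 = C\<mu> * (2 * A0 * (C2 / C1)) powr \<omega>"

lemma K1_pos: "0 < K1"
  using C\<mu>_pos C1_pos C2_pos by (simp add: K1_def)

lemma big_le_bl:
  assumes "d (z l \<alpha>) (z l \<beta>) \<le> C2 * \<delta> powi l"
  shows "V (C2 * \<delta> powi l) (z l \<alpha>) \<le> K1 * V (C1 * \<delta> powi l) (z l \<beta>)"
  unfolding K1_def using assms C1_pos C1_le_C2 radius_pos[of l] by (intro V_compare) (auto simp: field_simps)

lemma T_le_maxi: "T l g x \<le> ennreal K1 * maxi g x"
proof -
  define \<alpha> where "\<alpha> = idx l x"
  have x: "x \<in> big l \<alpha>"
    using cube_dist[of l x] radius_mono(1)[of l] unfolding big_def qball_def \<alpha>_def mem_Collect_eq by linarith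
  have v: "V (C2 * \<delta> powi l) (z l \<alpha>) \<le> K1 * V (C1 * \<delta> powi l) (z l \<alpha>)"
    using radius_pos[of l] by (intro big_le_bl) auto
  have sub: "bl l \<alpha> \<subseteq> big l \<alpha>"
    using radius_mono(2)[of l] unfolding bl_def big_def qball_def by (auto intro: less_le_trans)
  have p: "0 < V (C2 * \<delta> powi l) (z l \<alpha>)" "0 < V (C1 * \<delta> powi l) (z l \<alpha>)"
    using radius_pos by (auto intro: V_pos)
  have "T l g x = ennreal (1 / V (C1 * \<delta> powi l) (z l \<alpha>)) * (\<integral>\<^sup>+u\<in>bl l \<alpha>. g u \<partial>M)"
    unfolding T_def \<alpha>_def[symmetric] bl_def using radius_pos by (simp add: avg_ball)
  also have "\<dots> \<le> ennreal (K1 * (1 / V (C2 * \<delta> powi l) (z l \<alpha>))) * (\<integral>\<^sup>+u\<in>big l \<alpha>. g u \<partial>M)"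
    using p v sub by (intro mult_mono ennreal_leI nn_integral_mono) (auto simp: field_simps split: split_indicator)
  also have "\<dots> = ennreal K1 * avg (big l \<alpha>) g"
    using radius_pos K1_pos p by (subst ennreal_mult) (auto simp: avg_ball big_def mult.assoc)
  also have "\<dots> \<le> ennreal K1 * maxi g x"
    using x idx(1) unfolding \<alpha>_def by (intro mult_left_mono maxi_ge) auto
  finally show ?thesis .
qed

text \<open>Tonelli moves the average onto h. At u the transposed kernel sums integrals of h over
  the cubes whose \<open>bl\<close> ball contains u. These cubes are disjoint and lie in the single
  ball \<open>big l \<beta>\<close> of the cube of u, whose volume is comparable to theirs, so the
  sum is an average seen by \<open>maxi\<close>.\<close>

lemma T_duality:
  assumes [measurable]: "g \<in> borel_measurable M" "h \<in> borel_measurable M"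
  shows "(\<integral>\<^sup>+x. T l g x * h x \<partial>M) \<le> ennreal K1 * (\<integral>\<^sup>+u. g u * maxi h u \<partial>M)"
proof -
  define c where "c \<alpha> = ennreal (1 / V (C1 * \<delta> powi l) (z l \<alpha>))" for \<alpha>
  have avg: "avg (bl l \<alpha>) f = c \<alpha> * (\<integral>\<^sup>+u\<in>bl l \<alpha>. f u \<partial>M)" for f \<alpha>
    using radius_pos by (simp add: avg_ball bl_def c_def)
  have "(\<integral>\<^sup>+x. T l g x * h x \<partial>M) = (\<integral>\<^sup>+x. (\<integral>\<^sup>+\<alpha>. avg (bl l \<alpha>) g * indicator (cube l \<alpha>) x * h x \<partial>count_space (A l)) \<partial>M)"
    by (simp add: nn_integral_multc nn_integral_idx T_def)
  also have "\<dots> = (\<integral>\<^sup>+\<alpha>. (\<integral>\<^sup>+x. avg (bl l \<alpha>) g * indicator (cube l \<alpha>) x * h x \<partial>M) \<partial>count_space (A l))"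
    using countable_A by (intro nn_integral_count_space_nn_integral) auto
  also have "\<dots> = (\<integral>\<^sup>+\<alpha>. (\<integral>\<^sup>+u. g u * (c \<alpha> * (\<integral>\<^sup>+x\<in>cube l \<alpha>. h x \<partial>M) * indicator (bl l \<alpha>) u) \<partial>M) \<partial>count_space (A l))"
  proof (rule nn_integral_cong)
    fix \<alpha> assume "\<alpha> \<in> space (count_space (A l))"
    then have [measurable]: "cube l \<alpha> \<in> sets M" by simp
    have "(\<integral>\<^sup>+x. avg (bl l \<alpha>) g * indicator (cube l \<alpha>) x * h x \<partial>M) = avg (bl l \<alpha>) g * (\<integral>\<^sup>+x\<in>cube l \<alpha>. h x \<partial>M)"
      by (simp add: mult.assoc nn_integral_cmult mult.commute[of "indicator _ _" "h _"])
    also have "\<dots> = (\<integral>\<^sup>+u. (c \<alpha> * (\<integral>\<^sup>+x\<in>cube l \<alpha>. h x \<partial>M)) * (g u * indicator (bl l \<alpha>) u) \<partial>M)"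
      by (subst nn_integral_cmult) (auto simp: avg mult_ac)
    also have "\<dots> = (\<integral>\<^sup>+u. g u * (c \<alpha> * (\<integral>\<^sup>+x\<in>cube l \<alpha>. h x \<partial>M) * indicator (bl l \<alpha>) u) \<partial>M)"
      by (intro nn_integral_cong) (simp add: mult_ac)
    finally show "(\<integral>\<^sup>+x. avg (bl l \<alpha>) g * indicator (cube l \<alpha>) x * h x \<partial>M) =
      (\<integral>\<^sup>+u. g u * (c \<alpha> * (\<integral>\<^sup>+x\<in>cube l \<alpha>. h x \<partial>M) * indicator (bl l \<alpha>) u) \<partial>M)" .
  qed
  also have "\<dots> = (\<integral>\<^sup>+u. (\<integral>\<^sup>+\<alpha>. g u * (c \<alpha> * (\<integral>\<^sup>+x\<in>cube l \<alpha>. h x \<partial>M) * indicator (bl l \<alpha>) u) \<partial>count_space (A l)) \<partial>M)"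
    using countable_A by (intro nn_integral_count_space_nn_integral[symmetric]) auto
  also have "\<dots> = (\<integral>\<^sup>+u. g u * (\<integral>\<^sup>+\<alpha>. c \<alpha> * (\<integral>\<^sup>+x\<in>cube l \<alpha>. h x \<partial>M) * indicator (bl l \<alpha>) u \<partial>count_space (A l)) \<partial>M)"
    by (simp add: nn_integral_cmult)
  also have "\<dots> \<le> (\<integral>\<^sup>+u. g u * (ennreal K1 * maxi h u) \<partial>M)"
  proof (intro nn_integral_mono mult_left_mono)
    fix u
    define \<beta> where "\<beta> = idx l u"
    define v where "v = ennreal (K1 / V (C2 * \<delta> powi l) (z l \<beta>))"
    have u\<beta>: "d (z l \<beta>) u < 2 * A0 * C0 * \<delta> powi l" using cube_dist by (simp add: \<beta>_def)
    have 1: "cube l \<alpha> \<subseteq> big l \<beta> \<and> c \<alpha> \<le> v" if \<alpha>: "\<alpha> \<in> A l" "u \<in> bl l \<alpha>" for \<alpha>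
    proof
      have u: "d (z l \<alpha>) u < C1 * \<delta> powi l" using \<alpha> by (simp add: bl_def qball_def)
      have C2eq: "C2 * \<delta> powi l = C1 * \<delta> powi l + A0 * (2 * A0 * C0 * \<delta> powi l + A0 * (C1 * \<delta> powi l + 2 * A0 * C0 * \<delta> powi l))"
        by (simp add: C2_def algebra_simps)
      show "cube l \<alpha> \<subseteq> big l \<beta>"
      proof
        fix x assume "x \<in> cube l \<alpha>"
        then have x: "d (z l \<alpha>) x < 2 * A0 * C0 * \<delta> powi l" using cube_outer[OF \<alpha>(1)] by (auto simp: qball_def)
        have "A0 * (d u (z l \<alpha>) + d (z l \<alpha>) x) \<le> A0 * (C1 * \<delta> powi l + 2 * A0 * C0 * \<delta> powi l)"
          using u x by (intro mult_left_mono) (auto simp: d_sym[of u])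
        then have "d u x \<le> A0 * (C1 * \<delta> powi l + 2 * A0 * C0 * \<delta> powi l)"
          using d_triangle[of u x "z l \<alpha>"] by linarith
        then have "A0 * (d (z l \<beta>) u + d u x) \<le> A0 * (2 * A0 * C0 * \<delta> powi l + A0 * (C1 * \<delta> powi l + 2 * A0 * C0 * \<delta> powi l))"
          using u\<beta> by (intro mult_left_mono) auto
        then show "x \<in> big l \<beta>"
          using d_triangle[of "z l \<beta>" x u] radius_pos(1)[of l] C2eq unfolding big_def qball_def mem_Collect_eq by linarith
      qed
      have "1 * (C1 * \<delta> powi l) \<le> A0 * (C1 * \<delta> powi l)" using A0_ge_1 radius_pos(1)[of l] by (intro mult_right_mono) auto
      moreover have "0 \<le> A0 * (2 * A0 * C0 * \<delta> powi l)" using C0_pos by simp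
      ultimately have "d (z l \<beta>) u + d u (z l \<alpha>) \<le> 2 * A0 * C0 * \<delta> powi l + A0 * (C1 * \<delta> powi l + 2 * A0 * C0 * \<delta> powi l)"
        using u u\<beta> by (simp add: d_sym[of u] distrib_left)
      then have "A0 * (d (z l \<beta>) u + d u (z l \<alpha>)) \<le> A0 * (2 * A0 * C0 * \<delta> powi l + A0 * (C1 * \<delta> powi l + 2 * A0 * C0 * \<delta> powi l))"
        by (intro mult_left_mono) auto
      then have "d (z l \<beta>) (z l \<alpha>) \<le> C2 * \<delta> powi l"
        using d_triangle[of "z l \<beta>" "z l \<alpha>" u] radius_pos(1)[of l] C2eq by linarith
      then have "V (C2 * \<delta> powi l) (z l \<beta>) \<le> K1 * V (C1 * \<delta> powi l) (z l \<alpha>)" by (rule big_le_bl)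
      then show "c \<alpha> \<le> v" unfolding c_def v_def
        using V_pos[OF radius_pos(1)[of l], of "z l \<alpha>"] V_pos[OF radius_pos(2)[of l], of "z l \<beta>"]
        by (intro ennreal_leI) (simp add: field_simps)
    qed
    have "(\<integral>\<^sup>+\<alpha>. c \<alpha> * (\<integral>\<^sup>+x\<in>cube l \<alpha>. h x \<partial>M) * indicator (bl l \<alpha>) u \<partial>count_space (A l)) \<le>
        (\<integral>\<^sup>+\<alpha>. v * (\<integral>\<^sup>+x. h x * indicator (big l \<beta>) x * indicator (cube l \<alpha>) x \<partial>M) \<partial>count_space (A l))"
    proof (rule nn_integral_mono)
      fix \<alpha> assume "\<alpha> \<in> space (count_space (A l))"
      then have \<alpha>: "\<alpha> \<in> A l" by simp
      show "c \<alpha> * (\<integral>\<^sup>+x\<in>cube l \<alpha>. h x \<partial>M) * indicator (bl l \<alpha>) u \<le> v * (\<integral>\<^sup>+x. h x * indicator (big l \<beta>) x * indicator (cube l \<alpha>) x \<partial>M)"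
      proof (cases "u \<in> bl l \<alpha>")
        case True
        have "h x * indicator (cube l \<alpha>) x = h x * indicator (big l \<beta>) x * indicator (cube l \<alpha>) x" for x
          using 1[OF \<alpha> True] by (cases "x \<in> cube l \<alpha>") auto
        then show ?thesis using 1[OF \<alpha> True] True by (simp add: mult_right_mono)
      qed simp
    qed
    also have "\<dots> = v * (\<integral>\<^sup>+x. (\<integral>\<^sup>+\<alpha>. h x * indicator (big l \<beta>) x * indicator (cube l \<alpha>) x \<partial>count_space (A l)) \<partial>M)"
      using countable_A by (subst nn_integral_count_space_nn_integral) (auto simp: nn_integral_cmult)
    also have "\<dots> = v * (\<integral>\<^sup>+x\<in>big l \<beta>. h x \<partial>M)" by (simp add: nn_integral_idx)
    also have "\<dots> = ennreal K1 * avg (big l \<beta>) h"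
      using radius_pos K1_pos by (simp add: avg_ball big_def v_def ennreal_mult'[symmetric] mult.assoc[symmetric])
    also have "\<dots> \<le> ennreal K1 * maxi h u"
    proof (intro mult_left_mono maxi_ge)
      show "\<beta> \<in> A l" using idx(1) by (simp add: \<beta>_def)
      show "u \<in> big l \<beta>"
        using u\<beta> radius_mono(1)[of l] unfolding big_def qball_def mem_Collect_eq by linarith
    qed simp
    finally show "(\<integral>\<^sup>+\<alpha>. c \<alpha> * (\<integral>\<^sup>+x\<in>cube l \<alpha>. h x \<partial>M) * indicator (bl l \<alpha>) u \<partial>count_space (A l)) \<le> ennreal K1 * maxi h u" .
  qed simp
  also have "\<dots> = (\<integral>\<^sup>+u. ennreal K1 * (g u * maxi h u) \<partial>M)"
    by (intro nn_integral_cong) (simp add: mult_ac)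
  also have "\<dots> = ennreal K1 * (\<integral>\<^sup>+u. g u * maxi h u \<partial>M)" by (simp add: nn_integral_cmult)
  finally show ?thesis .
qed

text \<open>The superlevel set is a countable union of balls with average above lam. For finite
  subfamilies Vitali selects disjoint balls whose enlargements cover, and the measure of each is
  bounded by the integral of g over it; continuity from below gives the full union.\<close>

lemma maxi_weak_type:
  obtains K where "0 < K" "\<And>g (lam::real). 0 < lam \<Longrightarrow> g \<in> borel_measurable M \<Longrightarrow>
    ennreal lam * emeasure M {x\<in>space M. ennreal lam < maxi g x} \<le> ennreal K * (\<integral>\<^sup>+x. g x \<partial>M)"
proof -
  define K where "K = C\<mu> * (3 * A0\<^sup>2) powr \<omega>"
  have A: "1 * 1 \<le> A0 * A0" using A0_ge_1 by (intro mult_mono) auto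
  have K: "0 < K" using C\<mu>_pos by (simp add: K_def)
  have "ennreal lam * emeasure M {x\<in>space M. ennreal lam < maxi g x} \<le> ennreal K * (\<integral>\<^sup>+x. g x \<partial>M)"
    if l: "0 < lam" and [measurable]: "g \<in> borel_measurable M" for g and lam :: real
  proof -
    define I where "I = {(l, \<alpha>). \<alpha> \<in> A l \<and> ennreal lam < avg (big l \<alpha>) g}"
    have cI: "countable I"
      using countable_A by (intro countable_subset[of I "Sigma UNIV A"] countable_SIGMA) (auto simp: I_def)
    have U: "{x\<in>space M. ennreal lam < maxi g x} = (\<Union>(l, \<alpha>)\<in>I. big l \<alpha>)"
      by (auto simp: maxi_def less_SUP_iff I_def split: split_indicator_asm split_indicator)
    have "emeasure M (\<Union>p\<in>I. big (fst p) (snd p)) \<le> ennreal K * (\<integral>\<^sup>+x. g x \<partial>M) / ennreal lam"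
    proof (rule emeasure_countable_UN_le[OF cI])
      fix F assume F: "finite F" "F \<subseteq> I"
      define b where "b p = (z (fst p) (snd p), C2 * \<delta> powi fst p)" for p :: "int \<times> 'i"
      have bp: "qball d (fst (b p)) (snd (b p)) = big (fst p) (snd p)" for p by (simp add: b_def big_def)
      have fb: "finite (b ` F)" using F by simp
      obtain G where G: "G \<subseteq> b ` F"
        "\<And>p q. p \<in> G \<Longrightarrow> q \<in> G \<Longrightarrow> p \<noteq> q \<Longrightarrow> qball d (fst p) (snd p) \<inter> qball d (fst q) (snd q) = {}"
        "(\<Union>p\<in>b ` F. qball d (fst p) (snd p)) \<subseteq> (\<Union>p\<in>G. qball d (fst p) (3 * A0\<^sup>2 * snd p))"
        using finite_Vitali[OF fb] by blast
      have fG: "finite G" using G(1) fb by (rule finite_subset)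
      have one: "ennreal lam * emeasure M (qball d (fst q) (3 * A0\<^sup>2 * snd q)) \<le>
          ennreal K * (\<integral>\<^sup>+x\<in>qball d (fst q) (snd q). g x \<partial>M)" if q: "q \<in> G" for q
      proof -
        obtain p where p: "p \<in> I" "q = b p" using subsetD[OF G(1) q] F by auto
        have r: "0 < snd q" using radius_pos by (simp add: p b_def)
        have v: "V (3 * A0\<^sup>2 * snd q) (fst q) \<le> K * V (snd q) (fst q)"
          unfolding K_def using r A by (intro V_scale) (auto simp: power2_eq_square)
        have vp: "0 < V (snd q) (fst q)" using r by (rule V_pos)
        have "ennreal lam \<le> avg (qball d (fst q) (snd q)) g" using p by (auto simp: I_def p(2) bp split: prod.splits)
        then have "ennreal lam * ennreal (V (snd q) (fst q)) \<le> (ennreal (1 / V (snd q) (fst q)) * (\<integral>\<^sup>+u\<in>qball d (fst q) (snd q). g u \<partial>M)) * ennreal (V (snd q) (fst q))"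
          unfolding avg_ball[OF r] by (rule mult_right_mono) simp
        also have "\<dots> = (ennreal (1 / V (snd q) (fst q)) * ennreal (V (snd q) (fst q))) * (\<integral>\<^sup>+u\<in>qball d (fst q) (snd q). g u \<partial>M)"
          by (simp only: mult_ac)
        also have "ennreal (1 / V (snd q) (fst q)) * ennreal (V (snd q) (fst q)) = 1"
          using vp by (simp flip: ennreal_mult)
        finally have m: "ennreal lam * ennreal (V (snd q) (fst q)) \<le> (\<integral>\<^sup>+u\<in>qball d (fst q) (snd q). g u \<partial>M)" by simp
        have "ennreal lam * emeasure M (qball d (fst q) (3 * A0\<^sup>2 * snd q)) \<le> ennreal lam * ennreal (K * V (snd q) (fst q))"
          unfolding emeasure_qball using v by (intro mult_left_mono ennreal_leI) auto
        also have "\<dots> = ennreal K * (ennreal lam * ennreal (V (snd q) (fst q)))"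
          using K by (simp add: ennreal_mult mult_ac)
        also have "\<dots> \<le> ennreal K * (\<integral>\<^sup>+u\<in>qball d (fst q) (snd q). g u \<partial>M)" using m by (rule mult_left_mono) simp
        finally show ?thesis .
      qed
      have "emeasure M (\<Union>p\<in>F. big (fst p) (snd p)) \<le> emeasure M (\<Union>p\<in>G. qball d (fst p) (3 * A0\<^sup>2 * snd p))"
        using G(3) fG by (intro emeasure_mono sets.finite_UN) (auto simp: bp)
      also have "\<dots> \<le> (\<Sum>p\<in>G. emeasure M (qball d (fst p) (3 * A0\<^sup>2 * snd p)))"
        using fG by (intro emeasure_subadditive_finite) auto
      finally have "ennreal lam * emeasure M (\<Union>p\<in>F. big (fst p) (snd p)) \<le>
          (\<Sum>p\<in>G. ennreal lam * emeasure M (qball d (fst p) (3 * A0\<^sup>2 * snd p)))"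
        by (simp add: mult_left_mono flip: sum_distrib_left)
      also have "\<dots> \<le> (\<Sum>p\<in>G. ennreal K * (\<integral>\<^sup>+x\<in>qball d (fst p) (snd p). g x \<partial>M))"
        by (intro sum_mono one)
      also have "\<dots> = ennreal K * (\<integral>\<^sup>+x. (\<Sum>p\<in>G. g x * indicator (qball d (fst p) (snd p)) x) \<partial>M)"
        by (simp add: nn_integral_sum sum_distrib_left)
      also have "\<dots> \<le> ennreal K * (\<integral>\<^sup>+x. g x \<partial>M)"
      proof (intro mult_left_mono nn_integral_mono)
        fix x
        have "disjoint_family_on (\<lambda>p. qball d (fst p) (snd p)) G"
          using G(2) by (auto simp: disjoint_family_on_def)
        then have "(\<Sum>p\<in>G. indicator (qball d (fst p) (snd p)) x) = (indicator (\<Union>p\<in>G. qball d (fst p) (snd p)) x :: ennreal)"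
          by (intro indicator_UN_disjoint[symmetric] fG)
        then have "(\<Sum>p\<in>G. g x * indicator (qball d (fst p) (snd p)) x) = g x * indicator (\<Union>p\<in>G. qball d (fst p) (snd p)) x"
          by (simp flip: sum_distrib_left)
        then show "(\<Sum>p\<in>G. g x * indicator (qball d (fst p) (snd p)) x) \<le> g x" by (simp split: split_indicator)
      qed simp
      finally have "ennreal (1 / lam) * (ennreal lam * emeasure M (\<Union>p\<in>F. big (fst p) (snd p))) \<le>
          ennreal (1 / lam) * (ennreal K * (\<integral>\<^sup>+x. g x \<partial>M))"
        by (rule mult_left_mono) simp
      then show "emeasure M (\<Union>p\<in>F. big (fst p) (snd p)) \<le> ennreal K * (\<integral>\<^sup>+x. g x \<partial>M) / ennreal lam"
        using l by (simp add: ennreal_divide_real mult.assoc[symmetric] flip: ennreal_mult)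
    qed simp
    then have "ennreal lam * emeasure M (\<Union>p\<in>I. big (fst p) (snd p)) \<le> ennreal lam * (ennreal K * (\<integral>\<^sup>+x. g x \<partial>M) / ennreal lam)"
      by (rule mult_left_mono) simp
    also have "\<dots> = ennreal K * (\<integral>\<^sup>+x. g x \<partial>M)"
      using l by (simp add: ennreal_divide_real mult.assoc[symmetric] flip: ennreal_mult)
    finally show ?thesis unfolding U by (simp add: case_prod_unfold)
  qed
  then show thesis using that K by blast
qed

text \<open>g is at most its part above c plus the constant c, and the average of c is c. This
  brings in the truncation that \<open>strong_type_of_weak_type\<close> asks for.\<close>

lemma maxi_le_split:
  assumes "g \<in> borel_measurable M"
  shows "maxi g x \<le> maxi (\<lambda>u. g u * indicator {u. c < g u} u) x + c"
  unfolding maxi_def[of g]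
proof (rule SUP_least, clarify)
  fix l \<alpha> assume \<alpha>: "\<alpha> \<in> A l"
  note [measurable] = assms
  show "avg (big l \<alpha>) g * indicator (big l \<alpha>) x \<le> maxi (\<lambda>u. g u * indicator {u. c < g u} u) x + c"
  proof (cases "x \<in> big l \<alpha>")
    case True
    have vp: "0 < V (C2 * \<delta> powi l) (z l \<alpha>)" using radius_pos by (auto intro: V_pos)
    have "(\<integral>\<^sup>+u\<in>big l \<alpha>. g u \<partial>M) \<le> (\<integral>\<^sup>+u. (g u * indicator {u. c < g u} u) * indicator (big l \<alpha>) u + c * indicator (big l \<alpha>) u \<partial>M)"
      by (intro nn_integral_mono) (auto split: split_indicator)
    also have "\<dots> = (\<integral>\<^sup>+u\<in>big l \<alpha>. g u * indicator {u. c < g u} u \<partial>M) + c * emeasure M (big l \<alpha>)"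
      by (subst nn_integral_add) (auto simp: nn_integral_cmult)
    finally have "avg (big l \<alpha>) g \<le> avg (big l \<alpha>) (\<lambda>u. g u * indicator {u. c < g u} u) + c * emeasure M (big l \<alpha>) / emeasure M (big l \<alpha>)"
      unfolding avg_def by (subst add_divide_distrib_ennreal[symmetric]) (rule divide_right_mono_ennreal)
    also have "c * emeasure M (big l \<alpha>) / emeasure M (big l \<alpha>) = c"
      using vp by (simp add: big_def emeasure_qball ennreal_divide_real mult.left_commute flip: ennreal_mult)
    also have "avg (big l \<alpha>) (\<lambda>u. g u * indicator {u. c < g u} u) \<le> maxi (\<lambda>u. g u * indicator {u. c < g u} u) x"
      using \<alpha> True by (rule maxi_ge)
    finally show ?thesis using True by (simp add: add_right_mono)
  qed simp
qed

theorem maxi_strong_type: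
  assumes "1 < P"
  obtains C where "0 < C" "\<And>g. g \<in> borel_measurable M \<Longrightarrow>
    (\<integral>\<^sup>+x. epowr (maxi g x) P \<partial>M) \<le> ennreal C * (\<integral>\<^sup>+x. epowr (g x) P \<partial>M)"
proof -
  obtain K where K: "0 < K" "\<And>g (lam::real). 0 < lam \<Longrightarrow> g \<in> borel_measurable M \<Longrightarrow>
    ennreal lam * emeasure M {x\<in>space M. ennreal lam < maxi g x} \<le> ennreal K * (\<integral>\<^sup>+x. g x \<partial>M)"
    using maxi_weak_type by blast
  \<comment> \<open>Where \<open>maxi g\<close> exceeds lam, the maximal function of the part of g
    above lam/2 exceeds lam/2; the weak type bound at that level doubles the constant.\<close>
  have "0 < 2 * K" using K by simp
  then obtain C where C: "0 < C" "\<And>(N :: 'a measure) m g. \<lbrakk>m \<in> borel_measurable N; g \<in> borel_measurable N;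
      \<And>lam::real. 0 < lam \<Longrightarrow> ennreal lam * emeasure N {x\<in>space N. ennreal lam < m x} \<le>
         ennreal (2 * K) * (\<integral>\<^sup>+x. g x * indicator {x. ennreal (lam / 2) < g x} x \<partial>N)\<rbrakk>
    \<Longrightarrow> (\<integral>\<^sup>+x. epowr (m x) P \<partial>N) \<le> ennreal C * (\<integral>\<^sup>+x. epowr (g x) P \<partial>N)"
    by (rule strong_type_of_weak_type[OF assms]) (erule that, blast)
  have "(\<integral>\<^sup>+x. epowr (maxi g x) P \<partial>M) \<le> ennreal C * (\<integral>\<^sup>+x. epowr (g x) P \<partial>M)"
    if [measurable]: "g \<in> borel_measurable M" for g
  proof (rule C(2))
    fix lam :: real assume l: "0 < lam"
    define h where "h u = g u * indicator {u. ennreal (lam / 2) < g u} u" for u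
    have [measurable]: "h \<in> borel_measurable M" unfolding h_def by measurable
    have sub: "{x\<in>space M. ennreal lam < maxi g x} \<subseteq> {x\<in>space M. ennreal (lam / 2) < maxi h x}"
    proof clarsimp
      fix x assume "ennreal lam < maxi g x"
      also have "maxi g x \<le> maxi h x + ennreal (lam / 2)" unfolding h_def by (rule maxi_le_split) simp
      finally have "ennreal (lam / 2) + ennreal (lam / 2) < maxi h x + ennreal (lam / 2)"
        using l by (simp flip: ennreal_plus)
      then show "ennreal (lam / 2) < maxi h x" by (meson add_right_mono not_less)
    qed
    have "ennreal lam * emeasure M {x\<in>space M. ennreal lam < maxi g x} \<le> ennreal (2 * (lam / 2)) * emeasure M {x\<in>space M. ennreal (lam / 2) < maxi h x}"
    proof -
      have "{x\<in>space M. ennreal (lam / 2) < maxi h x} \<in> sets M" by measurable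
      from emeasure_mono[OF sub this] show ?thesis by (intro mult_mono) auto
    qed
    also have "\<dots> = 2 * (ennreal (lam / 2) * emeasure M {x\<in>space M. ennreal (lam / 2) < maxi h x})"
      using l by (subst ennreal_mult) (auto simp: mult.assoc)
    also have "\<dots> \<le> 2 * (ennreal K * (\<integral>\<^sup>+x. h x \<partial>M))"
      using l by (intro mult_left_mono K) auto
    also have "\<dots> = ennreal (2 * K) * (\<integral>\<^sup>+x. h x \<partial>M)"
      using K by (subst ennreal_mult) (auto simp: mult.assoc)
    finally show "ennreal lam * emeasure M {x\<in>space M. ennreal lam < maxi g x} \<le>
       ennreal (2 * K) * (\<integral>\<^sup>+x. g x * indicator {x. ennreal (lam / 2) < g x} x \<partial>M)" by (simp add: h_def)
  qed auto
  then show thesis using that C by blast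
qed

lemma T_strong_type:
  assumes "1 < P"
  obtains C where "0 < C" "\<And>g l. g \<in> borel_measurable M \<Longrightarrow>
    (\<integral>\<^sup>+x. epowr (T l g x) P \<partial>M) \<le> ennreal C * (\<integral>\<^sup>+x. epowr (g x) P \<partial>M)"
proof -
  obtain C where C: "0 < C" "\<And>g. g \<in> borel_measurable M \<Longrightarrow>
    (\<integral>\<^sup>+x. epowr (maxi g x) P \<partial>M) \<le> ennreal C * (\<integral>\<^sup>+x. epowr (g x) P \<partial>M)"
    using maxi_strong_type[OF assms] by blast
  have "(\<integral>\<^sup>+x. epowr (T l g x) P \<partial>M) \<le> ennreal (K1 powr P * C) * (\<integral>\<^sup>+x. epowr (g x) P \<partial>M)"
    if [measurable]: "g \<in> borel_measurable M" for g l
  proof -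
    have "(\<integral>\<^sup>+x. epowr (T l g x) P \<partial>M) \<le> (\<integral>\<^sup>+x. ennreal (K1 powr P) * epowr (maxi g x) P \<partial>M)"
      using assms K1_pos epowr_mono[OF T_le_maxi, of P]
      by (intro nn_integral_mono) (simp add: epowr_mult epowr_ennreal)
    also have "\<dots> \<le> ennreal (K1 powr P) * (ennreal C * (\<integral>\<^sup>+x. epowr (g x) P \<partial>M))"
      using C(2)[OF that] by (simp add: nn_integral_cmult mult_left_mono)
    finally show ?thesis using C(1) by (simp add: ennreal_mult mult.assoc)
  qed
  then show thesis using that[of "K1 powr P * C"] C(1) K1_pos by simp
qed

end

section \<open>Vector-valued inequalities\<close>

definition geo :: "real \<Rightarrow> nat \<Rightarrow> nat \<Rightarrow> ennreal" where
  "geo \<theta> k j = ennreal (\<theta> powr \<bar>real j - real k\<bar>)"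

lemma geo_sym: "geo \<theta> k j = geo \<theta> j k"
  by (simp add: geo_def abs_minus_commute)

lemma epowr_geo: "epowr (geo \<theta> k j) r = geo (\<theta> powr r) k j"
  by (simp add: geo_def epowr_ennreal powr_powr mult.commute)

text \<open>Each distance i = |j - k| is attained by at most two indices j, so the sum is at most
  twice a geometric series.\<close>

lemma nn_integral_geo:
  assumes "0 < \<theta>" "\<theta> < 1"
  shows "(\<integral>\<^sup>+j. geo \<theta> k j \<partial>count_space UNIV) \<le> ennreal (2 / (1 - \<theta>))"
proof -
  define a where "a i = (ennreal (\<theta> ^ i))" for i :: nat
  have sum_a: "(\<integral>\<^sup>+i. a i \<partial>count_space UNIV) = ennreal (1 / (1 - \<theta>))"
    unfolding a_def nn_integral_count_space_nat
    using assms by (subst suminf_ennreal2) (auto simp: summable_geometric suminf_geometric)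
  have "(\<integral>\<^sup>+j. geo \<theta> k j \<partial>count_space UNIV) \<le>
      (\<integral>\<^sup>+j. (\<integral>\<^sup>+i. a i * (indicator {k + i} j + indicator {j. j + i = k} j) \<partial>count_space UNIV) \<partial>count_space UNIV)"
  proof (rule nn_integral_mono)
    fix j
    define i where "i = nat \<bar>int j - int k\<bar>"
    have i: "real i = \<bar>real j - real k\<bar>" "j = k + i \<or> j + i = k" by (auto simp: i_def)
    have "geo \<theta> k j = a i" unfolding geo_def a_def i(1)[symmetric] using assms by (simp add: powr_realpow)
    also have "\<dots> \<le> a i * (indicator {k + i} j + indicator {j. j + i = k} j)"
    proof -
      have "(1::ennreal) \<le> indicator {k + i} j + indicator {j. j + i = k} j"
        using i(2) by (auto simp: indicator_def)
      then have "a i * 1 \<le> a i * (indicator {k + i} j + indicator {j. j + i = k} j)" by (rule mult_left_mono) simp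
      then show ?thesis by simp
    qed
    also have "\<dots> \<le> (\<integral>\<^sup>+i. a i * (indicator {k + i} j + indicator {j. j + i = k} j) \<partial>count_space UNIV)"
      by (rule nn_integral_ge_point) simp
    finally show "geo \<theta> k j \<le> (\<integral>\<^sup>+i. a i * (indicator {k + i} j + indicator {j. j + i = k} j) \<partial>count_space UNIV)" .
  qed
  also have "\<dots> = (\<integral>\<^sup>+i. (\<integral>\<^sup>+j. a i * (indicator {k + i} j + indicator {j. j + i = k} j) \<partial>count_space UNIV) \<partial>count_space UNIV)"
    by (rule nn_integral_count_space_nn_integral) auto
  also have "\<dots> \<le> (\<integral>\<^sup>+i. a i * 2 \<partial>count_space UNIV)"
  proof (rule nn_integral_mono)
    fix i
    have "(\<integral>\<^sup>+j. indicator {j. j + i = k} j \<partial>count_space UNIV) \<le> (\<integral>\<^sup>+j. indicator {k - i} j \<partial>count_space UNIV)"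
      by (intro nn_integral_mono) (auto split: split_indicator)
    then have "(\<integral>\<^sup>+j. indicator {k + i} j + indicator {j. j + i = k} j \<partial>count_space UNIV) \<le> 1 + (1::ennreal)"
      by (subst nn_integral_add) (auto intro!: add_left_mono simp del: one_add_one)
    then show "(\<integral>\<^sup>+j. a i * (indicator {k + i} j + indicator {j. j + i = k} j) \<partial>count_space UNIV) \<le> a i * 2"
      by (simp add: nn_integral_cmult mult_left_mono)
  qed
  also have "\<dots> = ennreal (2 / (1 - \<theta>))"
    using assms by (subst nn_integral_multc) (auto simp: sum_a simp flip: ennreal_numeral ennreal_mult)
  finally show ?thesis .
qed

lemma geo_Schur_sum:
  assumes "0 < \<theta>" "\<theta> < 1"
  shows "(\<integral>\<^sup>+k. (\<integral>\<^sup>+j. geo \<theta> k j * b j \<partial>count_space UNIV) \<partial>count_space UNIV) \<le> ennreal (2 / (1 - \<theta>)) * (\<integral>\<^sup>+j. b j \<partial>count_space UNIV)"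
proof -
  have "(\<integral>\<^sup>+k. (\<integral>\<^sup>+j. geo \<theta> k j * b j \<partial>count_space UNIV) \<partial>count_space UNIV) =
      (\<integral>\<^sup>+j. (\<integral>\<^sup>+k. geo \<theta> k j * b j \<partial>count_space UNIV) \<partial>count_space UNIV)"
    by (rule nn_integral_count_space_nn_integral) auto
  also have "\<dots> = (\<integral>\<^sup>+j. (\<integral>\<^sup>+k. geo \<theta> j k \<partial>count_space UNIV) * b j \<partial>count_space UNIV)"
    by (simp add: nn_integral_multc geo_sym[of \<theta> _ j for j])
  also have "\<dots> \<le> (\<integral>\<^sup>+j. ennreal (2 / (1 - \<theta>)) * b j \<partial>count_space UNIV)"
    by (intro nn_integral_mono mult_right_mono nn_integral_geo assms) auto
  also have "\<dots> = ennreal (2 / (1 - \<theta>)) * (\<integral>\<^sup>+j. b j \<partial>count_space UNIV)" by (simp add: nn_integral_cmult)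
  finally show ?thesis .
qed

text \<open>For \<sigma> <= 1 the power goes inside the sum and the kernel becomes that of
  \<theta>^\<sigma>. For \<sigma> > 1 Jensen's inequality with the finite mass of the kernel does
  the same. Both end in the exchange of sums of \<open>geo_Schur_sum\<close>.\<close>

lemma geo_Schur:
  assumes "0 < \<theta>" "\<theta> < 1" "0 < \<sigma>"
  obtains C where "0 < C" "\<And>b. (\<integral>\<^sup>+k. epowr (\<integral>\<^sup>+j. geo \<theta> k j * b j \<partial>count_space UNIV) \<sigma> \<partial>count_space UNIV)
    \<le> ennreal C * (\<integral>\<^sup>+j. epowr (b j) \<sigma> \<partial>count_space UNIV)"
proof (cases "\<sigma> \<le> 1")
  case True
  have t: "0 < \<theta> powr \<sigma>" "\<theta> powr \<sigma> < 1" using assms powr_less_mono2[of \<sigma> \<theta> 1] by auto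
  show thesis
  proof (rule that[of "2 / (1 - \<theta> powr \<sigma>)"])
    show "0 < 2 / (1 - \<theta> powr \<sigma>)" using t by simp
    fix b :: "nat \<Rightarrow> ennreal"
    have "(\<integral>\<^sup>+k. epowr (\<integral>\<^sup>+j. geo \<theta> k j * b j \<partial>count_space UNIV) \<sigma> \<partial>count_space UNIV) \<le>
      (\<integral>\<^sup>+k. (\<integral>\<^sup>+j. geo (\<theta> powr \<sigma>) k j * epowr (b j) \<sigma> \<partial>count_space UNIV) \<partial>count_space UNIV)"
      using assms
      by (intro nn_integral_mono order_trans[OF epowr_nn_integral_count_le[OF assms(3) True]])
        (simp add: epowr_mult epowr_geo[symmetric])
    also have "\<dots> \<le> ennreal (2 / (1 - \<theta> powr \<sigma>)) * (\<integral>\<^sup>+j. epowr (b j) \<sigma> \<partial>count_space UNIV)"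
      by (rule geo_Schur_sum[OF t])
    finally show "(\<integral>\<^sup>+k. epowr (\<integral>\<^sup>+j. geo \<theta> k j * b j \<partial>count_space UNIV) \<sigma> \<partial>count_space UNIV)
      \<le> ennreal (2 / (1 - \<theta> powr \<sigma>)) * (\<integral>\<^sup>+j. epowr (b j) \<sigma> \<partial>count_space UNIV)" .
  qed
next
  case False
  then have s: "1 \<le> \<sigma>" by simp
  define D where "D = 2 / (1 - \<theta>)"
  have D: "0 < D" using assms by (simp add: D_def)
  show thesis
  proof (rule that[of "D powr (\<sigma> - 1) * D"])
    show "0 < D powr (\<sigma> - 1) * D" using D by simp
    fix b :: "nat \<Rightarrow> ennreal"
    have "(\<integral>\<^sup>+k. epowr (\<integral>\<^sup>+j. geo \<theta> k j * b j \<partial>count_space UNIV) \<sigma> \<partial>count_space UNIV) \<le>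
      (\<integral>\<^sup>+k. ennreal (D powr (\<sigma> - 1)) * (\<integral>\<^sup>+j. geo \<theta> k j * epowr (b j) \<sigma> \<partial>count_space UNIV) \<partial>count_space UNIV)"
    proof (rule nn_integral_mono)
      fix k
      have "epowr (\<integral>\<^sup>+j. geo \<theta> k j * b j \<partial>count_space UNIV) \<sigma> \<le>
        epowr (\<integral>\<^sup>+j. geo \<theta> k j \<partial>count_space UNIV) (\<sigma> - 1) * (\<integral>\<^sup>+j. geo \<theta> k j * epowr (b j) \<sigma> \<partial>count_space UNIV)"
        using s by (intro nn_integral_Jensen) auto
      also have "\<dots> \<le> epowr (ennreal D) (\<sigma> - 1) * (\<integral>\<^sup>+j. geo \<theta> k j * epowr (b j) \<sigma> \<partial>count_space UNIV)"
        using s nn_integral_geo[OF assms(1,2)] unfolding D_def by (intro mult_right_mono epowr_mono) auto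
      finally show "epowr (\<integral>\<^sup>+j. geo \<theta> k j * b j \<partial>count_space UNIV) \<sigma> \<le>
        ennreal (D powr (\<sigma> - 1)) * (\<integral>\<^sup>+j. geo \<theta> k j * epowr (b j) \<sigma> \<partial>count_space UNIV)"
        using D by (simp add: epowr_ennreal)
    qed
    also have "\<dots> = ennreal (D powr (\<sigma> - 1)) * (\<integral>\<^sup>+k. (\<integral>\<^sup>+j. geo \<theta> k j * epowr (b j) \<sigma> \<partial>count_space UNIV) \<partial>count_space UNIV)"
      by (simp add: nn_integral_cmult)
    also have "\<dots> \<le> ennreal (D powr (\<sigma> - 1)) * (ennreal D * (\<integral>\<^sup>+j. epowr (b j) \<sigma> \<partial>count_space UNIV))"
      unfolding D_def by (intro mult_left_mono geo_Schur_sum assms) auto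
    finally show "(\<integral>\<^sup>+k. epowr (\<integral>\<^sup>+j. geo \<theta> k j * b j \<partial>count_space UNIV) \<sigma> \<partial>count_space UNIV)
      \<le> ennreal (D powr (\<sigma> - 1) * D) * (\<integral>\<^sup>+j. epowr (b j) \<sigma> \<partial>count_space UNIV)"
      using D by (simp add: ennreal_mult mult.assoc)
  qed
qed

text \<open>X^(1-a) is cancelled from both sides, which is legitimate only for finite X; the case X
  = top satisfies the hypothesis without the conclusion.\<close>

lemma epowr_absorb:
  assumes a: "0 < a" "a < 1" and X: "X \<noteq> top" and le: "X \<le> c * epowr Y a * epowr X (1 - a)"
  shows "X \<le> epowr c (1 / a) * Y"
proof (cases "X = 0")
  case False
  define x where "x = enn2real X"
  have x: "X = ennreal x" "0 < x" using X False by (auto simp: x_def enn2real_positive_iff less_top zero_less_iff_neq_zero)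
  have "epowr X a * epowr X (1 - a) \<le> c * epowr Y a * epowr X (1 - a)"
    using le by (simp flip: epowr_add)
  then have "epowr X a * (epowr X (1 - a) * ennreal (x powr (a - 1))) \<le> c * epowr Y a * (epowr X (1 - a) * ennreal (x powr (a - 1)))"
    unfolding mult.assoc[symmetric] by (rule mult_right_mono) simp
  moreover have "epowr X (1 - a) * ennreal (x powr (a - 1)) = 1"
    using x by (simp add: epowr_ennreal flip: ennreal_mult powr_add)
  ultimately have "epowr X a \<le> c * epowr Y a" by simp
  then have "epowr (epowr X a) (1 / a) \<le> epowr (c * epowr Y a) (1 / a)" using a by (intro epowr_mono) auto
  then show ?thesis using a by (simp add: epowr_mult epowr_inverse)
qed simp

context dyadic_system
begin

text \<open>The index p is a pair (j, i): j is the level of the input, i the ring of the spatial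
  decay. The generation min j k - i may be negative, so that balls of arbitrarily large radius
  occur; it never exceeds k, which keeps the result constant on cubes of generation k.\<close>

definition HT :: "real \<Rightarrow> real \<Rightarrow> (nat \<Rightarrow> 'a \<Rightarrow> ennreal) \<Rightarrow> nat \<Rightarrow> 'a \<Rightarrow> ennreal" where
  "HT \<theta> \<kappa> G k x = (\<integral>\<^sup>+p. geo \<theta> k (fst p) * ennreal (\<kappa> ^ snd p) *
     T (int (min (fst p) k) - int (snd p)) (G (fst p)) x \<partial>count_space UNIV)"

lemma HT_measurable [measurable]: "HT \<theta> \<kappa> G k \<in> borel_measurable M"
  unfolding HT_def[abs_def] by (intro measurable_nn_integral_count_space) auto

lemma nn_integral_weight:
  assumes "0 < \<kappa>" "\<kappa> < 1"
  shows "(\<integral>\<^sup>+p. geo \<theta> k (fst p) * ennreal (\<kappa> ^ snd p) * b (fst p) \<partial>count_space UNIV) =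
    ennreal (1 / (1 - \<kappa>)) * (\<integral>\<^sup>+j. geo \<theta> k j * b j \<partial>count_space UNIV)"
proof -
  have sum: "(\<integral>\<^sup>+i. ennreal (\<kappa> ^ i) \<partial>count_space UNIV) = ennreal (1 / (1 - \<kappa>))"
    unfolding nn_integral_count_space_nat
    using assms by (subst suminf_ennreal2) (auto simp: summable_geometric suminf_geometric)
  have "(\<integral>\<^sup>+p. geo \<theta> k (fst p) * ennreal (\<kappa> ^ snd p) * b (fst p) \<partial>count_space UNIV) =
      (\<integral>\<^sup>+j. (\<integral>\<^sup>+i. geo \<theta> k j * ennreal (\<kappa> ^ i) * b j \<partial>count_space UNIV) \<partial>count_space UNIV)"
    by (subst nn_integral_fst_count_space[symmetric]) simp
  also have "\<dots> = (\<integral>\<^sup>+j. ennreal (1 / (1 - \<kappa>)) * (geo \<theta> k j * b j) \<partial>count_space UNIV)"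
    by (intro nn_integral_cong) (simp add: nn_integral_multc nn_integral_cmult sum mult_ac)
  finally show ?thesis by (simp add: nn_integral_cmult)
qed

definition wt :: "real \<Rightarrow> real \<Rightarrow> real" where "wt \<theta> \<kappa> = 1 / (1 - \<kappa>) * (2 / (1 - \<theta>))"

lemma ennreal_wt: "\<theta> < 1 \<Longrightarrow> \<kappa> < 1 \<Longrightarrow> ennreal (wt \<theta> \<kappa>) = ennreal (1 / (1 - \<kappa>)) * ennreal (2 / (1 - \<theta>))"
  unfolding wt_def by (intro ennreal_mult) auto

lemma wt_pos: "\<theta> < 1 \<Longrightarrow> \<kappa> < 1 \<Longrightarrow> 0 < wt \<theta> \<kappa>"
  by (simp add: wt_def)

lemma weight_total:
  assumes "0 < \<theta>" "\<theta> < 1" "0 < \<kappa>" "\<kappa> < 1"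
  shows "(\<integral>\<^sup>+p. geo \<theta> k (fst p) * ennreal (\<kappa> ^ snd p) \<partial>count_space UNIV) \<le> ennreal (wt \<theta> \<kappa>)"
proof -
  have "(\<integral>\<^sup>+p. geo \<theta> k (fst p) * ennreal (\<kappa> ^ snd p) \<partial>count_space UNIV) = ennreal (1 / (1 - \<kappa>)) * (\<integral>\<^sup>+j. geo \<theta> k j \<partial>count_space UNIV)"
    using nn_integral_weight[OF assms(3,4), of \<theta> k "\<lambda>_. 1"] by simp
  also have "\<dots> \<le> ennreal (1 / (1 - \<kappa>)) * ennreal (2 / (1 - \<theta>))"
    by (intro mult_left_mono nn_integral_geo assms) auto
  finally show ?thesis using assms by (simp add: wt_def flip: ennreal_mult)
qed

lemma weight_Schur:
  assumes "0 < \<theta>" "\<theta> < 1" "0 < \<kappa>" "\<kappa> < 1"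
  shows "(\<integral>\<^sup>+k. (\<integral>\<^sup>+p. geo \<theta> k (fst p) * ennreal (\<kappa> ^ snd p) * b (fst p) \<partial>count_space UNIV) \<partial>count_space UNIV)
    \<le> ennreal (wt \<theta> \<kappa>) * (\<integral>\<^sup>+j. b j \<partial>count_space UNIV)"
proof -
  have "(\<integral>\<^sup>+k. (\<integral>\<^sup>+p. geo \<theta> k (fst p) * ennreal (\<kappa> ^ snd p) * b (fst p) \<partial>count_space UNIV) \<partial>count_space UNIV)
    = ennreal (1 / (1 - \<kappa>)) * (\<integral>\<^sup>+k. (\<integral>\<^sup>+j. geo \<theta> k j * b j \<partial>count_space UNIV) \<partial>count_space UNIV)"
    by (simp add: nn_integral_weight[OF assms(3,4)] nn_integral_cmult)
  also have "\<dots> \<le> ennreal (1 / (1 - \<kappa>)) * (ennreal (2 / (1 - \<theta>)) * (\<integral>\<^sup>+j. b j \<partial>count_space UNIV))"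
    by (intro mult_left_mono geo_Schur_sum assms) auto
  finally show ?thesis using assms by (simp only: ennreal_wt mult.assoc)
qed

lemma HT_Jensen:
  assumes "0 < \<theta>" "\<theta> < 1" "0 < \<kappa>" "\<kappa> < 1" "1 \<le> P"
  shows "epowr (HT \<theta> \<kappa> G k x) P \<le> ennreal (wt \<theta> \<kappa> powr (P - 1)) *
    (\<integral>\<^sup>+p. geo \<theta> k (fst p) * ennreal (\<kappa> ^ snd p) *
       epowr (T (int (min (fst p) k) - int (snd p)) (G (fst p)) x) P \<partial>count_space UNIV)"
proof -
  have "epowr (HT \<theta> \<kappa> G k x) P \<le> epowr (\<integral>\<^sup>+p. geo \<theta> k (fst p) * ennreal (\<kappa> ^ snd p) \<partial>count_space UNIV) (P - 1) *
    (\<integral>\<^sup>+p. geo \<theta> k (fst p) * ennreal (\<kappa> ^ snd p) *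
       epowr (T (int (min (fst p) k) - int (snd p)) (G (fst p)) x) P \<partial>count_space UNIV)"
    unfolding HT_def using assms by (intro nn_integral_Jensen) auto
  also have "\<dots> \<le> epowr (ennreal (wt \<theta> \<kappa>)) (P - 1) * (\<integral>\<^sup>+p. geo \<theta> k (fst p) * ennreal (\<kappa> ^ snd p) *
       epowr (T (int (min (fst p) k) - int (snd p)) (G (fst p)) x) P \<partial>count_space UNIV)"
    using assms by (intro mult_right_mono epowr_mono weight_total) auto
  finally show ?thesis using wt_pos[of \<theta> \<kappa>] assms by (simp add: epowr_ennreal)
qed

text \<open>The second bound keeps the power P inside the sum over p and is the basis of the
  diagonal case; the first follows from it by Jensen. Both rest on the strong type of
  \<open>T l\<close> being uniform in l.\<close>

lemma HT_Lp:
  assumes "0 < \<theta>" "\<theta> < 1" "0 < \<kappa>" "\<kappa> < 1" "1 < P"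
  obtains C where "0 < C" "\<And>G k. (\<And>j. G j \<in> borel_measurable M) \<Longrightarrow>
    (\<integral>\<^sup>+x. epowr (HT \<theta> \<kappa> G k x) P \<partial>M) \<le> ennreal C * (\<integral>\<^sup>+j. geo \<theta> k j * (\<integral>\<^sup>+x. epowr (G j x) P \<partial>M) \<partial>count_space UNIV)"
    "\<And>G k. (\<And>j. G j \<in> borel_measurable M) \<Longrightarrow>
    (\<integral>\<^sup>+x. (\<integral>\<^sup>+p. geo \<theta> k (fst p) * ennreal (\<kappa> ^ snd p) *
       epowr (T (int (min (fst p) k) - int (snd p)) (G (fst p)) x) P \<partial>count_space UNIV) \<partial>M)
     \<le> ennreal C * (\<integral>\<^sup>+j. geo \<theta> k j * (\<integral>\<^sup>+x. epowr (G j x) P \<partial>M) \<partial>count_space UNIV)"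
proof -
  obtain C where C: "0 < C" "\<And>g l. g \<in> borel_measurable M \<Longrightarrow>
    (\<integral>\<^sup>+x. epowr (T l g x) P \<partial>M) \<le> ennreal C * (\<integral>\<^sup>+x. epowr (g x) P \<partial>M)"
    using T_strong_type[OF assms(5)] by blast
  define W where "W = wt \<theta> \<kappa> powr (P - 1)"
  have W: "0 < W" using wt_pos[of \<theta> \<kappa>] assms by (simp add: W_def)
  define D where "D = (1 + W) * (C * (1 / (1 - \<kappa>)))"
  define E where "E = C * (1 / (1 - \<kappa>))"
  have E: "0 < E" using C assms by (simp add: E_def)
  have EE: "ennreal E = ennreal C * ennreal (1 / (1 - \<kappa>))"
    unfolding E_def using C assms by (intro ennreal_mult) auto
  have DE: "D = (1 + W) * E" by (simp add: D_def E_def)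
  have main: "(\<integral>\<^sup>+x. (\<integral>\<^sup>+p. geo \<theta> k (fst p) * ennreal (\<kappa> ^ snd p) *
       epowr (T (int (min (fst p) k) - int (snd p)) (G (fst p)) x) P \<partial>count_space UNIV) \<partial>M)
     \<le> ennreal E * (\<integral>\<^sup>+j. geo \<theta> k j * (\<integral>\<^sup>+x. epowr (G j x) P \<partial>M) \<partial>count_space UNIV)"
    if G[measurable]: "\<And>j. G j \<in> borel_measurable M" for G k
  proof -
    have "(\<integral>\<^sup>+x. (\<integral>\<^sup>+p. geo \<theta> k (fst p) * ennreal (\<kappa> ^ snd p) *
       epowr (T (int (min (fst p) k) - int (snd p)) (G (fst p)) x) P \<partial>count_space UNIV) \<partial>M) =
       (\<integral>\<^sup>+p. geo \<theta> k (fst p) * ennreal (\<kappa> ^ snd p) *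
         (\<integral>\<^sup>+x. epowr (T (int (min (fst p) k) - int (snd p)) (G (fst p)) x) P \<partial>M) \<partial>count_space UNIV)"
      by (subst nn_integral_count_space_nn_integral) (auto simp: nn_integral_cmult)
    also have "\<dots> \<le> (\<integral>\<^sup>+p. geo \<theta> k (fst p) * ennreal (\<kappa> ^ snd p) * (ennreal C * (\<integral>\<^sup>+x. epowr (G (fst p) x) P \<partial>M)) \<partial>count_space UNIV)"
      by (intro nn_integral_mono mult_left_mono C G) auto
    also have "\<dots> = ennreal (1 / (1 - \<kappa>)) * (\<integral>\<^sup>+j. geo \<theta> k j * (ennreal C * (\<integral>\<^sup>+x. epowr (G j x) P \<partial>M)) \<partial>count_space UNIV)"
      by (rule nn_integral_weight[OF assms(3,4)])
    also have "\<dots> = ennreal E * (\<integral>\<^sup>+j. geo \<theta> k j * (\<integral>\<^sup>+x. epowr (G j x) P \<partial>M) \<partial>count_space UNIV)"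
      by (simp add: mult.left_commute[of "geo _ _ _"] nn_integral_cmult EE mult_ac)
    finally show ?thesis .
  qed
  have le: "ennreal E * X \<le> ennreal D * X" "ennreal W * (ennreal E * X) \<le> ennreal D * X" for X
  proof -
    have "E \<le> D" "W * E \<le> D" using E W by (auto simp: DE algebra_simps)
    then show "ennreal E * X \<le> ennreal D * X" by (intro mult_right_mono ennreal_leI) auto
    have "ennreal W * (ennreal E * X) = ennreal (W * E) * X" using W E by (simp add: ennreal_mult mult.assoc)
    also have "\<dots> \<le> ennreal D * X" using \<open>W * E \<le> D\<close> by (intro mult_right_mono ennreal_leI) auto
    finally show "ennreal W * (ennreal E * X) \<le> ennreal D * X" .
  qed
  show thesis
  proof (rule that[of D])
    show "0 < D" using E W by (simp add: DE)
    fix G :: "nat \<Rightarrow> 'a \<Rightarrow> ennreal" and k assume G[measurable]: "\<And>j. G j \<in> borel_measurable M"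
    show "(\<integral>\<^sup>+x. (\<integral>\<^sup>+p. geo \<theta> k (fst p) * ennreal (\<kappa> ^ snd p) *
       epowr (T (int (min (fst p) k) - int (snd p)) (G (fst p)) x) P \<partial>count_space UNIV) \<partial>M)
     \<le> ennreal D * (\<integral>\<^sup>+j. geo \<theta> k j * (\<integral>\<^sup>+x. epowr (G j x) P \<partial>M) \<partial>count_space UNIV)"
      using main[OF G] le(1) by (rule order_trans)
    have m: "(\<lambda>x. \<integral>\<^sup>+p. geo \<theta> k (fst p) * ennreal (\<kappa> ^ snd p) *
       epowr (T (int (min (fst p) k) - int (snd p)) (G (fst p)) x) P \<partial>count_space UNIV) \<in> borel_measurable M"
      by (intro measurable_nn_integral_count_space) auto
    have "(\<integral>\<^sup>+x. epowr (HT \<theta> \<kappa> G k x) P \<partial>M) \<le> (\<integral>\<^sup>+x. ennreal W * (\<integral>\<^sup>+p. geo \<theta> k (fst p) * ennreal (\<kappa> ^ snd p) *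
       epowr (T (int (min (fst p) k) - int (snd p)) (G (fst p)) x) P \<partial>count_space UNIV) \<partial>M)"
      unfolding W_def using assms by (intro nn_integral_mono HT_Jensen) auto
    also have "\<dots> \<le> ennreal W * (ennreal E * (\<integral>\<^sup>+j. geo \<theta> k j * (\<integral>\<^sup>+x. epowr (G j x) P \<partial>M) \<partial>count_space UNIV))"
      using main[of G k, OF G] m by (subst nn_integral_cmult) (auto intro: mult_left_mono)
    also note le(2)
    finally show "(\<integral>\<^sup>+x. epowr (HT \<theta> \<kappa> G k x) P \<partial>M) \<le> ennreal D * (\<integral>\<^sup>+j. geo \<theta> k j * (\<integral>\<^sup>+x. epowr (G j x) P \<partial>M) \<partial>count_space UNIV)" .
  qed
qed

lemma HT_le_maxi:
  assumes "0 < \<theta>" "\<theta> < 1" "0 < \<kappa>" "\<kappa> < 1" and G: "\<And>j u. G j u \<le> \<Gamma> u"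
  shows "HT \<theta> \<kappa> G k x \<le> ennreal (wt \<theta> \<kappa> * K1) * maxi \<Gamma> x"
proof -
  have "T l (G j) x \<le> ennreal K1 * maxi \<Gamma> x" for l j
    using order_trans[OF T_mono[OF G] T_le_maxi] .
  then have "HT \<theta> \<kappa> G k x \<le> (\<integral>\<^sup>+p. geo \<theta> k (fst p) * ennreal (\<kappa> ^ snd p) * (ennreal K1 * maxi \<Gamma> x) \<partial>count_space UNIV)"
    unfolding HT_def by (intro nn_integral_mono mult_left_mono) auto
  also have "\<dots> = (\<integral>\<^sup>+p. geo \<theta> k (fst p) * ennreal (\<kappa> ^ snd p) \<partial>count_space UNIV) * (ennreal K1 * maxi \<Gamma> x)"
    by (rule nn_integral_multc) simp
  also have "\<dots> \<le> ennreal (wt \<theta> \<kappa>) * (ennreal K1 * maxi \<Gamma> x)"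
    by (intro mult_right_mono weight_total assms) auto
  finally show ?thesis using wt_pos[of \<theta> \<kappa>] assms K1_pos by (simp add: ennreal_mult mult.assoc)
qed

text \<open>For the supremum over levels no vector-valued argument is needed: every G j is below
  their supremum, so each HT is below a multiple of one maximal function.\<close>

lemma HT_TL_sup:
  assumes "0 < \<theta>" "\<theta> < 1" "0 < \<kappa>" "\<kappa> < 1" "1 < P"
  obtains C where "0 < C" "\<And>G. (\<And>j. G j \<in> borel_measurable M) \<Longrightarrow>
    (\<integral>\<^sup>+x. epowr (SUP k. HT \<theta> \<kappa> G k x) P \<partial>M) \<le> ennreal C * (\<integral>\<^sup>+x. epowr (SUP j. G j x) P \<partial>M)"
proof -
  obtain C where C: "0 < C" "\<And>g. g \<in> borel_measurable M \<Longrightarrow>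
    (\<integral>\<^sup>+x. epowr (maxi g x) P \<partial>M) \<le> ennreal C * (\<integral>\<^sup>+x. epowr (g x) P \<partial>M)"
    using maxi_strong_type[OF assms(5)] by blast
  define W where "W = wt \<theta> \<kappa> * K1"
  have W: "0 < W" using wt_pos[of \<theta> \<kappa>] assms K1_pos by (simp add: W_def)
  have "(\<integral>\<^sup>+x. epowr (SUP k. HT \<theta> \<kappa> G k x) P \<partial>M) \<le> ennreal (W powr P * C) * (\<integral>\<^sup>+x. epowr (SUP j. G j x) P \<partial>M)"
    if [measurable]: "\<And>j. G j \<in> borel_measurable M" for G
  proof -
    define \<Gamma> where "\<Gamma> x = (SUP j. G j x)" for x
    have [measurable]: "\<Gamma> \<in> borel_measurable M" unfolding \<Gamma>_def by measurable
    have "(\<integral>\<^sup>+x. epowr (SUP k. HT \<theta> \<kappa> G k x) P \<partial>M) \<le> (\<integral>\<^sup>+x. ennreal (W powr P) * epowr (maxi \<Gamma> x) P \<partial>M)"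
    proof (rule nn_integral_mono)
      fix x
      have "(SUP k. HT \<theta> \<kappa> G k x) \<le> ennreal W * maxi \<Gamma> x"
        unfolding W_def using assms by (intro SUP_least HT_le_maxi) (auto simp: \<Gamma>_def intro: SUP_upper)
      then have "epowr (SUP k. HT \<theta> \<kappa> G k x) P \<le> epowr (ennreal W * maxi \<Gamma> x) P"
        using assms by (intro epowr_mono) auto
      then show "epowr (SUP k. HT \<theta> \<kappa> G k x) P \<le> ennreal (W powr P) * epowr (maxi \<Gamma> x) P"
        using assms W by (simp add: epowr_mult epowr_ennreal)
    qed
    also have "\<dots> \<le> ennreal (W powr P) * (ennreal C * (\<integral>\<^sup>+x. epowr (\<Gamma> x) P \<partial>M))"
      by (simp add: nn_integral_cmult mult_left_mono C)
    finally show ?thesis using C(1) by (simp add: ennreal_mult mult.assoc \<Gamma>_def)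
  qed
  then show thesis using that[of "W powr P * C"] C(1) W by simp
qed

lemma HT_TL_diag:
  assumes "0 < \<theta>" "\<theta> < 1" "0 < \<kappa>" "\<kappa> < 1" "1 < P"
  obtains C where "0 < C" "\<And>G. (\<And>j. G j \<in> borel_measurable M) \<Longrightarrow>
    (\<integral>\<^sup>+k. (\<integral>\<^sup>+x. (\<integral>\<^sup>+p. geo \<theta> k (fst p) * ennreal (\<kappa> ^ snd p) *
       epowr (T (int (min (fst p) k) - int (snd p)) (G (fst p)) x) P \<partial>count_space UNIV) \<partial>M) \<partial>count_space UNIV)
     \<le> ennreal C * (\<integral>\<^sup>+x. (\<integral>\<^sup>+j. epowr (G j x) P \<partial>count_space UNIV) \<partial>M)"
proof (rule HT_Lp[OF assms])
  fix C assume C: "0 < C" "\<And>G k. (\<And>j. G j \<in> borel_measurable M) \<Longrightarrow>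
    (\<integral>\<^sup>+x. (\<integral>\<^sup>+p. geo \<theta> k (fst p) * ennreal (\<kappa> ^ snd p) *
       epowr (T (int (min (fst p) k) - int (snd p)) (G (fst p)) x) P \<partial>count_space UNIV) \<partial>M)
     \<le> ennreal C * (\<integral>\<^sup>+j. geo \<theta> k j * (\<integral>\<^sup>+x. epowr (G j x) P \<partial>M) \<partial>count_space UNIV)"
  show thesis
  proof (rule that[of "C * (2 / (1 - \<theta>))"])
    show "0 < C * (2 / (1 - \<theta>))" using C assms by simp
    have e: "ennreal (C * (2 / (1 - \<theta>))) = ennreal C * ennreal (2 / (1 - \<theta>))"
      using C(1) assms by (intro ennreal_mult) auto
    fix G :: "nat \<Rightarrow> 'a \<Rightarrow> ennreal" assume G[measurable]: "\<And>j. G j \<in> borel_measurable M"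
    have "(\<integral>\<^sup>+k. (\<integral>\<^sup>+x. (\<integral>\<^sup>+p. geo \<theta> k (fst p) * ennreal (\<kappa> ^ snd p) *
       epowr (T (int (min (fst p) k) - int (snd p)) (G (fst p)) x) P \<partial>count_space UNIV) \<partial>M) \<partial>count_space UNIV) \<le>
       (\<integral>\<^sup>+k. ennreal C * (\<integral>\<^sup>+j. geo \<theta> k j * (\<integral>\<^sup>+x. epowr (G j x) P \<partial>M) \<partial>count_space UNIV) \<partial>count_space UNIV)"
      by (intro nn_integral_mono C G)
    also have "\<dots> \<le> ennreal C * (ennreal (2 / (1 - \<theta>)) * (\<integral>\<^sup>+j. (\<integral>\<^sup>+x. epowr (G j x) P \<partial>M) \<partial>count_space UNIV))"
      by (simp add: nn_integral_cmult mult_left_mono geo_Schur_sum assms)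
    also have "(\<integral>\<^sup>+j. (\<integral>\<^sup>+x. epowr (G j x) P \<partial>M) \<partial>count_space UNIV) = (\<integral>\<^sup>+x. (\<integral>\<^sup>+j. epowr (G j x) P \<partial>count_space UNIV) \<partial>M)"
      by (rule nn_integral_count_space_nn_integral[symmetric]) auto
    finally show "(\<integral>\<^sup>+k. (\<integral>\<^sup>+x. (\<integral>\<^sup>+p. geo \<theta> k (fst p) * ennreal (\<kappa> ^ snd p) *
       epowr (T (int (min (fst p) k) - int (snd p)) (G (fst p)) x) P \<partial>count_space UNIV) \<partial>M) \<partial>count_space UNIV)
     \<le> ennreal (C * (2 / (1 - \<theta>))) * (\<integral>\<^sup>+x. (\<integral>\<^sup>+j. epowr (G j x) P \<partial>count_space UNIV) \<partial>M)"
      unfolding e mult.assoc .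
  qed
qed

text \<open>The case \<open>P < Q\<close>: writing \<open>\<Gamma>\<close> for the \<open>\<ell>\<^sup>Q\<close>-norm and
  \<open>G = a\<^bsup>P/Q\<^esup> \<Gamma>\<^bsup>1-P/Q\<^esup>\<close>, the positive operator \<open>T\<close> splits by Hoelder into the diagonal case
  applied to \<open>a\<close> and the maximal function of \<open>\<Gamma>\<close>.\<close>

lemma HT_TL_less:
  assumes "0 < \<theta>" "\<theta> < 1" "0 < \<kappa>" "\<kappa> < 1" "1 < P" "P < Q"
  obtains C where "0 < C" "\<And>G. (\<And>j. G j \<in> borel_measurable M) \<Longrightarrow>
    (\<integral>\<^sup>+x. epowr (\<integral>\<^sup>+k. epowr (HT \<theta> \<kappa> G k x) Q \<partial>count_space UNIV) (P / Q) \<partial>M)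
      \<le> ennreal C * (\<integral>\<^sup>+x. epowr (\<integral>\<^sup>+j. epowr (G j x) Q \<partial>count_space UNIV) (P / Q) \<partial>M)"
proof -
  obtain C where C: "0 < C" "\<And>g. g \<in> borel_measurable M \<Longrightarrow>
    (\<integral>\<^sup>+x. epowr (maxi g x) P \<partial>M) \<le> ennreal C * (\<integral>\<^sup>+x. epowr (g x) P \<partial>M)"
    using maxi_strong_type[OF assms(5)] by blast
  obtain D where D: "0 < D" "\<And>G. (\<And>j. G j \<in> borel_measurable M) \<Longrightarrow>
    (\<integral>\<^sup>+k. (\<integral>\<^sup>+x. (\<integral>\<^sup>+p. geo \<theta> k (fst p) * ennreal (\<kappa> ^ snd p) *
       epowr (T (int (min (fst p) k) - int (snd p)) (G (fst p)) x) P \<partial>count_space UNIV) \<partial>M) \<partial>count_space UNIV)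
     \<le> ennreal D * (\<integral>\<^sup>+x. (\<integral>\<^sup>+j. epowr (G j x) P \<partial>count_space UNIV) \<partial>M)"
    using HT_TL_diag[OF assms(1-5)] by blast
  define t where "t = P / Q"
  have t: "0 < t" "t < 1" "P = t * Q" "0 < Q" "1 < Q" using assms by (auto simp: t_def)
  define W where "W = wt \<theta> \<kappa> powr (Q - 1)"
  define B where "B = W * K1 powr (Q - P)"
  have B: "0 < B" using wt_pos[of \<theta> \<kappa>] assms K1_pos by (simp add: W_def B_def)
  define E where "E = B powr t * (D powr t * C powr (1 - t))"
  have E: "0 < E" using B C D by (simp add: E_def)
  show thesis
  proof (rule that[OF E])
    fix G :: "nat \<Rightarrow> 'a \<Rightarrow> ennreal" assume G[measurable]: "\<And>j. G j \<in> borel_measurable M"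
    define \<Gamma> where "\<Gamma> x = epowr (\<integral>\<^sup>+j. epowr (G j x) Q \<partial>count_space UNIV) (1 / Q)" for x
    have [measurable]: "\<Gamma> \<in> borel_measurable M"
      unfolding \<Gamma>_def[abs_def] by (intro epowr_measurable measurable_nn_integral_count_space) auto
    \<comment> \<open>The normalisation makes the sum of a^P at most \<Gamma>^P. If \<Gamma> x = 0
      then all G j x vanish. If \<Gamma> x = top its negative power is again top, so
      \<open>a\<close> is top unless G j x = 0, and \<open>fac\<close> survives.\<close>
    define a where "a j x = epowr (G j x) (1 / t) * epowr (\<Gamma> x) (1 - 1 / t)" for j x
    have [measurable]: "a j \<in> borel_measurable M" for j unfolding a_def[abs_def] by measurable
    have G_le_\<Gamma>: "G j x \<le> \<Gamma> x" for j x
    proof -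
      have "epowr (G j x) Q \<le> (\<integral>\<^sup>+j. epowr (G j x) Q \<partial>count_space UNIV)"
        by (rule nn_integral_ge_point) simp
      then have "epowr (epowr (G j x) Q) (1 / Q) \<le> \<Gamma> x"
        unfolding \<Gamma>_def using t by (intro epowr_mono) auto
      then show ?thesis using t by (simp add: epowr_inverse)
    qed
    have fac: "G j x \<le> epowr (a j x) t * epowr (\<Gamma> x) (1 - t)" for j x
    proof -
      consider "\<Gamma> x = 0" | "\<Gamma> x = top" | g where "\<Gamma> x = ennreal g" "0 < g"
        by (cases "\<Gamma> x") (auto simp: less_le)
      then show ?thesis
      proof cases
        case 1 then show ?thesis using G_le_\<Gamma>[of j x] by simp
      next
        case 2 then show ?thesis by (cases "G j x = 0") (auto simp: a_def ennreal_mult_eq_top_iff ennreal_top_mult)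
      next
        case (3 g)
        have "epowr (a j x) t * epowr (\<Gamma> x) (1 - t) = epowr (epowr (G j x) (1 / t)) t * (epowr (\<Gamma> x) (t - 1) * epowr (\<Gamma> x) (1 - t))"
          using t by (simp add: a_def epowr_mult epowr_epowr left_diff_distrib mult.assoc)
        also have "epowr (\<Gamma> x) (t - 1) * epowr (\<Gamma> x) (1 - t) = 1"
          using 3 by (simp add: epowr_ennreal flip: ennreal_mult powr_add)
        also have "epowr (epowr (G j x) (1 / t)) t = G j x" using t by (simp add: epowr_inverse)
        finally show ?thesis by simp
      qed
    qed
    have suma: "(\<integral>\<^sup>+j. epowr (a j x) P \<partial>count_space UNIV) \<le> epowr (\<Gamma> x) P" for x
    proof -
      have "epowr (a j x) P = epowr (G j x) Q * epowr (\<Gamma> x) (P - Q)" for j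
        using t assms by (simp add: a_def epowr_mult epowr_epowr left_diff_distrib)
      then have "(\<integral>\<^sup>+j. epowr (a j x) P \<partial>count_space UNIV) = epowr (\<Gamma> x) Q * epowr (\<Gamma> x) (P - Q)"
        using t by (simp add: nn_integral_multc \<Gamma>_def epowr_inverse)
      then show ?thesis by (simp flip: epowr_add)
    qed
    \<comment> \<open>The left-hand side of the diagonal estimate for \<open>a\<close>. Only this
      factor has to be summed over levels, since the maximal function of \<Gamma> carries no
      index.\<close>
    define Z where "Z x = (\<integral>\<^sup>+k. (\<integral>\<^sup>+p. geo \<theta> k (fst p) * ennreal (\<kappa> ^ snd p) *
       epowr (T (int (min (fst p) k) - int (snd p)) (a (fst p)) x) P \<partial>count_space UNIV) \<partial>count_space UNIV)" for x
    have [measurable]: "Z \<in> borel_measurable M"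
      unfolding Z_def[abs_def] by (intro measurable_nn_integral_count_space) auto
    have ZI: "(\<integral>\<^sup>+x. Z x \<partial>M) \<le> ennreal D * (\<integral>\<^sup>+x. epowr (\<Gamma> x) P \<partial>M)"
    proof -
      have "(\<integral>\<^sup>+x. Z x \<partial>M) \<le> ennreal D * (\<integral>\<^sup>+x. (\<integral>\<^sup>+j. epowr (a j x) P \<partial>count_space UNIV) \<partial>M)"
        unfolding Z_def
        by (subst nn_integral_count_space_nn_integral) (auto intro!: D(2) measurable_nn_integral_count_space)
      also have "\<dots> \<le> ennreal D * (\<integral>\<^sup>+x. epowr (\<Gamma> x) P \<partial>M)"
        by (intro mult_left_mono nn_integral_mono suma) auto
      finally show ?thesis .
    qed
    have T_le: "epowr (T l (G j) x) Q \<le> epowr (T l (a j) x) P * (ennreal (K1 powr (Q - P)) * epowr (maxi \<Gamma> x) (Q - P))" for l j x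
    proof -
      have "T l (G j) x \<le> T l (\<lambda>u. epowr (a j u) t * epowr (\<Gamma> u) (1 - t)) x" by (intro T_mono fac)
      also have "\<dots> \<le> epowr (T l (a j) x) t * epowr (T l \<Gamma> x) (1 - t)"
        unfolding T_def bl_def using t radius_pos by (intro avg_ball_Holder) auto
      also have "\<dots> \<le> epowr (T l (a j) x) t * epowr (ennreal K1 * maxi \<Gamma> x) (1 - t)"
        using t by (intro mult_left_mono epowr_mono T_le_maxi) auto
      finally have "epowr (T l (G j) x) Q \<le> epowr (epowr (T l (a j) x) t * epowr (ennreal K1 * maxi \<Gamma> x) (1 - t)) Q"
        using t by (intro epowr_mono) auto
      also have "\<dots> = epowr (T l (a j) x) P * epowr (ennreal K1 * maxi \<Gamma> x) (Q - P)"
        using t by (simp add: epowr_mult epowr_epowr left_diff_distrib)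
      also have "epowr (ennreal K1 * maxi \<Gamma> x) (Q - P) = ennreal (K1 powr (Q - P)) * epowr (maxi \<Gamma> x) (Q - P)"
        using assms K1_pos by (simp add: epowr_mult epowr_ennreal)
      finally show ?thesis .
    qed
    have pw: "(\<integral>\<^sup>+k. epowr (HT \<theta> \<kappa> G k x) Q \<partial>count_space UNIV) \<le> ennreal B * (Z x * epowr (maxi \<Gamma> x) (Q - P))" for x
    proof -
      define m where "m = ennreal (K1 powr (Q - P)) * epowr (maxi \<Gamma> x) (Q - P)"
      have "(\<integral>\<^sup>+k. epowr (HT \<theta> \<kappa> G k x) Q \<partial>count_space UNIV) \<le> (\<integral>\<^sup>+k. ennreal W * (\<integral>\<^sup>+p. geo \<theta> k (fst p) * ennreal (\<kappa> ^ snd p) *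
         epowr (T (int (min (fst p) k) - int (snd p)) (G (fst p)) x) Q \<partial>count_space UNIV) \<partial>count_space UNIV)"
        unfolding W_def using assms t by (intro nn_integral_mono HT_Jensen) auto
      also have "\<dots> \<le> (\<integral>\<^sup>+k. ennreal W * (\<integral>\<^sup>+p. geo \<theta> k (fst p) * ennreal (\<kappa> ^ snd p) *
         (epowr (T (int (min (fst p) k) - int (snd p)) (a (fst p)) x) P * m) \<partial>count_space UNIV) \<partial>count_space UNIV)"
        unfolding m_def by (intro nn_integral_mono mult_left_mono T_le) auto
      also have "\<dots> = ennreal W * (Z x * m)"
        by (simp add: Z_def nn_integral_cmult nn_integral_multc mult.assoc[symmetric])
      also have "\<dots> = ennreal B * (Z x * epowr (maxi \<Gamma> x) (Q - P))"
        by (simp add: B_def W_def m_def ennreal_mult mult_ac)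
      finally show ?thesis .
    qed
    have "(\<integral>\<^sup>+x. epowr (\<integral>\<^sup>+k. epowr (HT \<theta> \<kappa> G k x) Q \<partial>count_space UNIV) t \<partial>M) \<le>
        (\<integral>\<^sup>+x. ennreal (B powr t) * (epowr (Z x) t * epowr (epowr (maxi \<Gamma> x) P) (1 - t)) \<partial>M)"
    proof (rule nn_integral_mono)
      fix x
      have "epowr (\<integral>\<^sup>+k. epowr (HT \<theta> \<kappa> G k x) Q \<partial>count_space UNIV) t \<le> epowr (ennreal B * (Z x * epowr (maxi \<Gamma> x) (Q - P))) t"
        using t pw by (intro epowr_mono) auto
      also have "\<dots> = ennreal (B powr t) * (epowr (Z x) t * epowr (epowr (maxi \<Gamma> x) P) (1 - t))"
      proof -
        have "(Q - P) * t = P * (1 - t)" using t(3) by (simp add: algebra_simps)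
        then have "epowr (epowr (maxi \<Gamma> x) (Q - P)) t = epowr (epowr (maxi \<Gamma> x) P) (1 - t)"
          by (simp only: epowr_epowr)
        then show ?thesis using t(1) B by (simp add: epowr_mult epowr_ennreal)
      qed
      finally show "epowr (\<integral>\<^sup>+k. epowr (HT \<theta> \<kappa> G k x) Q \<partial>count_space UNIV) t \<le>
        ennreal (B powr t) * (epowr (Z x) t * epowr (epowr (maxi \<Gamma> x) P) (1 - t))" .
    qed
    also have "\<dots> = ennreal (B powr t) * (\<integral>\<^sup>+x. epowr (Z x) t * epowr (epowr (maxi \<Gamma> x) P) (1 - t) \<partial>M)"
      by (rule nn_integral_cmult) measurable
    also have "\<dots> \<le> ennreal (B powr t) * (epowr (\<integral>\<^sup>+x. Z x \<partial>M) t * epowr (\<integral>\<^sup>+x. epowr (maxi \<Gamma> x) P \<partial>M) (1 - t))"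
      using t by (intro mult_left_mono nn_integral_Holder) auto
    also have "\<dots> \<le> ennreal (B powr t) * (epowr (ennreal D * (\<integral>\<^sup>+x. epowr (\<Gamma> x) P \<partial>M)) t * epowr (ennreal C * (\<integral>\<^sup>+x. epowr (\<Gamma> x) P \<partial>M)) (1 - t))"
      using t by (intro mult_left_mono mult_mono epowr_mono ZI C) auto
    also have "\<dots> = ennreal E * (epowr (\<integral>\<^sup>+x. epowr (\<Gamma> x) P \<partial>M) t * epowr (\<integral>\<^sup>+x. epowr (\<Gamma> x) P \<partial>M) (1 - t))"
      using t B C D by (simp add: E_def epowr_mult epowr_ennreal ennreal_mult mult_ac)
    also have "epowr (\<integral>\<^sup>+x. epowr (\<Gamma> x) P \<partial>M) t * epowr (\<integral>\<^sup>+x. epowr (\<Gamma> x) P \<partial>M) (1 - t) = (\<integral>\<^sup>+x. epowr (\<Gamma> x) P \<partial>M)"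
      by (simp flip: epowr_add)
    also have "\<dots> = (\<integral>\<^sup>+x. epowr (\<integral>\<^sup>+j. epowr (G j x) Q \<partial>count_space UNIV) t \<partial>M)"
      by (simp add: \<Gamma>_def epowr_epowr t_def)
    finally show "(\<integral>\<^sup>+x. epowr (\<integral>\<^sup>+k. epowr (HT \<theta> \<kappa> G k x) Q \<partial>count_space UNIV) (P / Q) \<partial>M)
      \<le> ennreal E * (\<integral>\<^sup>+x. epowr (\<integral>\<^sup>+j. epowr (G j x) Q \<partial>count_space UNIV) (P / Q) \<partial>M)" by (simp add: t_def)
  qed
qed

text \<open>The case \<open>Q < P\<close>: with \<open>R = P / Q\<close> and \<open>U\<close> a finite partial sum,
  \<open>\<integral>U\<^sup>R = \<integral>U U\<^bsup>R-1\<^esup>\<close> is moved by duality onto the maximal function of \<open>U\<^bsup>R-1\<^esup>\<close> and absorbed.\<close>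

lemma finite_sum_T_bound:
  assumes R: "1 < R"
  obtains C where "0 < C" "\<And>I (w :: 'k \<Rightarrow> real) l g \<Gamma> c. \<lbrakk>finite I; \<And>i. i \<in> I \<Longrightarrow> g i \<in> borel_measurable M;
      \<Gamma> \<in> borel_measurable M; \<And>i. i \<in> I \<Longrightarrow> 0 \<le> w i; 0 \<le> c; \<And>i x. i \<in> I \<Longrightarrow> g i x \<le> \<Gamma> x;
      \<And>x. (\<Sum>i\<in>I. ennreal (w i) * g i x) \<le> ennreal c * \<Gamma> x\<rbrakk> \<Longrightarrow>
    (\<integral>\<^sup>+x. epowr (\<Sum>i\<in>I. ennreal (w i) * T (l i) (g i) x) R \<partial>M) \<le> ennreal (C * c powr R) * (\<integral>\<^sup>+x. epowr (\<Gamma> x) R \<partial>M)"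
proof -
  \<comment> \<open>The conjugate exponent of R: (R - 1) S = R makes the integral of (U^(R-1))^S
    equal to X again, so that X appears on both sides.\<close>
  define S where "S = R / (R - 1)"
  have S: "1 < S" "(R - 1) * S = R" "1 - 1 / R = 1 / S" using R by (auto simp: S_def field_simps)
  obtain C where C: "0 < C" "\<And>g. g \<in> borel_measurable M \<Longrightarrow>
    (\<integral>\<^sup>+x. epowr (maxi g x) S \<partial>M) \<le> ennreal C * (\<integral>\<^sup>+x. epowr (g x) S \<partial>M)"
    using maxi_strong_type[OF S(1)] by blast
  obtain D where D: "0 < D" "\<And>g l. g \<in> borel_measurable M \<Longrightarrow>
    (\<integral>\<^sup>+x. epowr (T l g x) R \<partial>M) \<le> ennreal D * (\<integral>\<^sup>+x. epowr (g x) R \<partial>M)"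
    using T_strong_type[OF R] by blast
  define E where "E = (K1 * C powr (1 / S)) powr R"
  have E: "0 < E" using K1_pos C by (simp add: E_def)
  show thesis
  proof (rule that[OF E])
    fix I and w :: "'k \<Rightarrow> real" and l g \<Gamma> and c :: real
    assume I: "finite I" and g: "\<And>i. i \<in> I \<Longrightarrow> g i \<in> borel_measurable M" and [measurable]: "\<Gamma> \<in> borel_measurable M"
      and w: "\<And>i. i \<in> I \<Longrightarrow> 0 \<le> w i" and c: "0 \<le> c" and g\<Gamma>: "\<And>i x. i \<in> I \<Longrightarrow> g i x \<le> \<Gamma> x"
      and sum: "\<And>x. (\<Sum>i\<in>I. ennreal (w i) * g i x) \<le> ennreal c * \<Gamma> x"
    define Y where "Y = (\<integral>\<^sup>+x. epowr (\<Gamma> x) R \<partial>M)"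
    define U where "U x = (\<Sum>i\<in>I. ennreal (w i) * T (l i) (g i) x)" for x
    define h where "h x = epowr (U x) (R - 1)" for x
    have [measurable]: "U \<in> borel_measurable M" unfolding U_def[abs_def] by measurable
    have [measurable]: "h \<in> borel_measurable M" unfolding h_def[abs_def] by measurable
    define X where "X = (\<integral>\<^sup>+x. epowr (U x) R \<partial>M)"
    have X: "X \<le> ennreal (K1 * c * C powr (1 / S)) * epowr Y (1 / R) * epowr X (1 - 1 / R)"
    proof -
      have "X = (\<integral>\<^sup>+x. (\<Sum>i\<in>I. ennreal (w i) * (T (l i) (g i) x * h x)) \<partial>M)"
      proof -
        have "epowr (U x) R = U x * h x" for x
          using epowr_add[of "U x" 1 "R - 1"] by (simp add: h_def)
        then show ?thesis by (simp add: X_def U_def sum_distrib_right mult.assoc)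
      qed
      also have "\<dots> = (\<Sum>i\<in>I. ennreal (w i) * (\<integral>\<^sup>+x. T (l i) (g i) x * h x \<partial>M))"
        by (simp add: nn_integral_sum nn_integral_cmult)
      also have "\<dots> \<le> (\<Sum>i\<in>I. ennreal (w i) * (ennreal K1 * (\<integral>\<^sup>+u. g i u * maxi h u \<partial>M)))"
        using g by (intro sum_mono mult_left_mono T_duality) auto
      also have "\<dots> = ennreal K1 * (\<integral>\<^sup>+u. (\<Sum>i\<in>I. ennreal (w i) * g i u) * maxi h u \<partial>M)"
        using g by (simp add: sum_distrib_right nn_integral_sum nn_integral_cmult sum_distrib_left mult_ac)
      also have "\<dots> \<le> ennreal K1 * (\<integral>\<^sup>+u. (ennreal c * \<Gamma> u) * maxi h u \<partial>M)"
        by (intro mult_left_mono nn_integral_mono mult_right_mono sum) auto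
      also have "\<dots> = ennreal (K1 * c) * (\<integral>\<^sup>+u. epowr (epowr (\<Gamma> u) R) (1 / R) * epowr (epowr (maxi h u) S) (1 - 1 / R) \<partial>M)"
        using R S K1_pos c by (simp add: epowr_inverse mult.assoc nn_integral_cmult ennreal_mult)
      also have "\<dots> \<le> ennreal (K1 * c) * (epowr Y (1 / R) * epowr (\<integral>\<^sup>+u. epowr (maxi h u) S \<partial>M) (1 - 1 / R))"
        unfolding Y_def using R by (intro mult_left_mono nn_integral_Holder) auto
      also have "\<dots> \<le> ennreal (K1 * c) * (epowr Y (1 / R) * epowr (ennreal C * X) (1 - 1 / R))"
      proof -
        have "(\<integral>\<^sup>+u. epowr (maxi h u) S \<partial>M) \<le> ennreal C * (\<integral>\<^sup>+u. epowr (h u) S \<partial>M)" by (intro C) simp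
        also have "(\<integral>\<^sup>+u. epowr (h u) S \<partial>M) = X" by (simp add: h_def X_def epowr_epowr S)
        finally show ?thesis using R by (intro mult_left_mono epowr_mono) auto
      qed
      also have "epowr (ennreal C * X) (1 - 1 / R) = ennreal (C powr (1 / S)) * epowr X (1 - 1 / R)"
        unfolding S(3) using S(1) C(1) by (simp add: epowr_mult epowr_ennreal)
      finally show ?thesis using K1_pos c by (simp add: ennreal_mult mult_ac)
    qed
    have "X \<le> ennreal (E * c powr R) * Y"
    proof (cases "Y = top")
      case True
      show ?thesis
      proof (cases "c = 0")
        \<comment> \<open>The right-hand side is 0 * top = 0 here, so X must vanish; the inequality
          for X with c = 0 shows that it does.\<close>
        case c0: True
        then show ?thesis using X R by simp
      next
        case False
        then show ?thesis using True E c by (simp add: ennreal_mult_eq_top_iff less_le ennreal_mult_top)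
      qed
    next
      case False
      \<comment> \<open>Only finiteness is at stake: this bound depends on the number of terms and
        the weights, and it serves to license the absorption. It is the reason for working with
        finite sums.\<close>
      have "X \<le> (\<integral>\<^sup>+x. ennreal (real (card I) powr (R - 1)) * (\<Sum>i\<in>I. epowr (ennreal (w i) * T (l i) (g i) x) R) \<partial>M)"
        unfolding X_def U_def using R I by (intro nn_integral_mono epowr_sum_le_card) auto
      also have "\<dots> = ennreal (real (card I) powr (R - 1)) * (\<Sum>i\<in>I. epowr (ennreal (w i)) R * (\<integral>\<^sup>+x. epowr (T (l i) (g i) x) R \<partial>M))"
        using R by (simp add: nn_integral_cmult nn_integral_sum epowr_mult)
      also have "\<dots> \<le> ennreal (real (card I) powr (R - 1)) * (\<Sum>i\<in>I. epowr (ennreal (w i)) R * (ennreal D * Y))"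
      proof (intro mult_left_mono sum_mono)
        fix i assume i: "i \<in> I"
        have "(\<integral>\<^sup>+x. epowr (T (l i) (g i) x) R \<partial>M) \<le> ennreal D * (\<integral>\<^sup>+x. epowr (g i x) R \<partial>M)"
          by (intro D g i)
        also have "\<dots> \<le> ennreal D * Y"
          unfolding Y_def using R i by (intro mult_left_mono nn_integral_mono epowr_mono g\<Gamma>) auto
        finally show "(\<integral>\<^sup>+x. epowr (T (l i) (g i) x) R \<partial>M) \<le> ennreal D * Y" .
      qed auto
      also have "\<dots> = ennreal (real (card I) powr (R - 1)) * (ennreal (\<Sum>i\<in>I. w i powr R) * (ennreal D * Y))"
      proof -
        have "(\<Sum>i\<in>I. epowr (ennreal (w i)) R * Z) = (\<Sum>i\<in>I. ennreal (w i powr R)) * Z" for Z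
          unfolding sum_distrib_right using w by (intro sum.cong) (simp_all add: epowr_ennreal)
        then show ?thesis by (simp add: sum_ennreal)
      qed
      also have "\<dots> < top"
      proof -
        have m: "ennreal r * y < top" if "y < top" for r y
          using ennreal_less_top[of r] that unfolding ennreal_mult_less_top by blast
        have "Y < top" using False less_top by blast
        then show ?thesis by (intro m)
      qed
      finally have "X \<noteq> top" by (rule less_imp_neq)
      then have "X \<le> epowr (ennreal (K1 * c * C powr (1 / S))) (1 / (1 / R)) * Y"
        using R X by (intro epowr_absorb) auto
      also have "epowr (ennreal (K1 * c * C powr (1 / S))) (1 / (1 / R)) = ennreal (E * c powr R)"
        using K1_pos c by (simp add: epowr_ennreal E_def powr_mult mult_ac)
      finally show ?thesis .
    qed
    then show "(\<integral>\<^sup>+x. epowr (\<Sum>i\<in>I. ennreal (w i) * T (l i) (g i) x) R \<partial>M) \<le> ennreal (E * c powr R) * (\<integral>\<^sup>+x. epowr (\<Gamma> x) R \<partial>M)"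
      by (simp add: X_def U_def Y_def)
  qed
qed

text \<open>Jensen, in the sum and in each average, moves the power Q onto G. The sum over k then
  becomes one weighted sum of averages over triples (k, (j, i)), which is exhausted by the finite
  boxes J n. \<open>finite_sum_T_bound\<close> is uniform in n because the total weight reaching
  each level j is bounded by \<open>weight_Schur\<close>.\<close>

lemma HT_TL_greater:
  assumes "0 < \<theta>" "\<theta> < 1" "0 < \<kappa>" "\<kappa> < 1" "1 < Q" "Q < P"
  obtains C where "0 < C" "\<And>G. (\<And>j. G j \<in> borel_measurable M) \<Longrightarrow>
    (\<integral>\<^sup>+x. epowr (\<integral>\<^sup>+k. epowr (HT \<theta> \<kappa> G k x) Q \<partial>count_space UNIV) (P / Q) \<partial>M)
      \<le> ennreal C * (\<integral>\<^sup>+x. epowr (\<integral>\<^sup>+j. epowr (G j x) Q \<partial>count_space UNIV) (P / Q) \<partial>M)"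
proof -
  define R where "R = P / Q"
  have R: "1 < R" using assms by (simp add: R_def)
  show thesis
  proof (rule finite_sum_T_bound[OF R])
  fix C assume C: "0 < C" "\<And>I (w :: nat \<times> nat \<times> nat \<Rightarrow> real) l g \<Gamma> c. \<lbrakk>finite I; \<And>i. i \<in> I \<Longrightarrow> g i \<in> borel_measurable M;
      \<Gamma> \<in> borel_measurable M; \<And>i. i \<in> I \<Longrightarrow> 0 \<le> w i; 0 \<le> c; \<And>i x. i \<in> I \<Longrightarrow> g i x \<le> \<Gamma> x;
      \<And>x. (\<Sum>i\<in>I. ennreal (w i) * g i x) \<le> ennreal c * \<Gamma> x\<rbrakk> \<Longrightarrow>
    (\<integral>\<^sup>+x. epowr (\<Sum>i\<in>I. ennreal (w i) * T (l i) (g i) x) R \<partial>M) \<le> ennreal (C * c powr R) * (\<integral>\<^sup>+x. epowr (\<Gamma> x) R \<partial>M)"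
  define V where "V = 1 + wt \<theta> \<kappa>"
  have V: "0 < V" "wt \<theta> \<kappa> \<le> V" using wt_pos[of \<theta> \<kappa>] assms by (auto simp: V_def)
  define W where "W = wt \<theta> \<kappa> powr (Q - 1)"
  have W: "0 < W" using wt_pos[of \<theta> \<kappa>] assms by (simp add: W_def)
  define E where "E = W powr R * (C * V powr R)"
  have E: "0 < E" using C V W by (simp add: E_def)
  show thesis
  proof (rule that[OF E])
    fix G :: "nat \<Rightarrow> 'a \<Rightarrow> ennreal" assume G[measurable]: "\<And>j. G j \<in> borel_measurable M"
    define g where "g j x = epowr (G j x) Q" for j x
    have g[measurable]: "g j \<in> borel_measurable M" for j unfolding g_def[abs_def] by measurable
    define \<Gamma> where "\<Gamma> x = (\<integral>\<^sup>+j. g j x \<partial>count_space UNIV)" for x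
    have [measurable]: "\<Gamma> \<in> borel_measurable M"
      unfolding \<Gamma>_def[abs_def] by (intro measurable_nn_integral_count_space) auto
    define w where "w q = \<theta> powr \<bar>real (fst (snd q)) - real (fst q)\<bar> * \<kappa> ^ snd (snd q)" for q :: "nat \<times> nat \<times> nat"
    define l where "l q = int (min (fst (snd q)) (fst q)) - int (snd (snd q))" for q :: "nat \<times> nat \<times> nat"
    have w: "0 \<le> w q" "ennreal (w (k, p)) = geo \<theta> k (fst p) * ennreal (\<kappa> ^ snd p)" for q k p
      using assms by (auto simp: w_def geo_def ennreal_mult)
    define f where "f x q = ennreal (w q) * T (l q) (g (fst (snd q))) x" for x q
    define U where "U x = (\<integral>\<^sup>+q. f x q \<partial>count_space UNIV)" for x
    have U_eq: "(\<integral>\<^sup>+k. (\<integral>\<^sup>+p. geo \<theta> k (fst p) * ennreal (\<kappa> ^ snd p) *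
         T (int (min (fst p) k) - int (snd p)) (g (fst p)) x \<partial>count_space UNIV) \<partial>count_space UNIV) = U x" for x
      unfolding U_def by (subst nn_integral_fst_count_space[symmetric]) (simp add: f_def w l_def)
    define J where "J n = {..n} \<times> ({..n} \<times> {..n})" for n :: nat
    have J: "finite (J n)" for n by (simp add: J_def)
    have UJ: "U x = (SUP n. \<Sum>q\<in>J n. f x q)" for x
    proof -
      have "f x q = (SUP n. f x q * indicator (J n) q)" for q
      proof (rule antisym)
        define n where "n = max (fst q) (max (fst (snd q)) (snd (snd q)))"
        have "q \<in> J n" by (cases q) (auto simp: J_def n_def)
        then show "f x q \<le> (SUP n. f x q * indicator (J n) q)" by (intro SUP_upper2[of n]) auto
        show "(SUP n. f x q * indicator (J n) q) \<le> f x q" by (intro SUP_least) (auto split: split_indicator)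
      qed
      then have "U x = (\<integral>\<^sup>+q. (SUP n. f x q * indicator (J n) q) \<partial>count_space UNIV)" unfolding U_def by (rule nn_integral_cong)
      also have "\<dots> = (SUP n. \<integral>\<^sup>+q. f x q * indicator (J n) q \<partial>count_space UNIV)"
        by (intro nn_integral_monotone_convergence_SUP) (auto simp: incseq_def le_fun_def J_def intro!: mult_left_mono split: split_indicator)
      also have "\<dots> = (SUP n. \<Sum>q\<in>J n. f x q)"
        using J by (simp add: nn_integral_count_space_indicator[symmetric] nn_integral_count_space_finite)
      finally show ?thesis .
    qed
    have fin: "(\<integral>\<^sup>+x. epowr (\<Sum>q\<in>J n. f x q) R \<partial>M) \<le> ennreal (C * V powr R) * (\<integral>\<^sup>+x. epowr (\<Gamma> x) R \<partial>M)" for n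
      unfolding f_def
    proof (rule C(2)[OF J])
      show "g (fst (snd q)) x \<le> \<Gamma> x" for q :: "nat \<times> nat \<times> nat" and x
        unfolding \<Gamma>_def by (rule nn_integral_ge_point) simp
      fix x
      have "(\<Sum>q\<in>J n. ennreal (w q) * g (fst (snd q)) x) \<le> (\<integral>\<^sup>+q. ennreal (w q) * g (fst (snd q)) x \<partial>count_space UNIV)"
        using J by (subst nn_integral_count_space_finite[symmetric], simp)
          (auto simp: nn_integral_count_space_indicator[of "J n"] intro!: nn_integral_mono split: split_indicator)
      also have "\<dots> = (\<integral>\<^sup>+k. (\<integral>\<^sup>+p. geo \<theta> k (fst p) * ennreal (\<kappa> ^ snd p) * g (fst p) x \<partial>count_space UNIV) \<partial>count_space UNIV)"
        by (subst nn_integral_fst_count_space[symmetric]) (simp add: w)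
      also have "\<dots> \<le> ennreal (wt \<theta> \<kappa>) * \<Gamma> x"
        unfolding \<Gamma>_def by (rule weight_Schur[OF assms(1-4)])
      also have "\<dots> \<le> ennreal V * \<Gamma> x" using V by (intro mult_right_mono ennreal_leI) auto
      finally show "(\<Sum>q\<in>J n. ennreal (w q) * g (fst (snd q)) x) \<le> ennreal V * \<Gamma> x" .
    qed (use V w in auto)
    have fm[measurable]: "(\<lambda>x. f x q) \<in> borel_measurable M" for q unfolding f_def by measurable
    have Um[measurable]: "U \<in> borel_measurable M"
      unfolding U_def[abs_def] by (intro measurable_nn_integral_count_space) auto
    have "(\<integral>\<^sup>+x. epowr (U x) R \<partial>M) = (\<integral>\<^sup>+x. (SUP n. epowr (\<Sum>q\<in>J n. f x q) R) \<partial>M)"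
      unfolding UJ using R by (simp add: epowr_Sup)
    also have "\<dots> = (SUP n. \<integral>\<^sup>+x. epowr (\<Sum>q\<in>J n. f x q) R \<partial>M)"
      using R by (intro nn_integral_monotone_convergence_SUP)
        (auto simp: incseq_def le_fun_def J_def intro!: epowr_mono sum_mono2)
    also have "\<dots> \<le> ennreal (C * V powr R) * (\<integral>\<^sup>+x. epowr (\<Gamma> x) R \<partial>M)"
      by (intro SUP_least fin)
    finally have U_bound: "(\<integral>\<^sup>+x. epowr (U x) R \<partial>M) \<le> ennreal (C * V powr R) * (\<integral>\<^sup>+x. epowr (\<Gamma> x) R \<partial>M)" .
    have "(\<integral>\<^sup>+x. epowr (\<integral>\<^sup>+k. epowr (HT \<theta> \<kappa> G k x) Q \<partial>count_space UNIV) R \<partial>M) \<le> (\<integral>\<^sup>+x. ennreal (W powr R) * epowr (U x) R \<partial>M)"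
    proof (rule nn_integral_mono)
      fix x
      have "(\<integral>\<^sup>+k. epowr (HT \<theta> \<kappa> G k x) Q \<partial>count_space UNIV) \<le> (\<integral>\<^sup>+k. ennreal W * (\<integral>\<^sup>+p. geo \<theta> k (fst p) * ennreal (\<kappa> ^ snd p) *
         T (int (min (fst p) k) - int (snd p)) (g (fst p)) x \<partial>count_space UNIV) \<partial>count_space UNIV)"
      proof (rule nn_integral_mono)
        fix k
        have "epowr (HT \<theta> \<kappa> G k x) Q \<le> ennreal W * (\<integral>\<^sup>+p. geo \<theta> k (fst p) * ennreal (\<kappa> ^ snd p) *
          epowr (T (int (min (fst p) k) - int (snd p)) (G (fst p)) x) Q \<partial>count_space UNIV)"
          unfolding W_def using assms by (intro HT_Jensen) auto
        also have "\<dots> \<le> ennreal W * (\<integral>\<^sup>+p. geo \<theta> k (fst p) * ennreal (\<kappa> ^ snd p) *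
          T (int (min (fst p) k) - int (snd p)) (g (fst p)) x \<partial>count_space UNIV)"
          unfolding T_def bl_def g_def using radius_pos assms
          by (intro mult_left_mono nn_integral_mono avg_ball_Jensen) auto
        finally show "epowr (HT \<theta> \<kappa> G k x) Q \<le> ennreal W * (\<integral>\<^sup>+p. geo \<theta> k (fst p) * ennreal (\<kappa> ^ snd p) *
          T (int (min (fst p) k) - int (snd p)) (g (fst p)) x \<partial>count_space UNIV)" .
      qed
      also have "\<dots> = ennreal W * U x" by (simp add: nn_integral_cmult U_eq)
      finally have "epowr (\<integral>\<^sup>+k. epowr (HT \<theta> \<kappa> G k x) Q \<partial>count_space UNIV) R \<le> epowr (ennreal W * U x) R"
        using R by (intro epowr_mono) auto
      then show "epowr (\<integral>\<^sup>+k. epowr (HT \<theta> \<kappa> G k x) Q \<partial>count_space UNIV) R \<le> ennreal (W powr R) * epowr (U x) R"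
        using R W by (simp add: epowr_mult epowr_ennreal)
    qed
    also have "\<dots> \<le> ennreal (W powr R) * (ennreal (C * V powr R) * (\<integral>\<^sup>+x. epowr (\<Gamma> x) R \<partial>M))"
      using U_bound by (simp add: nn_integral_cmult mult_left_mono)
    also have "\<dots> = ennreal E * (\<integral>\<^sup>+x. epowr (\<Gamma> x) R \<partial>M)"
      using C V W by (simp add: E_def ennreal_mult mult.assoc)
    finally show "(\<integral>\<^sup>+x. epowr (\<integral>\<^sup>+k. epowr (HT \<theta> \<kappa> G k x) Q \<partial>count_space UNIV) (P / Q) \<partial>M)
      \<le> ennreal E * (\<integral>\<^sup>+x. epowr (\<integral>\<^sup>+j. epowr (G j x) Q \<partial>count_space UNIV) (P / Q) \<partial>M)"
      by (simp add: R_def \<Gamma>_def g_def)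
  qed
qed
qed

theorem HT_TL:
  assumes "0 < \<theta>" "\<theta> < 1" "0 < \<kappa>" "\<kappa> < 1" "1 < P" "1 < Q"
  obtains C where "0 < C" "\<And>G. (\<And>j. G j \<in> borel_measurable M) \<Longrightarrow>
    (\<integral>\<^sup>+x. epowr (\<integral>\<^sup>+k. epowr (HT \<theta> \<kappa> G k x) Q \<partial>count_space UNIV) (P / Q) \<partial>M)
      \<le> ennreal C * (\<integral>\<^sup>+x. epowr (\<integral>\<^sup>+j. epowr (G j x) Q \<partial>count_space UNIV) (P / Q) \<partial>M)"
proof (cases P Q rule: linorder_cases)
  case less
  then show thesis using HT_TL_less[OF assms(1-5)] that by blast
next
  case greater
  then show thesis using HT_TL_greater[OF assms(1-4,6)] that by blast
next
  case equal
  obtain D where D: "0 < D" "\<And>G. (\<And>j. G j \<in> borel_measurable M) \<Longrightarrow>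
    (\<integral>\<^sup>+k. (\<integral>\<^sup>+x. (\<integral>\<^sup>+p. geo \<theta> k (fst p) * ennreal (\<kappa> ^ snd p) *
       epowr (T (int (min (fst p) k) - int (snd p)) (G (fst p)) x) P \<partial>count_space UNIV) \<partial>M) \<partial>count_space UNIV)
     \<le> ennreal D * (\<integral>\<^sup>+x. (\<integral>\<^sup>+j. epowr (G j x) P \<partial>count_space UNIV) \<partial>M)"
    using HT_TL_diag[OF assms(1-5)] by blast
  define W where "W = wt \<theta> \<kappa> powr (P - 1)"
  have W: "0 < W" using wt_pos[of \<theta> \<kappa>] assms by (simp add: W_def)
  have "(\<integral>\<^sup>+x. (\<integral>\<^sup>+k. epowr (HT \<theta> \<kappa> G k x) P \<partial>count_space UNIV) \<partial>M)
      \<le> ennreal (W * D) * (\<integral>\<^sup>+x. (\<integral>\<^sup>+j. epowr (G j x) P \<partial>count_space UNIV) \<partial>M)"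
    if G[measurable]: "\<And>j. G j \<in> borel_measurable M" for G
  proof -
    have m: "(\<lambda>x. \<integral>\<^sup>+p. geo \<theta> k (fst p) * ennreal (\<kappa> ^ snd p) *
       epowr (T (int (min (fst p) k) - int (snd p)) (G (fst p)) x) P \<partial>count_space UNIV) \<in> borel_measurable M" for k
      by (intro measurable_nn_integral_count_space) auto
    have "(\<integral>\<^sup>+x. (\<integral>\<^sup>+k. epowr (HT \<theta> \<kappa> G k x) P \<partial>count_space UNIV) \<partial>M) = (\<integral>\<^sup>+k. (\<integral>\<^sup>+x. epowr (HT \<theta> \<kappa> G k x) P \<partial>M) \<partial>count_space UNIV)"
      by (rule nn_integral_count_space_nn_integral) auto
    also have "\<dots> \<le> (\<integral>\<^sup>+k. (\<integral>\<^sup>+x. ennreal W * (\<integral>\<^sup>+p. geo \<theta> k (fst p) * ennreal (\<kappa> ^ snd p) *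
       epowr (T (int (min (fst p) k) - int (snd p)) (G (fst p)) x) P \<partial>count_space UNIV) \<partial>M) \<partial>count_space UNIV)"
      unfolding W_def using assms by (intro nn_integral_mono HT_Jensen) auto
    also have "\<dots> = ennreal W * (\<integral>\<^sup>+k. (\<integral>\<^sup>+x. (\<integral>\<^sup>+p. geo \<theta> k (fst p) * ennreal (\<kappa> ^ snd p) *
       epowr (T (int (min (fst p) k) - int (snd p)) (G (fst p)) x) P \<partial>count_space UNIV) \<partial>M) \<partial>count_space UNIV)"
      using m by (simp add: nn_integral_cmult)
    also have "\<dots> \<le> ennreal W * (ennreal D * (\<integral>\<^sup>+x. (\<integral>\<^sup>+j. epowr (G j x) P \<partial>count_space UNIV) \<partial>M))"
      by (intro mult_left_mono D G) auto
    finally show ?thesis using W D by (simp add: ennreal_mult mult.assoc)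
  qed
  then show thesis using that[of "W * D"] W D assms equal by simp
qed

lemma T_le_esssup:
  assumes [measurable]: "g \<in> borel_measurable M"
  shows "T l g x \<le> esssup M g"
proof -
  define B where "B = bl l (idx l x)"
  have B: "emeasure M B = ennreal (V (C1 * \<delta> powi l) (z l (idx l x)))" "0 < V (C1 * \<delta> powi l) (z l (idx l x))"
    using radius_pos by (auto simp: B_def bl_def emeasure_qball intro: V_pos)
  have [measurable]: "B \<in> sets M" by (simp add: B_def)
  have "(\<integral>\<^sup>+u\<in>B. g u \<partial>M) \<le> (\<integral>\<^sup>+u\<in>B. esssup M g \<partial>M)"
    using esssup_AE[of g M] by (intro nn_integral_mono_AE) (auto elim!: eventually_mono split: split_indicator)
  also have "\<dots> = esssup M g * emeasure M B" by (simp add: nn_integral_cmult)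
  finally have "avg B g \<le> esssup M g * emeasure M B / emeasure M B"
    unfolding avg_def by (rule divide_right_mono_ennreal)
  also have "\<dots> = esssup M g"
    using B by (simp add: ennreal_divide_real mult.left_commute flip: ennreal_mult)
  finally show ?thesis by (simp add: T_def B_def)
qed

lemma HT_le_esssup:
  assumes "0 < \<kappa>" "\<kappa> < 1" and G: "\<And>j. G j \<in> borel_measurable M"
  shows "HT \<theta> \<kappa> G k x \<le> ennreal (1 / (1 - \<kappa>)) * (\<integral>\<^sup>+j. geo \<theta> k j * esssup M (G j) \<partial>count_space UNIV)"
proof -
  have "HT \<theta> \<kappa> G k x \<le> (\<integral>\<^sup>+p. geo \<theta> k (fst p) * ennreal (\<kappa> ^ snd p) * esssup M (G (fst p)) \<partial>count_space UNIV)"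
    unfolding HT_def by (intro nn_integral_mono mult_left_mono T_le_esssup G) auto
  then show ?thesis by (simp only: nn_integral_weight[OF assms(1,2), where b = "\<lambda>j. esssup M (G j)"])
qed

end

section \<open>The reproducing formula pointwise\<close>

context homogeneous_space
begin

lemma sigma_finite: "sigma_finite_measure M"
proof
  fix x :: 'a
  have "(\<Union>n. qball d x (real n)) = UNIV"
    using reals_Archimedean2 by (auto simp: qball_def)
  then show "\<exists>A. countable A \<and> A \<subseteq> sets M \<and> \<Union> A = space M \<and> (\<forall>a\<in>A. emeasure M a \<noteq> \<infinity>)"
    by (intro exI[of _ "range (\<lambda>n. qball d x (real n))"]) (auto simp: emeasure_qball)
qed

lemma measurable_kernel:
  assumes "L2_bounded_kernel M K"
  shows "(\<lambda>y. K x y) \<in> borel_measurable M" "(\<lambda>u. K u y) \<in> borel_measurable M"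
  using measurable_Pair2[of "\<lambda>(x, y). K x y" M M borel x] measurable_Pair1[of "\<lambda>(x, y). K x y" M M borel y] assms
  by (auto simp: L2_bounded_kernel_def)

text \<open>Within a cell y moves by at most D R, which changes R + d x y by a bounded factor
  only.\<close>

lemma W_shift:
  assumes "0 < R" "0 \<le> e" "d y y' \<le> D * R" "1 \<le> D"
  shows "W R e x y \<le> WC e (A0 * (2 + D)) * W R e x y'"
    and "R + d x y' \<le> A0 * (2 + D) * (R + d x y)"
proof -
  have K: "1 * 1 \<le> A0 * (2 + D)" using A0_ge_1 assms by (intro mult_mono) auto
  have "A0 * (d x y + d y y') \<le> A0 * (d x y + D * R)" using assms by (intro mult_left_mono) auto
  then have "R + d x y' \<le> R + A0 * (d x y + D * R)" using d_triangle[of x y' y] by linarith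
  also have "\<dots> \<le> A0 * R + A0 * (d x y + D * R)" using mult_right_mono[OF A0_ge_1, of R] assms by simp
  also have "\<dots> = A0 * (d x y + (1 + D) * R)" by (simp add: algebra_simps)
  also have "\<dots> \<le> A0 * ((2 + D) * (R + d x y))"
  proof (rule mult_left_mono)
    have "0 \<le> (1 + D) * d x y" "0 \<le> R" using assms by auto
    then show "d x y + (1 + D) * R \<le> (2 + D) * (R + d x y)" by (simp add: algebra_simps)
  qed simp
  finally show "R + d x y' \<le> A0 * (2 + D) * (R + d x y)" by (simp add: mult.assoc)
  then show "W R e x y \<le> WC e (A0 * (2 + D)) * W R e x y'"
    using assms K by (intro W_compare) auto
qed

text \<open>This covers the term \<open>k = 0\<close> of the reproducing formula.\<close>

lemma mean_kernel:
  fixes K :: "'a \<Rightarrow> 'a \<Rightarrow> complex"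
  assumes "0 < R" "0 < \<beta>" "0 < \<gamma>" "0 < C" "1 \<le> D"
    and K: "(\<lambda>(x, y). K x y) \<in> borel_measurable (M \<Otimes>\<^sub>M M)"
    and size: "\<And>x y. cmod (K x y) \<le> C * W R \<gamma> x y"
    and reg: "\<And>x x' y. d x x' \<le> (R + d x y) / (2 * A0) \<Longrightarrow>
       cmod (K x y - K x' y) \<le> C * (d x x' / (R + d x y)) powr \<beta> * W R \<gamma> x y"
    and E: "E \<in> sets M" "0 < emeasure M E" "emeasure M E < \<infinity>" "y \<in> E" "\<And>w. w \<in> E \<Longrightarrow> d w y \<le> D * R"
  defines "B \<equiv> A0 * (2 + D)"
  defines "H \<equiv> \<lambda>u. (\<integral>w\<in>E. K u w \<partial>M) / measure M E"
  shows "H \<in> borel_measurable M"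
    and "cmod (H u) \<le> C * B powr \<beta> * WC \<gamma> B * W R \<gamma> u y"
    and "d x u \<le> (R + d x y) / (2 * A0 * B) \<Longrightarrow>
       cmod (H u - H x) \<le> C * B powr \<beta> * WC \<gamma> B * (d x u / (R + d x y)) powr \<beta> * W R \<gamma> x y"
proof -
  have "1 * 1 \<le> A0 * (2 + D)" using A0_ge_1 assms by (intro mult_mono) auto
  then have B: "1 \<le> B" by (simp add: B_def)
  have wc: "0 < WC \<gamma> B" using B by (rule WC_pos)
  have B1: "1 \<le> B powr \<beta>" using B assms by (intro ge_one_powr_ge_zero) auto
  have m: "0 < measure M E" using E by (simp add: measure_def enn2real_positive_iff)
  have em: "emeasure M E = ennreal (measure M E)" using E by (intro emeasure_eq_ennreal_measure) auto
  interpret sigma_finite_measure M by (rule sigma_finite)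
  note [measurable] = E(1) K
  have meas[measurable]: "(\<lambda>w. K u w) \<in> borel_measurable M" for u
    using measurable_Pair2[OF K] by simp
  have shift: "W R \<gamma> u w \<le> WC \<gamma> B * W R \<gamma> u y" if "w \<in> E" for u w
    unfolding B_def using assms that by (intro W_shift(1)) auto
  have b: "cmod (indicator E w *\<^sub>R K u w) \<le> (C * (WC \<gamma> B * W R \<gamma> u y)) * indicator E w" for u w
  proof (cases "w \<in> E")
    case True
    have "cmod (K u w) \<le> C * W R \<gamma> u w" by (rule size)
    also have "\<dots> \<le> C * (WC \<gamma> B * W R \<gamma> u y)" using assms by (intro mult_left_mono shift True) auto
    finally show ?thesis using True by simp
  qed simp
  have nn: "(\<integral>\<^sup>+w. ennreal (c * indicator E w) \<partial>M) = ennreal (c * measure M E)" if "0 \<le> c" for c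
  proof -
    have "(\<integral>\<^sup>+w. ennreal (c * indicator E w) \<partial>M) = (\<integral>\<^sup>+w. ennreal c * indicator E w \<partial>M)"
      by (intro nn_integral_cong) (simp split: split_indicator)
    then show ?thesis using that by (simp add: nn_integral_cmult em ennreal_mult)
  qed
  have int: "integrable M (\<lambda>w. indicator E w *\<^sub>R K u w)" for u
  proof (rule integrableI_bounded)
    have "(\<integral>\<^sup>+w. ennreal (cmod (indicator E w *\<^sub>R K u w)) \<partial>M) \<le> (\<integral>\<^sup>+w. ennreal ((C * (WC \<gamma> B * W R \<gamma> u y)) * indicator E w) \<partial>M)"
      by (intro nn_integral_mono ennreal_leI b)
    also have "\<dots> < \<infinity>" using assms wc by (subst nn) auto
    finally show "(\<integral>\<^sup>+w. ennreal (norm (indicator E w *\<^sub>R K u w)) \<partial>M) < \<infinity>" .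
  qed measurable
  have avg: "cmod ((\<integral>w. F w \<partial>M) / measure M E) \<le> c" if "0 \<le> c" "\<And>w. cmod (F w) \<le> c * indicator E w" for F c
  proof -
    have "(\<integral>\<^sup>+w. ennreal (cmod (F w)) \<partial>M) \<le> ennreal (c * measure M E)"
      unfolding nn[OF that(1), symmetric] by (intro nn_integral_mono ennreal_leI that)
    then have "cmod (\<integral>w. F w \<partial>M) \<le> c * measure M E" using that m by (intro norm_integral_le_nn) auto
    then show ?thesis using m by (simp add: norm_divide field_simps)
  qed
  show "H \<in> borel_measurable M"
    unfolding H_def set_lebesgue_integral_def by measurable
  show "cmod (H u) \<le> C * B powr \<beta> * WC \<gamma> B * W R \<gamma> u y"
  proof -
    have "cmod (H u) \<le> C * (WC \<gamma> B * W R \<gamma> u y)"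
      unfolding H_def set_lebesgue_integral_def using assms wc by (intro avg b) auto
    also have "\<dots> = C * 1 * WC \<gamma> B * W R \<gamma> u y" by simp
    also have "\<dots> \<le> C * B powr \<beta> * WC \<gamma> B * W R \<gamma> u y"
      using assms wc B1 by (intro mult_right_mono mult_left_mono) auto
    finally show ?thesis .
  qed
  assume near: "d x u \<le> (R + d x y) / (2 * A0 * B)"
  have n: "0 < R + d x y" using assms by simp
  define c where "c = C * B powr \<beta> * WC \<gamma> B * (d x u / (R + d x y)) powr \<beta> * W R \<gamma> x y"
  have c: "0 \<le> c" using assms wc by (simp add: c_def)
  have "cmod (K x w - K u w) \<le> c" if w: "w \<in> E" for w
  proof -
    have nw: "0 < R + d x w" using assms by simp
    have le: "R + d x y \<le> B * (R + d x w)"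
      unfolding B_def using assms w by (intro W_shift(2)) auto
    then have le': "(R + d x y) / B \<le> R + d x w" using B by (simp add: field_simps)
    have "d x u \<le> ((R + d x y) / B) / (2 * A0)" using near by (simp add: field_simps)
    also have "\<dots> \<le> (R + d x w) / (2 * A0)" using le' by (intro divide_right_mono) auto
    finally have "cmod (K x w - K u w) \<le> C * (d x u / (R + d x w)) powr \<beta> * W R \<gamma> x w" by (rule reg)
    also have "\<dots> \<le> C * (B powr \<beta> * (d x u / (R + d x y)) powr \<beta>) * (WC \<gamma> B * W R \<gamma> x y)"
    proof (intro mult_mono)
      have "d x u / (R + d x w) \<le> B * (d x u / (R + d x y))"
        using mult_left_mono[OF le, of "d x u"] n nw by (simp add: field_simps)
      then have "(d x u / (R + d x w)) powr \<beta> \<le> (B * (d x u / (R + d x y))) powr \<beta>"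
        using assms nw by (intro powr_mono2) auto
      then show "(d x u / (R + d x w)) powr \<beta> \<le> B powr \<beta> * (d x u / (R + d x y)) powr \<beta>"
        by (simp only: powr_mult)
    qed (use assms shift w in auto)
    finally show ?thesis by (simp add: c_def mult_ac)
  qed
  then have "cmod (indicator E w *\<^sub>R K u w - indicator E w *\<^sub>R K x w) \<le> c * indicator E w" for w
    by (simp add: norm_minus_commute split: split_indicator)
  then have "cmod ((\<integral>w. indicator E w *\<^sub>R K u w - indicator E w *\<^sub>R K x w \<partial>M) / measure M E) \<le> c"
    by (rule avg[OF c])
  then show "cmod (H u - H x) \<le> C * B powr \<beta> * WC \<gamma> B * (d x u / (R + d x y)) powr \<beta> * W R \<gamma> x y"
    unfolding H_def set_lebesgue_integral_def c_def using int by (simp add: diff_divide_distrib)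
qed

end

context dyadic_system
begin

definition sample :: "nat \<Rightarrow> (nat \<Rightarrow> 'a \<Rightarrow> 'a \<Rightarrow> complex) \<Rightarrow> (('a \<Rightarrow> complex) \<Rightarrow> complex) \<Rightarrow> nat \<Rightarrow> 'a set \<Rightarrow> 'a \<Rightarrow> complex" where
  "sample N Q f k E y = (if k \<le> N then cmean M E (dist_apply Q k f) else dist_apply Q k f y)"

text \<open>All three kinds of terms become cell measure, times a kernel H paired with \<phi>, times
  one coefficient. H is the kernel at the sample point for k >= 1 and its mean over the cell for k =
  0; it is regular in the first variable, and has integral 0 for k > N.\<close>

lemma reproducing_term_kernel:
  assumes "0 < \<beta>" "0 < \<gamma>" "0 < CK"
  obtains c C where "0 < c" "c \<le> 1" "0 < C" "\<And>Qt Q N k \<alpha> m y f \<phi>. reproducing_kernels M d A0 \<delta> \<beta> \<gamma> CK N Qt \<Longrightarrow>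
    cells (int k) \<alpha> m \<Longrightarrow> y \<in> S (int k) \<alpha> m \<Longrightarrow>
    \<exists>H. H \<in> borel_measurable M \<and> (\<forall>u. cmod (H u) \<le> C * W (\<delta> ^ k) \<gamma> u y) \<and>
      (\<forall>u x. d x u \<le> c * (\<delta> ^ k + d x y) \<longrightarrow> cmod (H u - H x) \<le> C * (d x u / (\<delta> ^ k + d x y)) powr \<beta> * W (\<delta> ^ k) \<gamma> x y) \<and>
      (N < k \<longrightarrow> (\<integral>u. H u \<partial>M) = 0) \<and>
      reproducing_term M Q Qt N k (S (int k) \<alpha> m) y f \<phi> =
        complex_of_real (measure M (S (int k) \<alpha> m)) * (\<integral>u. H u * \<phi> u \<partial>M) * sample N Q f k (S (int k) \<alpha> m) y"
proof -
  obtain D where D: "1 \<le> D" "\<And>k \<alpha> m x y. cells (int k) \<alpha> m \<Longrightarrow> x \<in> S (int k) \<alpha> m \<Longrightarrow> y \<in> S (int k) \<alpha> m \<Longrightarrow> d x y \<le> D * \<delta> ^ k"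
    "\<And>k \<alpha> m. cells (int k) \<alpha> m \<Longrightarrow> 0 < emeasure M (S (int k) \<alpha> m) \<and> emeasure M (S (int k) \<alpha> m) < \<infinity>"
    using subcube_size by metis
  define B where "B = A0 * (2 + D)"
  have "1 * 1 \<le> A0 * (2 + D)" using A0_ge_1 D(1) by (intro mult_mono) auto
  then have B: "1 \<le> B" by (simp add: B_def)
  have wc: "0 < WC \<gamma> B" using B by (rule WC_pos)
  define C0' where "C0' = CK * C\<mu>"
  have C0': "0 < C0'" using assms C\<mu>_pos by (simp add: C0'_def)
  define C where "C = C0' * (1 + B powr \<beta> * WC \<gamma> B)"
  have C: "0 < C" "C0' \<le> C" "C0' * B powr \<beta> * WC \<gamma> B \<le> C"
    using C0' wc B by (auto simp: C_def algebra_simps intro: add_pos_pos)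
  \<comment> \<open>Smaller than the 1 / (2 A0) of the hypothesis by the factor B: for the mean over
    the cell, closeness measured at y must imply closeness measured at every other point w of the
    cell.\<close>
  define c where "c = 1 / (2 * A0 * B)"
  have "1 * 1 \<le> (2 * A0) * B" using A0_ge_1 B by (intro mult_mono) auto
  then have c: "0 < c" "c \<le> 1" using B by (auto simp: c_def)
  have c': "c \<le> 1 / (2 * A0)"
    unfolding c_def using B A0_ge_1 mult_left_mono[OF B, of "2 * A0"] by (intro divide_left_mono) auto
  show thesis
  proof (rule that[OF c C(1)])
    fix Qt Q :: "nat \<Rightarrow> 'a \<Rightarrow> 'a \<Rightarrow> complex" and N k \<alpha> m y f \<phi>
    assume rk: "reproducing_kernels M d A0 \<delta> \<beta> \<gamma> CK N Qt" and cell: "cells (int k) \<alpha> m" and y: "y \<in> S (int k) \<alpha> m"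
    define E where "E = S (int k) \<alpha> m"
    define R where "R = \<delta> ^ k"
    have R: "0 < R" using delta by (simp add: R_def)
    have L2: "L2_bounded_kernel M (Qt k)" using rk by (simp add: reproducing_kernels_def)
    have size: "cmod (Qt k x w) \<le> C0' * W R \<gamma> x w" for x w
    proof -
      have "cmod (Qt k x w) \<le> CK * poly_bound M d \<gamma> R x w" using rk unfolding reproducing_kernels_def R_def by blast
      also have "\<dots> \<le> CK * (C\<mu> * W R \<gamma> x w)" using assms R by (intro mult_left_mono poly_bound_le_W) auto
      finally show ?thesis by (simp add: C0'_def mult.assoc)
    qed
    have reg: "cmod (Qt k x w - Qt k x' w) \<le> C0' * (d x x' / (R + d x w)) powr \<beta> * W R \<gamma> x w"
      if "d x x' \<le> (R + d x w) / (2 * A0)" for x x' w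
    proof -
      have "cmod (Qt k x w - Qt k x' w) \<le> CK * (d x x' / (R + d x w)) powr \<beta> * poly_bound M d \<gamma> R x w"
        using rk that unfolding reproducing_kernels_def R_def by blast
      also have "\<dots> \<le> CK * (d x x' / (R + d x w)) powr \<beta> * (C\<mu> * W R \<gamma> x w)"
        using assms R by (intro mult_left_mono poly_bound_le_W) auto
      finally show ?thesis by (simp add: C0'_def mult_ac)
    qed
    have E: "E \<in> sets M" "0 < emeasure M E" "emeasure M E < \<infinity>" "y \<in> E" "\<And>w. w \<in> E \<Longrightarrow> d w y \<le> D * R"
      using subcube_measurable[OF cell] D(3)[OF cell] y D(2)[OF cell _ y] by (auto simp: E_def R_def)
    have m: "0 < measure M E" using E by (simp add: measure_def enn2real_positive_iff)
    have near: "d x u \<le> (R + d x y) / (2 * A0)" "d x u \<le> (R + d x y) / (2 * A0 * B)" if "d x u \<le> c * (R + d x y)" for x u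
    proof -
      have "c * (R + d x y) \<le> 1 / (2 * A0) * (R + d x y)" using R c' by (intro mult_right_mono) auto
      then show "d x u \<le> (R + d x y) / (2 * A0)" using that by simp
      show "d x u \<le> (R + d x y) / (2 * A0 * B)" using that by (simp add: c_def)
    qed
    have up: "X \<le> C * Z" if "X \<le> c' * Z" "c' \<le> C" "0 \<le> Z" for X Z c'
      using that mult_right_mono by (meson order_trans)
    show "\<exists>H. H \<in> borel_measurable M \<and> (\<forall>u. cmod (H u) \<le> C * W (\<delta> ^ k) \<gamma> u y) \<and>
      (\<forall>u x. d x u \<le> c * (\<delta> ^ k + d x y) \<longrightarrow> cmod (H u - H x) \<le> C * (d x u / (\<delta> ^ k + d x y)) powr \<beta> * W (\<delta> ^ k) \<gamma> x y) \<and>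
      (N < k \<longrightarrow> (\<integral>u. H u \<partial>M) = 0) \<and>
      reproducing_term M Q Qt N k (S (int k) \<alpha> m) y f \<phi> =
        complex_of_real (measure M (S (int k) \<alpha> m)) * (\<integral>u. H u * \<phi> u \<partial>M) * sample N Q f k (S (int k) \<alpha> m) y"
      unfolding R_def[symmetric] E_def[symmetric]
    proof (cases "k = 0")
      case False
      have 1: "cmod (Qt k u y) \<le> C * W R \<gamma> u y" for u by (rule up[OF size C(2)]) simp
      have 2: "cmod (Qt k u y - Qt k x y) \<le> C * (d x u / (R + d x y)) powr \<beta> * W R \<gamma> x y"
        if "d x u \<le> c * (R + d x y)" for x u
      proof -
        have "cmod (Qt k u y - Qt k x y) \<le> C0' * ((d x u / (R + d x y)) powr \<beta> * W R \<gamma> x y)"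
          using reg[OF near(1)[OF that]] by (simp add: norm_minus_commute mult.assoc)
        from up[OF this C(2)] show ?thesis by (simp add: mult.assoc)
      qed
      have 3: "N < k \<longrightarrow> (\<integral>u. Qt k u y \<partial>M) = 0" using rk by (auto simp: reproducing_kernels_def)
      show "\<exists>H. H \<in> borel_measurable M \<and> (\<forall>u. cmod (H u) \<le> C * W R \<gamma> u y) \<and>
      (\<forall>u x. d x u \<le> c * (R + d x y) \<longrightarrow> cmod (H u - H x) \<le> C * (d x u / (R + d x y)) powr \<beta> * W R \<gamma> x y) \<and>
      (N < k \<longrightarrow> (\<integral>u. H u \<partial>M) = 0) \<and>
      reproducing_term M Q Qt N k E y f \<phi> =
        complex_of_real (measure M E) * (\<integral>u. H u * \<phi> u \<partial>M) * sample N Q f k E y"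
        using False 1 2 3 measurable_kernel(2)[OF L2]
        by (intro exI[of _ "\<lambda>u. Qt k u y"]) (auto simp: reproducing_term_def sample_def)
    next
      case True
      define H where "H u = (\<integral>w\<in>E. Qt k u w \<partial>M) / measure M E" for u
      have jm: "(\<lambda>(x, y). Qt k x y) \<in> borel_measurable (M \<Otimes>\<^sub>M M)" using L2 by (simp add: L2_bounded_kernel_def)
      have mk1: "H \<in> borel_measurable M"
        unfolding H_def by (rule mean_kernel(1)[where y = y]) (rule R assms(1,2) C0' D(1) jm size E reg | assumption)+
      have mk2: "cmod (H u) \<le> C0' * B powr \<beta> * WC \<gamma> B * W R \<gamma> u y" for u
        unfolding H_def B_def by (rule mean_kernel(2)) (rule R assms(1,2) C0' D(1) jm size E reg | assumption)+
      have mk3: "cmod (H u - H x) \<le> C0' * B powr \<beta> * WC \<gamma> B * (d x u / (R + d x y)) powr \<beta> * W R \<gamma> x y"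
        if "d x u \<le> (R + d x y) / (2 * A0 * B)" for x u
        using that unfolding H_def B_def
        by (intro mean_kernel(3)) (rule R assms(1,2) C0' D(1) jm size E reg | assumption)+
      have 1: "cmod (H u) \<le> C * W R \<gamma> u y" for u by (rule up[OF mk2 C(3)]) simp
      have 2: "cmod (H u - H x) \<le> C * (d x u / (R + d x y)) powr \<beta> * W R \<gamma> x y"
        if "d x u \<le> c * (R + d x y)" for x u
      proof -
        have "cmod (H u - H x) \<le> (C0' * B powr \<beta> * WC \<gamma> B) * ((d x u / (R + d x y)) powr \<beta> * W R \<gamma> x y)"
          using mk3[OF near(2)[OF that]] by (simp add: mult.assoc)
        from up[OF this C(3)] show ?thesis by (simp add: mult.assoc)
      qed
      have 4: "(\<integral>x. (\<integral>w\<in>E. Qt 0 x w \<partial>M) * \<phi> x \<partial>M) = complex_of_real (measure M E) * (\<integral>u. H u * \<phi> u \<partial>M)"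
      proof -
        have "(\<integral>x. (\<integral>w\<in>E. Qt 0 x w \<partial>M) * \<phi> x \<partial>M) = (\<integral>u. complex_of_real (measure M E) * (H u * \<phi> u) \<partial>M)"
          using m True by (intro Bochner_Integration.integral_cong) (auto simp: H_def)
        then show ?thesis by simp
      qed
      show "\<exists>H. H \<in> borel_measurable M \<and> (\<forall>u. cmod (H u) \<le> C * W R \<gamma> u y) \<and>
      (\<forall>u x. d x u \<le> c * (R + d x y) \<longrightarrow> cmod (H u - H x) \<le> C * (d x u / (R + d x y)) powr \<beta> * W R \<gamma> x y) \<and>
      (N < k \<longrightarrow> (\<integral>u. H u \<partial>M) = 0) \<and>
      reproducing_term M Q Qt N k E y f \<phi> =
        complex_of_real (measure M E) * (\<integral>u. H u * \<phi> u \<partial>M) * sample N Q f k E y"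
        using True 1 2 4 mk1 by (intro exI[of _ H]) (auto simp: reproducing_term_def sample_def)
    qed
  qed
qed

text \<open>For k < k' the cancellation of P_k' gives the gain, for k > N and k >= k' that of the
  reproducing kernel. The restrictions on t come from the regularity of the reproducing kernel
  (\<beta>), its decay (\<gamma>) and the regularity of P_k' (\<eta>).\<close>

lemma reproducing_term_bound:
  assumes P: "exp_IATI M d \<delta> A' z' \<eta> P" and e: "0 < \<beta>" "0 < \<gamma>" "0 < t" "t < \<gamma>" "t \<le> \<beta>" "t \<le> \<eta>" "0 < CK"
  obtains C where "0 < C" "\<And>Qt Q k' x k \<alpha> m y f. reproducing_kernels M d A0 \<delta> \<beta> \<gamma> CK N Qt \<Longrightarrow>
    cells (int k) \<alpha> m \<Longrightarrow> y \<in> S (int k) \<alpha> m \<Longrightarrow>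
    cmod (reproducing_term M Q Qt N k (S (int k) \<alpha> m) y f (P k' x)) \<le>
      C * \<delta> powr (t * \<bar>real k - real k'\<bar>) * W (\<delta> ^ min k k') \<gamma> x y *
        (measure M (S (int k) \<alpha> m) * cmod (sample N Q f k (S (int k) \<alpha> m) y))"
proof (rule reproducing_term_kernel[OF e(1,2,7)])
  fix c CH assume H: "0 < c" "c \<le> 1" "0 < CH" "\<And>Qt Q N k \<alpha> m y f \<phi>. reproducing_kernels M d A0 \<delta> \<beta> \<gamma> CK N Qt \<Longrightarrow>
    cells (int k) \<alpha> m \<Longrightarrow> y \<in> S (int k) \<alpha> m \<Longrightarrow>
    \<exists>H. H \<in> borel_measurable M \<and> (\<forall>u. cmod (H u) \<le> CH * W (\<delta> ^ k) \<gamma> u y) \<and>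
      (\<forall>u x. d x u \<le> c * (\<delta> ^ k + d x y) \<longrightarrow> cmod (H u - H x) \<le> CH * (d x u / (\<delta> ^ k + d x y)) powr \<beta> * W (\<delta> ^ k) \<gamma> x y) \<and>
      (N < k \<longrightarrow> (\<integral>u. H u \<partial>M) = 0) \<and>
      reproducing_term M Q Qt N k (S (int k) \<alpha> m) y f \<phi> =
        complex_of_real (measure M (S (int k) \<alpha> m)) * (\<integral>u. H u * \<phi> u \<partial>M) * sample N Q f k (S (int k) \<alpha> m) y"
  \<comment> \<open>The order of decay that \<open>almost_orthogonal_fine\<close> asks of the finer
    function.\<close>
  have L: "0 \<le> \<gamma> + \<beta>" using e by simp
  obtain CP where CP: "0 < CP" "\<And>k x y. cmod (P k x y) \<le> CP * W (\<delta> ^ k) (\<gamma> + \<beta>) x y"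
    "\<And>k x y y'. d y y' \<le> \<delta> ^ k \<Longrightarrow>
        cmod (P k x y - P k x y') \<le> CP * (d y y' / \<delta> ^ k) powr \<eta> * W (\<delta> ^ k) (\<gamma> + \<beta>) x y"
    using exp_IATI_W_bounds[OF P delta L] by metis
  have CP': "cmod (P k x y) \<le> CP * W (\<delta> ^ k) \<gamma> x y" for k x y
    using order_trans[OF CP(2) mult_left_mono[OF W_mono_exp]] CP(1) e delta by simp
  have CPr: "cmod (P k x u - P k x y) \<le> CP * (d y u / \<delta> ^ k) powr t * W (\<delta> ^ k) \<gamma> x y" if "d y u \<le> \<delta> ^ k" for k x y u
  proof -
    have "cmod (P k x y - P k x u) \<le> CP * (d y u / \<delta> ^ k) powr \<eta> * W (\<delta> ^ k) (\<gamma> + \<beta>) x y"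
      by (rule CP(3)[OF that])
    also have "\<dots> \<le> CP * (d y u / \<delta> ^ k) powr t * W (\<delta> ^ k) \<gamma> x y"
      using CP(1) e delta that by (intro mult_mono mult_left_mono powr_mono' W_mono_exp) auto
    finally show ?thesis by (simp add: norm_minus_commute)
  qed
  have Pm: "P k x \<in> borel_measurable M" for k x
    using measurable_kernel(1)[of "P k" x] P by (simp add: exp_IATI_def)
  have P0: "(\<integral>u. P k x u \<partial>M) = 0" if "1 \<le> k" for k x using P that by (simp add: exp_IATI_def)
  show thesis
  proof (rule almost_orthogonal_fine[OF e(1,2) H(1,2)])
  fix C1' assume AO1: "0 < C1'" "\<And>r R x y \<phi> H C1 C2. \<lbrakk>0 < r; r \<le> R; 0 \<le> C1; 0 \<le> C2;
      \<phi> \<in> borel_measurable M; H \<in> borel_measurable M;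
      \<And>u. cmod (\<phi> u) \<le> C1 * W r (\<gamma> + \<beta>) x u; (\<integral>u. \<phi> u \<partial>M) = 0;
      \<And>u. cmod (H u) \<le> C2 * W R \<gamma> u y;
      \<And>u. d x u \<le> c * (R + d x y) \<Longrightarrow>
         cmod (H u - H x) \<le> C2 * (d x u / (R + d x y)) powr \<beta> * W R \<gamma> x y\<rbrakk>
    \<Longrightarrow> cmod (\<integral>u. H u * \<phi> u \<partial>M) \<le> C1' * C1 * C2 * (r / R) powr \<beta> * W R \<gamma> x y"
  show thesis
  proof (rule almost_orthogonal_coarse[OF e(2,3,4)])
  fix C2' assume AO2: "0 < C2'" "\<And>r R x y \<phi> H C1 C2. \<lbrakk>0 < R; R \<le> r; 0 \<le> C1; 0 \<le> C2;
      \<phi> \<in> borel_measurable M; H \<in> borel_measurable M;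
      \<And>u. cmod (\<phi> u) \<le> C1 * W r \<gamma> x u;
      \<And>u. d y u \<le> r \<Longrightarrow> cmod (\<phi> u - \<phi> y) \<le> C1 * (d y u / r) powr t * W r \<gamma> x y;
      \<And>u. cmod (H u) \<le> C2 * W R \<gamma> u y; (\<integral>u. H u \<partial>M) = 0\<rbrakk>
    \<Longrightarrow> cmod (\<integral>u. H u * \<phi> u \<partial>M) \<le> C2' * C1 * C2 * (R / r) powr t * W r \<gamma> x y"
  show thesis
  proof (rule almost_orthogonal_size[OF e(2)])
  fix C3' assume AO3: "0 < C3'" "\<And>r R x y \<phi> H C1 C2. \<lbrakk>0 < R; R \<le> r; 0 \<le> C1; 0 \<le> C2;
      \<And>u. cmod (\<phi> u) \<le> C1 * W r \<gamma> x u; \<And>u. cmod (H u) \<le> C2 * W R \<gamma> u y\<rbrakk>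
    \<Longrightarrow> cmod (\<integral>u. H u * \<phi> u \<partial>M) \<le> C3' * C1 * C2 * W r \<gamma> x y"
  \<comment> \<open>In the case k' <= k <= N nothing cancels. There |k - k'| <= N, so
    \<delta>^(t|k-k'|) is at least \<delta>^(tN), and dividing by that constant inserts the
    factor.\<close>
  define C4 where "C4 = C3' * \<delta> powr (- (t * real N))"
  define C where "C = (C1' + C2' + C4) * CP * CH"
  have pos: "0 < C4" "0 < CP * CH" using AO3 CP H delta by (auto simp: C4_def)
  have C: "0 < C" "C1' * CP * CH \<le> C" "C2' * CP * CH \<le> C" "C4 * CP * CH \<le> C"
    unfolding C_def using AO1(1) AO2(1) pos CP(1) H(3) by (auto intro!: mult_right_mono mult_pos_pos)
  have ratio: "(\<delta> ^ i / \<delta> ^ j) powr s = \<delta> powr (s * (real i - real j))" for i j s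
    using delta by (simp add: powr_diff powr_powr flip: powr_realpow) (simp add: powr_powr mult.commute flip: powr_diff)
  have bound: "cmod (\<integral>u. G u * P k' x u \<partial>M) \<le> C * \<delta> powr (t * \<bar>real k - real k'\<bar>) * W (\<delta> ^ min k k') \<gamma> x y"
    if G: "G \<in> borel_measurable M" "\<forall>u. cmod (G u) \<le> CH * W (\<delta> ^ k) \<gamma> u y"
      "\<forall>u x. d x u \<le> c * (\<delta> ^ k + d x y) \<longrightarrow> cmod (G u - G x) \<le> CH * (d x u / (\<delta> ^ k + d x y)) powr \<beta> * W (\<delta> ^ k) \<gamma> x y"
      "N < k \<longrightarrow> (\<integral>u. G u \<partial>M) = 0" for G k k' x y
  proof -
    consider "k < k'" | "k' \<le> k" "k \<le> N" | "k' \<le> k" "N < k" by linarith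
    then show ?thesis
    proof cases
      case 1
      have "cmod (\<integral>u. G u * P k' x u \<partial>M) \<le> C1' * CP * CH * (\<delta> ^ k' / \<delta> ^ k) powr \<beta> * W (\<delta> ^ k) \<gamma> x y"
        using G CP(1,2) H(3) delta 1 P0[of k' x] by (intro AO1(2) Pm) (auto intro: power_decreasing)
      also have "(\<delta> ^ k' / \<delta> ^ k) powr \<beta> \<le> \<delta> powr (t * \<bar>real k - real k'\<bar>)"
        unfolding ratio using 1 delta e by (intro powr_mono') (auto intro!: mult_right_mono)
      finally have "cmod (\<integral>u. G u * P k' x u \<partial>M) \<le> C1' * CP * CH * (\<delta> powr (t * \<bar>real k - real k'\<bar>) * W (\<delta> ^ k) \<gamma> x y)"
        using AO1(1) CP(1) H(3) by (simp add: mult_left_mono mult_right_mono mult.assoc)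
      also have "\<dots> \<le> C * (\<delta> powr (t * \<bar>real k - real k'\<bar>) * W (\<delta> ^ k) \<gamma> x y)"
        using C(2) by (intro mult_right_mono) auto
      finally show ?thesis using 1 by (simp add: min_def mult.assoc)
    next
      case 2
      have "cmod (\<integral>u. G u * P k' x u \<partial>M) \<le> C3' * CP * CH * W (\<delta> ^ k') \<gamma> x y"
        using G CP(1) CP' H(3) delta 2
        by (intro AO3(2)[where r = "\<delta> ^ k'" and R = "\<delta> ^ k" and ?C1.0 = CP and ?C2.0 = CH]) (auto intro: power_decreasing)
      also have "\<dots> \<le> C4 * CP * CH * (\<delta> powr (t * \<bar>real k - real k'\<bar>) * W (\<delta> ^ k') \<gamma> x y)"
      proof -
        have "\<delta> powr (t * real N) \<le> \<delta> powr (t * \<bar>real k - real k'\<bar>)"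
          using 2 delta e by (intro powr_mono') auto
        then have "1 \<le> \<delta> powr (- (t * real N)) * \<delta> powr (t * \<bar>real k - real k'\<bar>)"
          using delta by (simp add: powr_minus field_simps)
        then have "C3' * CP * CH * W (\<delta> ^ k') \<gamma> x y * 1 \<le> C3' * CP * CH * W (\<delta> ^ k') \<gamma> x y * (\<delta> powr (- (t * real N)) * \<delta> powr (t * \<bar>real k - real k'\<bar>))"
          using AO3(1) CP(1) H(3) by (intro mult_left_mono) auto
        then show ?thesis by (simp add: C4_def mult_ac)
      qed
      also have "\<dots> \<le> C * (\<delta> powr (t * \<bar>real k - real k'\<bar>) * W (\<delta> ^ k') \<gamma> x y)"
        using C(4) by (intro mult_right_mono) auto
      finally show ?thesis using 2 by (simp add: min.absorb2 mult.assoc)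
    next
      case 3
      have "cmod (\<integral>u. G u * P k' x u \<partial>M) \<le> C2' * CP * CH * (\<delta> ^ k / \<delta> ^ k') powr t * W (\<delta> ^ k') \<gamma> x y"
        using G CP(1) CP' CPr H(3) delta 3 by (intro AO2(2) Pm) (auto intro: power_decreasing)
      also have "(\<delta> ^ k / \<delta> ^ k') powr t = \<delta> powr (t * \<bar>real k - real k'\<bar>)"
        unfolding ratio using 3 by simp
      also have "C2' * CP * CH * \<delta> powr (t * \<bar>real k - real k'\<bar>) * W (\<delta> ^ k') \<gamma> x y \<le> C * \<delta> powr (t * \<bar>real k - real k'\<bar>) * W (\<delta> ^ k') \<gamma> x y"
        using C(3) by (intro mult_right_mono) auto
      finally show ?thesis using 3 by (simp add: min.absorb2)
    qed
  qed
  show thesis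
  proof (rule that[OF C(1)])
    fix Qt Q :: "nat \<Rightarrow> 'a \<Rightarrow> 'a \<Rightarrow> complex" and k' x k \<alpha> m y f
    assume "reproducing_kernels M d A0 \<delta> \<beta> \<gamma> CK N Qt" and cell: "cells (int k) \<alpha> m" and y: "y \<in> S (int k) \<alpha> m"
    from H(4)[OF this, of Q f "P k' x"] obtain G where G: "G \<in> borel_measurable M" "\<forall>u. cmod (G u) \<le> CH * W (\<delta> ^ k) \<gamma> u y"
      "\<forall>u x. d x u \<le> c * (\<delta> ^ k + d x y) \<longrightarrow> cmod (G u - G x) \<le> CH * (d x u / (\<delta> ^ k + d x y)) powr \<beta> * W (\<delta> ^ k) \<gamma> x y"
      "N < k \<longrightarrow> (\<integral>u. G u \<partial>M) = 0"
      "reproducing_term M Q Qt N k (S (int k) \<alpha> m) y f (P k' x) =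
        complex_of_real (measure M (S (int k) \<alpha> m)) * (\<integral>u. G u * P k' x u \<partial>M) * sample N Q f k (S (int k) \<alpha> m) y"
      by blast
    have "cmod (reproducing_term M Q Qt N k (S (int k) \<alpha> m) y f (P k' x)) =
      cmod (\<integral>u. G u * P k' x u \<partial>M) * (measure M (S (int k) \<alpha> m) * cmod (sample N Q f k (S (int k) \<alpha> m) y))"
      unfolding G(5) by (simp add: norm_mult mult_ac)
    also have "\<dots> \<le> (C * \<delta> powr (t * \<bar>real k - real k'\<bar>) * W (\<delta> ^ min k k') \<gamma> x y) * (measure M (S (int k) \<alpha> m) * cmod (sample N Q f k (S (int k) \<alpha> m) y))"
      by (intro mult_right_mono bound G) auto
    finally show "cmod (reproducing_term M Q Qt N k (S (int k) \<alpha> m) y f (P k' x)) \<le>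
      C * \<delta> powr (t * \<bar>real k - real k'\<bar>) * W (\<delta> ^ min k k') \<gamma> x y *
        (measure M (S (int k) \<alpha> m) * cmod (sample N Q f k (S (int k) \<alpha> m) y))" .
  qed
qed
qed
qed
qed

text \<open>With n = R + d x y, v = V n x and \<mu> the measure of the cell, (\<mu>/v)^r equals
  \<mu>/v times (v/\<mu>)^(1-r), and \<open>subcube_size\<close> bounds v/\<mu> by
  (n/\<delta>^k)^\<omega>. Writing n/\<delta>^k = (R/\<delta>^k)(n/R), the first factor is the loss
  between levels and the second lowers the decay to \<epsilon>. The free point u lets the kernel be
  moved under an integral over the cell.\<close>

lemma cell_kernel_power:
  assumes "0 < r" "r \<le> 1" "0 < \<gamma>" "0 < \<epsilon>" "\<epsilon> = \<gamma> * r - \<omega> * (1 - r)"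
  obtains C where "0 < C" "\<And>j k \<alpha> m x y u. j \<le> k \<Longrightarrow> cells (int k) \<alpha> m \<Longrightarrow> y \<in> S (int k) \<alpha> m \<Longrightarrow> u \<in> S (int k) \<alpha> m \<Longrightarrow>
    (W (\<delta> ^ j) \<gamma> x y * measure M (S (int k) \<alpha> m)) powr r \<le>
      C * (\<delta> ^ j / \<delta> ^ k) powr (\<omega> * (1 - r)) * W (\<delta> ^ j) \<epsilon> x u * measure M (S (int k) \<alpha> m)"
proof (rule subcube_size)
  fix D assume D: "1 \<le> D" "\<And>k \<alpha> m x y. cells (int k) \<alpha> m \<Longrightarrow> x \<in> S (int k) \<alpha> m \<Longrightarrow> y \<in> S (int k) \<alpha> m \<Longrightarrow> d x y \<le> D * \<delta> ^ k"
    "\<And>k \<alpha> m x y n. cells (int k) \<alpha> m \<Longrightarrow> y \<in> S (int k) \<alpha> m \<Longrightarrow> d x y \<le> n \<Longrightarrow> \<delta> ^ k \<le> n \<Longrightarrow>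
       V n x \<le> D * (n / \<delta> ^ k) powr \<omega> * measure M (S (int k) \<alpha> m)"
    "\<And>k \<alpha> m. cells (int k) \<alpha> m \<Longrightarrow> 0 < emeasure M (S (int k) \<alpha> m) \<and> emeasure M (S (int k) \<alpha> m) < \<infinity>"
  have "1 * 1 \<le> A0 * (2 + D)" using A0_ge_1 D(1) by (intro mult_mono) auto
  then have wc: "0 < WC \<epsilon> (A0 * (2 + D))" by (intro WC_pos) simp
  define C where "C = D powr (1 - r) * WC \<epsilon> (A0 * (2 + D))"
  have C: "0 < C" using D wc by (simp add: C_def)
  show thesis
  proof (rule that[OF C])
    fix j k \<alpha> m x y u assume jk: "j \<le> k" and c: "cells (int k) \<alpha> m" and y: "y \<in> S (int k) \<alpha> m" and u: "u \<in> S (int k) \<alpha> m"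
    define \<mu> where "\<mu> = measure M (S (int k) \<alpha> m)"
    define R where "R = \<delta> ^ j"
    define n where "n = R + d x y"
    define v where "v = V n x"
    define q where "q = \<omega> * (1 - r)"
    have R: "0 < R" "\<delta> ^ k \<le> R" using delta jk by (auto simp: R_def intro: power_decreasing)
    have n: "0 < n" "R \<le> n" "\<delta> ^ k \<le> n" using R by (auto simp: n_def intro: order_trans[OF R(2)])
    have \<mu>: "0 < \<mu>" using D(4)[OF c] by (simp add: \<mu>_def measure_def enn2real_positive_iff)
    have v: "0 < v" using V_pos[OF n(1)] by (simp add: v_def)
    have dk: "0 < \<delta> ^ k" using delta by simp
    have "v \<le> D * (n / \<delta> ^ k) powr \<omega> * \<mu>"
      unfolding v_def \<mu>_def
    proof (rule D(3)[OF c y])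
      show "d x y \<le> n" using R(1) by (simp add: n_def)
    qed (rule n(3))
    then have "v powr (1 - r) \<le> (D * (n / \<delta> ^ k) powr \<omega> * \<mu>) powr (1 - r)"
      using v assms by (intro powr_mono2) auto
    also have "\<dots> = D powr (1 - r) * (n / \<delta> ^ k) powr q * \<mu> powr (1 - r)"
      by (simp add: powr_mult powr_powr q_def)
    also have "(n / \<delta> ^ k) powr q = (R / \<delta> ^ k) powr q * (R / n) powr (- q)"
    proof -
      have "n / \<delta> ^ k = (R / \<delta> ^ k) * (n / R)" using R by simp
      moreover have "(n / R) powr q = (R / n) powr (- q)" using n R by (simp add: powr_minus powr_divide)
      ultimately show ?thesis by (simp only: powr_mult)
    qed
    finally have vr: "v powr (1 - r) \<le> D powr (1 - r) * ((R / \<delta> ^ k) powr q * (R / n) powr (- q)) * \<mu> powr (1 - r)" .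
    have "(W R \<gamma> x y * \<mu>) powr r = (R / n) powr (\<gamma> * r) * (\<mu> powr r * (1 / v powr r))"
      unfolding W_def n_def[symmetric] v_def[symmetric] using n R v \<mu> by (simp add: powr_mult powr_divide powr_powr)
    also have "1 / v powr r = v powr (1 - r) / v" using v by (simp add: powr_diff)
    also have "(R / n) powr (\<gamma> * r) * (\<mu> powr r * (v powr (1 - r) / v)) \<le>
       (R / n) powr (\<gamma> * r) * (\<mu> powr r * ((D powr (1 - r) * ((R / \<delta> ^ k) powr q * (R / n) powr (- q)) * \<mu> powr (1 - r)) / v))"
      using vr v by (intro mult_left_mono divide_right_mono) auto
    also have "\<dots> = D powr (1 - r) * (R / \<delta> ^ k) powr q * (((R / n) powr (\<gamma> * r) * (R / n) powr (- q)) / v) * (\<mu> powr r * \<mu> powr (1 - r))"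
      by simp
    also have "(R / n) powr (\<gamma> * r) * (R / n) powr (- q) = (R / n) powr \<epsilon>"
      by (simp add: assms(5) q_def flip: powr_add)
    also have "\<mu> powr r * \<mu> powr (1 - r) = \<mu>" using \<mu> by (simp flip: powr_add)
    also have "(R / n) powr \<epsilon> / v = W R \<epsilon> x y" by (simp add: W_def n_def v_def)
    also have "D powr (1 - r) * (R / \<delta> ^ k) powr q * W R \<epsilon> x y * \<mu> \<le> D powr (1 - r) * (R / \<delta> ^ k) powr q * (WC \<epsilon> (A0 * (2 + D)) * W R \<epsilon> x u) * \<mu>"
    proof (intro mult_right_mono mult_left_mono W_shift)
      have "d y u \<le> D * \<delta> ^ k" using D(2)[OF c y u] .
      also have "\<dots> \<le> D * R" using R D by (intro mult_left_mono) auto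
      finally show "d y u \<le> D * R" .
    qed (use R assms D \<mu> in auto)
    finally show "(W (\<delta> ^ j) \<gamma> x y * measure M (S (int k) \<alpha> m)) powr r \<le>
      C * (\<delta> ^ j / \<delta> ^ k) powr (\<omega> * (1 - r)) * W (\<delta> ^ j) \<epsilon> x u * measure M (S (int k) \<alpha> m)"
      by (simp add: C_def R_def \<mu>_def q_def mult_ac)
  qed
qed

text \<open>The rings of \<open>nn_integral_W_le\<close> have radii \<delta>^(j-i). Each ball about
  x is enlarged to the ball attached to the cube of x at that generation, which has comparable
  volume.\<close>

lemma nn_integral_W_le_T:
  assumes "0 < \<epsilon>"
  obtains C where "0 < C" "\<And>j x g. g \<in> borel_measurable M \<Longrightarrow>
    (\<integral>\<^sup>+u. ennreal (W (\<delta> ^ j) \<epsilon> x u) * g u \<partial>M) \<le>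
      ennreal C * (\<integral>\<^sup>+i. ennreal ((\<delta> powr \<epsilon>) ^ i) * T (int j - int i) g x \<partial>count_space UNIV)"
proof -
  define K where "K = 1 + 2 * A0 * C0 + C1"
  define B where "B = C\<mu> * (2 * A0 * K) powr \<omega>"
  have K: "1 \<le> K" using C0_pos C1_pos by (simp add: K_def)
  have B: "0 < B" using C\<mu>_pos K by (simp add: B_def)
  have le: "avg (qball d x (\<delta> powi l)) g \<le> ennreal B * T l g x" for l g x
  proof -
    define w where "w = z l (idx l x)"
    have wx: "d w x < 2 * A0 * C0 * \<delta> powi l" using cube_dist by (simp add: w_def)
    have sub: "qball d x (\<delta> powi l) \<subseteq> bl l (idx l x)"
    proof
      fix y assume "y \<in> qball d x (\<delta> powi l)"
      then have "d w x + d x y < (1 + 2 * A0 * C0) * \<delta> powi l" using wx by (simp add: qball_def algebra_simps)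
      then have "A0 * (d w x + d x y) < A0 * ((1 + 2 * A0 * C0) * \<delta> powi l)" by simp
      also have "\<dots> = C1 * \<delta> powi l" by (simp add: C1_def)
      finally have "A0 * (d w x + d x y) < C1 * \<delta> powi l" .
      then show "y \<in> bl l (idx l x)"
        using d_triangle[of w y x] unfolding bl_def w_def[symmetric] qball_def mem_Collect_eq by linarith
    qed
    have "V (C1 * \<delta> powi l) w \<le> B * V (\<delta> powi l) x"
      unfolding B_def
    proof (rule V_compare)
      show "C1 * \<delta> powi l \<le> K * \<delta> powi l" using C0_pos by (intro mult_right_mono) (auto simp: K_def)
      have "2 * A0 * C0 * \<delta> powi l \<le> K * \<delta> powi l" using C1_pos by (intro mult_right_mono) (auto simp: K_def)
      then show "d w x \<le> K * \<delta> powi l" using wx by linarith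
    qed (use K in auto)
    moreover have p: "0 < V (\<delta> powi l) x" "0 < V (C1 * \<delta> powi l) w" using C1_pos by (auto intro: V_pos)
    ultimately have "1 / V (\<delta> powi l) x \<le> B * (1 / V (C1 * \<delta> powi l) w)" by (simp add: field_simps)
    then have "avg (qball d x (\<delta> powi l)) g \<le> ennreal (B * (1 / V (C1 * \<delta> powi l) w)) * (\<integral>\<^sup>+u\<in>bl l (idx l x). g u \<partial>M)"
      unfolding avg_ball[OF delta_powi_pos] using sub
      by (intro mult_mono ennreal_leI nn_integral_mono) (auto split: split_indicator)
    also have "\<dots> = ennreal B * T l g x"
      using B p radius_pos(1)[of l] by (subst ennreal_mult) (auto simp: T_def bl_def avg_ball w_def mult.assoc)
    finally show ?thesis .
  qed
  define c where "c = \<delta> powr (- \<epsilon>) * (C\<mu> * \<delta> powr (- \<omega>))"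
  have c: "0 < c" using delta C\<mu>_pos by (simp add: c_def)
  show thesis
  proof (rule that[of "c * B"])
    show "0 < c * B" using c B by simp
    fix j x and g :: "'a \<Rightarrow> ennreal" assume [measurable]: "g \<in> borel_measurable M"
    have "(\<integral>\<^sup>+u. ennreal (W (\<delta> ^ j) \<epsilon> x u) * g u \<partial>M) \<le> ennreal c * (\<Sum>i. ennreal (\<delta> powr (\<epsilon> * real i)) *
       ((\<integral>\<^sup>+u\<in>qball d x (\<delta> ^ j / \<delta> ^ i). g u \<partial>M) / emeasure M (qball d x (\<delta> ^ j / \<delta> ^ i))))"
      unfolding c_def using delta assms by (intro nn_integral_W_le) auto
    also have "\<dots> \<le> ennreal c * (\<Sum>i. ennreal B * (ennreal ((\<delta> powr \<epsilon>) ^ i) * T (int j - int i) g x))"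
    proof (intro mult_left_mono suminf_le)
      fix i
      have e: "\<delta> ^ j / \<delta> ^ i = \<delta> powi (int j - int i)" using delta by (simp add: power_int_diff)
      have p: "\<delta> powr (\<epsilon> * real i) = (\<delta> powr \<epsilon>) ^ i" using delta by (simp add: powr_powr flip: powr_realpow)
      show "ennreal (\<delta> powr (\<epsilon> * real i)) * ((\<integral>\<^sup>+u\<in>qball d x (\<delta> ^ j / \<delta> ^ i). g u \<partial>M) / emeasure M (qball d x (\<delta> ^ j / \<delta> ^ i)))
        \<le> ennreal B * (ennreal ((\<delta> powr \<epsilon>) ^ i) * T (int j - int i) g x)"
        unfolding e p using mult_left_mono[OF le[of x "int j - int i" g], of "ennreal ((\<delta> powr \<epsilon>) ^ i)"]
        by (simp add: avg_def mult_ac)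
    qed auto
    also have "\<dots> = ennreal (c * B) * (\<integral>\<^sup>+i. ennreal ((\<delta> powr \<epsilon>) ^ i) * T (int j - int i) g x \<partial>count_space UNIV)"
      using c B by (simp add: nn_integral_count_space_nat ennreal_mult mult.assoc)
    finally show "(\<integral>\<^sup>+u. ennreal (W (\<delta> ^ j) \<epsilon> x u) * g u \<partial>M) \<le>
      ennreal (c * B) * (\<integral>\<^sup>+i. ennreal ((\<delta> powr \<epsilon>) ^ i) * T (int j - int i) g x \<partial>count_space UNIV)" .
  qed
qed

end

text \<open>If h is not integrable on E, the complex mean is 0 by the convention for Bochner
  integrals.\<close>

lemma cmean_le_abs_mean:
  assumes "0 < emeasure M E" "emeasure M E < \<infinity>"
  shows "ennreal (cmod (cmean M E h)) \<le> abs_mean M E h"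
proof -
  define m where "m = measure M E"
  have em: "emeasure M E = ennreal m" using assms by (simp add: m_def emeasure_eq_ennreal_measure)
  have m: "0 < m" using assms by (simp add: m_def measure_def enn2real_positive_iff)
  have "ennreal (cmod (\<integral>x\<in>E. h x \<partial>M)) \<le> (\<integral>\<^sup>+x\<in>E. ennreal (cmod (h x)) \<partial>M)"
  proof (cases "integrable M (\<lambda>x. indicator E x *\<^sub>R h x)")
    case True
    have "ennreal (cmod (\<integral>x\<in>E. h x \<partial>M)) \<le> (\<integral>\<^sup>+x. ennreal (cmod (indicator E x *\<^sub>R h x)) \<partial>M)"
      unfolding set_lebesgue_integral_def using integral_norm_bound_ennreal[OF True] .
    also have "\<dots> = (\<integral>\<^sup>+x\<in>E. ennreal (cmod (h x)) \<partial>M)"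
      by (intro nn_integral_cong) (simp split: split_indicator)
    finally show ?thesis .
  qed (simp add: set_lebesgue_integral_def not_integrable_integral_eq)
  then have "ennreal (1 / m) * ennreal (cmod (\<integral>x\<in>E. h x \<partial>M)) \<le> ennreal (1 / m) * (\<integral>\<^sup>+x\<in>E. ennreal (cmod (h x)) \<partial>M)"
    by (rule mult_left_mono) simp
  then show ?thesis
    using m by (simp add: cmean_def abs_mean_def em ennreal_divide_real norm_divide m_def[symmetric] flip: ennreal_mult)
qed

text \<open>For the levels k' <= N': a pointwise bound that is the same at all points of the cell
  survives averaging, because the r-th root can be taken before integrating.\<close>

lemma epowr_abs_mean_le:
  assumes [measurable]: "h \<in> borel_measurable M" "E \<in> sets M" and E: "0 < emeasure M E" "emeasure M E < \<infinity>"
    and r: "0 < r" and le: "\<And>u. u \<in> E \<Longrightarrow> epowr (c * ennreal (cmod (h u))) r \<le> B"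
  shows "epowr (c * abs_mean M E h) r \<le> B"
proof -
  define b where "b = epowr B (1 / r)"
  have b: "c * ennreal (cmod (h u)) \<le> b" if "u \<in> E" for u
    using epowr_mono[OF le[OF that], of "1 / r"] r by (simp add: b_def epowr_inverse)
  define m where "m = measure M E"
  have em: "emeasure M E = ennreal m" using E by (simp add: m_def emeasure_eq_ennreal_measure)
  have m: "0 < m" using E by (simp add: m_def measure_def enn2real_positive_iff)
  have "c * (\<integral>\<^sup>+x\<in>E. ennreal (cmod (h x)) \<partial>M) = (\<integral>\<^sup>+x. c * (ennreal (cmod (h x)) * indicator E x) \<partial>M)"
    by (rule nn_integral_cmult[symmetric]) measurable
  also have "\<dots> \<le> (\<integral>\<^sup>+x\<in>E. b \<partial>M)"
    using b by (intro nn_integral_mono) (auto split: split_indicator)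
  also have "\<dots> = b * ennreal m" by (simp add: nn_integral_cmult em)
  finally have "c * abs_mean M E h \<le> ennreal (1 / m) * (b * ennreal m)"
    using m by (simp add: abs_mean_def em ennreal_divide_real mult.left_commute[of c] mult_left_mono)
  also have "\<dots> = b" using m by (simp add: mult.left_commute[of _ b] flip: ennreal_mult)
  finally have "epowr (c * abs_mean M E h) r \<le> epowr b r" using r by (intro epowr_mono) auto
  then show ?thesis using r by (simp add: b_def epowr_inverse)
qed

context dyadic_system
begin

definition cellmean :: "nat \<Rightarrow> ('a \<Rightarrow> complex) \<Rightarrow> 'a \<Rightarrow> ennreal" where
  "cellmean k h x = cell_sum (int k) (\<lambda>\<alpha> m. abs_mean M (S (int k) \<alpha> m) h * indicator (S (int k) \<alpha> m) x)"

lemma cellmean_eq: "cells (int k) \<alpha> m \<Longrightarrow> x \<in> S (int k) \<alpha> m \<Longrightarrow> cellmean k h x = abs_mean M (S (int k) \<alpha> m) h"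
  unfolding cellmean_def by (rule cell_sum_point[where c = "\<lambda>\<alpha> m. abs_mean M (S (int k) \<alpha> m) h"])

lemma cellmean_measurable [measurable]: "cellmean k h \<in> borel_measurable M"
  unfolding cellmean_def[abs_def] by (intro cell_sum_measurable) measurable

text \<open>Low and high parts as one sequence: the weighted size of Q_k f, replaced by its cell
  means for k <= N. The weight is included for k <= N too, where the quantities have none; finitely
  many weights only change constants.\<close>

definition amp :: "(nat \<Rightarrow> 'a \<Rightarrow> 'a \<Rightarrow> complex) \<Rightarrow> nat \<Rightarrow> real \<Rightarrow> (('a \<Rightarrow> complex) \<Rightarrow> complex) \<Rightarrow> nat \<Rightarrow> 'a \<Rightarrow> ennreal" where
  "amp Q N s f k x = ennreal (\<delta> powr (- real k * s)) *
     (if k \<le> N then cellmean k (dist_apply Q k f) x else ennreal (cmod (dist_apply Q k f x)))"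

text \<open>All averages in \<open>HT\<close> at level k belong to generations at most k, and two
  points of a cell share their cubes of these generations.\<close>

lemma HT_cell_const:
  assumes "cells (int k) \<alpha> m" "x \<in> S (int k) \<alpha> m" "y \<in> S (int k) \<alpha> m"
  shows "HT \<theta> \<kappa> G k x = HT \<theta> \<kappa> G k y"
proof -
  have c: "\<alpha> \<in> A (int k)" "x \<in> cube (int k) \<alpha>" "y \<in> cube (int k) \<alpha>"
    using assms subcube[OF assms(1)] by blast+
  have "T (int (min j k) - int i) g x = T (int (min j k) - int i) g y" for i j g
    unfolding T_def by (subst idx_nested[OF _ c]) auto
  then show ?thesis by (simp add: HT_def)
qed

text \<open>The passage from the reproducing formula to \<open>HT\<close>. The constants must
  precede f although the sample points are adapted to f; this is possible because the kernel
  constant in \<open>calderon_index\<close> is chosen before the points.\<close>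

theorem pointwise_estimate:
  assumes Q: "exp_IATI M d \<delta> A zQ \<eta> Q" and P: "exp_IATI M d \<delta> A zP \<eta> P"
    and e: "0 < \<beta>" "\<beta> < \<eta>" "0 < \<gamma>" "\<gamma> < \<eta>"
    and cal: "calderon_index M d A0 \<delta> A Num S x0 \<eta> \<beta> \<gamma> Q N"
    and s: "- min \<beta> \<gamma> < s" "s < min \<beta> \<gamma>"
    and r: "0 < r" "r \<le> 1" "\<omega> * (1 - r) < r * min \<beta> \<gamma>" "\<omega> * (1 - r) < r * (min \<beta> \<gamma> + s)"
  obtains C \<theta> \<kappa> where "0 < C" "0 < \<theta>" "\<theta> < 1" "0 < \<kappa>" "\<kappa> < 1"
    "\<And>f k' x. f \<in> distributions M d A0 x0 \<eta> \<beta> \<gamma> \<Longrightarrow>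
       epowr (amp P N' s f k' x) r \<le> ennreal C * HT \<theta> \<kappa> (\<lambda>k x. epowr (amp Q N s f k x) r) k' x"
proof -
  have e': "\<beta> \<le> \<eta>" "\<gamma> \<le> \<eta>" using e by auto
  \<comment> \<open>The lower bounds on the order t of the gain: |s| < t beats the weight, and
    \<omega> (1-r) < r (t + s) beats the loss for k > k'. The hypotheses on r say exactly that such
    t exist below min \<beta> \<gamma>.\<close>
  define t0 where "t0 = max (max 0 \<bar>s\<bar>) (max (\<omega> * (1 - r) / r) (\<omega> * (1 - r) / r - s))"
  have "t0 < min \<beta> \<gamma>"
  proof -
    have "\<omega> * (1 - r) / r < min \<beta> \<gamma>" "\<omega> * (1 - r) / r < min \<beta> \<gamma> + s"
      using r(1,3,4) by (simp_all only: pos_divide_less_eq mult.commute[of r])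
    moreover have "0 < min \<beta> \<gamma>" "\<bar>s\<bar> < min \<beta> \<gamma>" using e s by linarith+
    ultimately show ?thesis unfolding t0_def by linarith
  qed
  then obtain t where t: "t0 < t" "t < min \<beta> \<gamma>" using dense by blast
  have t': "0 < t" "\<bar>s\<bar> < t" "\<omega> * (1 - r) < r * (t + s)" "t < \<gamma>" "t \<le> \<beta>" "t \<le> \<eta>"
    using t e r(1) unfolding t0_def by (auto simp: field_simps)
  define \<epsilon> where "\<epsilon> = \<gamma> * r - \<omega> * (1 - r)"
  have "r * min \<beta> \<gamma> \<le> r * \<gamma>" using r by (intro mult_left_mono) auto
  then have "\<omega> * (1 - r) < r * \<gamma>" using r(3) by linarith
  then have \<epsilon>: "0 < \<epsilon>" by (simp add: \<epsilon>_def mult.commute)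
  \<comment> \<open>Net exponents after gain, weight and loss: r (t - s) for k <= k', and r (t + s)
    - \<omega> (1-r) for k > k'.\<close>
  define a where "a = min (r * (t - s)) (r * (t + s) - \<omega> * (1 - r))"
  have a: "0 < a" using t' r by (auto simp: a_def)
  define \<theta> where "\<theta> = \<delta> powr a"
  define \<kappa> where "\<kappa> = \<delta> powr \<epsilon>"
  have \<theta>: "0 < \<theta>" "\<theta> < 1" using delta a powr_less_mono2[of a \<delta> 1] by (auto simp: \<theta>_def)
  have \<kappa>: "0 < \<kappa>" "\<kappa> < 1" using delta \<epsilon> powr_less_mono2[of \<epsilon> \<delta> 1] by (auto simp: \<kappa>_def)
  obtain CK where CK: "0 < CK" "\<And>y :: nat \<Rightarrow> 'i \<Rightarrow> nat \<Rightarrow> 'a.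
        (\<forall>k. \<forall>\<alpha>\<in>A (int k). \<forall>m\<in>{1..Num (int k) \<alpha>}. y k \<alpha> m \<in> S (int k) \<alpha> m) \<Longrightarrow>
        (\<exists>Qt. reproducing_kernels M d A0 \<delta> \<beta> \<gamma> CK N Qt \<and>
           (\<forall>f\<in>distributions M d A0 x0 \<eta> \<beta> \<gamma>. \<forall>\<phi>\<in>test_space0 M d A0 x0 \<eta> \<beta> \<gamma>.
              let T = (\<lambda>k \<alpha>. \<Sum>m = 1..Num (int k) \<alpha>.
                         reproducing_term M Q Qt N k (S (int k) \<alpha> m) (y k \<alpha> m) f \<phi>)
              in (\<forall>k. T k summable_on A (int k)) \<and>
                 (\<lambda>k. \<Sum>\<^sub>\<infinity>\<alpha>\<in>A (int k). T k \<alpha>) sums f \<phi>))"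
    using cal unfolding calderon_index_def by blast
  show thesis
  proof (rule reproducing_term_bound[where N = N, OF P e(1,3) t'(1,4,5,6) CK(1)])
  fix CT assume CT: "0 < CT" "\<And>Qt Q k' x k \<alpha> m y f. reproducing_kernels M d A0 \<delta> \<beta> \<gamma> CK N Qt \<Longrightarrow>
    cells (int k) \<alpha> m \<Longrightarrow> y \<in> S (int k) \<alpha> m \<Longrightarrow>
    cmod (reproducing_term M Q Qt N k (S (int k) \<alpha> m) y f (P k' x)) \<le>
      CT * \<delta> powr (t * \<bar>real k - real k'\<bar>) * W (\<delta> ^ min k k') \<gamma> x y *
        (measure M (S (int k) \<alpha> m) * cmod (sample N Q f k (S (int k) \<alpha> m) y))"
  show thesis
  proof (rule cell_kernel_power[OF r(1,2) e(3) \<epsilon> \<epsilon>_def])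
  fix CP assume CP: "0 < CP" "\<And>j k \<alpha> m x y u. j \<le> k \<Longrightarrow> cells (int k) \<alpha> m \<Longrightarrow> y \<in> S (int k) \<alpha> m \<Longrightarrow> u \<in> S (int k) \<alpha> m \<Longrightarrow>
    (W (\<delta> ^ j) \<gamma> x y * measure M (S (int k) \<alpha> m)) powr r \<le>
      CP * (\<delta> ^ j / \<delta> ^ k) powr (\<omega> * (1 - r)) * W (\<delta> ^ j) \<epsilon> x u * measure M (S (int k) \<alpha> m)"
  show thesis
  proof (rule nn_integral_W_le_T[OF \<epsilon>])
  fix CW assume CW: "0 < CW" "\<And>j x g. g \<in> borel_measurable M \<Longrightarrow>
    (\<integral>\<^sup>+u. ennreal (W (\<delta> ^ j) \<epsilon> x u) * g u \<partial>M) \<le>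
      ennreal CW * (\<integral>\<^sup>+i. ennreal ((\<delta> powr \<epsilon>) ^ i) * T (int j - int i) g x \<partial>count_space UNIV)"
  obtain D where D: "\<And>k \<alpha> m. cells (int k) \<alpha> m \<Longrightarrow> 0 < emeasure M (S (int k) \<alpha> m) \<and> emeasure M (S (int k) \<alpha> m) < \<infinity>"
    using subcube_size by metis
  define C where "C = CT powr r * CP * CW"
  have C: "0 < C" using CT(1) CP(1) CW(1) by (simp add: C_def)
  have exponent: "\<delta> powr (- real k' * s * r) * \<delta> powr (t * \<bar>real k - real k'\<bar> * r) * (\<delta> ^ min k k' / \<delta> ^ k) powr (\<omega> * (1 - r)) *
      \<delta> powr (real k * s * r) \<le> \<theta> powr \<bar>real k - real k'\<bar>" for k k' :: nat
  proof -
    define b where "b = - real k' * s * r + t * \<bar>real k - real k'\<bar> * r + (real (min k k') - real k) * (\<omega> * (1 - r)) + real k * s * r"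
    have L: "(\<delta> ^ min k k' / \<delta> ^ k) powr (\<omega> * (1 - r)) = \<delta> powr ((real (min k k') - real k) * (\<omega> * (1 - r)))"
      using delta by (simp add: powr_diff powr_powr[symmetric] powr_realpow)
    have "\<delta> powr (- real k' * s * r) * \<delta> powr (t * \<bar>real k - real k'\<bar> * r) * (\<delta> ^ min k k' / \<delta> ^ k) powr (\<omega> * (1 - r)) *
      \<delta> powr (real k * s * r) = \<delta> powr b"
      unfolding L b_def powr_add ..
    also have "\<dots> \<le> \<delta> powr (a * \<bar>real k - real k'\<bar>)"
    proof (rule powr_mono')
      show "a * \<bar>real k - real k'\<bar> \<le> b"
      proof (cases "k \<le> k'")
        case True
        have "a * \<bar>real k - real k'\<bar> \<le> (r * (t - s)) * \<bar>real k - real k'\<bar>" by (intro mult_right_mono) (auto simp: a_def)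
        also have "\<dots> = b" using True by (simp add: b_def algebra_simps)
        finally show ?thesis .
      next
        case False
        have "a * \<bar>real k - real k'\<bar> \<le> (r * (t + s) - \<omega> * (1 - r)) * \<bar>real k - real k'\<bar>" by (intro mult_right_mono) (auto simp: a_def)
        also have "\<dots> = b" using False by (simp add: b_def algebra_simps)
        finally show ?thesis .
      qed
    qed (use delta in auto)
    finally show ?thesis by (simp add: \<theta>_def powr_powr)
  qed
  have high: "epowr (ennreal (\<delta> powr (- real k' * s)) * ennreal (cmod (dist_apply P k' f x))) r \<le>
      ennreal C * HT \<theta> \<kappa> (\<lambda>k x. epowr (amp Q N s f k x) r) k' x"
    if f: "f \<in> distributions M d A0 x0 \<eta> \<beta> \<gamma>" for f k' x
  proof -
    define q where "q k = dist_apply Q k f" for k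
    have [measurable]: "q k \<in> borel_measurable M" for k
      unfolding q_def by (rule dist_apply_measurable[OF f Q e(1) e'])
    define G where "G k x = epowr (amp Q N s f k x) r" for k x
    have G[measurable]: "G k \<in> borel_measurable M" for k
      unfolding G_def[abs_def] amp_def q_def[symmetric] by measurable
    \<comment> \<open>The points are adapted to |Q_k f|^r, so that the sampled value is controlled
      by the mean of exactly the power that appears in the estimate.\<close>
    define good where "good k \<alpha> m w \<longleftrightarrow> w \<in> S (int k) \<alpha> m \<and>
        epowr (ennreal (cmod (q k w))) r * emeasure M (S (int k) \<alpha> m) \<le> (\<integral>\<^sup>+u\<in>S (int k) \<alpha> m. epowr (ennreal (cmod (q k u))) r \<partial>M)" for k \<alpha> m w
    have good: "\<exists>w. good k \<alpha> m w" if c: "cells (int k) \<alpha> m" for k \<alpha> m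
    proof -
      obtain w where "w \<in> S (int k) \<alpha> m" "epowr (ennreal (cmod (q k w))) r * emeasure M (S (int k) \<alpha> m) \<le> (\<integral>\<^sup>+u\<in>S (int k) \<alpha> m. epowr (ennreal (cmod (q k u))) r \<partial>M)"
        using exists_le_mean[of "\<lambda>u. epowr (ennreal (cmod (q k u))) r" M "S (int k) \<alpha> m"] D[OF c] subcube_measurable[OF c]
        by (auto simp: epowr_ennreal)
      then show ?thesis unfolding good_def by blast
    qed
    define y where "y k \<alpha> m = (SOME w. good k \<alpha> m w)" for k \<alpha> m
    have "good k \<alpha> m (y k \<alpha> m)" if "cells (int k) \<alpha> m" for k \<alpha> m
      unfolding y_def by (rule someI_ex[OF good[OF that]])
    then have y: "\<And>k \<alpha> m. cells (int k) \<alpha> m \<Longrightarrow> y k \<alpha> m \<in> S (int k) \<alpha> m"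
      "\<And>k \<alpha> m. cells (int k) \<alpha> m \<Longrightarrow>
        epowr (ennreal (cmod (q k (y k \<alpha> m)))) r * emeasure M (S (int k) \<alpha> m) \<le> (\<integral>\<^sup>+u\<in>S (int k) \<alpha> m. epowr (ennreal (cmod (q k u))) r \<partial>M)"
      by (simp_all add: good_def)
    have "\<forall>k. \<forall>\<alpha>\<in>A (int k). \<forall>m\<in>{1..Num (int k) \<alpha>}. y k \<alpha> m \<in> S (int k) \<alpha> m" using y(1) by blast
    from CK(2)[OF this] obtain Qt where Qt: "reproducing_kernels M d A0 \<delta> \<beta> \<gamma> CK N Qt"
      "\<forall>f\<in>distributions M d A0 x0 \<eta> \<beta> \<gamma>. \<forall>\<phi>\<in>test_space0 M d A0 x0 \<eta> \<beta> \<gamma>.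
              let T = (\<lambda>k \<alpha>. \<Sum>m = 1..Num (int k) \<alpha>.
                         reproducing_term M Q Qt N k (S (int k) \<alpha> m) (y k \<alpha> m) f \<phi>)
              in (\<forall>k. T k summable_on A (int k)) \<and>
                 (\<lambda>k. \<Sum>\<^sub>\<infinity>\<alpha>\<in>A (int k). T k \<alpha>) sums f \<phi>" by blast
    define \<tau> where "\<tau> k \<alpha> m = reproducing_term M Q Qt N k (S (int k) \<alpha> m) (y k \<alpha> m) f (P k' x)" for k \<alpha> m
    have "P k' x \<in> test_space0 M d A0 x0 \<eta> \<beta> \<gamma>"
      using exp_IATI_test_space0[OF P delta e(1) e', of 1 k' x] by simp
    with Qt(2) f have sm: "(\<lambda>\<alpha>. \<Sum>m = 1..Num (int k) \<alpha>. \<tau> k \<alpha> m) summable_on A (int k)"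
      and su: "(\<lambda>k. \<Sum>\<^sub>\<infinity>\<alpha>\<in>A (int k). \<Sum>m = 1..Num (int k) \<alpha>. \<tau> k \<alpha> m) sums f (P k' x)" for k
      unfolding Let_def \<tau>_def by blast+
    have "ennreal (cmod (f (P k' x))) \<le> (\<Sum>k. ennreal (cmod (\<Sum>\<^sub>\<infinity>\<alpha>\<in>A (int k). \<Sum>m = 1..Num (int k) \<alpha>. \<tau> k \<alpha> m)))"
      by (rule ennreal_norm_sums_le[OF su])
    also have "\<dots> \<le> (\<Sum>k. cell_sum (int k) (\<lambda>\<alpha> m. ennreal (cmod (\<tau> k \<alpha> m))))"
    proof (intro suminf_le)
      fix k
      have "ennreal (cmod (\<Sum>\<^sub>\<infinity>\<alpha>\<in>A (int k). \<Sum>m = 1..Num (int k) \<alpha>. \<tau> k \<alpha> m)) \<le>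
         (\<integral>\<^sup>+\<alpha>. ennreal (cmod (\<Sum>m = 1..Num (int k) \<alpha>. \<tau> k \<alpha> m)) \<partial>count_space (A (int k)))"
        by (rule ennreal_norm_infsum_le[OF sm])
      also have "\<dots> \<le> cell_sum (int k) (\<lambda>\<alpha> m. ennreal (cmod (\<tau> k \<alpha> m)))"
        unfolding cell_sum_def by (intro nn_integral_mono) (simp add: sum_ennreal ennreal_leI norm_sum)
      finally show "ennreal (cmod (\<Sum>\<^sub>\<infinity>\<alpha>\<in>A (int k). \<Sum>m = 1..Num (int k) \<alpha>. \<tau> k \<alpha> m)) \<le> cell_sum (int k) (\<lambda>\<alpha> m. ennreal (cmod (\<tau> k \<alpha> m)))" .
    qed auto
    also have "\<dots> = (\<integral>\<^sup>+k. cell_sum (int k) (\<lambda>\<alpha> m. ennreal (cmod (\<tau> k \<alpha> m))) \<partial>count_space UNIV)"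
      by (simp add: nn_integral_count_space_nat)
    finally have "epowr (ennreal (cmod (f (P k' x)))) r \<le> epowr (\<integral>\<^sup>+k. cell_sum (int k) (\<lambda>\<alpha> m. ennreal (cmod (\<tau> k \<alpha> m))) \<partial>count_space UNIV) r"
      using r by (intro epowr_mono) auto
    also have "\<dots> \<le> (\<integral>\<^sup>+k. epowr (cell_sum (int k) (\<lambda>\<alpha> m. ennreal (cmod (\<tau> k \<alpha> m)))) r \<partial>count_space UNIV)"
      using r by (intro epowr_nn_integral_count_le) auto
    also have "\<dots> \<le> (\<integral>\<^sup>+k. cell_sum (int k) (\<lambda>\<alpha> m. epowr (ennreal (cmod (\<tau> k \<alpha> m))) r) \<partial>count_space UNIV)"
      using r by (intro nn_integral_mono cell_sum_epowr_le) auto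
    finally have sum: "epowr (ennreal (cmod (f (P k' x)))) r \<le> (\<integral>\<^sup>+k. cell_sum (int k) (\<lambda>\<alpha> m. epowr (ennreal (cmod (\<tau> k \<alpha> m))) r) \<partial>count_space UNIV)" .
    define w' where "w' = \<delta> powr (- real k' * s * r)"
    \<comment> \<open>For k > N this is the choice of y. For k <= N the coefficient is a cell mean;
      G is then constant on the cell, with the value of the mean of |Q_k f|.\<close>
    have samp: "epowr (ennreal (cmod (sample N Q f k (S (int k) \<alpha> m) (y k \<alpha> m)))) r * emeasure M (S (int k) \<alpha> m) \<le>
        ennreal (\<delta> powr (real k * s * r)) * (\<integral>\<^sup>+u\<in>S (int k) \<alpha> m. G k u \<partial>M)" if c: "cells (int k) \<alpha> m" for k \<alpha> m
    proof -
      have [measurable]: "S (int k) \<alpha> m \<in> sets M" using c by (rule subcube_measurable)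
      have one: "ennreal (\<delta> powr (real k * s * r)) * epowr (ennreal (\<delta> powr (- real k * s)) * v) r = epowr v r" for v
      proof -
        have "ennreal (\<delta> powr (real k * s * r)) * ennreal (\<delta> powr (- real k * s * r)) = 1"
          using delta by (simp flip: ennreal_mult powr_add)
        moreover have "epowr (ennreal (\<delta> powr (- real k * s)) * v) r = ennreal (\<delta> powr (- real k * s * r)) * epowr v r"
          using r by (simp add: epowr_mult epowr_ennreal powr_powr)
        ultimately show ?thesis by (simp add: mult.assoc[symmetric])
      qed
      show ?thesis
      proof (cases "k \<le> N")
        case True
        define b where "b = abs_mean M (S (int k) \<alpha> m) (q k)"
        have "ennreal (cmod (sample N Q f k (S (int k) \<alpha> m) (y k \<alpha> m))) \<le> b"
          using True D[OF c] by (simp add: sample_def b_def q_def cmean_le_abs_mean)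
        then have "epowr (ennreal (cmod (sample N Q f k (S (int k) \<alpha> m) (y k \<alpha> m)))) r * emeasure M (S (int k) \<alpha> m) \<le> epowr b r * emeasure M (S (int k) \<alpha> m)"
          using r by (intro mult_right_mono epowr_mono) auto
        also have "\<dots> = ennreal (\<delta> powr (real k * s * r)) * (epowr (ennreal (\<delta> powr (- real k * s)) * b) r * emeasure M (S (int k) \<alpha> m))"
          using one[of b] by (simp add: mult.assoc[symmetric])
        also have "epowr (ennreal (\<delta> powr (- real k * s)) * b) r * emeasure M (S (int k) \<alpha> m) = (\<integral>\<^sup>+u\<in>S (int k) \<alpha> m. epowr (ennreal (\<delta> powr (- real k * s)) * b) r \<partial>M)"
          by (simp add: nn_integral_cmult)
        also have "\<dots> = (\<integral>\<^sup>+u\<in>S (int k) \<alpha> m. G k u \<partial>M)"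
          using True cellmean_eq[OF c] by (intro nn_integral_cong) (auto simp: G_def amp_def b_def q_def split: split_indicator)
        finally show ?thesis .
      next
        case False
        have "ennreal (\<delta> powr (real k * s * r)) * (\<integral>\<^sup>+u\<in>S (int k) \<alpha> m. G k u \<partial>M) =
            (\<integral>\<^sup>+u. ennreal (\<delta> powr (real k * s * r)) * (G k u * indicator (S (int k) \<alpha> m) u) \<partial>M)"
          by (rule nn_integral_cmult[symmetric]) measurable
        also have "\<dots> = (\<integral>\<^sup>+u\<in>S (int k) \<alpha> m. epowr (ennreal (cmod (q k u))) r \<partial>M)"
          using False one by (intro nn_integral_cong) (simp add: G_def amp_def q_def mult.assoc[symmetric])
        finally show ?thesis using y(2)[OF c] False by (simp add: sample_def q_def)
      qed
    qed
    have summand: "ennreal w' * epowr (ennreal (cmod (\<tau> k \<alpha> m))) r \<le> ennreal (CT powr r * CP) * geo \<theta> k' k *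
        (\<integral>\<^sup>+u\<in>S (int k) \<alpha> m. ennreal (W (\<delta> ^ min k k') \<epsilon> x u) * G k u \<partial>M)" if c: "cells (int k) \<alpha> m" for k \<alpha> m
    proof -
      define E where "E = S (int k) \<alpha> m"
      have [measurable]: "E \<in> sets M" using subcube_measurable[OF c] by (simp add: E_def)
      define j where "j = min k k'"
      define \<mu> where "\<mu> = measure M E"
      have em: "emeasure M E = ennreal \<mu>" using D[OF c] unfolding \<mu>_def E_def by (intro emeasure_eq_ennreal_measure) auto
      have \<mu>: "0 < \<mu>" using D[OF c] by (simp add: \<mu>_def E_def measure_def enn2real_positive_iff)
      define v where "v = cmod (sample N Q f k E (y k \<alpha> m))"
      define dd where "dd = \<delta> powr (t * \<bar>real k - real k'\<bar>)"
      define L where "L = (\<delta> ^ j / \<delta> ^ k) powr (\<omega> * (1 - r))"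
      \<comment> \<open>X does not involve u, yet it is bounded by the kernel at every u of the
        cell. So it can be carried under the integral of G and replaced there by W (\<delta>^j)
        \<epsilon> x u.\<close>
      define X where "X = (W (\<delta> ^ j) \<gamma> x (y k \<alpha> m) * \<mu>) powr r / \<mu>"
      have X0: "0 \<le> X" using \<mu> by (simp add: X_def)
      have X: "X \<le> CP * L * W (\<delta> ^ j) \<epsilon> x u" if "u \<in> E" for u
      proof -
        have "(W (\<delta> ^ j) \<gamma> x (y k \<alpha> m) * \<mu>) powr r \<le> CP * L * W (\<delta> ^ j) \<epsilon> x u * \<mu>"
          unfolding L_def \<mu>_def E_def using c y(1)[OF c] that by (intro CP(2)) (auto simp: j_def E_def)
        then show ?thesis using \<mu> by (simp add: X_def field_simps)
      qed
      have "cmod (\<tau> k \<alpha> m) \<le> CT * dd * W (\<delta> ^ j) \<gamma> x (y k \<alpha> m) * (\<mu> * v)"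
        unfolding \<tau>_def dd_def j_def \<mu>_def v_def E_def by (rule CT(2)[OF Qt(1) c y(1)[OF c]])
      then have "cmod (\<tau> k \<alpha> m) powr r \<le> (CT * dd * W (\<delta> ^ j) \<gamma> x (y k \<alpha> m) * (\<mu> * v)) powr r"
        using r by (intro powr_mono2) auto
      also have "\<dots> = (CT powr r * dd powr r) * ((W (\<delta> ^ j) \<gamma> x (y k \<alpha> m) * \<mu>) powr r * v powr r)"
        by (simp add: powr_mult mult_ac)
      also have "\<dots> = (CT powr r * dd powr r) * (X * (v powr r * \<mu>))" using \<mu> by (simp add: X_def)
      finally have 1: "cmod (\<tau> k \<alpha> m) powr r \<le> (CT powr r * dd powr r) * (X * (v powr r * \<mu>))" .
      have 2: "ennreal (X * (v powr r * \<mu>)) \<le> ennreal (CP * L * \<delta> powr (real k * s * r)) * (\<integral>\<^sup>+u\<in>E. ennreal (W (\<delta> ^ j) \<epsilon> x u) * G k u \<partial>M)"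
      proof -
        have "ennreal (X * (v powr r * \<mu>)) = ennreal X * (epowr (ennreal v) r * emeasure M E)"
          using X0 \<mu> by (simp add: epowr_ennreal v_def em flip: ennreal_mult)
        also have "\<dots> \<le> ennreal X * (ennreal (\<delta> powr (real k * s * r)) * (\<integral>\<^sup>+u\<in>E. G k u \<partial>M))"
          unfolding v_def E_def by (intro mult_left_mono samp c) auto
        also have "\<dots> = ennreal (\<delta> powr (real k * s * r)) * (\<integral>\<^sup>+u. ennreal X * (G k u * indicator E u) \<partial>M)"
          by (simp add: nn_integral_cmult mult.left_commute)
        also have "\<dots> \<le> ennreal (\<delta> powr (real k * s * r)) * (\<integral>\<^sup>+u. ennreal (CP * L) * (ennreal (W (\<delta> ^ j) \<epsilon> x u) * G k u * indicator E u) \<partial>M)"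
        proof (intro mult_left_mono nn_integral_mono)
          fix u
          show "ennreal X * (G k u * indicator E u) \<le> ennreal (CP * L) * (ennreal (W (\<delta> ^ j) \<epsilon> x u) * G k u * indicator E u)"
          proof (cases "u \<in> E")
            case True
            have "ennreal X * G k u \<le> ennreal (CP * L * W (\<delta> ^ j) \<epsilon> x u) * G k u"
              by (intro mult_right_mono ennreal_leI X True) auto
            then show ?thesis using True CP(1) by (simp add: ennreal_mult L_def mult.assoc)
          qed simp
        qed auto
        also have "\<dots> = ennreal (CP * L * \<delta> powr (real k * s * r)) * (\<integral>\<^sup>+u\<in>E. ennreal (W (\<delta> ^ j) \<epsilon> x u) * G k u \<partial>M)"
        proof -
          have "ennreal (CP * L * \<delta> powr (real k * s * r)) = ennreal (\<delta> powr (real k * s * r)) * ennreal (CP * L)"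
            using CP(1) by (simp add: L_def mult.commute flip: ennreal_mult)
          then show ?thesis by (subst nn_integral_cmult) (auto simp: mult.assoc)
        qed
        finally show ?thesis .
      qed
      define I where "I = (\<integral>\<^sup>+u\<in>E. ennreal (W (\<delta> ^ j) \<epsilon> x u) * G k u \<partial>M)"
      have "ennreal w' * epowr (ennreal (cmod (\<tau> k \<alpha> m))) r \<le> ennreal w' * ennreal ((CT powr r * dd powr r) * (X * (v powr r * \<mu>)))"
        using 1 by (intro mult_left_mono) (auto simp: epowr_ennreal ennreal_leI)
      also have "\<dots> = ennreal (w' * (CT powr r * dd powr r)) * ennreal (X * (v powr r * \<mu>))"
        using X0 \<mu> by (simp add: w'_def mult.assoc flip: ennreal_mult)
      also have "\<dots> \<le> ennreal (w' * (CT powr r * dd powr r)) * (ennreal (CP * L * \<delta> powr (real k * s * r)) * I)"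
        unfolding I_def by (intro mult_left_mono 2) auto
      also have "\<dots> = ennreal ((CT powr r * CP) * (w' * dd powr r * L * \<delta> powr (real k * s * r))) * I"
      proof -
        have "ennreal (w' * (CT powr r * dd powr r)) * ennreal (CP * L * \<delta> powr (real k * s * r)) =
            ennreal ((w' * (CT powr r * dd powr r)) * (CP * L * \<delta> powr (real k * s * r)))"
          using CP(1) by (intro ennreal_mult[symmetric]) (auto simp: w'_def L_def)
        also have "(w' * (CT powr r * dd powr r)) * (CP * L * \<delta> powr (real k * s * r)) =
            (CT powr r * CP) * (w' * dd powr r * L * \<delta> powr (real k * s * r))"
          by (simp only: mult_ac)
        finally show ?thesis by (simp only: mult.assoc[symmetric])
      qed
      also have "\<dots> \<le> ennreal ((CT powr r * CP) * \<theta> powr \<bar>real k - real k'\<bar>) * I"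
      proof (intro mult_right_mono ennreal_leI mult_left_mono)
        have "dd powr r = \<delta> powr (t * \<bar>real k - real k'\<bar> * r)" by (simp add: dd_def powr_powr)
        then show "w' * dd powr r * L * \<delta> powr (real k * s * r) \<le> \<theta> powr \<bar>real k - real k'\<bar>"
          using exponent[of k' k] by (simp add: w'_def L_def j_def)
      qed (use CP(1) in auto)
      also have "\<dots> = ennreal (CT powr r * CP) * geo \<theta> k' k * I"
        using CP(1) by (simp add: geo_def ennreal_mult)
      finally show ?thesis by (simp add: I_def E_def j_def)
    qed
    have "epowr (ennreal (\<delta> powr (- real k' * s)) * ennreal (cmod (dist_apply P k' f x))) r =
        ennreal w' * epowr (ennreal (cmod (f (P k' x)))) r"
      using r by (simp add: epowr_mult epowr_ennreal[of "\<delta> powr _"] w'_def powr_powr dist_apply_def)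
    also have "\<dots> \<le> ennreal w' * (\<integral>\<^sup>+k. cell_sum (int k) (\<lambda>\<alpha> m. epowr (ennreal (cmod (\<tau> k \<alpha> m))) r) \<partial>count_space UNIV)"
      by (intro mult_left_mono sum) auto
    also have "\<dots> = (\<integral>\<^sup>+k. cell_sum (int k) (\<lambda>\<alpha> m. ennreal w' * epowr (ennreal (cmod (\<tau> k \<alpha> m))) r) \<partial>count_space UNIV)"
      by (simp add: cell_sum_cmult nn_integral_cmult)
    also have "\<dots> \<le> (\<integral>\<^sup>+k. cell_sum (int k) (\<lambda>\<alpha> m. (ennreal (CT powr r * CP) * geo \<theta> k' k) *
        (\<integral>\<^sup>+u\<in>S (int k) \<alpha> m. ennreal (W (\<delta> ^ min k k') \<epsilon> x u) * G k u \<partial>M)) \<partial>count_space UNIV)"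
      by (intro nn_integral_mono cell_sum_mono summand)
    also have "\<dots> = (\<integral>\<^sup>+k. (ennreal (CT powr r * CP) * geo \<theta> k' k) * (\<integral>\<^sup>+u. ennreal (W (\<delta> ^ min k k') \<epsilon> x u) * G k u \<partial>M) \<partial>count_space UNIV)"
      by (simp add: cell_sum_cmult cell_sum_integral)
    also have "\<dots> \<le> (\<integral>\<^sup>+k. (ennreal (CT powr r * CP) * geo \<theta> k' k) *
        (ennreal CW * (\<integral>\<^sup>+i. ennreal (\<kappa> ^ i) * T (int (min k k') - int i) (G k) x \<partial>count_space UNIV)) \<partial>count_space UNIV)"
      unfolding \<kappa>_def by (intro nn_integral_mono mult_left_mono CW G) auto
    also have "\<dots> = (\<integral>\<^sup>+k. (\<integral>\<^sup>+i. ennreal C * (geo \<theta> k' k * ennreal (\<kappa> ^ i) * T (int (min k k') - int i) (G k) x) \<partial>count_space UNIV) \<partial>count_space UNIV)"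
    proof (rule nn_integral_cong)
      fix k
      have "ennreal C = ennreal (CT powr r * CP) * ennreal CW"
        unfolding C_def using CT(1) CP(1) CW(1) by (intro ennreal_mult) auto
      then show "(ennreal (CT powr r * CP) * geo \<theta> k' k) * (ennreal CW * (\<integral>\<^sup>+i. ennreal (\<kappa> ^ i) * T (int (min k k') - int i) (G k) x \<partial>count_space UNIV)) =
        (\<integral>\<^sup>+i. ennreal C * (geo \<theta> k' k * ennreal (\<kappa> ^ i) * T (int (min k k') - int i) (G k) x) \<partial>count_space UNIV)"
        by (simp add: nn_integral_cmult mult.assoc) (simp only: mult_ac)
    qed
    also have "\<dots> = ennreal C * HT \<theta> \<kappa> G k' x"
      unfolding HT_def by (subst nn_integral_fst_count_space[symmetric]) (simp add: nn_integral_cmult)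
    finally show ?thesis by (simp add: G_def[abs_def])
  qed
  show thesis
  proof (rule that[OF C \<theta> \<kappa>])
    fix f k' x assume f: "f \<in> distributions M d A0 x0 \<eta> \<beta> \<gamma>"
    have [measurable]: "dist_apply P k' f \<in> borel_measurable M"
      by (rule dist_apply_measurable[OF f P e(1) e'])
    show "epowr (amp P N' s f k' x) r \<le> ennreal C * HT \<theta> \<kappa> (\<lambda>k x. epowr (amp Q N s f k x) r) k' x"
    proof (cases "k' \<le> N'")
      case True
      \<comment> \<open>The right-hand side takes the same value on the whole cell of x, so the
        estimate for single values of P_k' f extends to their mean.\<close>
      obtain \<alpha> m where c: "cells (int k') \<alpha> m" "x \<in> S (int k') \<alpha> m" using subcube_cover by blast
      have le: "epowr (ennreal (\<delta> powr (- real k' * s)) * ennreal (cmod (dist_apply P k' f u))) r \<le>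
          ennreal C * HT \<theta> \<kappa> (\<lambda>k x. epowr (amp Q N s f k x) r) k' x" if "u \<in> S (int k') \<alpha> m" for u
        using high[OF f, of k' u] unfolding HT_cell_const[OF c(1) that c(2)] .
      have "epowr (ennreal (\<delta> powr (- real k' * s)) * abs_mean M (S (int k') \<alpha> m) (dist_apply P k' f)) r \<le>
          ennreal C * HT \<theta> \<kappa> (\<lambda>k x. epowr (amp Q N s f k x) r) k' x"
        using D[OF c(1)] subcube_measurable[OF c(1)] r(1) le
        by (intro epowr_abs_mean_le) auto
      then show ?thesis using True cellmean_eq[OF c] by (simp add: amp_def)
    next
      case False
      then show ?thesis using high[OF f, of k' x] by (simp add: amp_def)
    qed
  qed
  qed
  qed
  qed
qed

end

section \<open>Mixed norms\<close>

lemma lq_norm_top: "lq_norm I top c = (SUP k\<in>I. c k)"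
  by (simp add: lq_norm_def)

lemma lq_norm_finite: "q \<noteq> top \<Longrightarrow> lq_norm I q c = epowr (\<integral>\<^sup>+k. epowr (c k) (enn2real q) \<partial>count_space I) (1 / enn2real q)"
  by (simp add: lq_norm_def)

lemma Lp_norm_finite: "p \<noteq> top \<Longrightarrow> Lp_norm M p g = epowr (\<integral>\<^sup>+x. epowr (g x) (enn2real p) \<partial>M) (1 / enn2real p)"
  by (simp add: Lp_norm_def)

lemma enn2real_pos: "0 < q \<Longrightarrow> q \<noteq> top \<Longrightarrow> 0 < enn2real q"
  by (simp add: enn2real_positive_iff less_top)

lemma nn_integral_count_space_mono_set:
  "I \<subseteq> J \<Longrightarrow> (\<integral>\<^sup>+k. f k \<partial>count_space I) \<le> (\<integral>\<^sup>+k. f k \<partial>count_space J)"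
  by (auto simp: nn_integral_count_space_indicator[of I] nn_integral_count_space_indicator[of J]
      intro!: nn_integral_mono split: split_indicator)

lemma lq_norm_mono:
  assumes "0 < q" "I \<subseteq> J" "\<And>k. k \<in> I \<Longrightarrow> c k \<le> c' k"
  shows "lq_norm I q c \<le> lq_norm J q c'"
proof (cases "q = top")
  case True
  then show ?thesis using assms unfolding True lq_norm_top by (intro SUP_mono) auto
next
  case False
  have "(\<integral>\<^sup>+k. epowr (c k) (enn2real q) \<partial>count_space I) \<le> (\<integral>\<^sup>+k. epowr (c' k) (enn2real q) \<partial>count_space I)"
    using assms by (intro nn_integral_mono epowr_mono) auto
  also have "\<dots> \<le> (\<integral>\<^sup>+k. epowr (c' k) (enn2real q) \<partial>count_space J)"
    by (rule nn_integral_count_space_mono_set[OF assms(2)])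
  finally show ?thesis unfolding lq_norm_finite[OF False] by (intro epowr_mono) auto
qed

lemma lq_norm_ge:
  assumes "0 < q" "k \<in> I"
  shows "c k \<le> lq_norm I q c"
proof (cases "q = top")
  case True
  then show ?thesis using assms by (auto simp: lq_norm_top intro: SUP_upper)
next
  case False
  have "epowr (c k) (enn2real q) \<le> (\<integral>\<^sup>+k. epowr (c k) (enn2real q) \<partial>count_space I)"
    by (rule nn_integral_ge_point[OF assms(2)])
  then have "epowr (epowr (c k) (enn2real q)) (1 / enn2real q) \<le> lq_norm I q c"
    unfolding lq_norm_finite[OF False] by (intro epowr_mono) auto
  then show ?thesis using enn2real_pos[OF assms(1) False] by (simp add: epowr_inverse)
qed

text \<open>N + 1 single terms and one tail, each at most the right-hand sum; for finite q this
  gives the constant (N + 2)^(1/q).\<close>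

lemma lq_norm_split:
  assumes "0 < q"
  obtains C where "0 < C" "\<And>c. lq_norm UNIV q c \<le> ennreal C * ((\<Sum>k\<le>N. c k) + lq_norm {N+1..} q c)"
proof (cases "q = top")
  case True
  have "lq_norm UNIV q c \<le> ennreal 1 * ((\<Sum>k\<le>N. c k) + lq_norm {N+1..} q c)" for c
    unfolding True lq_norm_top
  proof (rule SUP_least)
    fix k
    show "c k \<le> ennreal 1 * ((\<Sum>k\<le>N. c k) + (SUP k\<in>{N+1..}. c k))"
    proof (cases "k \<le> N")
      case True
      then have "c k \<le> (\<Sum>k\<le>N. c k)" by (intro member_le_sum) auto
      then show ?thesis by (simp add: add_increasing2)
    next
      case False
      then have "c k \<le> (SUP k\<in>{N+1..}. c k)" by (intro SUP_upper) auto
      then show ?thesis by (simp add: add_increasing)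
    qed
  qed
  then show thesis using that[of 1] by simp
next
  case False
  define r where "r = enn2real q"
  have r: "0 < r" using enn2real_pos[OF assms False] by (simp add: r_def)
  define C where "C = (real N + 2) powr (1 / r)"
  have "lq_norm UNIV q c \<le> ennreal C * ((\<Sum>k\<le>N. c k) + lq_norm {N+1..} q c)" for c
  proof -
    define X where "X = (\<Sum>k\<le>N. c k) + lq_norm {N+1..} q c"
    have U: "UNIV = {..N} \<union> {N+1..}" by auto
    have "(\<integral>\<^sup>+k. epowr (c k) r \<partial>count_space UNIV) \<le> (\<Sum>k\<le>N. epowr (c k) r) + (\<integral>\<^sup>+k. epowr (c k) r \<partial>count_space {N+1..})"
    proof -
      have "(\<integral>\<^sup>+k. epowr (c k) r \<partial>count_space UNIV) = (\<integral>\<^sup>+k. epowr (c k) r * indicator {..N} k + epowr (c k) r * indicator {N+1..} k \<partial>count_space UNIV)"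
        by (intro nn_integral_cong) (auto split: split_indicator)
      then show ?thesis
        by (simp add: nn_integral_add nn_integral_count_space_indicator[symmetric] nn_integral_count_space_finite)
    qed
    also have "\<dots> \<le> (\<Sum>k\<le>N. epowr X r) + epowr X r"
    proof (intro add_mono sum_mono)
      fix k assume "k \<in> {..N}"
      then have "c k \<le> (\<Sum>k\<le>N. c k)" by (intro member_le_sum) auto
      then show "epowr (c k) r \<le> epowr X r" using r by (intro epowr_mono) (auto simp: X_def add_increasing2)
    next
      have "epowr (lq_norm {N+1..} q c) r \<le> epowr X r" using r by (intro epowr_mono) (auto simp: X_def)
      then show "(\<integral>\<^sup>+k. epowr (c k) r \<partial>count_space {N+1..}) \<le> epowr X r"
        unfolding lq_norm_finite[OF False] r_def[symmetric] using r by (simp add: epowr_inverse)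
    qed
    also have "\<dots> = ennreal (real N + 2) * epowr X r"
    proof -
      have "ennreal (real N + 2) = of_nat (Suc N) + 1"
        by (simp add: ennreal_of_nat_eq_real_of_nat flip: ennreal_plus ennreal_1)
      then show ?thesis by (simp add: distrib_right)
    qed
    finally have "lq_norm UNIV q c \<le> epowr (ennreal (real N + 2) * epowr X r) (1 / r)"
      unfolding lq_norm_finite[OF False] r_def[symmetric] using r by (intro epowr_mono) auto
    then show ?thesis using r by (simp add: epowr_cmult epowr_inverse C_def X_def del: ennreal_plus)
  qed
  moreover have "0 < C" by (simp add: C_def)
  ultimately show thesis using that by blast
qed

lemma lq_norm_measurable:
  fixes I :: "nat set"
  assumes [measurable]: "\<And>k. c k \<in> borel_measurable M"
  shows "(\<lambda>x. lq_norm I q (\<lambda>k. c k x)) \<in> borel_measurable M"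
proof (cases "q = top")
  case True
  then show ?thesis unfolding True lq_norm_top by (intro borel_measurable_SUP) auto
next
  case False
  then show ?thesis unfolding lq_norm_finite[OF False]
    by (intro epowr_measurable measurable_nn_integral_count_space) auto
qed

lemma Lp_norm_mono:
  assumes "f \<in> borel_measurable M" "\<And>x. f x \<le> g x"
  shows "Lp_norm M p f \<le> Lp_norm M p g"
proof (cases "p = top")
  case True
  have "AE x in M. f x \<le> esssup M g"
    using esssup_AE[of g M] assms(2) by (auto elim!: eventually_mono intro: order_trans)
  then show ?thesis using assms(1) by (simp add: Lp_norm_def True esssup_I)
next
  case False
  then show ?thesis using assms by (simp add: Lp_norm_finite epowr_mono nn_integral_mono)
qed

lemma Lp_norm_cmult_le:
  assumes "0 < p" and [measurable]: "g \<in> borel_measurable M" and "0 < c"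
  shows "Lp_norm M p (\<lambda>x. ennreal c * g x) \<le> ennreal c * Lp_norm M p g"
proof (cases "p = top")
  case True
  have "AE x in M. ennreal c * g x \<le> ennreal c * esssup M g"
    using esssup_AE[of g M] by (auto elim!: eventually_mono intro: mult_left_mono)
  then show ?thesis by (simp add: Lp_norm_def True esssup_I)
next
  case False
  have "0 < enn2real p" by (rule enn2real_pos[OF assms(1) False])
  then show ?thesis using assms(3)
    by (simp add: Lp_norm_finite[OF False] epowr_mult nn_integral_cmult epowr_epowr)
qed

lemma Lp_norm_cmult:
  assumes "0 < p" and [measurable]: "g \<in> borel_measurable M" and "0 < c"
  shows "Lp_norm M p (\<lambda>x. ennreal c * g x) = ennreal c * Lp_norm M p g"
proof (rule antisym)
  have inv: "ennreal (1 / c) * (ennreal c * X) = X" "ennreal c * (ennreal (1 / c) * X) = X" for X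
    using assms(3) by (simp_all add: mult.assoc[symmetric] flip: ennreal_mult)
  have "Lp_norm M p (\<lambda>x. ennreal (1 / c) * (ennreal c * g x)) \<le> ennreal (1 / c) * Lp_norm M p (\<lambda>x. ennreal c * g x)"
    using assms by (intro Lp_norm_cmult_le) auto
  then have "ennreal c * Lp_norm M p g \<le> ennreal c * (ennreal (1 / c) * Lp_norm M p (\<lambda>x. ennreal c * g x))"
    unfolding inv(1) by (rule mult_left_mono) simp
  then show "ennreal c * Lp_norm M p g \<le> Lp_norm M p (\<lambda>x. ennreal c * g x)" unfolding inv(2) .
qed (rule Lp_norm_cmult_le[OF assms])

text \<open>A quasi-triangle inequality, valid also for p < 1. The measure and the functions come
  after the constant, which depends on p and the number of summands only.\<close>

lemma Lp_norm_sum: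
  fixes I :: "'i set"
  assumes "0 < p" "p \<noteq> top" "finite I"
  obtains C where "0 < C" "\<And>(M :: 'a measure) (h :: 'i \<Rightarrow> 'a \<Rightarrow> ennreal). (\<And>i. i \<in> I \<Longrightarrow> h i \<in> borel_measurable M) \<Longrightarrow>
    Lp_norm M p (\<lambda>x. \<Sum>i\<in>I. h i x) \<le> ennreal C * (\<Sum>i\<in>I. Lp_norm M p (h i))"
proof -
  define r where "r = enn2real p"
  have r: "0 < r" using enn2real_pos[OF assms(1,2)] by (simp add: r_def)
  define D where "D = max 1 (real (card I) powr (r - 1))"
  define C where "C = (D * (real (card I) + 1)) powr (1 / r)"
  have D: "0 < D" by (simp add: D_def)
  have "Lp_norm M p (\<lambda>x. \<Sum>i\<in>I. h i x) \<le> ennreal C * (\<Sum>i\<in>I. Lp_norm M p (h i))"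
    if h: "\<And>i. i \<in> I \<Longrightarrow> h i \<in> borel_measurable M" for M :: "'a measure" and h :: "'i \<Rightarrow> 'a \<Rightarrow> ennreal"
  proof -
    define X where "X = (\<Sum>i\<in>I. Lp_norm M p (h i))"
    have "(\<integral>\<^sup>+x. epowr (\<Sum>i\<in>I. h i x) r \<partial>M) \<le> (\<integral>\<^sup>+x. ennreal D * (\<Sum>i\<in>I. epowr (h i x) r) \<partial>M)"
      unfolding D_def using r assms by (intro nn_integral_mono epowr_sum_le_quasi) auto
    also have "\<dots> = ennreal D * (\<Sum>i\<in>I. \<integral>\<^sup>+x. epowr (h i x) r \<partial>M)"
      using h by (subst nn_integral_cmult) (auto simp: nn_integral_sum)
    also have "\<dots> \<le> ennreal D * (\<Sum>i\<in>I. epowr X r)"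
    proof (intro mult_left_mono sum_mono)
      fix i assume i: "i \<in> I"
      have "Lp_norm M p (h i) \<le> X" unfolding X_def using i assms by (intro member_le_sum) auto
      then have "epowr (Lp_norm M p (h i)) r \<le> epowr X r" using r by (intro epowr_mono) auto
      then show "(\<integral>\<^sup>+x. epowr (h i x) r \<partial>M) \<le> epowr X r"
        using r by (simp add: Lp_norm_finite[OF assms(2)] r_def[symmetric] epowr_inverse)
    qed auto
    also have "\<dots> \<le> ennreal D * (ennreal (real (card I) + 1) * epowr X r)"
      by (intro mult_left_mono) (auto simp: ennreal_of_nat_eq_real_of_nat intro!: mult_right_mono ennreal_leI)
    finally have "Lp_norm M p (\<lambda>x. \<Sum>i\<in>I. h i x) \<le> epowr (ennreal D * (ennreal (real (card I) + 1) * epowr X r)) (1 / r)"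
      unfolding Lp_norm_finite[OF assms(2)] r_def[symmetric] using r by (intro epowr_mono) auto
    also have "\<dots> = ennreal C * X"
      using r D by (simp add: epowr_cmult epowr_inverse C_def powr_mult ennreal_mult mult.assoc del: ennreal_plus)
    finally show ?thesis by (simp add: X_def)
  qed
  moreover have "0 < C" using D by (simp add: C_def)
  ultimately show thesis using that by blast
qed

section \<open>Comparison of the quantities\<close>

context dyadic_system
begin

lemma amp_measurable:
  assumes "f \<in> distributions M d A0 x0 \<eta> \<beta> \<gamma>" "exp_IATI M d \<delta> A' z' \<eta> Q" "0 < \<beta>" "\<beta> < \<eta>" "\<gamma> < \<eta>"
  shows "amp Q N s f k \<in> borel_measurable M" "dist_apply Q k f \<in> borel_measurable M"
proof -
  show [measurable]: "dist_apply Q k f \<in> borel_measurable M"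
    using assms by (intro dist_apply_measurable) auto
  show "amp Q N s f k \<in> borel_measurable M" unfolding amp_def[abs_def] by measurable
qed

text \<open>Identifies each level of the low part with an L^p integral, so that it can enter the
  same sequence of norms as the high levels.\<close>

lemma nn_integral_cellmean:
  "(\<integral>\<^sup>+x. epowr (cellmean k h x) p \<partial>M) =
    cell_sum (int k) (\<lambda>\<alpha> m. emeasure M (S (int k) \<alpha> m) * epowr (abs_mean M (S (int k) \<alpha> m) h) p)"
proof -
  have "(\<integral>\<^sup>+x. epowr (cellmean k h x) p \<partial>M) = cell_sum (int k) (\<lambda>\<alpha> m. \<integral>\<^sup>+x\<in>S (int k) \<alpha> m. epowr (cellmean k h x) p \<partial>M)"
    by (rule cell_sum_integral[symmetric]) measurable
  also have "\<dots> = cell_sum (int k) (\<lambda>\<alpha> m. emeasure M (S (int k) \<alpha> m) * epowr (abs_mean M (S (int k) \<alpha> m) h) p)"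
  proof (rule cell_sum_cong)
    fix \<alpha> m assume c: "cells (int k) \<alpha> m"
    have [measurable]: "S (int k) \<alpha> m \<in> sets M" using c by (rule subcube_measurable)
    have "(\<integral>\<^sup>+x\<in>S (int k) \<alpha> m. epowr (cellmean k h x) p \<partial>M) = (\<integral>\<^sup>+x\<in>S (int k) \<alpha> m. epowr (abs_mean M (S (int k) \<alpha> m) h) p \<partial>M)"
      using cellmean_eq[OF c] by (intro nn_integral_cong) (auto split: split_indicator)
    also have "\<dots> = emeasure M (S (int k) \<alpha> m) * epowr (abs_mean M (S (int k) \<alpha> m) h) p"
      by (simp only: nn_integral_cmult_indicator[OF \<open>S (int k) \<alpha> m \<in> sets M\<close>] mult.commute[of "emeasure M _"])
    finally show "(\<integral>\<^sup>+x\<in>S (int k) \<alpha> m. epowr (cellmean k h x) p \<partial>M) = emeasure M (S (int k) \<alpha> m) * epowr (abs_mean M (S (int k) \<alpha> m) h) p" .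
  qed
  finally show ?thesis .
qed

lemma low_part_finite:
  assumes "p \<noteq> top"
  shows "low_part M A Num S Q N p f = epowr (\<Sum>k\<le>N. \<integral>\<^sup>+x. epowr (cellmean k (dist_apply Q k f) x) (enn2real p) \<partial>M) (1 / enn2real p)"
  using assms by (simp add: low_part_def nn_integral_cellmean cell_sum_def atMost_atLeast0)

lemma low_part_ge:
  assumes "0 < p" "k \<le> N"
  shows "Lp_norm M p (cellmean k (dist_apply Q k f)) \<le> low_part M A Num S Q N p f"
proof (cases "p = top")
  case True
  have "cellmean k (dist_apply Q k f) x \<le> low_part M A Num S Q N top f" for x
  proof -
    obtain \<alpha> m where c: "cells (int k) \<alpha> m" "x \<in> S (int k) \<alpha> m" using subcube_cover by blast
    have "abs_mean M (S (int k) \<alpha> m) (dist_apply Q k f) \<le> low_part M A Num S Q N top f"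
      unfolding low_part_def infinity_ennreal_def if_P[OF refl]
      using assms(2) c(1) by (intro SUP_upper2[of k] SUP_upper2[of \<alpha>] SUP_upper2[of m]) auto
    then show ?thesis using cellmean_eq[OF c] by simp
  qed
  then show ?thesis unfolding True by (simp add: Lp_norm_def esssup_I)
next
  case False
  have "(\<integral>\<^sup>+x. epowr (cellmean k (dist_apply Q k f) x) (enn2real p) \<partial>M) \<le>
      (\<Sum>k\<le>N. \<integral>\<^sup>+x. epowr (cellmean k (dist_apply Q k f) x) (enn2real p) \<partial>M)"
    using assms by (intro member_le_sum) auto
  then show ?thesis unfolding low_part_finite[OF False] Lp_norm_finite[OF False] by (intro epowr_mono) auto
qed

text \<open>For p = top an essential supremum has to control every single cell mean. This works
  because a cell has positive measure and \<open>cellmean\<close> is constant on it.\<close>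

lemma low_part_le:
  assumes "0 < p"
  obtains C where "0 < C" "\<And>Q f X. (\<And>k. k \<le> N \<Longrightarrow> Lp_norm M p (cellmean k (dist_apply Q k f)) \<le> X) \<Longrightarrow>
    low_part M A Num S Q N p f \<le> ennreal C * X"
proof (cases "p = top")
  case True
  obtain D where D: "\<And>k \<alpha> m. cells (int k) \<alpha> m \<Longrightarrow> 0 < emeasure M (S (int k) \<alpha> m) \<and> emeasure M (S (int k) \<alpha> m) < \<infinity>"
    using subcube_size by metis
  have "low_part M A Num S Q N p f \<le> ennreal 1 * X"
    if X: "\<And>k. k \<le> N \<Longrightarrow> Lp_norm M p (cellmean k (dist_apply Q k f)) \<le> X" for Q f X
  proof -
    have "abs_mean M (S (int k) \<alpha> m) (dist_apply Q k f) \<le> X" if k: "k \<le> N" and c: "cells (int k) \<alpha> m" for k \<alpha> m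
    proof (rule ccontr)
      assume n: "\<not> abs_mean M (S (int k) \<alpha> m) (dist_apply Q k f) \<le> X"
      have "AE x in M. cellmean k (dist_apply Q k f) x \<le> esssup M (cellmean k (dist_apply Q k f))" by (rule esssup_AE)
      then have "AE x in M. x \<notin> S (int k) \<alpha> m"
        using X[OF k] n cellmean_eq[OF c] by (auto simp: True Lp_norm_def elim!: eventually_mono)
      then have "S (int k) \<alpha> m \<in> null_sets M" using subcube_measurable[OF c] by (simp add: AE_iff_null_sets)
      then show False using D[OF c] by (auto simp: null_sets_def)
    qed
    then show ?thesis unfolding low_part_def True infinity_ennreal_def if_P[OF refl]
      by (auto intro!: SUP_least)
  qed
  then show thesis using that[of 1] by simp
next
  case False
  define r where "r = enn2real p"
  have r: "0 < r" using enn2real_pos[OF assms False] by (simp add: r_def)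
  define C where "C = (real N + 1) powr (1 / r)"
  have "low_part M A Num S Q N p f \<le> ennreal C * X"
    if X: "\<And>k. k \<le> N \<Longrightarrow> Lp_norm M p (cellmean k (dist_apply Q k f)) \<le> X" for Q f X
  proof -
    have "(\<Sum>k\<le>N. \<integral>\<^sup>+x. epowr (cellmean k (dist_apply Q k f) x) r \<partial>M) \<le> (\<Sum>k\<le>N. epowr X r)"
    proof (rule sum_mono)
      fix k assume "k \<in> {..N}"
      then have "epowr (Lp_norm M p (cellmean k (dist_apply Q k f))) r \<le> epowr X r" using r X by (intro epowr_mono) auto
      then show "(\<integral>\<^sup>+x. epowr (cellmean k (dist_apply Q k f) x) r \<partial>M) \<le> epowr X r"
        using r by (simp add: Lp_norm_finite[OF False] r_def[symmetric] epowr_inverse)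
    qed
    also have "\<dots> = ennreal (real N + 1) * epowr X r"
    proof -
      have "ennreal (real N + 1) = of_nat (Suc N)" unfolding ennreal_of_nat_eq_real_of_nat by (simp add: add.commute)
      then show ?thesis by (simp only: sum_constant card_atMost)
    qed
    finally have "low_part M A Num S Q N p f \<le> epowr (ennreal (real N + 1) * epowr X r) (1 / r)"
      unfolding low_part_finite[OF False] r_def[symmetric] using r by (intro epowr_mono) auto
    then show ?thesis using r by (simp add: epowr_cmult epowr_inverse C_def del: ennreal_plus)
  qed
  moreover have "0 < C" by (simp add: C_def)
  ultimately show thesis using that by blast
qed

lemma amp_low:
  assumes "0 < p" "k \<le> N"
  shows "Lp_norm M p (amp Q N s f k) = ennreal (\<delta> powr (- real k * s)) * Lp_norm M p (cellmean k (dist_apply Q k f))"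
proof -
  have "amp Q N s f k = (\<lambda>x. ennreal (\<delta> powr (- real k * s)) * cellmean k (dist_apply Q k f) x)"
    using assms by (simp add: amp_def fun_eq_iff)
  then show ?thesis using Lp_norm_cmult[OF assms(1), of "cellmean k (dist_apply Q k f)" M "\<delta> powr (- real k * s)"] delta by simp
qed

text \<open>One constant for both directions: it dominates the weights of the levels up to N and
  their inverses.\<close>

definition Dmax :: "nat \<Rightarrow> real \<Rightarrow> real" where
  "Dmax N s = (\<Sum>k\<le>N. \<delta> powr (- real k * s) + \<delta> powr (real k * s))"

lemma Dmax: "k \<le> N \<Longrightarrow> \<delta> powr (- real k * s) \<le> Dmax N s" "k \<le> N \<Longrightarrow> \<delta> powr (real k * s) \<le> Dmax N s"
  "0 < Dmax N s"
proof -
  have le: "\<delta> powr (- real k * s) + \<delta> powr (real k * s) \<le> Dmax N s" if "k \<le> N" for k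
    unfolding Dmax_def using that by (intro member_le_sum[of k "{..N}" "\<lambda>k. \<delta> powr (- real k * s) + \<delta> powr (real k * s)"]) auto
  show "k \<le> N \<Longrightarrow> \<delta> powr (- real k * s) \<le> Dmax N s" "k \<le> N \<Longrightarrow> \<delta> powr (real k * s) \<le> Dmax N s"
    using le[of k] powr_ge_zero[of \<delta> "- real k * s"] powr_ge_zero[of \<delta> "real k * s"] by linarith+
  have "0 < \<delta> powr (- real 0 * s) + \<delta> powr (real 0 * s)" using delta by simp
  then show "0 < Dmax N s" using le[of 0] by linarith
qed

lemma amp_low_le:
  assumes "0 < p" "k \<le> N"
  shows "Lp_norm M p (amp Q N s f k) \<le> ennreal (Dmax N s) * low_part M A Num S Q N p f"
  unfolding amp_low[OF assms] by (intro mult_mono low_part_ge assms ennreal_leI Dmax) auto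

lemma low_part_le_amp:
  assumes "0 < p"
  obtains C where "0 < C" "\<And>Q f X. (\<And>k. k \<le> N \<Longrightarrow> Lp_norm M p (amp Q N s f k) \<le> X) \<Longrightarrow>
    low_part M A Num S Q N p f \<le> ennreal C * X"
proof -
  obtain C where C: "0 < C" "\<And>Q f X. (\<And>k. k \<le> N \<Longrightarrow> Lp_norm M p (cellmean k (dist_apply Q k f)) \<le> X) \<Longrightarrow>
    low_part M A Num S Q N p f \<le> ennreal C * X"
    using low_part_le[OF assms, of N] by metis
  have "low_part M A Num S Q N p f \<le> ennreal (C * Dmax N s) * X"
    if X: "\<And>k. k \<le> N \<Longrightarrow> Lp_norm M p (amp Q N s f k) \<le> X" for Q f X
  proof -
    have "low_part M A Num S Q N p f \<le> ennreal C * (ennreal (Dmax N s) * X)"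
    proof (rule C(2))
      fix k assume k: "k \<le> N"
      have "Lp_norm M p (cellmean k (dist_apply Q k f)) = ennreal (\<delta> powr (real k * s)) * Lp_norm M p (amp Q N s f k)"
        unfolding amp_low[OF assms k] using delta by (simp add: mult.assoc[symmetric] flip: ennreal_mult powr_add)
      also have "\<dots> \<le> ennreal (Dmax N s) * X"
        using k by (intro mult_mono X ennreal_leI Dmax) auto
      finally show "Lp_norm M p (cellmean k (dist_apply Q k f)) \<le> ennreal (Dmax N s) * X" .
    qed
    then show ?thesis using C(1) Dmax(3)[of N s] by (simp add: ennreal_mult mult.assoc)
  qed
  then show thesis using that[of "C * Dmax N s"] C(1) Dmax(3)[of N s] by simp
qed

lemma besov_quantity_amp:
  assumes "0 < p" "\<And>k. dist_apply Q k f \<in> borel_measurable M"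
  shows "besov_quantity M \<delta> A Num S Q N s p q f =
    low_part M A Num S Q N p f + lq_norm {N+1..} q (\<lambda>k. Lp_norm M p (amp Q N s f k))"
proof -
  have "ennreal (\<delta> powr (- real k * s)) * Lp_norm M p (\<lambda>x. ennreal (cmod (dist_apply Q k f x))) = Lp_norm M p (amp Q N s f k)"
    if "k \<in> {N+1..}" for k
  proof -
    have "amp Q N s f k = (\<lambda>x. ennreal (\<delta> powr (- real k * s)) * ennreal (cmod (dist_apply Q k f x)))"
      using that by (simp add: amp_def fun_eq_iff)
    then show ?thesis
      using Lp_norm_cmult[OF assms(1), of "\<lambda>x. ennreal (cmod (dist_apply Q k f x))" M "\<delta> powr (- real k * s)"] delta assms(2) by simp
  qed
  then have "lq_norm {N+1..} q (\<lambda>k. ennreal (\<delta> powr (- real k * s)) * Lp_norm M p (\<lambda>x. ennreal (cmod (dist_apply Q k f x)))) =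
      lq_norm {N+1..} q (\<lambda>k. Lp_norm M p (amp Q N s f k))"
    unfolding lq_norm_def by (auto intro!: SUP_cong nn_integral_cong arg_cong[where f = "\<lambda>v. epowr v _"])
  then show ?thesis by (simp add: besov_quantity_def)
qed

lemma triebel_lizorkin_quantity_amp:
  "triebel_lizorkin_quantity M \<delta> A Num S Q N s p q f =
    low_part M A Num S Q N p f + Lp_norm M p (\<lambda>x. lq_norm {N+1..} q (\<lambda>k. amp Q N s f k x))"
proof -
  have "lq_norm {N+1..} q (\<lambda>k. ennreal (\<delta> powr (- real k * s)) * ennreal (cmod (dist_apply Q k f x))) =
      lq_norm {N+1..} q (\<lambda>k. amp Q N s f k x)" for x
    unfolding lq_norm_def amp_def by (auto intro!: SUP_cong nn_integral_cong arg_cong[where f = "\<lambda>v. epowr v _"])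
  then show ?thesis by (simp add: triebel_lizorkin_quantity_def)
qed

text \<open>The exponent e is p if p is finite and r otherwise. Stated for e-th powers, the L^p
  bound is a linear inequality between sequences, and no triangle inequality in L^p is needed when p
  < 1.\<close>

lemma besov_relation:
  assumes p: "ennreal r < p" "0 < r" and \<theta>: "0 < \<theta>" "\<theta> < 1" and \<kappa>: "0 < \<kappa>" "\<kappa> < 1" and C: "0 < C"
  obtains e K where "0 < e" "0 < K" "\<And>g g'. \<lbrakk>\<And>k. g k \<in> borel_measurable M; \<And>k. g' k \<in> borel_measurable M;
     \<And>k x. epowr (g' k x) r \<le> ennreal C * HT \<theta> \<kappa> (\<lambda>k x. epowr (g k x) r) k x\<rbrakk> \<Longrightarrow>
     (\<forall>k. epowr (Lp_norm M p (g' k)) e \<le> ennreal K * (\<integral>\<^sup>+j. geo \<theta> k j * epowr (Lp_norm M p (g j)) e \<partial>count_space UNIV))"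
proof (cases "p = top")
  case True
  show thesis
  proof (rule that[of r "C * (1 / (1 - \<kappa>))"])
    show "0 < C * (1 / (1 - \<kappa>))" using C \<kappa> by simp
    fix g g' :: "nat \<Rightarrow> 'a \<Rightarrow> ennreal" assume [measurable]: "\<And>k. g k \<in> borel_measurable M" "\<And>k. g' k \<in> borel_measurable M"
      and le: "\<And>k x. epowr (g' k x) r \<le> ennreal C * HT \<theta> \<kappa> (\<lambda>k x. epowr (g k x) r) k x"
    have sup: "esssup M (\<lambda>x. epowr (g j x) r) \<le> epowr (Lp_norm M p (g j)) r" for j
      using esssup_AE[of "g j" M] p(2)
      by (intro esssup_I) (auto simp: Lp_norm_def True elim!: eventually_mono intro: epowr_mono)
    have "epowr (Lp_norm M p (g' k)) r \<le> ennreal (C * (1 / (1 - \<kappa>))) * (\<integral>\<^sup>+j. geo \<theta> k j * epowr (Lp_norm M p (g j)) r \<partial>count_space UNIV)"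
      (is "_ \<le> ?X") for k
    proof -
      have "g' k x \<le> epowr ?X (1 / r)" for x
      proof -
        have "epowr (g' k x) r \<le> ennreal C * (ennreal (1 / (1 - \<kappa>)) * (\<integral>\<^sup>+j. geo \<theta> k j * esssup M (\<lambda>x. epowr (g j x) r) \<partial>count_space UNIV))"
          using le[of k x] mult_left_mono[OF HT_le_esssup[OF \<kappa>, of "\<lambda>k x. epowr (g k x) r" \<theta> k x], of "ennreal C"]
          by (auto intro: order_trans)
        also have "\<dots> \<le> ennreal C * (ennreal (1 / (1 - \<kappa>)) * (\<integral>\<^sup>+j. geo \<theta> k j * epowr (Lp_norm M p (g j)) r \<partial>count_space UNIV))"
          by (intro mult_left_mono nn_integral_mono sup) auto
        also have "\<dots> = ?X"
        proof -
          have "ennreal (C * (1 / (1 - \<kappa>))) = ennreal C * ennreal (1 / (1 - \<kappa>))" using C \<kappa> by (intro ennreal_mult) auto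
          then show ?thesis by (simp only: mult.assoc)
        qed
        finally have "epowr (epowr (g' k x) r) (1 / r) \<le> epowr ?X (1 / r)" using p by (intro epowr_mono) auto
        then show ?thesis using p by (simp add: epowr_inverse)
      qed
      then have "Lp_norm M p (g' k) \<le> epowr ?X (1 / r)" by (simp add: Lp_norm_def True esssup_I)
      then have "epowr (Lp_norm M p (g' k)) r \<le> epowr (epowr ?X (1 / r)) r" using p by (intro epowr_mono) auto
      then show ?thesis using p by (simp add: epowr_inverse)
    qed
    then show "\<forall>k. epowr (Lp_norm M p (g' k)) r \<le> ennreal (C * (1 / (1 - \<kappa>))) * (\<integral>\<^sup>+j. geo \<theta> k j * epowr (Lp_norm M p (g j)) r \<partial>count_space UNIV)"
      by blast
  qed (use p in auto)
next
  case False
  define e where "e = enn2real p"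
  have pe: "p = ennreal e" using False by (simp add: e_def ennreal_enn2real_if)
  have e: "r < e" "0 < e" using p pe by (auto simp: ennreal_less_iff)
  have P: "1 < e / r" using e p by simp
  show thesis
  proof (rule HT_Lp[OF \<theta> \<kappa> P])
    fix D assume D: "0 < D" "\<And>G k. (\<And>j. G j \<in> borel_measurable M) \<Longrightarrow>
      (\<integral>\<^sup>+x. epowr (HT \<theta> \<kappa> G k x) (e / r) \<partial>M) \<le> ennreal D * (\<integral>\<^sup>+j. geo \<theta> k j * (\<integral>\<^sup>+x. epowr (G j x) (e / r) \<partial>M) \<partial>count_space UNIV)"
    show thesis
    proof (rule that[OF e(2), of "C powr (e / r) * D"])
      show "0 < C powr (e / r) * D" using C D by simp
      fix g g' :: "nat \<Rightarrow> 'a \<Rightarrow> ennreal" assume [measurable]: "\<And>k. g k \<in> borel_measurable M" "\<And>k. g' k \<in> borel_measurable M"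
        and le: "\<And>k x. epowr (g' k x) r \<le> ennreal C * HT \<theta> \<kappa> (\<lambda>k x. epowr (g k x) r) k x"
      have nrm: "epowr (Lp_norm M p h) e = (\<integral>\<^sup>+x. epowr (h x) e \<partial>M)" for h :: "'a \<Rightarrow> ennreal"
        using e by (simp add: Lp_norm_finite[OF False] e_def[symmetric] epowr_inverse)
      have pw: "epowr (g' k x) e \<le> ennreal (C powr (e / r)) * epowr (HT \<theta> \<kappa> (\<lambda>k x. epowr (g k x) r) k x) (e / r)" for k x
        using epowr_mono[OF le[of k x], of "e / r"] e p C by (simp add: epowr_epowr epowr_mult epowr_ennreal)
      have "(\<integral>\<^sup>+x. epowr (g' k x) e \<partial>M) \<le> ennreal (C powr (e / r) * D) * (\<integral>\<^sup>+j. geo \<theta> k j * (\<integral>\<^sup>+x. epowr (g j x) e \<partial>M) \<partial>count_space UNIV)" for k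
      proof -
        have "(\<integral>\<^sup>+x. epowr (g' k x) e \<partial>M) \<le> ennreal (C powr (e / r)) * (\<integral>\<^sup>+x. epowr (HT \<theta> \<kappa> (\<lambda>k x. epowr (g k x) r) k x) (e / r) \<partial>M)"
          by (subst nn_integral_cmult[symmetric]) (auto intro!: nn_integral_mono pw)
        also have "\<dots> \<le> ennreal (C powr (e / r)) * (ennreal D * (\<integral>\<^sup>+j. geo \<theta> k j * (\<integral>\<^sup>+x. epowr (epowr (g j x) r) (e / r) \<partial>M) \<partial>count_space UNIV))"
          by (intro mult_left_mono D(2)) auto
        finally show ?thesis using p D(1) by (simp add: epowr_epowr ennreal_mult mult.assoc)
      qed
      then show "\<forall>k. epowr (Lp_norm M p (g' k)) e \<le> ennreal (C powr (e / r) * D) * (\<integral>\<^sup>+j. geo \<theta> k j * epowr (Lp_norm M p (g j)) e \<partial>count_space UNIV)"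
        unfolding nrm by blast
    qed
  qed
qed

text \<open>After taking e-th powers the sequence norm has exponent q/e, which may lie below or
  above 1; \<open>geo_Schur\<close> covers both.\<close>

lemma lq_norm_geo:
  assumes "0 < q" "0 < \<theta>" "\<theta> < 1" "0 < e" "0 < K"
  obtains D where "0 < D" "\<And>b b'. (\<forall>k. epowr (b' k) e \<le> ennreal K * (\<integral>\<^sup>+j. geo \<theta> k j * epowr (b j) e \<partial>count_space UNIV)) \<Longrightarrow>
    lq_norm UNIV q b' \<le> ennreal D * lq_norm UNIV q b"
proof (cases "q = top")
  case True
  define L where "L = K * (2 / (1 - \<theta>))"
  have L: "0 < L" using assms by (simp add: L_def)
  show thesis
  proof (rule that[of "L powr (1 / e)"])
    show "0 < L powr (1 / e)" using L by simp
    fix b b' :: "nat \<Rightarrow> ennreal" assume le: "\<forall>k. epowr (b' k) e \<le> ennreal K * (\<integral>\<^sup>+j. geo \<theta> k j * epowr (b j) e \<partial>count_space UNIV)"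
    define X where "X = lq_norm UNIV q b"
    have "b' k \<le> ennreal (L powr (1 / e)) * X" for k
    proof -
      have "epowr (b j) e \<le> epowr X e" for j unfolding X_def using assms by (intro epowr_mono lq_norm_ge) auto
      then have "ennreal K * (\<integral>\<^sup>+j. geo \<theta> k j * epowr (b j) e \<partial>count_space UNIV) \<le> ennreal K * (\<integral>\<^sup>+j. geo \<theta> k j * epowr X e \<partial>count_space UNIV)"
        by (intro mult_left_mono nn_integral_mono) auto
      also have "\<dots> \<le> ennreal K * (ennreal (2 / (1 - \<theta>)) * epowr X e)"
        using nn_integral_geo[OF assms(2,3), of k] by (simp add: nn_integral_multc mult_left_mono mult_right_mono)
      also have "\<dots> = ennreal L * epowr X e"
      proof -
        have "ennreal L = ennreal K * ennreal (2 / (1 - \<theta>))" unfolding L_def using assms by (intro ennreal_mult) auto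
        then show ?thesis by (simp only: mult.assoc)
      qed
      finally have "epowr (b' k) e \<le> ennreal L * epowr X e" using le by (meson order_trans)
      then have "epowr (epowr (b' k) e) (1 / e) \<le> epowr (ennreal L * epowr X e) (1 / e)" using assms by (intro epowr_mono) auto
      then show ?thesis using assms L by (simp add: epowr_mult epowr_inverse epowr_ennreal)
    qed
    then show "lq_norm UNIV q b' \<le> ennreal (L powr (1 / e)) * lq_norm UNIV q b"
      unfolding X_def unfolding True lq_norm_top by (intro SUP_least) auto
  qed
next
  case False
  define t where "t = enn2real q"
  have t: "0 < t" using enn2real_pos[OF assms(1) False] by (simp add: t_def)
  have te: "0 < t / e" using t assms by simp
  obtain D where D: "0 < D" "\<And>b. (\<integral>\<^sup>+k. epowr (\<integral>\<^sup>+j. geo \<theta> k j * b j \<partial>count_space UNIV) (t / e) \<partial>count_space UNIV)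
    \<le> ennreal D * (\<integral>\<^sup>+j. epowr (b j) (t / e) \<partial>count_space UNIV)"
    using geo_Schur[OF assms(2,3) te] by blast
  define L where "L = K powr (t / e) * D"
  have L: "0 < L" using assms D by (simp add: L_def)
  show thesis
  proof (rule that[of "L powr (1 / t)"])
    show "0 < L powr (1 / t)" using L by simp
    fix b b' :: "nat \<Rightarrow> ennreal" assume le: "\<forall>k. epowr (b' k) e \<le> ennreal K * (\<integral>\<^sup>+j. geo \<theta> k j * epowr (b j) e \<partial>count_space UNIV)"
    have "epowr (b' k) t \<le> ennreal (K powr (t / e)) * epowr (\<integral>\<^sup>+j. geo \<theta> k j * epowr (b j) e \<partial>count_space UNIV) (t / e)" for k
      using epowr_mono[OF le[rule_format, of k], of "t / e"] te assms by (simp add: epowr_epowr epowr_mult epowr_ennreal)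
    then have "(\<integral>\<^sup>+k. epowr (b' k) t \<partial>count_space UNIV) \<le> (\<integral>\<^sup>+k. ennreal (K powr (t / e)) * epowr (\<integral>\<^sup>+j. geo \<theta> k j * epowr (b j) e \<partial>count_space UNIV) (t / e) \<partial>count_space UNIV)"
      by (intro nn_integral_mono)
    also have "\<dots> \<le> ennreal (K powr (t / e)) * (ennreal D * (\<integral>\<^sup>+j. epowr (epowr (b j) e) (t / e) \<partial>count_space UNIV))"
      by (simp add: nn_integral_cmult mult_left_mono D)
    also have "\<dots> = ennreal L * (\<integral>\<^sup>+j. epowr (b j) t \<partial>count_space UNIV)"
      using assms D by (simp add: epowr_epowr L_def ennreal_mult mult.assoc)
    finally have "lq_norm UNIV q b' \<le> epowr (ennreal L * (\<integral>\<^sup>+j. epowr (b j) t \<partial>count_space UNIV)) (1 / t)"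
      unfolding lq_norm_finite[OF False] t_def[symmetric] using t by (intro epowr_mono) auto
    then show "lq_norm UNIV q b' \<le> ennreal (L powr (1 / t)) * lq_norm UNIV q b"
      unfolding lq_norm_finite[OF False] t_def[symmetric] using t L by (simp add: epowr_mult epowr_ennreal)
  qed
qed

text \<open>Taking r-th powers turns the exponents p and q into p/r and q/r, both larger than 1,
  where the mixed-norm bounds for \<open>HT\<close> apply.\<close>

lemma triebel_relation:
  assumes p: "ennreal r < p" "p \<noteq> top" and q: "ennreal r < q" and r: "0 < r"
    and \<theta>: "0 < \<theta>" "\<theta> < 1" and \<kappa>: "0 < \<kappa>" "\<kappa> < 1" and C: "0 < C"
  obtains K where "0 < K" "\<And>g g'. \<lbrakk>\<And>k. g k \<in> borel_measurable M;
     \<And>k x. epowr (g' k x) r \<le> ennreal C * HT \<theta> \<kappa> (\<lambda>k x. epowr (g k x) r) k x\<rbrakk> \<Longrightarrow>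
     Lp_norm M p (\<lambda>x. lq_norm UNIV q (\<lambda>k. g' k x)) \<le> ennreal K * Lp_norm M p (\<lambda>x. lq_norm UNIV q (\<lambda>k. g k x))"
proof -
  define e where "e = enn2real p"
  have pe: "p = ennreal e" using p by (simp add: e_def ennreal_enn2real_if)
  have e: "r < e" "0 < e" using p(1) pe r by (auto simp: ennreal_less_iff)
  have P: "1 < e / r" using e r by simp
  \<comment> \<open>The e-th power of the inner norm as a functional of the r-th powers, so that q =
    top and finite q can be treated together from here on.\<close>
  define \<Phi> where "\<Phi> u = (if q = top then epowr (SUP k. u k) (e / r)
     else epowr (\<integral>\<^sup>+k. epowr (u k) (enn2real q / r) \<partial>count_space UNIV) ((e / r) / (enn2real q / r)))" for u :: "nat \<Rightarrow> ennreal"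
  have q0: "0 < q" using q r by (metis ennreal_less_zero_iff less_trans not_less_zero zero_less_iff_neq_zero less_le_trans zero_le)
  have \<Phi>: "epowr (lq_norm UNIV q c) e = \<Phi> (\<lambda>k. epowr (c k) r)" for c
  proof (cases "q = top")
    case True
    then show ?thesis using r by (simp add: \<Phi>_def lq_norm_top epowr_Sup[symmetric] epowr_epowr)
  next
    case False
    then show ?thesis using r enn2real_pos[OF q0 False] by (simp add: \<Phi>_def lq_norm_finite epowr_epowr)
  qed
  have \<Phi>_mono: "\<Phi> u \<le> ennreal (B powr (e / r)) * \<Phi> v" if u: "\<And>k. u k \<le> ennreal B * v k" and B: "0 < B" for u v B
  proof (cases "q = top")
    case True
    have "(SUP k. u k) \<le> ennreal B * (SUP k. v k)"
      using u by (intro SUP_least) (meson SUP_upper UNIV_I mult_left_mono order_trans zero_le)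
    then have "epowr (SUP k. u k) (e / r) \<le> epowr (ennreal B * (SUP k. v k)) (e / r)" using P by (intro epowr_mono) auto
    then show ?thesis using P B by (simp add: \<Phi>_def True epowr_mult epowr_ennreal)
  next
    case False
    define t where "t = enn2real q / r"
    have t: "0 < t" using enn2real_pos[OF q0 False] r by (simp add: t_def)
    have "(\<integral>\<^sup>+k. epowr (u k) t \<partial>count_space UNIV) \<le> (\<integral>\<^sup>+k. epowr (ennreal B * v k) t \<partial>count_space UNIV)"
      using t u by (intro nn_integral_mono epowr_mono) auto
    also have "\<dots> = ennreal (B powr t) * (\<integral>\<^sup>+k. epowr (v k) t \<partial>count_space UNIV)"
      using t B by (simp add: epowr_mult epowr_ennreal nn_integral_cmult)
    finally have "\<Phi> u \<le> epowr (ennreal (B powr t) * (\<integral>\<^sup>+k. epowr (v k) t \<partial>count_space UNIV)) ((e / r) / t)"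
      unfolding \<Phi>_def if_not_P[OF False] t_def[symmetric] using r e t by (intro epowr_mono) auto
    also have "\<dots> = ennreal (B powr (e / r)) * \<Phi> v"
      unfolding \<Phi>_def if_not_P[OF False] t_def[symmetric] using P t B e r by (subst epowr_cmult) (auto simp: powr_powr)
    finally show ?thesis .
  qed
  have "\<exists>D>0. \<forall>G. (\<forall>j. G j \<in> borel_measurable M) \<longrightarrow>
    (\<integral>\<^sup>+x. \<Phi> (\<lambda>k. HT \<theta> \<kappa> G k x) \<partial>M) \<le> ennreal D * (\<integral>\<^sup>+x. \<Phi> (\<lambda>k. G k x) \<partial>M)"
  proof (cases "q = top")
    case True
    then show ?thesis using HT_TL_sup[OF \<theta> \<kappa> P] unfolding \<Phi>_def if_P[OF True] by metis
  next
    case False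
    have "r < enn2real q" using q False r by (cases q) (auto simp: ennreal_less_iff)
    then have "1 < enn2real q / r" using r by simp
    then show ?thesis using HT_TL[OF \<theta> \<kappa> P] False unfolding \<Phi>_def if_not_P[OF False] by metis
  qed
  then obtain D where D: "0 < D" "\<And>G. (\<forall>j. G j \<in> borel_measurable M) \<Longrightarrow>
    (\<integral>\<^sup>+x. \<Phi> (\<lambda>k. HT \<theta> \<kappa> G k x) \<partial>M) \<le> ennreal D * (\<integral>\<^sup>+x. \<Phi> (\<lambda>k. G k x) \<partial>M)" by blast
  define L where "L = C powr (e / r) * D"
  have L: "0 < L" using C D by (simp add: L_def)
  show thesis
  proof (rule that[of "L powr (1 / e)"])
    show "0 < L powr (1 / e)" using L by simp
    fix g g' :: "nat \<Rightarrow> 'a \<Rightarrow> ennreal" assume g[measurable]: "\<And>k. g k \<in> borel_measurable M"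
      and le: "\<And>k x. epowr (g' k x) r \<le> ennreal C * HT \<theta> \<kappa> (\<lambda>k x. epowr (g k x) r) k x"
    have "(\<integral>\<^sup>+x. epowr (lq_norm UNIV q (\<lambda>k. g' k x)) e \<partial>M) \<le>
        (\<integral>\<^sup>+x. ennreal (C powr (e / r)) * \<Phi> (\<lambda>k. HT \<theta> \<kappa> (\<lambda>k x. epowr (g k x) r) k x) \<partial>M)"
      unfolding \<Phi> by (intro nn_integral_mono \<Phi>_mono le C)
    also have "\<dots> = ennreal (C powr (e / r)) * (\<integral>\<^sup>+x. \<Phi> (\<lambda>k. HT \<theta> \<kappa> (\<lambda>k x. epowr (g k x) r) k x) \<partial>M)"
    proof (rule nn_integral_cmult)
      show "(\<lambda>x. \<Phi> (\<lambda>k. HT \<theta> \<kappa> (\<lambda>k x. epowr (g k x) r) k x)) \<in> borel_measurable M"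
        unfolding \<Phi>_def
        by (cases "q = top") (auto intro!: epowr_measurable measurable_nn_integral_count_space borel_measurable_SUP)
    qed
    also have "\<dots> \<le> ennreal (C powr (e / r)) * (ennreal D * (\<integral>\<^sup>+x. \<Phi> (\<lambda>k. epowr (g k x) r) \<partial>M))"
      by (intro mult_left_mono D) auto
    also have "\<dots> = ennreal L * (\<integral>\<^sup>+x. epowr (lq_norm UNIV q (\<lambda>k. g k x)) e \<partial>M)"
      unfolding \<Phi> using C D by (simp add: L_def ennreal_mult mult.assoc)
    finally have "Lp_norm M p (\<lambda>x. lq_norm UNIV q (\<lambda>k. g' k x)) \<le> epowr (ennreal L * (\<integral>\<^sup>+x. epowr (lq_norm UNIV q (\<lambda>k. g k x)) e \<partial>M)) (1 / e)"
      unfolding Lp_norm_finite[OF p(2)] e_def[symmetric] using e by (intro epowr_mono) auto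
    then show "Lp_norm M p (\<lambda>x. lq_norm UNIV q (\<lambda>k. g' k x)) \<le> ennreal (L powr (1 / e)) * Lp_norm M p (\<lambda>x. lq_norm UNIV q (\<lambda>k. g k x))"
      unfolding Lp_norm_finite[OF p(2)] e_def[symmetric] using e L by (simp add: epowr_mult epowr_ennreal)
  qed
qed

text \<open>r > \<omega>/(\<omega>+t) is the same as \<omega> (1-r) < r t, and r >
  \<omega>/(\<omega>+t+s) the same as \<omega> (1-r) < r (t+s): the index encodes the two conditions
  of the pointwise estimate.\<close>

lemma exponent_between:
  assumes p: "ennreal (p_index \<omega> s t) < p" and t: "0 < t" "- t < s"
  obtains r where "0 < r" "r \<le> 1" "ennreal r < p" "\<omega> * (1 - r) < r * t" "\<omega> * (1 - r) < r * (t + s)"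
proof -
  have t2: "0 < \<omega> + t" "0 < \<omega> + t + s" using t omega_nonneg by linarith+
  have i: "0 \<le> p_index \<omega> s t" "p_index \<omega> s t < 1"
    using t t2 omega_nonneg by (auto simp: p_index_def le_max_iff_disj)
  then have "ennreal (p_index \<omega> s t) < min p 1" using p by (simp add: ennreal_less_one_iff)
  then obtain x where x: "ennreal (p_index \<omega> s t) < x" "x < min p 1" using dense by blast
  then obtain r where r: "x = ennreal r" "0 \<le> r" by (cases x) auto
  have r1: "p_index \<omega> s t < r" "r < 1" "ennreal r < p"
    using x r i by (auto simp: ennreal_less_iff ennreal_less_one_iff)
  then have "\<omega> / (\<omega> + t) < r" "\<omega> / (\<omega> + t + s) < r" by (auto simp: p_index_def)
  then have "\<omega> < r * (\<omega> + t)" "\<omega> < r * (\<omega> + t + s)" using t2 by (auto simp: pos_divide_less_eq)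
  then have "\<omega> * (1 - r) < r * t" "\<omega> * (1 - r) < r * (t + s)" by (auto simp: algebra_simps)
  then show thesis using that[of r] r1 i by simp
qed

section \<open>One-sided comparison of the quantities\<close>

context
  fixes Q P :: "nat \<Rightarrow> 'a \<Rightarrow> 'a \<Rightarrow> complex" and zQ zP :: "int \<Rightarrow> 'i \<Rightarrow> 'a" and x0 :: 'a and \<eta> \<beta> \<gamma> s :: real and N N' :: nat
  assumes Q: "exp_IATI M d \<delta> A zQ \<eta> Q" and P: "exp_IATI M d \<delta> A zP \<eta> P"
    and ex: "0 < \<beta>" "\<beta> < \<eta>" "0 < \<gamma>" "\<gamma> < \<eta>"
    and cal: "calderon_index M d A0 \<delta> A Num S x0 \<eta> \<beta> \<gamma> Q N"
    and s: "- min \<beta> \<gamma> < s" "s < min \<beta> \<gamma>"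
begin

text \<open>The estimate runs over the complete sequence of levels. Low and high parts for Q are
  merged into one sequence norm, transferred to P, and the result is taken apart again at
  N'.\<close>

lemma besov_le:
  assumes p: "ennreal (p_index \<omega> s (min \<beta> \<gamma>)) < p" and q: "0 < q"
  obtains C where "0 < C" "\<And>f. f \<in> distributions M d A0 x0 \<eta> \<beta> \<gamma> \<Longrightarrow>
    besov_quantity M \<delta> A Num S P N' s p q f \<le> ennreal C * besov_quantity M \<delta> A Num S Q N s p q f"
proof -
  have "0 < min \<beta> \<gamma>" using ex by simp
  then obtain r where r: "0 < r" "r \<le> 1" "ennreal r < p" "\<omega> * (1 - r) < r * min \<beta> \<gamma>" "\<omega> * (1 - r) < r * (min \<beta> \<gamma> + s)"
    using exponent_between[OF p _ s(1)] by metis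
  have p0: "0 < p" using r by (metis ennreal_less_zero_iff less_le_trans not_less zero_le less_trans)
  show thesis
  proof (rule pointwise_estimate[OF Q P ex cal s r(1,2,4,5), of N'])
    fix C0' \<theta> \<kappa> assume C0': "0 < C0'" and \<theta>: "0 < \<theta>" "\<theta> < 1" and \<kappa>: "0 < \<kappa>" "\<kappa> < 1"
      and pw: "\<And>f k' x. f \<in> distributions M d A0 x0 \<eta> \<beta> \<gamma> \<Longrightarrow>
       epowr (amp P N' s f k' x) r \<le> ennreal C0' * HT \<theta> \<kappa> (\<lambda>k x. epowr (amp Q N s f k x) r) k' x"
    show thesis
    proof (rule besov_relation[OF r(3,1) \<theta> \<kappa> C0'])
      fix e K assume e: "0 < e" and K: "0 < K" and rel: "\<And>g g'. \<lbrakk>\<And>k. g k \<in> borel_measurable M; \<And>k. g' k \<in> borel_measurable M;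
        \<And>k x. epowr (g' k x) r \<le> ennreal C0' * HT \<theta> \<kappa> (\<lambda>k x. epowr (g k x) r) k x\<rbrakk> \<Longrightarrow>
        (\<forall>k. epowr (Lp_norm M p (g' k)) e \<le> ennreal K * (\<integral>\<^sup>+j. geo \<theta> k j * epowr (Lp_norm M p (g j)) e \<partial>count_space UNIV))"
      obtain D where D: "0 < D" "\<And>b b'. (\<forall>k. epowr (b' k) e \<le> ennreal K * (\<integral>\<^sup>+j. geo \<theta> k j * epowr (b j) e \<partial>count_space UNIV)) \<Longrightarrow>
        lq_norm UNIV q b' \<le> ennreal D * lq_norm UNIV q b"
        using lq_norm_geo[OF q \<theta> e K] by blast
      obtain C1' where C1': "0 < C1'" "\<And>c. lq_norm UNIV q c \<le> ennreal C1' * ((\<Sum>k\<le>N. c k) + lq_norm {N+1..} q c)"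
        using lq_norm_split[OF q] by blast
      obtain C2' where C2': "0 < C2'" "\<And>Q f X. (\<And>k. k \<le> N' \<Longrightarrow> Lp_norm M p (amp Q N' s f k) \<le> X) \<Longrightarrow>
        low_part M A Num S Q N' p f \<le> ennreal C2' * X"
        using low_part_le_amp[OF p0, of N' s] by metis
      \<comment> \<open>N + 1 low levels, each at most Dmax times the quantity X, and X once more
        for the tail.\<close>
      define C3 where "C3 = (real N + 1) * Dmax N s + 1"
      have C3: "0 < C3" using Dmax(3)[of N s] by (simp add: C3_def add_nonneg_pos)
      define E where "E = (C2' + 1) * (D * (C1' * C3))"
      have E: "0 < E" using C1' C2' C3 D by (simp add: E_def)
      show thesis
      proof (rule that[OF E])
        fix f assume f: "f \<in> distributions M d A0 x0 \<eta> \<beta> \<gamma>"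
        note mQ = amp_measurable[OF f Q ex(1,2,4)] and mP = amp_measurable[OF f P ex(1,2,4)]
        define b where "b k = Lp_norm M p (amp Q N s f k)" for k
        define b' where "b' k = Lp_norm M p (amp P N' s f k)" for k
        define X where "X = besov_quantity M \<delta> A Num S Q N s p q f"
        have Xeq: "X = low_part M A Num S Q N p f + lq_norm {N+1..} q b"
          unfolding X_def b_def by (rule besov_quantity_amp[OF p0 mQ(2)])
        have low: "b k \<le> ennreal (Dmax N s) * X" if "k \<le> N" for k
        proof -
          have "b k \<le> ennreal (Dmax N s) * low_part M A Num S Q N p f" unfolding b_def by (rule amp_low_le[OF p0 that])
          also have "\<dots> \<le> ennreal (Dmax N s) * X" by (intro mult_left_mono) (auto simp: Xeq)
          finally show ?thesis .
        qed
        have "(\<Sum>k\<le>N. b k) + lq_norm {N+1..} q b \<le> (\<Sum>k\<le>N. ennreal (Dmax N s) * X) + X"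
          by (intro add_mono sum_mono low) (auto simp: Xeq)
        also have "\<dots> = ennreal C3 * X"
        proof -
          have "ennreal C3 = of_nat (Suc N) * ennreal (Dmax N s) + 1"
            unfolding ennreal_of_nat_eq_real_of_nat C3_def using Dmax(3)[of N s]
            by (simp add: add.commute flip: ennreal_mult ennreal_plus ennreal_1)
          then show ?thesis by (simp add: distrib_right mult.assoc)
        qed
        finally have 1: "lq_norm UNIV q b \<le> ennreal C1' * (ennreal C3 * X)"
          using C1'(2)[of b] by (meson mult_left_mono order_trans zero_le)
        have "\<forall>k. epowr (b' k) e \<le> ennreal K * (\<integral>\<^sup>+j. geo \<theta> k j * epowr (b j) e \<partial>count_space UNIV)"
          unfolding b_def b'_def by (rule rel[OF mQ(1) mP(1) pw[OF f]])
        then have 2: "lq_norm UNIV q b' \<le> ennreal D * (ennreal C1' * (ennreal C3 * X))"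
          using D(2) 1 by (meson mult_left_mono order_trans zero_le)
        define Y where "Y = ennreal D * (ennreal C1' * (ennreal C3 * X))"
        have "low_part M A Num S P N' p f \<le> ennreal C2' * Y"
        proof (rule C2'(2))
          fix k
          have "b' k \<le> lq_norm UNIV q b'" using q by (intro lq_norm_ge) auto
          then show "Lp_norm M p (amp P N' s f k) \<le> Y" using 2 unfolding b'_def Y_def by (rule order_trans)
        qed
        moreover have "lq_norm {N'+1..} q b' \<le> Y"
          using lq_norm_mono[OF q, of "{N'+1..}" UNIV b' b'] 2 by (auto simp: Y_def)
        ultimately have "besov_quantity M \<delta> A Num S P N' s p q f \<le> ennreal C2' * Y + Y"
          unfolding besov_quantity_amp[OF p0 mP(2)] b'_def[symmetric] by (rule add_mono)
        also have "\<dots> = ennreal (C2' + 1) * Y" using C2'(1) by (simp add: distrib_right)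
        also have "\<dots> = ennreal E * X"
          using C1' C2' C3 D unfolding E_def Y_def by (simp add: ennreal_mult mult.assoc del: ennreal_plus)
        finally show "besov_quantity M \<delta> A Num S P N' s p q f \<le> ennreal E * besov_quantity M \<delta> A Num S Q N s p q f"
          by (simp add: X_def)
      qed
    qed
  qed
qed

text \<open>As for \<open>besov_le\<close>, but the splitting at N takes place inside the L^p norm,
  so the finitely many pieces have to be separated by \<open>Lp_norm_sum\<close>.\<close>

lemma triebel_lizorkin_le:
  assumes p: "ennreal (p_index \<omega> s (min \<beta> \<gamma>)) < p" "p \<noteq> top" and q: "ennreal (p_index \<omega> s (min \<beta> \<gamma>)) < q"
  obtains C where "0 < C" "\<And>f. f \<in> distributions M d A0 x0 \<eta> \<beta> \<gamma> \<Longrightarrow>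
    triebel_lizorkin_quantity M \<delta> A Num S P N' s p q f \<le> ennreal C * triebel_lizorkin_quantity M \<delta> A Num S Q N s p q f"
proof -
  have "0 < min \<beta> \<gamma>" "ennreal (p_index \<omega> s (min \<beta> \<gamma>)) < min p q" using ex p q by auto
  then obtain r where r: "0 < r" "r \<le> 1" "ennreal r < min p q" "\<omega> * (1 - r) < r * min \<beta> \<gamma>" "\<omega> * (1 - r) < r * (min \<beta> \<gamma> + s)"
    using exponent_between[OF _ _ s(1)] by metis
  have pq: "ennreal r < p" "ennreal r < q" using r by auto
  have p0: "0 < p" "0 < q" using pq r by (metis ennreal_less_zero_iff less_le_trans not_less zero_le less_trans)+
  show thesis
  proof (rule pointwise_estimate[OF Q P ex cal s r(1,2,4,5), of N'])
    fix C0' \<theta> \<kappa> assume C0': "0 < C0'" and \<theta>: "0 < \<theta>" "\<theta> < 1" and \<kappa>: "0 < \<kappa>" "\<kappa> < 1"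
      and pw: "\<And>f k' x. f \<in> distributions M d A0 x0 \<eta> \<beta> \<gamma> \<Longrightarrow>
       epowr (amp P N' s f k' x) r \<le> ennreal C0' * HT \<theta> \<kappa> (\<lambda>k x. epowr (amp Q N s f k x) r) k' x"
    show thesis
    proof (rule triebel_relation[OF pq(1) p(2) pq(2) r(1) \<theta> \<kappa> C0'])
      fix D assume D: "0 < D" and rel: "\<And>g g'. \<lbrakk>\<And>k. g k \<in> borel_measurable M;
        \<And>k x. epowr (g' k x) r \<le> ennreal C0' * HT \<theta> \<kappa> (\<lambda>k x. epowr (g k x) r) k x\<rbrakk> \<Longrightarrow>
        Lp_norm M p (\<lambda>x. lq_norm UNIV q (\<lambda>k. g' k x)) \<le> ennreal D * Lp_norm M p (\<lambda>x. lq_norm UNIV q (\<lambda>k. g k x))"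
      obtain C1' where C1': "0 < C1'" "\<And>c. lq_norm UNIV q c \<le> ennreal C1' * ((\<Sum>k\<le>N. c k) + lq_norm {N+1..} q c)"
        using lq_norm_split[OF p0(2)] by blast
      obtain C2' where C2': "0 < C2'" "\<And>Q f X. (\<And>k. k \<le> N' \<Longrightarrow> Lp_norm M p (amp Q N' s f k) \<le> X) \<Longrightarrow>
        low_part M A Num S Q N' p f \<le> ennreal C2' * X"
        using low_part_le_amp[OF p0(1), of N' s] by metis
      have fin: "finite {..Suc N}" by simp
      obtain C4 where C4: "0 < C4" "\<And>(M :: 'a measure) h. (\<And>i. i \<in> {..Suc N} \<Longrightarrow> h i \<in> borel_measurable M) \<Longrightarrow>
        Lp_norm M p (\<lambda>x. \<Sum>i\<le>Suc N. h i x) \<le> ennreal C4 * (\<Sum>i\<le>Suc N. Lp_norm M p (h i))"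
        by (rule Lp_norm_sum[OF p0(1) p(2) fin]) (erule that, blast)
      define C3 where "C3 = (real N + 1) * Dmax N s + 1"
      have C3: "0 < C3" using Dmax(3)[of N s] by (simp add: C3_def add_nonneg_pos)
      define E where "E = (C2' + 1) * (D * (C1' * (C4 * C3)))"
      have E: "0 < E" using C1' C2' C3 C4(1) D by (simp add: E_def)
      show thesis
      proof (rule that[OF E])
        fix f assume f: "f \<in> distributions M d A0 x0 \<eta> \<beta> \<gamma>"
        note mQ = amp_measurable[OF f Q ex(1,2,4)] and mP = amp_measurable[OF f P ex(1,2,4)]
        define g where "g = amp Q N s f"
        define g' where "g' = amp P N' s f"
        have [measurable]: "g k \<in> borel_measurable M" "g' k \<in> borel_measurable M" for k
          using mQ(1) mP(1) by (auto simp: g_def g'_def)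
        define t where "t x = lq_norm {N+1..} q (\<lambda>k. g k x)" for x
        have tm[measurable]: "t \<in> borel_measurable M" unfolding t_def[abs_def] by (rule lq_norm_measurable) simp
        define X where "X = triebel_lizorkin_quantity M \<delta> A Num S Q N s p q f"
        have Xeq: "X = low_part M A Num S Q N p f + Lp_norm M p t"
          unfolding X_def t_def g_def by (rule triebel_lizorkin_quantity_amp)
        have low: "Lp_norm M p (g k) \<le> ennreal (Dmax N s) * X" if "k \<le> N" for k
        proof -
          have "Lp_norm M p (g k) \<le> ennreal (Dmax N s) * low_part M A Num S Q N p f" unfolding g_def by (rule amp_low_le[OF p0(1) that])
          also have "\<dots> \<le> ennreal (Dmax N s) * X" by (intro mult_left_mono) (auto simp: Xeq)
          finally show ?thesis .
        qed
        \<comment> \<open>Slots 0 to N carry the low levels and slot N + 1 the sequence norm of all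
          higher ones, which gives a finite family for \<open>Lp_norm_sum\<close>.\<close>
        define h where "h i = (if i \<le> N then g i else t)" for i
        have hm: "h i \<in> borel_measurable M" for i by (simp add: h_def)
        have sumh: "(\<Sum>i\<le>Suc N. F (h i)) = (\<Sum>i\<le>N. F (g i)) + F t" for F :: "('a \<Rightarrow> ennreal) \<Rightarrow> ennreal"
          by (simp add: h_def)
        have "Lp_norm M p (\<lambda>x. lq_norm UNIV q (\<lambda>k. g k x)) \<le> Lp_norm M p (\<lambda>x. ennreal C1' * (\<Sum>i\<le>Suc N. h i x))"
        proof (rule Lp_norm_mono)
          show "(\<lambda>x. lq_norm UNIV q (\<lambda>k. g k x)) \<in> borel_measurable M" by (rule lq_norm_measurable) simp
          show "lq_norm UNIV q (\<lambda>k. g k x) \<le> ennreal C1' * (\<Sum>i\<le>Suc N. h i x)" for x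
            using C1'(2)[of "\<lambda>k. g k x"] sumh[of "\<lambda>u. u x"] by (simp add: t_def)
        qed
        also have "\<dots> = ennreal C1' * Lp_norm M p (\<lambda>x. \<Sum>i\<le>Suc N. h i x)"
          using hm C1'(1) p0 by (intro Lp_norm_cmult) auto
        also have "\<dots> \<le> ennreal C1' * (ennreal C4 * (\<Sum>i\<le>Suc N. Lp_norm M p (h i)))"
          using hm by (intro mult_left_mono C4(2)) auto
        also have "(\<Sum>i\<le>Suc N. Lp_norm M p (h i)) = (\<Sum>i\<le>N. Lp_norm M p (g i)) + Lp_norm M p t"
          by (rule sumh)
        also have "\<dots> \<le> (\<Sum>k\<le>N. ennreal (Dmax N s) * X) + X"
          by (intro add_mono sum_mono low) (auto simp: Xeq)
        also have "\<dots> = ennreal C3 * X"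
        proof -
          have "ennreal C3 = of_nat (Suc N) * ennreal (Dmax N s) + 1"
            unfolding ennreal_of_nat_eq_real_of_nat C3_def using Dmax(3)[of N s]
            by (simp add: add.commute flip: ennreal_mult ennreal_plus ennreal_1)
          then show ?thesis by (simp add: distrib_right mult.assoc)
        qed
        finally have 1: "Lp_norm M p (\<lambda>x. lq_norm UNIV q (\<lambda>k. g k x)) \<le> ennreal C1' * (ennreal C4 * (ennreal C3 * X))"
          by (simp add: mult_left_mono)
        have "Lp_norm M p (\<lambda>x. lq_norm UNIV q (\<lambda>k. g' k x)) \<le> ennreal D * Lp_norm M p (\<lambda>x. lq_norm UNIV q (\<lambda>k. g k x))"
          unfolding g_def g'_def by (rule rel[OF mQ(1) pw[OF f]])
        also have "\<dots> \<le> ennreal D * (ennreal C1' * (ennreal C4 * (ennreal C3 * X)))"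
          using 1 by (rule mult_left_mono) simp
        finally have 2: "Lp_norm M p (\<lambda>x. lq_norm UNIV q (\<lambda>k. g' k x)) \<le> ennreal D * (ennreal C1' * (ennreal C4 * (ennreal C3 * X)))" .
        define Y where "Y = ennreal D * (ennreal C1' * (ennreal C4 * (ennreal C3 * X)))"
        have "low_part M A Num S P N' p f \<le> ennreal C2' * Y"
        proof (rule C2'(2))
          fix k
          have "Lp_norm M p (g' k) \<le> Lp_norm M p (\<lambda>x. lq_norm UNIV q (\<lambda>k. g' k x))"
            using p0 lq_norm_ge[OF p0(2), of k UNIV "\<lambda>k. g' k _"] by (intro Lp_norm_mono) auto
          then show "Lp_norm M p (amp P N' s f k) \<le> Y" using 2 unfolding g'_def Y_def by (rule order_trans)
        qed
        moreover have "Lp_norm M p (\<lambda>x. lq_norm {N'+1..} q (\<lambda>k. g' k x)) \<le> Y"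
        proof -
          have "Lp_norm M p (\<lambda>x. lq_norm {N'+1..} q (\<lambda>k. g' k x)) \<le> Lp_norm M p (\<lambda>x. lq_norm UNIV q (\<lambda>k. g' k x))"
            using p0 by (intro Lp_norm_mono lq_norm_mono lq_norm_measurable) auto
          then show ?thesis using 2 unfolding Y_def by (rule order_trans)
        qed
        ultimately have "triebel_lizorkin_quantity M \<delta> A Num S P N' s p q f \<le> ennreal C2' * Y + Y"
          unfolding triebel_lizorkin_quantity_amp g'_def[symmetric] by (rule add_mono)
        also have "\<dots> = ennreal (C2' + 1) * Y" using C2'(1) by (simp add: distrib_right)
        also have "\<dots> = ennreal E * X"
          using C1' C2' C3 C4(1) D unfolding E_def Y_def by (simp add: ennreal_mult mult.assoc del: ennreal_plus)
        finally show "triebel_lizorkin_quantity M \<delta> A Num S P N' s p q f \<le> ennreal E * triebel_lizorkin_quantity M \<delta> A Num S Q N s p q f"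
          by (simp add: X_def)
      qed
    qed
  qed
qed

end

end

lemma equivalent_onI:
  assumes "0 < C" "\<And>f. f \<in> F \<Longrightarrow> a f \<le> ennreal C * b f" and "0 < D" "\<And>f. f \<in> F \<Longrightarrow> b f \<le> ennreal D * a f"
  shows "equivalent_on F a b"
proof -
  define K where "K = max C D"
  have K: "0 < K" "C \<le> K" "D \<le> K" using assms by (auto simp: K_def)
  have "ennreal (1 / K) * a f \<le> b f" "b f \<le> ennreal K * a f" if f: "f \<in> F" for f
  proof -
    have "a f \<le> ennreal C * b f" by (rule assms(2)[OF f])
    also have "\<dots> \<le> ennreal K * b f" using K by (intro mult_right_mono ennreal_leI) auto
    finally have "ennreal (1 / K) * a f \<le> ennreal (1 / K) * (ennreal K * b f)" by (rule mult_left_mono) simp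
    also have "\<dots> = b f" using K by (simp add: mult.assoc[symmetric] flip: ennreal_mult)
    finally show "ennreal (1 / K) * a f \<le> b f" .
    have "b f \<le> ennreal D * a f" by (rule assms(4)[OF f])
    also have "\<dots> \<le> ennreal K * a f" using K by (intro mult_right_mono ennreal_leI) auto
    finally show "b f \<le> ennreal K * a f" .
  qed
  then show ?thesis using K(1) unfolding equivalent_on_def by blast
qed

theorem proposition4p3:
  fixes M :: "'a measure" and d :: "'a \<Rightarrow> 'a \<Rightarrow> real"
    and A :: "int \<Rightarrow> 'i set" and z :: "int \<Rightarrow> 'i \<Rightarrow> 'a" and cube :: "int \<Rightarrow> 'i \<Rightarrow> 'a set"
    and Num :: "int \<Rightarrow> 'i \<Rightarrow> nat" and S :: "int \<Rightarrow> 'i \<Rightarrow> nat \<Rightarrow> 'a set"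
    and x0 :: 'a and Q P :: "nat \<Rightarrow> 'a \<Rightarrow> 'a \<Rightarrow> complex"
    and A0 C\<mu> c0 C0 \<delta> \<omega> \<eta> \<beta> \<gamma> s :: real and j0 N N' :: nat
  assumes "homogeneous_type M d A0 C\<mu>" and "\<omega> = log 2 C\<mu>"
    and "dyadic_points d A0 c0 C0 \<delta> A z"
    and "dyadic_cubes M d A0 c0 C0 \<delta> A z cube"
    and "subcube_enumeration A0 C0 \<delta> A cube j0 Num S"
    and "0 < \<eta>" and "\<eta> < 1"
    and "exp_IATI M d \<delta> A z \<eta> Q" and "exp_IATI M d \<delta> A z \<eta> P"
    and "0 < \<beta>" and "\<beta> < \<eta>" and "0 < \<gamma>" and "\<gamma> < \<eta>"
    and "- min \<beta> \<gamma> < s" and "s < min \<beta> \<gamma>"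
    and "calderon_index M d A0 \<delta> A Num S x0 \<eta> \<beta> \<gamma> Q N"
    and "calderon_index M d A0 \<delta> A Num S x0 \<eta> \<beta> \<gamma> P N'"
  shows "(\<forall>p q :: ennreal. ennreal (p_index \<omega> s (min \<beta> \<gamma>)) < p \<and> p \<le> \<infinity> \<and> 0 < q \<and> q \<le> \<infinity> \<longrightarrow>
           equivalent_on (distributions M d A0 x0 \<eta> \<beta> \<gamma>)
             (besov_quantity M \<delta> A Num S Q N s p q)
             (besov_quantity M \<delta> A Num S P N' s p q))
       \<and> (\<forall>p q :: ennreal. ennreal (p_index \<omega> s (min \<beta> \<gamma>)) < p \<and> p < \<infinity> \<and>
                           ennreal (p_index \<omega> s (min \<beta> \<gamma>)) < q \<and> q \<le> \<infinity> \<longrightarrow>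
           equivalent_on (distributions M d A0 x0 \<eta> \<beta> \<gamma>)
             (triebel_lizorkin_quantity M \<delta> A Num S Q N s p q)
             (triebel_lizorkin_quantity M \<delta> A Num S P N' s p q))"
proof -
  interpret dyadic_system M d A0 C\<mu> c0 C0 \<delta> A z cube j0 Num S
    using assms(1,3,4,5) by unfold_locales
  have w: "\<omega> = homogeneous_space.\<omega> C\<mu>" using assms(2) by (simp add: \<omega>_def)
  show ?thesis
    unfolding w
  proof (intro conjI allI impI; elim conjE)
    fix p q :: ennreal assume p: "ennreal (p_index (homogeneous_space.\<omega> C\<mu>) s (min \<beta> \<gamma>)) < p" and q: "0 < q"
    show "equivalent_on (distributions M d A0 x0 \<eta> \<beta> \<gamma>)
             (besov_quantity M \<delta> A Num S Q N s p q) (besov_quantity M \<delta> A Num S P N' s p q)"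
      \<comment> \<open>The first instance has the two families interchanged and bounds the quantity
        of Q by that of P; the second bounds the quantity of P by that of Q.\<close>
      using besov_le[OF assms(9,8,10-13,17,14,15) p q, of N] besov_le[OF assms(8,9,10-13,16,14,15) p q, of N']
      by (metis equivalent_onI)
  next
    fix p q :: ennreal assume p: "ennreal (p_index (homogeneous_space.\<omega> C\<mu>) s (min \<beta> \<gamma>)) < p" "p < \<infinity>"
      and q: "ennreal (p_index (homogeneous_space.\<omega> C\<mu>) s (min \<beta> \<gamma>)) < q"
    have p': "p \<noteq> top" using p(2) by auto
    show "equivalent_on (distributions M d A0 x0 \<eta> \<beta> \<gamma>)
             (triebel_lizorkin_quantity M \<delta> A Num S Q N s p q) (triebel_lizorkin_quantity M \<delta> A Num S P N' s p q)"
      using triebel_lizorkin_le[OF assms(9,8,10-13,17,14,15) p(1) p' q, of N] triebel_lizorkin_le[OF assms(8,9,10-13,16,14,15) p(1) p' q, of N']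
      by (metis equivalent_onI)
  qed
qed

end
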